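(* There is an algorithm that, given an integer $k$ and an incidence graph $G$, runs in time $2^{2^{O(k)}}\cdot|G|$ and either (1) returns a strong recursive backdoor of $G$ to $\mathscr{C}_0$ of depth at most $3^k\cdot\lambda_k\cdot k^2$, where $\lambda_k=4\cdot 2^k$, or (2) correctly concludes that $\mathrm{srbd}_{\mathscr{C}_0}(G)>k$.
   Context: CNF formulas are identified with incidence graphs: bipartite graphs on variables and clauses, with a positive edge $\{x,c\}$ if $x_+\in c$ and a negative edge if $x_-\in c$ (no clause contains both); $|G|$ denotes the size of $G$. $G[x_\star]$ is the incidence graph of the formula obtained by setting $x$ to $\star\in\{+,-\}$: delete clauses containing $x_\star$ and delete the opposite literal of $x$ from the remaining clauses. $\mathscr{C}_0$ is the class of formulas with no clauses or only empty clauses (edgeless incidence graphs). For a class $\mathscr{C}$: $\mathrm{srbd}_{\mathscr{C}}(G)=0$ if $G\in\mathscr{C}$; $=1+\min_{x\in\mathrm{var}(G)}\max_{\star}\mathrm{srbd}_{\mathscr{C}}(G[x_\star])$ if $G\notin\mathscr{C}$ and $G$ is connected; otherwise the maximum of $\mathrm{srbd}_{\mathscr{C}}(H)$ over connected components $H$ of $G$. A strong recursive backdoor of $G$ to $\mathscr{C}$ is a rooted tree whose nodes are labeled with a subgraph of $G$ or a variable of $G$: the root is labeled $G$; an inner node labeled with a connected graph $H$ has one child labeled with a variable $x$, which has two children labeled $H[x_+]$, $H[x_-]$; an inner node labeled with a disconnected graph has one child per connected component labeled with the induced subgraph of that component; leaves are labeled with graphs in $\mathscr{C}$; its depth is the maximal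 number of variable nodes on a root-to-leaf path. *)

theory Defs
  imports Complex_Main "HOL-Library.Extended_Nat" "HOL-Library.Landau_Symbols"
begin

section \<open>Incidence graphs\<close>

datatype sign = Positive | Negative

record ('v, 'c) igraph =
  vars :: "'v set"
  clauses :: "'c set"
  pos_edges :: "('v \<times> 'c) set"
  neg_edges :: "('v \<times> 'c) set"

definition incidence_graph :: "('v, 'c) igraph \<Rightarrow> bool" where
  "incidence_graph G \<longleftrightarrow>
     finite (vars G) \<and> finite (clauses G) \<and>
     pos_edges G \<subseteq> vars G \<times> clauses G \<and> neg_edges G \<subseteq> vars G \<times> clauses G \<and>
     pos_edges G \<inter> neg_edges G = {}"

fun edges :: "('v, 'c) igraph \<Rightarrow> sign \<Rightarrow> ('v \<times> 'c) set" where
  "edges G Positive = pos_edges G"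
| "edges G Negative = neg_edges G"

text \<open>The size of a graph counts both vertices and edges.\<close>

definition igraph_size :: "('v, 'c) igraph \<Rightarrow> nat" where
  "igraph_size G =
     card (vars G) + card (clauses G) + card (pos_edges G) + card (neg_edges G)"

definition verts :: "('v, 'c) igraph \<Rightarrow> ('v + 'c) set" where
  "verts G = vars G <+> clauses G"

definition adjacency :: "('v, 'c) igraph \<Rightarrow> ('v + 'c) rel" where
  "adjacency G =
     {(Inl x, Inr c) |x c. (x, c) \<in> pos_edges G \<union> neg_edges G} \<union>
     {(Inr c, Inl x) |x c. (x, c) \<in> pos_edges G \<union> neg_edges G}"

definition induced :: "('v, 'c) igraph \<Rightarrow> ('v + 'c) set \<Rightarrow> ('v, 'c) igraph" where
  "induced G U =
     \<lparr>vars = {x \<in> vars G. Inl x \<in> U},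
      clauses = {c \<in> clauses G. Inr c \<in> U},
      pos_edges = {(x, c) \<in> pos_edges G. Inl x \<in> U \<and> Inr c \<in> U},
      neg_edges = {(x, c) \<in> neg_edges G. Inl x \<in> U \<and> Inr c \<in> U}\<rparr>"

text \<open>The empty graph counts as connected.\<close>

definition connected_ig :: "('v, 'c) igraph \<Rightarrow> bool" where
  "connected_ig G \<longleftrightarrow> (\<forall>u\<in>verts G. \<forall>w\<in>verts G. (u, w) \<in> (adjacency G)\<^sup>*)"

definition components :: "('v, 'c) igraph \<Rightarrow> ('v, 'c) igraph set" where
  "components G = {induced G ((adjacency G)\<^sup>* `` {u}) |u. u \<in> verts G}"

text \<open>
  Setting x to the given sign deletes the clauses containing the literal made true. Deleting the
  vertex x removes the opposite literal from all remaining clauses. The other variables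
  are kept, even if they become isolated, and clauses that become equal as sets of literals remain
  distinct vertices.
\<close>

definition assign :: "('v, 'c) igraph \<Rightarrow> 'v \<Rightarrow> sign \<Rightarrow> ('v, 'c) igraph" where
  "assign G x s = induced G (verts G - {Inl x} - {Inr c |c. (x, c) \<in> edges G s})"

text \<open>Formulas with no clauses or only empty clauses.\<close>

definition class0 :: "('v, 'c) igraph set" where
  "class0 = {G. incidence_graph G \<and> pos_edges G = {} \<and> neg_edges G = {}}"


section \<open>Strong recursive backdoor depth\<close>

lemma incidence_graph_induced: "incidence_graph G \<Longrightarrow> incidence_graph (induced G U)"
  by (auto simp: incidence_graph_def induced_def)

lemma card_verts:
  "incidence_graph G \<Longrightarrow> card (verts G) = card (vars G) + card (clauses G)"
  by (simp add: incidence_graph_def verts_def card_Plus)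

lemma finite_verts: "incidence_graph G \<Longrightarrow> finite (verts G)"
  by (simp add: incidence_graph_def verts_def)

lemma verts_induced: "verts (induced G U) = verts G \<inter> U"
  by (auto simp: verts_def induced_def)

lemma card_verts_assign:
  assumes "incidence_graph G" "x \<in> vars G"
  shows "card (verts (assign G x s)) < card (verts G)"
proof (rule psubset_card_mono)
  show "finite (verts G)" using assms by (simp add: finite_verts)
  have "Inl x \<in> verts G" using assms by (simp add: verts_def InlI)
  then show "verts (assign G x s) \<subset> verts G" by (auto simp: assign_def verts_induced)
qed

lemma card_verts_component:
  assumes "incidence_graph G" "\<not> connected_ig G" "H \<in> components G"
  shows "card (verts H) < card (verts G)"
proof (rule psubset_card_mono)
  show "finite (verts G)" using assms by (simp add: finite_verts)
  obtain u where u: "u \<in> verts G" and H: "H = induced G ((adjacency G)\<^sup>* `` {u})"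
    using assms(3) by (auto simp: components_def)
  have "sym ((adjacency G)\<^sup>*)"
    by (rule sym_rtrancl) (auto simp: sym_def adjacency_def)
  moreover obtain a b where ab: "a \<in> verts G" "b \<in> verts G" "(a, b) \<notin> (adjacency G)\<^sup>*"
    using assms(2) by (auto simp: connected_ig_def)
  ultimately have "(u, a) \<notin> (adjacency G)\<^sup>* \<or> (u, b) \<notin> (adjacency G)\<^sup>*"
    by (meson rtrancl_trans symD)
  then show "verts H \<subset> verts G" using ab by (auto simp: H verts_induced)
qed

text \<open>
  The minimum over an empty set of variables is infinite; this does not occur for class0, whose
  complement contains only graphs with an edge. The value on records that are not finite incidence
  graphs is a dummy needed for termination.
\<close>

function srbd :: "('v, 'c) igraph set \<Rightarrow> ('v, 'c) igraph \<Rightarrow> enat" where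
  "srbd \<C> G =
     (if G \<in> \<C> \<or> \<not> incidence_graph G then 0
      else if connected_ig G then
        1 + (INF x\<in>vars G. max (srbd \<C> (assign G x Positive)) (srbd \<C> (assign G x Negative)))
      else (SUP H\<in>components G. srbd \<C> H))"
  by pat_completeness auto
termination
  by (relation "measure (\<lambda>(\<C>, G). card (verts G))")
     (auto simp: card_verts_assign card_verts_component)

declare srbd.simps [simp del]


section \<open>Strong recursive backdoors\<close>

datatype 'l tree = Node (label: 'l) (children: "'l tree list")

datatype ('v, 'c) bd_label = Graph "('v, 'c) igraph" | Var 'v

type_synonym ('v, 'c) bd_tree = "('v, 'c) bd_label tree"

inductive bd_subtree :: "('v, 'c) igraph set \<Rightarrow> ('v, 'c) bd_tree \<Rightarrow> bool"
  for \<C> :: "('v, 'c) igraph set" where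
  leaf: "H \<in> \<C> \<Longrightarrow> bd_subtree \<C> (Node (Graph H) [])"
| variable:
    "\<lbrakk>connected_ig H; x \<in> vars H;
      bd_subtree \<C> T1; label T1 = Graph (assign H x Positive);
      bd_subtree \<C> T2; label T2 = Graph (assign H x Negative)\<rbrakk>
     \<Longrightarrow> bd_subtree \<C> (Node (Graph H) [Node (Var x) [T1, T2]])"
| split:
    "\<lbrakk>\<not> connected_ig H;
      \<forall>T\<in>set Ts. bd_subtree \<C> T;
      distinct (map label Ts); set (map label Ts) = Graph ` components H\<rbrakk>
     \<Longrightarrow> bd_subtree \<C> (Node (Graph H) Ts)"

definition strong_recursive_backdoor ::
  "('v, 'c) igraph set \<Rightarrow> ('v, 'c) igraph \<Rightarrow> ('v, 'c) bd_tree \<Rightarrow> bool" where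
  "strong_recursive_backdoor \<C> G T \<longleftrightarrow> label T = Graph G \<and> bd_subtree \<C> T"

fun bd_depth :: "('v, 'c) bd_tree \<Rightarrow> nat" where
  "bd_depth (Node (Graph H) Ts) = Max (insert 0 (bd_depth ` set Ts))"
| "bd_depth (Node (Var x) Ts) = 1 + Max (insert 0 (bd_depth ` set Ts))"

definition lambda_param :: "nat \<Rightarrow> nat" where
  "lambda_param k = 4 * 2 ^ k"


section \<open>Random access machine\<close>

text \<open>
  Algorithms are structured programs for a random access machine with the uniform cost measure.
  Beside finitely many registers (those named in the program) there is an unbounded memory,
  accessed indirectly via registers, and a write-only output tape. The arithmetic is
  restricted to addition and truncated subtraction. Every primitive command, every test
  and every procedure call takes one time unit. Registers are global: procedures have
  neither parameters nor local variables. A program is a list of possibly recursive procedures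
  and its execution starts with the procedure of index 0.
\<close>

type_synonym reg = nat

datatype com =
    Skip
  | Const reg nat
  | Add reg reg reg
  | Sub reg reg reg
  | Load reg reg
  | Store reg reg
  | Write reg
  | Seq com com
  | IfNZ reg com com
  | WhileNZ reg com
  | Call nat

type_synonym program = "com list"

record state =
  regs :: "reg \<Rightarrow> nat"
  mem :: "nat \<Rightarrow> nat"
  out_tape :: "nat list"

definition set_reg :: "reg \<Rightarrow> nat \<Rightarrow> state \<Rightarrow> state" where
  "set_reg r n \<sigma> = \<sigma>\<lparr>regs := (regs \<sigma>)(r := n)\<rparr>"

text \<open>In exec P c s t s', the number t is the running time.\<close>

inductive exec :: "program \<Rightarrow> com \<Rightarrow> state \<Rightarrow> nat \<Rightarrow> state \<Rightarrow> bool"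
  for P :: program where
  Skip: "exec P Skip \<sigma> 1 \<sigma>"
| Const: "exec P (Const r n) \<sigma> 1 (set_reg r n \<sigma>)"
| Add: "exec P (Add r a b) \<sigma> 1 (set_reg r (regs \<sigma> a + regs \<sigma> b) \<sigma>)"
| Sub: "exec P (Sub r a b) \<sigma> 1 (set_reg r (regs \<sigma> a - regs \<sigma> b) \<sigma>)"
| Load: "exec P (Load r a) \<sigma> 1 (set_reg r (mem \<sigma> (regs \<sigma> a)) \<sigma>)"
| Store: "exec P (Store a r) \<sigma> 1 (\<sigma>\<lparr>mem := (mem \<sigma>)(regs \<sigma> a := regs \<sigma> r)\<rparr>)"
| Write: "exec P (Write r) \<sigma> 1 (\<sigma>\<lparr>out_tape := out_tape \<sigma> @ [regs \<sigma> r]\<rparr>)"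
| Seq: "\<lbrakk>exec P c1 \<sigma> t1 \<sigma>1; exec P c2 \<sigma>1 t2 \<sigma>2\<rbrakk> \<Longrightarrow> exec P (Seq c1 c2) \<sigma> (t1 + t2) \<sigma>2"
| IfTrue: "\<lbrakk>regs \<sigma> r \<noteq> 0; exec P c1 \<sigma> t \<sigma>'\<rbrakk> \<Longrightarrow> exec P (IfNZ r c1 c2) \<sigma> (1 + t) \<sigma>'"
| IfFalse: "\<lbrakk>regs \<sigma> r = 0; exec P c2 \<sigma> t \<sigma>'\<rbrakk> \<Longrightarrow> exec P (IfNZ r c1 c2) \<sigma> (1 + t) \<sigma>'"
| WhileFalse: "regs \<sigma> r = 0 \<Longrightarrow> exec P (WhileNZ r c) \<sigma> 1 \<sigma>"
| WhileTrue:
    "\<lbrakk>regs \<sigma> r \<noteq> 0; exec P c \<sigma> t1 \<sigma>1; exec P (WhileNZ r c) \<sigma>1 t2 \<sigma>2\<rbrakk>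
     \<Longrightarrow> exec P (WhileNZ r c) \<sigma> (1 + t1 + t2) \<sigma>2"
| Call: "\<lbrakk>i < length P; exec P (P ! i) \<sigma> t \<sigma>'\<rbrakk> \<Longrightarrow> exec P (Call i) \<sigma> (1 + t) \<sigma>'"

lemma exec_deterministic:
  "exec P c \<sigma> t \<sigma>' \<Longrightarrow> exec P c \<sigma> t'' \<sigma>'' \<Longrightarrow> t'' = t \<and> \<sigma>'' = \<sigma>'"
proof (induction arbitrary: t'' \<sigma>'' rule: exec.induct)
  case (Seq c1 \<sigma> t1 \<sigma>1 c2 t2 \<sigma>2)
  from Seq.prems show ?case by cases (use Seq.IH in blast)
next
  case (WhileTrue \<sigma> r c t1 \<sigma>1 t2 \<sigma>2)
  from WhileTrue.prems show ?case by cases (use WhileTrue.IH WhileTrue.hyps in blast)+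
qed (erule exec.cases; auto)+

definition initial_state :: "nat list \<Rightarrow> state" where
  "initial_state xs =
     \<lparr>regs = (\<lambda>_. 0), mem = (\<lambda>a. if a < length xs then xs ! a else 0), out_tape = []\<rparr>"

definition computes :: "program \<Rightarrow> nat list \<Rightarrow> nat \<Rightarrow> nat list \<Rightarrow> bool" where
  "computes P xs t ys \<longleftrightarrow> (\<exists>\<sigma>. exec P (Call 0) (initial_state xs) t \<sigma> \<and> out_tape \<sigma> = ys)"


section \<open>Encoding of graphs and trees\<close>

text \<open>
  A graph is given by its list of variables, list of clauses, and lists of positive and
  negative edges, each in arbitrary order and preceded by its length.
\<close>

definition code_edges :: "(nat \<times> nat) list \<Rightarrow> nat list" where
  "code_edges es = length es # concat (map (\<lambda>(x, c). [x, c]) es)"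

definition codes_graph :: "(nat, nat) igraph \<Rightarrow> nat list \<Rightarrow> bool" where
  "codes_graph G ws \<longleftrightarrow>
     (\<exists>vs cs ps ns.
        distinct vs \<and> set vs = vars G \<and> distinct cs \<and> set cs = clauses G \<and>
        distinct ps \<and> set ps = pos_edges G \<and> distinct ns \<and> set ns = neg_edges G \<and>
        ws = length vs # vs @ length cs # cs @ code_edges ps @ code_edges ns)"

inductive codes_label :: "(nat, nat) bd_label \<Rightarrow> nat list \<Rightarrow> bool" where
  "codes_graph H ws \<Longrightarrow> codes_label (Graph H) (0 # ws)"
| "codes_label (Var x) [1, x]"

text \<open>Preorder: the label of the root, the number of its children, and the codes of the children.\<close>

inductive codes_tree :: "(nat, nat) bd_tree \<Rightarrow> nat list \<Rightarrow> bool" where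
  "\<lbrakk>codes_label l ws; list_all2 codes_tree Ts wss\<rbrakk>
   \<Longrightarrow> codes_tree (Node l Ts) (ws @ length Ts # concat wss)"
monos list_all2_mono

text \<open>As usual for inputs of algorithms, variables and clauses are numbered consecutively.\<close>

definition numbered :: "(nat, nat) igraph \<Rightarrow> bool" where
  "numbered G \<longleftrightarrow> vars G = {..<card (vars G)} \<and> clauses G = {..<card (clauses G)}"

end

theory Submission
 imports Defs
begin

text \<open>
 The algorithm branches on variables of the connected components and fails when a branch has assigned
 more than 2 k 4^k variables. A branch is divided into stages. A stage fixes a clause c of the current component and
 marks the first 2 k 4^k vertices on the path from c to the root of the breadth-first search tree of an earlier stage;
 it assigns variables adjacent to marked clauses until the current component has none.
 If the recursive backdoor depth is at most k, then clauses have degree at most k and induced paths contain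
 at most 2^(k + 1) - 2 clauses, so a stage assigns a bounded number of variables and a long branch has 2^k stages.
 Each stage leaves a connected set that forces depth independently of the
 later assignments, and two consecutive groups of 2^i stages, joined by the path marked in the later one, force
 depth i + 1. Hence an exhausted budget witnesses depth greater than k. The parent of a stage is found by clearing the lowest bit of
 its number, which makes the groups of 2^i stages nest.
\<close>

section \<open>Lower bounds for the backdoor depth\<close>

text \<open>The budget \<open>2 * k * 4 ^ k\<close> comes from counting: if the depth is at most
  \<open>k\<close>, a stage marks at most \<open>2 ^ (k + 1) - 2\<close> clauses, each with at most
  \<open>k\<close> variables, so fewer than \<open>2 ^ k\<close> stages cannot use up the budget.
  The program never tests degrees or path lengths. If they are too large, the depth exceeds
  \<open>k\<close> anyway, so a failure is still a correct answer; the two bounds enter only in a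
  proof by contradiction. The obstacle is that a lower bound on the depth must answer every choice
  of a first variable, also of one that the branch assigned long ago. An obstruction is therefore a
  statement about the component at the start of its group of stages, valid under all later
  assignments that spare a set X of variables. For two groups, a variable of the first X was
  assigned before the second group began; giving it its old value keeps the second obstruction, and
  any other variable leaves the first one alone. This is why a stage has to use up all neighbours of
  its marked clauses before the next one starts. For the time, components share no vertex, so the
  work of siblings adds up to linear, and each unit of budget costs only a constant factor.\<close>

definition incident :: "('v, 'c) igraph \<Rightarrow> 'v \<Rightarrow> 'c \<Rightarrow> bool" where
 "incident G x c \<longleftrightarrow> (\<exists>s. (x, c) \<in> edges G s)"

text \<open>Every graph that arises from \<open>G\<close> by assignments and splitting is an induced
  subgraph of \<open>G\<close>. The proof fixes \<open>G\<close> and computes with vertex sets; this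
  is \<open>assign\<close> on that level.\<close>

definition setvar :: "('v, 'c) igraph \<Rightarrow> ('v + 'c) set \<Rightarrow> 'v \<Rightarrow> sign \<Rightarrow> ('v + 'c) set" where
 "setvar G U x s = U - {Inl x} - {Inr c |c. (x, c) \<in> edges G s}"

definition comp :: "('v, 'c) igraph \<Rightarrow> ('v + 'c) set \<Rightarrow> 'v + 'c \<Rightarrow> ('v + 'c) set" where
 "comp G U u = (adjacency (induced G U))\<^sup>* `` {u}"

text \<open>The walks must stay inside Z, so the property does not depend on what is deleted outside
  Z.\<close>

definition linked :: "('v, 'c) igraph \<Rightarrow> ('v + 'c) set \<Rightarrow> bool" where
 "linked G Z \<longleftrightarrow> (\<forall>u\<in>Z. \<forall>w\<in>Z. (u, w) \<in> (adjacency G \<inter> Z \<times> Z)\<^sup>*)"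

text \<open>
 W arises from U by assigning the variables of U that are missing in W but incident to it, and by
 deleting further clauses. Unlike the removal of literals, this never increases the backdoor depth.
\<close>

definition reduct :: "('v, 'c) igraph \<Rightarrow> ('v + 'c) set \<Rightarrow> ('v + 'c) set \<Rightarrow> bool" where
 "reduct G W U \<longleftrightarrow>
   W \<subseteq> U \<and> (\<forall>x. Inl x \<in> U - W \<longrightarrow> (\<exists>s. \<forall>c. Inr c \<in> W \<longrightarrow> (x, c) \<notin> edges G s))"

section \<open>Reducts, linked sets and components\<close>

lemma incident_iff: "incident G x c \<longleftrightarrow> (x, c) \<in> pos_edges G \<union> neg_edges G"
 unfolding incident_def by (metis (full_types) UnE UnI1 UnI2 edges.simps sign.exhaust)

lemma adjacency_iff:
 "(u, w) \<in> adjacency G \<longleftrightarrow>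
   (\<exists>x c. incident G x c \<and> (u = Inl x \<and> w = Inr c \<or> u = Inr c \<and> w = Inl x))"
 by (auto simp: adjacency_def incident_iff)

lemma sym_adjacency: "sym (adjacency G)"
 by (auto simp: sym_def adjacency_iff)

lemma adjacency_induced: "adjacency (induced G U) = adjacency G \<inter> U \<times> U"
 by (auto simp: adjacency_def induced_def)

lemma induced_induced: "induced (induced G U) V = induced G (U \<inter> V)"
 by (auto simp: induced_def)

lemma edges_induced: "(x, c) \<in> edges (induced G U) s \<longleftrightarrow> (x, c) \<in> edges G s \<and> Inl x \<in> U \<and> Inr c \<in> U"
 by (cases s) (auto simp: induced_def)

lemma reduct_refl: "reduct G U U"
 by (auto simp: reduct_def)

lemma reduct_trans:
 assumes "reduct G W V" "reduct G V U" shows "reduct G W U"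
 unfolding reduct_def
proof (intro conjI allI impI)
 show "W \<subseteq> U" using assms by (auto simp: reduct_def)
 fix x assume "Inl x \<in> U - W"
 then show "\<exists>s. \<forall>c. Inr c \<in> W \<longrightarrow> (x, c) \<notin> edges G s"
  using assms unfolding reduct_def by (cases "Inl x \<in> V") blast+
qed

lemma linked_Un:
 assumes "linked G Y" "linked G Z" "Y \<inter> Z \<noteq> {}"
 shows "linked G (Y \<union> Z)"
 unfolding linked_def
proof (intro ballI)
 let ?R = "(adjacency G \<inter> (Y \<union> Z) \<times> (Y \<union> Z))\<^sup>*"
 obtain z where z: "z \<in> Y" "z \<in> Z" using assms(3) by blast
 have sub: "(adjacency G \<inter> Y \<times> Y)\<^sup>* \<subseteq> ?R" "(adjacency G \<inter> Z \<times> Z)\<^sup>* \<subseteq> ?R"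
  by (rule rtrancl_mono, blast)+
 fix u w assume "u \<in> Y \<union> Z" "w \<in> Y \<union> Z"
 then have "(u, z) \<in> ?R" "(z, w) \<in> ?R"
  using assms(1,2) z sub unfolding linked_def by blast+
 then show "(u, w) \<in> ?R" by (rule rtrancl_trans)
qed

lemma linked_singleton: "linked G {z}"
 by (simp add: linked_def)

lemma comp_refl: "u \<in> comp G U u"
 by (simp add: comp_def)

lemma comp_subset: "u \<in> U \<Longrightarrow> comp G U u \<subseteq> U"
proof
 fix w assume u: "u \<in> U" and "w \<in> comp G U u"
 then have "(u, w) \<in> (adjacency (induced G U))\<^sup>*" by (simp add: comp_def)
 then show "w \<in> U" by (induction) (use u in \<open>auto simp: adjacency_induced\<close>)
qed

lemma comp_closed:
 assumes "v \<in> comp G U u" "(v, w) \<in> adjacency G" "u \<in> U" "w \<in> U"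
 shows "w \<in> comp G U u"
proof -
 have "v \<in> U" using assms comp_subset by blast
 then have "(v, w) \<in> adjacency (induced G U)" using assms by (simp add: adjacency_induced)
 then show ?thesis using assms(1) by (auto simp: comp_def)
qed

lemma linked_comp: assumes "u \<in> U" shows "linked G (comp G U u)"
proof -
 let ?K = "comp G U u"
 let ?R = "(adjacency G \<inter> ?K \<times> ?K)\<^sup>*"
 have *: "(u, w) \<in> ?R" if "w \<in> ?K" for w
 proof -
  from that have "(u, w) \<in> (adjacency (induced G U))\<^sup>*" by (simp add: comp_def)
  then show ?thesis
  proof induction
   case (step y z)
   have "y \<in> ?K" "z \<in> ?K" using step(1,2) by (auto simp: comp_def)
   then have "(y, z) \<in> adjacency G \<inter> ?K \<times> ?K" using step(2) by (auto simp: adjacency_induced)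
   with step.IH show ?case by (rule rtrancl_into_rtrancl)
  qed simp
 qed
 have "sym ?R" by (rule sym_rtrancl) (use sym_adjacency in \<open>auto simp: sym_def\<close>)
 then show ?thesis unfolding linked_def using * by (meson rtrancl_trans symD)
qed

lemma linked_subset_comp:
 assumes "linked G Z" "Z \<subseteq> U" "z \<in> Z" shows "Z \<subseteq> comp G U z"
proof
 fix w assume "w \<in> Z"
 then have "(z, w) \<in> (adjacency G \<inter> Z \<times> Z)\<^sup>*" using assms by (auto simp: linked_def)
 moreover have "(adjacency G \<inter> Z \<times> Z)\<^sup>* \<subseteq> (adjacency (induced G U))\<^sup>*"
  by (rule rtrancl_mono) (use assms in \<open>auto simp: adjacency_induced\<close>)
 ultimately show "w \<in> comp G U z" by (auto simp: comp_def)
qed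

text \<open>No clause of a component is incident to a variable outside it, so for the lost variables
  any sign will do. Splitting thus falls under the same relation as assigning.\<close>

lemma comp_reduct: assumes "u \<in> U" shows "reduct G (comp G U u) U"
proof -
 have "\<not> incident G x c" if "Inl x \<in> U - comp G U u" "Inr c \<in> comp G U u" for x c
  using comp_closed[OF that(2), of "Inl x"] that assms by (auto simp: adjacency_iff)
 then show ?thesis using comp_subset[OF assms] unfolding reduct_def incident_def by blast
qed

lemma INF_enat_attained:
 fixes f :: "'a \<Rightarrow> enat"
 assumes "S \<noteq> {}"
 obtains y where "y \<in> S" "(INF x\<in>S. f x) = f y"
proof -
 have "(LEAST z. z \<in> f ` S) \<in> f ` S" by (rule LeastI_ex) (use assms in blast)
 then show ?thesis using that assms by (auto simp: Inf_enat_def)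
qed

section \<open>Backdoor depth as a function of vertex sets\<close>

locale formula =
 fixes G :: "('v, 'c) igraph"
 assumes ig: "incidence_graph G"
begin

definition sr :: "('v + 'c) set \<Rightarrow> enat" where
 "sr U = srbd class0 (induced G U)"

definition edgeless :: "('v + 'c) set \<Rightarrow> bool" where
 "edgeless U \<longleftrightarrow> (\<forall>x c. Inl x \<in> U \<longrightarrow> Inr c \<in> U \<longrightarrow> \<not> incident G x c)"

lemma incident_verts: "incident G x c \<Longrightarrow> Inl x \<in> verts G \<and> Inr c \<in> verts G"
 using ig by (auto simp: incident_iff incidence_graph_def verts_def)

lemma sign_avoids: "\<exists>s. (x, c) \<notin> edges G s"
proof (rule ccontr)
 assume "\<not> ?thesis"
 then have "(x, c) \<in> edges G Positive" "(x, c) \<in> edges G Negative" by blast+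
 then show False using ig by (auto simp: incidence_graph_def)
qed

lemma class0_iff: "induced G U \<in> class0 \<longleftrightarrow> edgeless U"
 using incidence_graph_induced[OF ig]
 by (auto simp: class0_def edgeless_def incident_iff induced_def)

text \<open>Vertex sets need not lie inside \<open>verts G\<close>; the surplus elements have no
  effect on the induced graph.\<close>

lemma induced_verts: "induced G (verts G \<inter> U) = induced G U"
 using ig by (auto simp: induced_def incidence_graph_def verts_def)

lemma sr_verts: "sr (verts G \<inter> U) = sr U"
 by (simp add: sr_def induced_verts)

lemma assign_induced:
 assumes "Inl x \<in> U" shows "assign (induced G U) x s = induced G (setvar G U x s)"
proof -
 have "assign (induced G U) x s = induced G (U \<inter> (verts G \<inter> U - {Inl x} -
   {Inr c |c. (x, c) \<in> edges (induced G U) s}))"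
  by (simp add: assign_def induced_induced verts_induced)
 also have "U \<inter> (verts G \<inter> U - {Inl x} - {Inr c |c. (x, c) \<in> edges (induced G U) s}) =
   verts G \<inter> setvar G U x s"
  using assms by (auto simp: setvar_def edges_induced)
 finally show ?thesis by (simp add: induced_verts)
qed

lemma components_induced:
 "components (induced G U) = (\<lambda>u. induced G (comp G U u)) ` (verts G \<inter> U)"
proof -
 have "induced (induced G U) ((adjacency (induced G U))\<^sup>* `` {u}) = induced G (comp G U u)"
  if "u \<in> U" for u
  using comp_subset[OF that, of G] by (simp add: induced_induced comp_def inf_absorb2)
 then show ?thesis
  unfolding components_def verts_induced setcompr_eq_image by (intro image_cong) auto
qed

lemma connected_induced_iff: "connected_ig (induced G U) \<longleftrightarrow> linked G (verts G \<inter> U)"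
proof -
 have "adjacency (induced G U) = adjacency G \<inter> (verts G \<inter> U) \<times> (verts G \<inter> U)"
  using incident_verts by (auto simp: adjacency_induced adjacency_iff)
 then show ?thesis by (simp add: connected_ig_def linked_def verts_induced)
qed

lemma sr_edgeless: "edgeless U \<Longrightarrow> sr U = 0"
 by (subst sr_def, subst srbd.simps) (simp add: class0_iff)

lemma sr_linked:
 assumes "\<not> edgeless U" "linked G (verts G \<inter> U)"
 shows "sr U = 1 + (INF x\<in>{x. Inl x \<in> verts G \<inter> U}.
      max (sr (setvar G U x Positive)) (sr (setvar G U x Negative)))"
proof -
 have v: "vars (induced G U) = {x. Inl x \<in> verts G \<inter> U}"
  by (auto simp: induced_def verts_def)
 have "(INF x\<in>vars (induced G U). max (srbd class0 (assign (induced G U) x Positive))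
     (srbd class0 (assign (induced G U) x Negative))) =
    (INF x\<in>vars (induced G U). max (sr (setvar G U x Positive)) (sr (setvar G U x Negative)))"
  by (rule INF_cong) (auto simp: v assign_induced sr_def)
 then show ?thesis
  unfolding sr_def[of U] using assms
  by (subst srbd.simps)
    (simp add: class0_iff connected_induced_iff incidence_graph_induced[OF ig] v)
qed

lemma sr_not_linked:
 assumes "\<not> edgeless U" "\<not> linked G (verts G \<inter> U)"
 shows "sr U = (SUP u\<in>verts G \<inter> U. sr (comp G U u))"
 unfolding sr_def[of U] using assms
 by (subst srbd.simps)
   (simp add: class0_iff connected_induced_iff incidence_graph_induced[OF ig]
    components_induced image_comp o_def sr_def)

lemma not_edgeless_comp:
 assumes "\<not> edgeless U"
 shows "\<exists>u\<in>verts G \<inter> U. \<not> edgeless (comp G U u)"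
proof -
 obtain x c where xc: "Inl x \<in> U" "Inr c \<in> U" "incident G x c"
  using assms by (auto simp: edgeless_def)
 then have "Inr c \<in> comp G U (Inl x)"
  by (intro comp_closed[OF comp_refl]) (auto simp: adjacency_iff)
 then show ?thesis using xc incident_verts[OF xc(3)] comp_refl unfolding edgeless_def by blast
qed

lemma comp_linked: 
 assumes "linked G (verts G \<inter> U)" "u \<in> verts G \<inter> U"
 shows "verts G \<inter> comp G U u = verts G \<inter> U"
 using linked_subset_comp[OF assms(1) _ assms(2), of U] comp_subset[of u U G] assms(2) by blast

lemma sr_comp_le: assumes "u \<in> verts G \<inter> U" shows "sr (comp G U u) \<le> sr U"
proof (cases "edgeless U")
 case True
 then have "edgeless (comp G U u)" using comp_subset[of u U G] assms by (auto simp: edgeless_def)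
 then show ?thesis by (simp add: sr_edgeless)
next
 case ne: False
 show ?thesis
 proof (cases "linked G (verts G \<inter> U)")
  case True
  then show ?thesis using comp_linked[OF True assms] sr_verts by (metis order_refl)
 next
  case False
  then show ?thesis using sr_not_linked[OF ne False] assms by (metis SUP_upper)
 qed
qed

lemma comp_verts: assumes "u \<in> verts G \<inter> U" shows "comp G U u \<subseteq> verts G"
proof
 fix w assume "w \<in> comp G U u"
 then have "(u, w) \<in> (adjacency (induced G U))\<^sup>*" by (simp add: comp_def)
 then show "w \<in> verts G"
  by induction (use assms incident_verts in \<open>auto simp: adjacency_induced adjacency_iff\<close>)
qed

lemma linked_verts_comp: "u \<in> verts G \<inter> U \<Longrightarrow> linked G (verts G \<inter> comp G U u)"
 using linked_comp[of u U G] comp_verts[of u U] by (simp add: inf_absorb2)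

text \<open>The common step of all lower bounds: it suffices to look at one component and to find,
  for each variable in it, a single sign that preserves depth i, since the recursion takes the
  maximum over the signs.\<close>

lemma sr_SucI:
 assumes z: "z \<in> verts G \<inter> U" and ne: "\<not> edgeless (comp G U z)"
  and x: "\<And>x. Inl x \<in> comp G U z \<Longrightarrow> \<exists>s. enat i \<le> sr (setvar G (comp G U z) x s)"
 shows "enat (Suc i) \<le> sr U"
proof -
 let ?K = "comp G U z"
 have "enat i \<le> (INF x\<in>{x. Inl x \<in> verts G \<inter> ?K}.
   max (sr (setvar G ?K x Positive)) (sr (setvar G ?K x Negative)))"
 proof (rule INF_greatest)
  fix y assume "y \<in> {x. Inl x \<in> verts G \<inter> ?K}"
  then obtain s where "enat i \<le> sr (setvar G ?K y s)" using x by blast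
  then show "enat i \<le> max (sr (setvar G ?K y Positive)) (sr (setvar G ?K y Negative))"
   by (cases s) (auto simp: le_max_iff_disj)
 qed
 then have "enat 1 + enat i \<le> sr ?K"
  unfolding sr_linked[OF ne linked_verts_comp[OF z]] one_enat_def[symmetric] by (rule add_left_mono)
 then show ?thesis using sr_comp_le[OF z] by (simp add: order_trans)
qed

lemma finite_verts_Int: "finite (verts G \<inter> U)"
 using finite_verts[OF ig] by simp

lemma reduct_setvar:
 assumes "reduct G W U" "Inl x \<in> U" "Inl x \<in> W"
 shows "reduct G (setvar G W x s) (setvar G U x s)"
 using assms unfolding reduct_def setvar_def by blast

text \<open>Induction on the size of U. A best variable for U that is still in W can be assigned in
  both graphs. One that is missing in W can be given the sign that satisfies no clause of W, and W
  remains a reduct of what is left of U. A linked W lies in one component of U, and an unlinked W is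
  handled component by component.\<close>

lemma sr_reduct_mono: "reduct G W U \<Longrightarrow> sr W \<le> sr U"
proof (induction "card (verts G \<inter> U)" arbitrary: U W rule: less_induct)
 case less
 show ?case
 proof (cases "edgeless W")
  case True
  then show ?thesis by (simp add: sr_edgeless)
 next
  case neW: False
  have WU: "W \<subseteq> U" using less.prems by (simp add: reduct_def)
  have neU: "\<not> edgeless U" using neW WU by (auto simp: edgeless_def)
  \<comment> \<open>Proved for every linked reduct of U, because it is also applied to the
    components of the given W.\<close>
  have conn: "sr W \<le> sr U" if W: "reduct G W U" and lW: "linked G (verts G \<inter> W)"
   and neW: "\<not> edgeless W" for W
  proof (cases "linked G (verts G \<inter> U)")
   case False
   obtain x c where xc: "Inl x \<in> W" "Inr c \<in> W" "incident G x c"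
    using neW by (auto simp: edgeless_def)
   define K where "K = comp G U (Inl x)"
   have WU: "W \<subseteq> U" using W by (simp add: reduct_def)
   have xU: "Inl x \<in> verts G \<inter> U" using xc incident_verts WU by blast
   have WK: "verts G \<inter> W \<subseteq> K" unfolding K_def
    by (rule linked_subset_comp[OF lW]) (use xc xU WU in auto)
   have KU: "K \<subseteq> U" using comp_subset[of "Inl x" U G] xU by (simp add: K_def)
   have "reduct G (verts G \<inter> W) K" unfolding reduct_def
   proof (intro conjI allI impI)
    fix y assume y: "Inl y \<in> K - verts G \<inter> W"
    have "K \<subseteq> verts G" unfolding K_def by (rule comp_verts[OF xU])
    then have "Inl y \<in> U - W" using y KU by blast
    then show "\<exists>s. \<forall>c. Inr c \<in> verts G \<inter> W \<longrightarrow> (y, c) \<notin> edges G s"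
     using W unfolding reduct_def by blast
   qed (rule WK)
   moreover have "card (verts G \<inter> K) < card (verts G \<inter> U)"
   proof (rule psubset_card_mono[OF finite_verts_Int])
    have "verts G \<inter> K \<noteq> verts G \<inter> U"
     using False linked_verts_comp[OF xU] by (auto simp: K_def)
    then show "verts G \<inter> K \<subset> verts G \<inter> U" using KU by blast
   qed
   ultimately have "sr (verts G \<inter> W) \<le> sr K" by (intro less.hyps)
   then show ?thesis using sr_comp_le[OF xU] by (simp add: sr_verts K_def)
  next
   case True
   let ?f = "\<lambda>U x. max (sr (setvar G U x Positive)) (sr (setvar G U x Negative))"
   have f: "sr (setvar G U x s) \<le> ?f U x" for U x s by (cases s) auto
   have "sr W \<le> 1 + ?f U x" if x: "Inl x \<in> verts G \<inter> U" for x
   proof -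
    have less: "card (verts G \<inter> setvar G U x s) < card (verts G \<inter> U)" for s
     by (rule psubset_card_mono[OF finite_verts_Int]) (use x in \<open>auto simp: setvar_def\<close>)
    show ?thesis
    proof (cases "Inl x \<in> W")
     case xW: True
     have "sr (setvar G W x s) \<le> sr (setvar G U x s)" for s
      by (rule less.hyps[OF less reduct_setvar]) (use W x xW in auto)
     then have "?f W x \<le> ?f U x" using f by (meson max.mono)
     moreover have "sr W \<le> 1 + ?f W x"
      unfolding sr_linked[OF neW lW]
      by (rule add_left_mono, rule INF_lower) (use x xW in auto)
     ultimately show ?thesis by (meson add_left_mono order_trans)
    next
     case False
     \<comment> \<open>The sign with which x was assigned on the way to W: setting x to it in U
       deletes no clause of W.\<close>
     then obtain s where s: "\<forall>c. Inr c \<in> W \<longrightarrow> (x, c) \<notin> edges G s"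
      using W x unfolding reduct_def by blast
     have "reduct G W (setvar G U x s)"
      using W False s unfolding reduct_def setvar_def by blast
     then have "sr W \<le> sr (setvar G U x s)" by (rule less.hyps[OF less])
     also have "\<dots> \<le> ?f U x" by (rule f)
     also have "\<dots> \<le> 1 + ?f U x" by (rule add_increasing[OF zero_le order_refl])
     finally show ?thesis .
    qed
   qed
   then have *: "sr W \<le> 1 + ?f U x" if "x \<in> {x. Inl x \<in> verts G \<inter> U}" for x using that by blast
   have "{x. Inl x \<in> verts G \<inter> U} \<noteq> {}"
    using neU incident_verts by (fastforce simp: edgeless_def)
   then obtain y where y: "y \<in> {x. Inl x \<in> verts G \<inter> U}"
    "(INF x\<in>{x. Inl x \<in> verts G \<inter> U}. ?f U x) = ?f U y"
    by (rule INF_enat_attained)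
   show ?thesis unfolding sr_linked[OF neU True] y(2) by (rule *[OF y(1)])
  qed
  show ?thesis
  proof (cases "linked G (verts G \<inter> W)")
   case True
   then show ?thesis using conn[OF less.prems True neW] by blast
  next
   case False
   have "sr (comp G W u) \<le> sr U" if u: "u \<in> verts G \<inter> W" for u
   proof (cases "edgeless (comp G W u)")
    case True
    then show ?thesis by (simp add: sr_edgeless)
   next
    case False
    show ?thesis
     by (rule conn[OF reduct_trans[OF comp_reduct less.prems] linked_verts_comp[OF u] False])
       (use u in blast)
   qed
   then show ?thesis unfolding sr_not_linked[OF neW False] by (rule SUP_least)
  qed
 qed
qed

lemma sr_ge_1: assumes "\<not> edgeless U" shows "enat 1 \<le> sr U"
proof -
 obtain u where u: "u \<in> verts G \<inter> U" "\<not> edgeless (comp G U u)"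
  using not_edgeless_comp[OF assms] by blast
 have "enat (Suc 0) \<le> sr U" by (rule sr_SucI[OF u]) (simp add: zero_enat_def[symmetric])
 then show ?thesis by simp
qed

end

section \<open>Obstructions that survive later assignments\<close>

context formula
begin

text \<open>A variable may be missing in H because it was assigned or because it was split off into
  another component. The incidence to a remaining clause singles out the former case, and only there
  membership in X is forbidden.\<close>

definition avoids :: "('v + 'c) set \<Rightarrow> ('v + 'c) set \<Rightarrow> 'v set \<Rightarrow> bool" where
 "avoids H A X \<longleftrightarrow> (\<forall>x c. Inl x \<in> A - H \<longrightarrow> Inr c \<in> H \<longrightarrow> incident G x c \<longrightarrow> x \<notin> X)"

text \<open>The depth of A stays at least i as long as Y is present and no variable in X is assigned.\<close>

definition robust :: "nat \<Rightarrow> ('v + 'c) set \<Rightarrow> 'v set \<Rightarrow> ('v + 'c) set \<Rightarrow> bool" where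
 "robust i A X Y \<longleftrightarrow>
   (\<forall>H. reduct G H A \<longrightarrow> Y \<subseteq> H \<longrightarrow> avoids H A X \<longrightarrow> enat i \<le> sr H)"

definition nbrs :: "('v + 'c) set \<Rightarrow> 'v set" where
 "nbrs M = {x. \<exists>c. Inr c \<in> M \<and> incident G x c}"

text \<open>The obstruction of a single stage: a remaining clause whose neighbours may not be
  assigned keeps its variable, hence an edge.\<close>

lemma robust_clause:
 assumes "Inl x \<in> A" "incident G x c" "nbrs {Inr c} \<subseteq> X"
 shows "robust 1 A X {Inr c}"
 unfolding robust_def
proof (intro allI impI)
 fix H assume H: "reduct G H A" "{Inr c} \<subseteq> H" "avoids H A X"
 have "x \<in> X" using assms by (auto simp: nbrs_def)
 then have "Inl x \<in> H" using H assms unfolding avoids_def by blast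
 then show "enat 1 \<le> sr H" by (intro sr_ge_1) (use H assms in \<open>auto simp: edgeless_def\<close>)
qed

text \<open>
 A variable outside X leaves the first obstruction intact. A variable in X gets the value that it
 had on the way to A', and then the second obstruction survives.
\<close>

lemma robust_combine:
 assumes Y: "robust i A X Y" and Y': "robust i A' X' Y'" and i: "0 < i"
  and A: "A \<subseteq> verts G" and A': "reduct G A' A" and X: "\<And>x. Inl x \<in> A' \<Longrightarrow> x \<notin> X"
  and nY: "nbrs Y \<subseteq> X" and vY: "\<And>x. Inl x \<in> Y \<Longrightarrow> x \<in> X" and YA: "Y' \<subseteq> A'"
  and Z: "linked G Z" "Z \<subseteq> A" "Z \<noteq> {}" "Y \<subseteq> Z" "Y' \<subseteq> Z"
 shows "robust (Suc i) A (X \<union> X') Z"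
 unfolding robust_def
proof (intro allI impI)
 fix H assume H: "reduct G H A" "Z \<subseteq> H" "avoids H A (X \<union> X')"
 obtain z where z: "z \<in> Z" using Z by blast
 have zH: "z \<in> verts G \<inter> H" using z H(2) Z(2) A by blast
 \<comment> \<open>Z is linked and still present, so one component of H contains both obstructions.
   Every variable of this component has to be answered.\<close>
 define K where "K = comp G H z"
 have KH: "reduct G K H" "K \<subseteq> H" unfolding K_def using comp_reduct[of z H] comp_subset[of z H] zH by auto
 have redK: "reduct G K A" by (rule reduct_trans[OF KH(1) H(1)])
 have ZK: "Z \<subseteq> K" unfolding K_def by (rule linked_subset_comp[OF Z(1) H(2) z])
 have avK: "avoids K A (X \<union> X')"
  unfolding avoids_def
 proof (intro allI impI)
  fix x c assume xc: "Inl x \<in> A - K" "Inr c \<in> K" "incident G x c"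
  have "Inl x \<notin> H"
  proof
   assume "Inl x \<in> H"
   then have "Inl x \<in> K" using comp_closed[of "Inr c" G H z "Inl x"] xc zH
    by (auto simp: adjacency_iff K_def)
   then show False using xc by blast
  qed
  then show "x \<notin> X \<union> X'" using H(3) xc KH unfolding avoids_def by blast
 qed
 have "avoids K A X" using avK unfolding avoids_def by blast
 then have "enat i \<le> sr K"
  using Y redK subset_trans[OF Z(4) ZK] unfolding robust_def by simp
 then have ne: "\<not> edgeless K" using sr_edgeless[of K] i by (auto simp: zero_enat_def)
 show "enat (Suc i) \<le> sr H"
 proof (rule sr_SucI[OF zH], fold K_def)
  show "\<not> edgeless K" by (rule ne)
  fix x assume x: "Inl x \<in> K"
  show "\<exists>s. enat i \<le> sr (setvar G K x s)"
  proof (cases "x \<in> X")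
   case False
   let ?H = "setvar G K x Positive"
   have red: "reduct G ?H A"
    unfolding reduct_def
   proof (intro conjI allI impI)
    show "?H \<subseteq> A" using redK by (auto simp: reduct_def setvar_def)
    fix y assume y: "Inl y \<in> A - ?H"
    show "\<exists>s. \<forall>c. Inr c \<in> ?H \<longrightarrow> (y, c) \<notin> edges G s"
    proof (cases "y = x")
     case True
     then show ?thesis by (intro exI[of _ Positive]) (auto simp: setvar_def)
    next
     case False
     then have "Inl y \<in> A - K" using y by (auto simp: setvar_def)
     then show ?thesis using redK unfolding reduct_def setvar_def by blast
    qed
   qed
   moreover have "Y \<subseteq> ?H"
   proof
    fix v assume v: "v \<in> Y"
    have "v \<noteq> Inl x" using v vY False by blast
    moreover have "(x, c) \<notin> edges G Positive" if "v = Inr c" for c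
     using v nY False that by (auto simp: nbrs_def incident_iff)
    ultimately show "v \<in> ?H" using v ZK Z(4) by (auto simp: setvar_def)
   qed
   moreover have "avoids ?H A X"
    using avK False unfolding avoids_def setvar_def by blast
   ultimately have "enat i \<le> sr ?H" using Y unfolding robust_def by simp
   then show ?thesis ..
  next
   case True
   \<comment> \<open>All variables of X are gone in A', so x was assigned between A and A'; s is the
     value it received there.\<close>
   have xA: "Inl x \<in> A - A'" using x redK X True by (auto simp: reduct_def)
   then obtain s where s: "\<forall>c. Inr c \<in> A' \<longrightarrow> (x, c) \<notin> edges G s"
    using A' unfolding reduct_def by blast
   \<comment> \<open>The part of K that also lies in A' is a reduct both of A' and of K after
     setting x to s. The second obstruction applies to it, and monotonicity carries the bound
     over.\<close>
   let ?W = "K \<inter> A'"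
   have "reduct G ?W (setvar G K x s)"
    unfolding reduct_def
   proof (intro conjI allI impI)
    show "?W \<subseteq> setvar G K x s" using xA s by (auto simp: setvar_def)
    fix y assume "Inl y \<in> setvar G K x s - ?W"
    then have "Inl y \<in> A - A'" using redK by (auto simp: setvar_def reduct_def)
    then show "\<exists>s. \<forall>c. Inr c \<in> ?W \<longrightarrow> (y, c) \<notin> edges G s"
     using A' unfolding reduct_def by blast
   qed
   then have "sr ?W \<le> sr (setvar G K x s)" by (rule sr_reduct_mono)
   moreover have "reduct G ?W A'"
    unfolding reduct_def
   proof (intro conjI allI impI)
    fix y assume "Inl y \<in> A' - ?W"
    then have "Inl y \<in> A - K" using A' by (auto simp: reduct_def)
    then show "\<exists>s. \<forall>c. Inr c \<in> ?W \<longrightarrow> (y, c) \<notin> edges G s"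
     using redK unfolding reduct_def by blast
   qed simp
   moreover have "avoids ?W A' X'" using avK A' unfolding avoids_def reduct_def by blast
   moreover have "Y' \<subseteq> ?W" using YA ZK Z(5) by blast
   ultimately have "enat i \<le> sr (setvar G K x s)"
    using Y' unfolding robust_def by (meson order_trans)
   then show ?thesis ..
  qed
 qed
qed

text \<open>Whichever variable is assigned, one of its signs does not satisfy c. The clause then
  survives and loses at most one variable.\<close>

lemma sr_ge_degree:
 assumes "Inr c \<in> U" "n \<le> card {x. Inl x \<in> U \<and> incident G x c}"
 shows "enat n \<le> sr U"
 using assms
proof (induction n arbitrary: U)
 case 0
 then show ?case by (simp add: zero_enat_def[symmetric])
next
 case (Suc n)
 let ?N = "\<lambda>U. {x. Inl x \<in> U \<and> incident G x c}"
 have "?N U \<noteq> {}" using Suc.prems by (metis card.empty Suc_n_not_le_n le_0_eq nat.simps(3))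
 then obtain y where y: "Inl y \<in> U" "incident G y c" by blast
 have cU: "Inr c \<in> verts G \<inter> U" using Suc.prems incident_verts[OF y(2)] by blast
 define K where "K = comp G U (Inr c)"
 have NK: "Inl x \<in> K" if "Inl x \<in> U" "incident G x c" for x
  unfolding K_def by (rule comp_closed[OF comp_refl]) (use that cU in \<open>auto simp: adjacency_iff\<close>)
 have cK: "Inr c \<in> K" by (simp add: K_def comp_refl)
 show ?case
 proof (rule sr_SucI[OF cU], fold K_def)
  show "\<not> edgeless K" using cK NK y by (auto simp: edgeless_def)
  fix x assume x: "Inl x \<in> K"
  obtain s where s: "(x, c) \<notin> edges G s" using sign_avoids by blast
  have "?N U - {x} \<subseteq> ?N (setvar G K x s)" using NK by (auto simp: setvar_def)
  moreover have "finite (?N (setvar G K x s))"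
  proof (rule finite_subset)
   show "?N (setvar G K x s) \<subseteq> vars G" using incident_verts by (force simp: verts_def)
  qed (use ig in \<open>simp add: incidence_graph_def\<close>)
  ultimately have "card (?N U - {x}) \<le> card (?N (setvar G K x s))" by (rule card_mono[rotated])
  then have "n \<le> card (?N (setvar G K x s))"
   using Suc.prems(2) card_Diff1_le[of "?N U" x] diff_card_le_card_Diff[of "{x}" "?N U"] by simp
  moreover have "Inr c \<in> setvar G K x s" using cK s by (auto simp: setvar_def)
  ultimately show "\<exists>s. enat n \<le> sr (setvar G K x s)" using Suc.IH by blast
 qed
qed

text \<open>
 A variable is incident to at most two consecutive clauses of an induced path of clauses, so one of
 the two remaining parts has at least half of the other clauses.
\<close>

lemma sr_ge_path:
 assumes "\<And>j. a \<le> j \<Longrightarrow> j < b \<Longrightarrow> Inr (q j) \<in> U \<and> (\<exists>x. Inl x \<in> U \<and> incident G x (q j))"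
  and "\<And>j. a \<le> j \<Longrightarrow> Suc j < b \<Longrightarrow>
   \<exists>x. Inl x \<in> U \<and> incident G x (q j) \<and> incident G x (q (Suc j))"
  and "\<And>j l x. a \<le> j \<Longrightarrow> j + 2 \<le> l \<Longrightarrow> l < b \<Longrightarrow> Inl x \<in> U \<Longrightarrow> incident G x (q j) \<Longrightarrow>
   \<not> incident G x (q l)"
  and "2 ^ n \<le> b - a + 1"
 shows "enat n \<le> sr U"
 using assms
proof (induction n arbitrary: a b U)
 case 0
 then show ?case by (simp add: zero_enat_def[symmetric])
next
 case (Suc n)
 have n2: "2 * 2 ^ n \<le> b - a + 1" "(1::nat) \<le> 2 ^ n" using Suc.prems(4) by simp_all
 then have ab: "a < b" by linarith
 obtain y where y: "Inr (q a) \<in> U" "Inl y \<in> U" "incident G y (q a)"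
  using Suc.prems(1)[of a] ab by blast
 have zU: "Inr (q a) \<in> verts G \<inter> U" using y incident_verts by blast
 define K where "K = comp G U (Inr (q a))"
 have cl: "w \<in> K" if "v \<in> K" "(v, w) \<in> adjacency G" "w \<in> U" for v w
  using that comp_closed[of v G U "Inr (q a)" w] y by (simp add: K_def)
 have KU: "K \<subseteq> U" using comp_subset y by (auto simp: K_def)
 note share = Suc.prems(2) and mem = Suc.prems(1)
 have qK: "Inr (q j) \<in> K" if "a \<le> j" "j < b" for j
  using that
 proof (induction j rule: nat_induct_at_least)
  case base
  then show ?case by (simp add: K_def comp_refl)
 next
  case (Suc j)
  obtain x where "Inl x \<in> U" "incident G x (q j)" "incident G x (q (Suc j))"
   using share[of j] Suc.hyps Suc.prems by blast
  then show ?case using cl[of "Inr (q j)" "Inl x"] cl[of "Inl x" "Inr (q (Suc j))"]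
    Suc.IH Suc.prems mem[of "Suc j"] Suc.hyps by (auto simp: adjacency_iff)
 qed
 have vK: "Inl x \<in> K" if "a \<le> j" "j < b" "Inl x \<in> U" "incident G x (q j)" for j x
  using cl[OF qK[OF that(1,2)], of "Inl x"] that by (auto simp: adjacency_iff)
 show ?case
 proof (rule sr_SucI[OF zU], fold K_def)
  show "\<not> edgeless K" using qK[of a] vK[of a] y ab by (auto simp: edgeless_def)
  fix x assume x: "Inl x \<in> K"
  \<comment> \<open>The sign is irrelevant here: the clauses in the subinterval are not incident to
    x, so they survive, together with all their variables.\<close>
  have part: "enat n \<le> sr (setvar G K x Positive)"
   if a': "a \<le> a'" "b' \<le> b" and un: "\<And>j. a' \<le> j \<Longrightarrow> j < b' \<Longrightarrow> \<not> incident G x (q j)"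
    and n: "2 ^ n \<le> b' - a' + 1" for a' b'
  proof (rule Suc.IH[OF _ _ _ n])
   have v: "Inl w \<in> setvar G K x Positive" if "a' \<le> j" "j < b'" "Inl w \<in> U" "incident G w (q j)" for j w
    using vK[of j w] that a' un[of j] by (auto simp: setvar_def)
   fix j assume j: "a' \<le> j"
   { assume jb: "j < b'"
    have "Inr (q j) \<in> setvar G K x Positive"
     using qK[of j] un[of j] j jb a' by (auto simp: setvar_def incident_iff)
    then show "Inr (q j) \<in> setvar G K x Positive \<and>
      (\<exists>w. Inl w \<in> setvar G K x Positive \<and> incident G w (q j))"
     using v[OF j jb] Suc.prems(1)[of j] j jb a' by force }
   { assume "Suc j < b'"
    then show "\<exists>w. Inl w \<in> setvar G K x Positive \<and> incident G w (q j) \<and> incident G w (q (Suc j))"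
     using v[OF j] Suc.prems(2)[of j] j a' by force }
   fix l w assume "j + 2 \<le> l" "l < b'" "Inl w \<in> setvar G K x Positive" "incident G w (q j)"
   then show "\<not> incident G w (q l)"
    using Suc.prems(3)[of j l w] j a' KU by (auto simp: setvar_def)
  qed
  have "enat n \<le> sr (setvar G K x Positive)"
  proof (cases "\<exists>j\<ge>a. j < b \<and> incident G x (q j)")
   case False
   then show ?thesis using Suc.prems(4) by (intro part[of a b]) auto
  next
   case True
   \<comment> \<open>x meets no clause before position j and none from \<open>j + 2\<close> on. The
     two remaining intervals have at least \<open>b - a - 2\<close> clauses together, so from
     \<open>2 * 2 ^ n \<le> b - a + 1\<close> one of them has at least \<open>2 ^ n - 1\<close>. A
     path of \<open>2 ^ n - 1\<close> clauses is what depth n needs, hence the summand 1 in the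
     hypothesis.\<close>
   define j where "j = (LEAST j. a \<le> j \<and> j < b \<and> incident G x (q j))"
   have j: "a \<le> j" "j < b" "incident G x (q j)"
    using LeastI_ex[OF True] by (simp_all add: j_def)
   have l: "\<not> incident G x (q i)" if "a \<le> i" "i < j" for i
    using not_less_Least[of i "\<lambda>j. a \<le> j \<and> j < b \<and> incident G x (q j)"] that j unfolding j_def by auto
   have r: "\<not> incident G x (q i)" if "j + 2 \<le> i" "i < b" for i
    using Suc.prems(3)[of j i x] that j x KU by blast
   have "2 ^ n \<le> j - a + 1 \<or> 2 ^ n \<le> b - (j + 2) + 1"
    using n2 j by linarith
   then show ?thesis
   proof
    assume "2 ^ n \<le> j - a + 1"
    then show ?thesis using l j by (intro part[of a j]) auto
   next
    assume "2 ^ n \<le> b - (j + 2) + 1"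
    then show ?thesis using r j by (intro part[of "j + 2" b]) auto
   qed
  qed
  then show "\<exists>s. enat n \<le> sr (setvar G K x s)" by blast
 qed
qed

end

text \<open>Clears the lowest set bit.\<close>

fun pre :: "nat \<Rightarrow> nat" where
 "pre n = (if n = 0 then 0 else if odd n then n - 1 else 2 * pre (n div 2))"

declare pre.simps [simp del]

lemma pre_0: "pre 0 = 0"
 by (subst pre.simps) simp

lemma pre_odd: "pre (Suc (2 * m)) = 2 * m"
 by (subst pre.simps) simp

lemma pre_even: "pre (2 * m) = 2 * pre m"
 by (subst pre.simps) (simp add: pre_0)

lemma pre_less: "0 < n \<Longrightarrow> pre n < n"
proof (induction n rule: less_induct)
 case (less n)
 then show ?case using less.IH[of "n div 2"] by (subst pre.simps) (auto elim!: evenE)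
qed

text \<open>If a group of \<open>2 ^ (i + 1)\<close> stages starts at s, its second half starts at
  \<open>s + 2 ^ i\<close>. So the path marked by the first stage of the second half leads back to
  the first stage of the group.\<close>

lemma pre_add_power: "2 ^ Suc i dvd s \<Longrightarrow> pre (s + 2 ^ i) = s"
proof (induction i arbitrary: s)
 case 0
 then obtain r where "s = 2 * r" by (auto elim: dvdE)
 then show ?case using pre_odd[of r] by simp
next
 case (Suc i)
 then obtain r where r: "s = 2 * r" "2 ^ Suc i dvd r" by (auto simp: dvd_def)
 then have "s + 2 ^ Suc i = 2 * (r + 2 ^ i)" by simp
 then show ?case using Suc.IH[OF r(2)] pre_even r by metis
qed

section \<open>Combining the stages of a branch into one obstruction\<close>

context formula
begin

text \<open>Induction on i: the two halves of a group give obstructions Y and Y', and the path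
  marked at the start of the second half connects them into a linked set. The protected set X
  consists of the neighbours of all clauses marked in the group; by \<open>fin\<close> those of the
  first half are gone when the second begins. The statements about the clauses and variables of Y
  are carried along to show that X shields Y.\<close>

lemma stages_robust:
 fixes A :: "nat \<Rightarrow> ('v + 'c) set"
 assumes A: "\<And>j. j < m \<Longrightarrow> A j \<subseteq> verts G"
  and c: "\<And>j. j < m \<Longrightarrow> Inr (c j) \<in> A j \<inter> M j \<and> (\<exists>x. Inl x \<in> A j \<and> incident G x (c j))"
  and red: "\<And>i j. i \<le> j \<Longrightarrow> j < m \<Longrightarrow> reduct G (A j) (A i)"
  and fin: "\<And>i j x. i < j \<Longrightarrow> j < m \<Longrightarrow> Inl x \<in> A j \<Longrightarrow> x \<notin> nbrs (M i)"
  and M: "\<And>j. 0 < j \<Longrightarrow> j < m \<Longrightarrow> M j \<subseteq> A (pre j) \<and> linked G (M j) \<and> Inr (c (pre j)) \<in> M j"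
  and s: "s + 2 ^ i \<le> m" "2 ^ i dvd s"
 defines "J \<equiv> \<lambda>s i. {s..<s + 2 ^ i}"
 shows "\<exists>Y. Y \<subseteq> A s \<and> linked G Y \<and> Inr (c s) \<in> Y \<and> (\<forall>d. Inr d \<in> Y \<longrightarrow> Inr d \<in> (\<Union>j\<in>J s i. M j)) \<and>
  (\<forall>x. Inl x \<in> Y \<longrightarrow> x \<in> nbrs (\<Union>j\<in>J s i. M j)) \<and>
  robust (Suc i) (A s) (nbrs (\<Union>j\<in>J s i. M j)) Y"
 using s
proof (induction i arbitrary: s)
 case 0
 then have s: "s < m" by simp
 then obtain x where x: "Inl x \<in> A s" "incident G x (c s)" using c by blast
 have "robust 1 (A s) (nbrs (\<Union>j\<in>J s 0. M j)) {Inr (c s)}"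
  using c[OF s] by (intro robust_clause[OF x]) (auto simp: nbrs_def J_def)
 then show ?case using c[OF s] by (intro exI[of _ "{Inr (c s)}"]) (auto simp: J_def linked_singleton)
next
 case (Suc i)
 let ?t = "s + 2 ^ i"
 have "s + 2 * 2 ^ i \<le> m" "(1::nat) \<le> 2 ^ i" using Suc.prems(1) by simp_all
 then have st: "s < ?t" "?t < m" "?t + 2 ^ i \<le> m" "s + 2 ^ i \<le> m" by linarith+
 have dv: "2 ^ i dvd s" by (rule dvd_trans[OF le_imp_power_dvd Suc.prems(2)]) simp
 then have dvt: "2 ^ i dvd ?t" by (rule dvd_add) simp
 have pre: "pre ?t = s" by (rule pre_add_power[OF Suc.prems(2)])
 have J: "J s (Suc i) = J s i \<union> J ?t i" by (auto simp: J_def)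
 obtain Y where Y: "Y \<subseteq> A s" "linked G Y" "Inr (c s) \<in> Y" "\<forall>d. Inr d \<in> Y \<longrightarrow> Inr d \<in> (\<Union>j\<in>J s i. M j)"
  "\<forall>x. Inl x \<in> Y \<longrightarrow> x \<in> nbrs (\<Union>j\<in>J s i. M j)" "robust (Suc i) (A s) (nbrs (\<Union>j\<in>J s i. M j)) Y"
  using Suc.IH[OF st(4) dv] by blast
 obtain Y' where Y': "Y' \<subseteq> A ?t" "linked G Y'" "Inr (c ?t) \<in> Y'"
  "\<forall>d. Inr d \<in> Y' \<longrightarrow> Inr d \<in> (\<Union>j\<in>J ?t i. M j)"
  "\<forall>x. Inl x \<in> Y' \<longrightarrow> x \<in> nbrs (\<Union>j\<in>J ?t i. M j)"
  "robust (Suc i) (A ?t) (nbrs (\<Union>j\<in>J ?t i. M j)) Y'"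
  using Suc.IH[OF st(3) dvt] by blast
 have Mt: "M ?t \<subseteq> A s" "linked G (M ?t)" "Inr (c s) \<in> M ?t" "Inr (c ?t) \<in> M ?t"
  using M[of ?t] c[OF st(2)] st pre by simp_all
 have Ats: "reduct G (A ?t) (A s)" using red[of s ?t] st by simp
 define Z where "Z = (Y \<union> M ?t) \<union> Y'"
 have tJ: "?t \<in> J ?t i" by (simp add: J_def)
 have lZ: "linked G Z" unfolding Z_def
  by (intro linked_Un Y(2) Y'(2) Mt(2)) (use Y(3) Y'(3) Mt in blast)+
 \<comment> \<open>A variable of the linked path can reach the clause \<open>c ?t\<close>, so the
   first step of this walk leads to a marked clause next to it.\<close>
 have linkM: "x \<in> nbrs (M ?t)" if "Inl x \<in> M ?t" for x
 proof -
  have "(Inl x, Inr (c ?t)) \<in> (adjacency G \<inter> M ?t \<times> M ?t)\<^sup>*"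
   using Mt that unfolding linked_def by blast
  then obtain v where "(Inl x, v) \<in> adjacency G \<inter> M ?t \<times> M ?t"
   by (cases rule: converse_rtranclE) auto
  then show ?thesis by (auto simp: adjacency_iff nbrs_def)
 qed
 have nU: "nbrs (\<Union>j\<in>J s (Suc i). M j) = nbrs (\<Union>j\<in>J s i. M j) \<union> nbrs (\<Union>j\<in>J ?t i. M j)"
  unfolding J nbrs_def by blast
 have "robust (Suc (Suc i)) (A s) (nbrs (\<Union>j\<in>J s i. M j) \<union> nbrs (\<Union>j\<in>J ?t i. M j)) Z"
 proof (rule robust_combine[OF Y(6) Y'(6) _ _ Ats _ _ _ Y'(1) lZ])
  show "A s \<subseteq> verts G" using A st by simp
  show "x \<notin> nbrs (\<Union>j\<in>J s i. M j)" if "Inl x \<in> A ?t" for x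
   using fin[OF _ st(2) that] unfolding nbrs_def J_def by fastforce
  show "nbrs Y \<subseteq> nbrs (\<Union>j\<in>J s i. M j)" using Y(4) unfolding nbrs_def by blast
  show "Z \<subseteq> A s" using Y(1) Y'(1) Mt(1) Ats unfolding Z_def reduct_def by blast
  show "x \<in> nbrs (\<Union>j\<in>J s i. M j)" if "Inl x \<in> Y" for x using Y(5) that by blast
  show "Z \<noteq> {}" "Y \<subseteq> Z" "Y' \<subseteq> Z" using Y(3) unfolding Z_def by blast+
 qed simp
 moreover have "Z \<subseteq> A s" using Y(1) Y'(1) Mt(1) Ats unfolding Z_def reduct_def by blast
 moreover have "\<forall>d. Inr d \<in> Z \<longrightarrow> Inr d \<in> (\<Union>j\<in>J s (Suc i). M j)"
  using Y(4) Y'(4) tJ unfolding Z_def J by blast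
 moreover have "\<forall>x. Inl x \<in> Z \<longrightarrow> x \<in> nbrs (\<Union>j\<in>J s (Suc i). M j)"
 proof (intro allI impI)
  fix x assume "Inl x \<in> Z"
  moreover have "nbrs (M ?t) \<subseteq> nbrs (\<Union>j\<in>J ?t i. M j)" using tJ unfolding nbrs_def by blast
  ultimately show "x \<in> nbrs (\<Union>j\<in>J s (Suc i). M j)"
   using Y(5) Y'(5) linkM unfolding Z_def nU by blast
 qed
 moreover have "Inr (c s) \<in> Z" using Y(3) by (simp add: Z_def)
 ultimately show ?case using lZ unfolding nU by blast
qed

text \<open>What a failed branch provides: the component \<open>A j\<close> in which stage j starts,
  its clause \<open>c j\<close> and its marked path \<open>M j\<close>. The cardinality bound is the
  maximal degree times the maximal number of clauses on an induced path. The last line says that the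
  path runs in the component of the parent stage.\<close>

definition stages :: "nat \<Rightarrow> nat \<Rightarrow> (nat \<Rightarrow> ('v + 'c) set) \<Rightarrow> (nat \<Rightarrow> 'c) \<Rightarrow> (nat \<Rightarrow> ('v + 'c) set) \<Rightarrow> bool" where
 "stages k m A c M \<longleftrightarrow>
   (\<forall>j<m. A j \<subseteq> verts G \<and> reduct G (A j) (verts G) \<and> Inr (c j) \<in> A j \<inter> M j \<and>
    (\<exists>x. Inl x \<in> A j \<and> incident G x (c j)) \<and>
    finite (nbrs (M j)) \<and> card (nbrs (M j)) \<le> k * (2 ^ Suc k - 2)) \<and>
   (\<forall>i j. i < j \<longrightarrow> j < m \<longrightarrow> reduct G (A j) (A i)) \<and>
   (\<forall>i j x. i < j \<longrightarrow> j < m \<longrightarrow> Inl x \<in> A j \<longrightarrow> x \<notin> nbrs (M i)) \<and>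
   (\<forall>j. 0 < j \<longrightarrow> j < m \<longrightarrow> M j \<subseteq> A (pre j) \<and> linked G (M j) \<and> Inr (c (pre j)) \<in> M j)"

text \<open>The group of all \<open>2 ^ k\<close> stages, applied to \<open>A 0\<close> itself,
  where no variable is missing yet.\<close>

lemma sr_stages:
 assumes "stages k m A c M" "2 ^ k \<le> m"
 shows "enat (Suc k) \<le> sr (verts G)"
proof -
 have "0 < m" using assms(2) by (meson less_le_trans zero_less_numeral zero_less_power)
 have "\<exists>Y. Y \<subseteq> A 0 \<and> linked G Y \<and> Inr (c 0) \<in> Y \<and>
  (\<forall>d. Inr d \<in> Y \<longrightarrow> Inr d \<in> (\<Union>j\<in>{0..<0 + 2 ^ k}. M j)) \<and>
  (\<forall>x. Inl x \<in> Y \<longrightarrow> x \<in> nbrs (\<Union>j\<in>{0..<0 + 2 ^ k}. M j)) \<and>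
  robust (Suc k) (A 0) (nbrs (\<Union>j\<in>{0..<0 + 2 ^ k}. M j)) Y"
 proof (rule stages_robust[of m])
  show "reduct G (A j) (A i)" if "i \<le> j" "j < m" for i j
   using assms(1) that reduct_refl unfolding stages_def by (cases "i = j") auto
 qed (use assms in \<open>auto simp: stages_def\<close>)
 then obtain X Y where Y: "Y \<subseteq> A 0" "robust (Suc k) (A 0) X Y" by blast
 have "enat (Suc k) \<le> sr (A 0)"
  using Y reduct_refl unfolding robust_def avoids_def by blast
 also have "\<dots> \<le> sr (verts G)"
  by (rule sr_reduct_mono) (use assms(1) \<open>0 < m\<close> in \<open>auto simp: stages_def\<close>)
 finally show ?thesis .
qed

text \<open>Counting: the assigned variables are neighbours of marked clauses, so m stages account
  for at most \<open>m * k * (2 ^ (k + 1) - 2)\<close> of them. For \<open>m < 2 ^ k\<close> this is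
  less than \<open>2 * k * 4 ^ k\<close>. If k = 0 the budget is 0 and the count says nothing, but
  then any remaining edge already shows depth at least 1.\<close>

lemma sr_stages_exhausted:
 assumes st: "stages k m A c M"
  and X: "X \<subseteq> (\<Union>j<m. nbrs (M j))" "card X = 2 * k * 4 ^ k"
  and U: "reduct G U (verts G)" "\<not> edgeless U"
 shows "enat k < sr (verts G)"
proof (cases "k = 0")
 case True
 then show ?thesis using sr_ge_1[OF U(2)] sr_reduct_mono[OF U(1)]
  by (metis One_nat_def enat_ord_simps(2) less_le_trans zero_less_one)
next
 case False
 let ?b = "2 ^ Suc k - 2 :: nat"
 have "(2::nat) ^ 1 \<le> 2 ^ k" using False by (intro power_increasing) auto
 then have b: "0 < ?b" by simp
 have "2 * k * 4 ^ k \<le> card (\<Union>j<m. nbrs (M j))"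
  unfolding X(2)[symmetric] by (rule card_mono[OF _ X(1)]) (use st in \<open>auto simp: stages_def\<close>)
 also have "\<dots> \<le> (\<Sum>j<m. card (nbrs (M j)))" by (rule card_UN_le) simp
 also have "\<dots> \<le> (\<Sum>j<m. k * ?b)" by (rule sum_mono) (use st in \<open>auto simp: stages_def\<close>)
 finally have "2 * k * 4 ^ k \<le> m * (k * ?b)" by simp
 moreover have "(4::nat) ^ k = 2 ^ k * 2 ^ k" by (simp flip: power_mult_distrib)
 ultimately have "k * (2 ^ k * (2 * 2 ^ k)) \<le> k * (m * ?b)" by (simp add: algebra_simps)
 then have le: "2 ^ k * (2 * 2 ^ k) \<le> m * ?b" using False by simp
 have "2 ^ k \<le> m"
 proof (rule ccontr)
  assume "\<not> 2 ^ k \<le> m"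
  then have "m * ?b \<le> 2 ^ k * ?b" by simp
  also have "\<dots> < 2 ^ k * (2 * 2 ^ k)" by (simp add: b)
  finally show False using le by simp
 qed
 from sr_stages[OF st this] show ?thesis by (simp add: Suc_ile_eq)
qed

text \<open>By \<open>sr_ge_degree\<close>, a clause with more than k variables would exceed the
  assumed depth.\<close>

lemma card_nbrs_le:
 assumes sr: "sr (verts G) \<le> enat k" and M: "finite C" "\<And>c. Inr c \<in> M \<Longrightarrow> c \<in> C"
 shows "finite (nbrs M)" "card (nbrs M) \<le> k * card C"
proof -
 have sub: "nbrs M \<subseteq> (\<Union>c\<in>C. {x. incident G x c})" using M by (auto simp: nbrs_def)
 have fin: "finite {x. incident G x c}" for c
  by (rule finite_subset[of _ "vars G"])
    (use ig incident_verts in \<open>force simp: verts_def incidence_graph_def\<close>)+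
 then have finU: "finite (\<Union>c\<in>C. {x. incident G x c})" using M by blast
 then show "finite (nbrs M)" using sub finite_subset by blast
 have deg: "card {x. incident G x c} \<le> k" for c
 proof (cases "{x. incident G x c} = {}")
  case False
  then obtain y where "incident G y c" by blast
  then have "Inr c \<in> verts G" using incident_verts by blast
  moreover have "{x. Inl x \<in> verts G \<and> incident G x c} = {x. incident G x c}"
   using incident_verts by blast
  ultimately have "enat (card {x. incident G x c}) \<le> sr (verts G)"
   using sr_ge_degree[of c "verts G" "card {x. incident G x c}"] by simp
  then show ?thesis using sr by (meson enat_ord_simps(1) order_trans)
 qed simp
 have "card (nbrs M) \<le> card (\<Union>c\<in>C. {x. incident G x c})" using sub finU by (rule card_mono[rotated])
 also have "\<dots> \<le> (\<Sum>c\<in>C. card {x. incident G x c})" using M(1) by (rule card_UN_le)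
 also have "\<dots> \<le> (\<Sum>c\<in>C. k)" by (rule sum_mono) (rule deg)
 finally show "card (nbrs M) \<le> k * card C" by (simp add: mult.commute)
qed

end

section \<open>Breadth-first search\<close>

text \<open>
 seg is the queue of a search in U from its head. The first i vertices are completely processed, and
 of the next one only the neighbours ys. The level function bounds the distance from the root.
\<close>

definition bfs_state ::
 "('a \<Rightarrow> 'a set) \<Rightarrow> 'a set \<Rightarrow> 'a list \<Rightarrow> nat \<Rightarrow> 'a set \<Rightarrow> ('a \<Rightarrow> 'a) \<Rightarrow> bool" where
 "bfs_state nb U seg i ys par \<longleftrightarrow>
   seg \<noteq> [] \<and> distinct seg \<and> set seg \<subseteq> U \<and> i \<le> length seg \<and> par (hd seg) = hd seg \<and>
   (\<exists>lev :: 'a \<Rightarrow> nat. lev (hd seg) = 0 \<and> sorted (map lev seg) \<and>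
    (\<forall>v\<in>set seg - {hd seg}. par v \<in> set seg \<and> v \<in> nb (par v) \<and> lev v = Suc (lev (par v))) \<and>
    (\<forall>j<i. \<forall>w\<in>nb (seg ! j) \<inter> U. w \<in> set seg \<and> lev w \<le> Suc (lev (seg ! j))) \<and>
    (i < length seg \<longrightarrow> (\<forall>v\<in>set seg. lev v \<le> Suc (lev (seg ! i))) \<and> ys \<inter> U \<subseteq> set seg))"

text \<open>The levels are only asserted to exist; the program stores parents alone. The last line,
  that levels rise by at most one along any edge of K, makes tree paths to the root shortest and
  hence induced.\<close>

definition bfs_tree :: "('a \<Rightarrow> 'a set) \<Rightarrow> 'a set \<Rightarrow> 'a \<Rightarrow> ('a \<Rightarrow> 'a) \<Rightarrow> bool" where
 "bfs_tree nb K r par \<longleftrightarrow>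
   r \<in> K \<and> par r = r \<and>
   (\<exists>lev :: 'a \<Rightarrow> nat. lev r = 0 \<and>
    (\<forall>v\<in>K - {r}. par v \<in> K \<and> v \<in> nb (par v) \<and> lev v = Suc (lev (par v))) \<and>
    (\<forall>u\<in>K. \<forall>w\<in>nb u \<inter> K. lev w \<le> Suc (lev u)))"

lemma bfs_state_init: "r \<in> U \<Longrightarrow> par r = r \<Longrightarrow> bfs_state nb U [r] 0 {} par"
 unfolding bfs_state_def by (auto intro!: exI[of _ "\<lambda>_. 0"])

lemma bfs_state_cong:
 assumes "bfs_state nb U seg i ys par" "\<And>v. v \<in> set seg \<Longrightarrow> par' v = par v"
 shows "bfs_state nb U seg i ys par'"
 using assms unfolding bfs_state_def by (metis DiffD1 hd_in_set)

lemma bfs_state_skip: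
 assumes "bfs_state nb U seg i ys par" "w \<notin> U \<or> w \<in> set seg"
 shows "bfs_state nb U seg i (insert w ys) par"
 using assms unfolding bfs_state_def by blast

text \<open>No level in the queue exceeds that of the current vertex by more than one. The new
  vertex gets exactly this value, so the queue stays sorted by level.\<close>

lemma bfs_state_visit:
 assumes s: "bfs_state nb U seg i ys par" and i: "i < length seg"
  and w: "w \<in> nb (seg ! i)" "w \<in> U" "w \<notin> set seg"
 shows "bfs_state nb U (seg @ [w]) i (insert w ys) (par(w := seg ! i))"
proof -
 obtain lev :: "'a \<Rightarrow> nat" where lev: "lev (hd seg) = 0" "sorted (map lev seg)"
  "\<forall>v\<in>set seg - {hd seg}. par v \<in> set seg \<and> v \<in> nb (par v) \<and> lev v = Suc (lev (par v))"
  "\<forall>j<i. \<forall>w\<in>nb (seg ! j) \<inter> U. w \<in> set seg \<and> lev w \<le> Suc (lev (seg ! j))"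
  "\<forall>v\<in>set seg. lev v \<le> Suc (lev (seg ! i))" "ys \<inter> U \<subseteq> set seg"
  using s i unfolding bfs_state_def by blast
 have seg: "seg \<noteq> []" "distinct seg" "set seg \<subseteq> U" "par (hd seg) = hd seg"
  using s by (auto simp: bfs_state_def)
 define l where "l = lev(w := Suc (lev (seg ! i)))"
 have l: "l v = lev v" if "v \<in> set seg" for v using that w by (auto simp: l_def)
 have hd: "hd seg \<in> set seg" "hd seg \<noteq> w" using seg w by auto
 have nth: "seg ! j \<in> set seg" if "j \<le> i" for j using that i by auto
 have "sorted (map l (seg @ [w]))"
  using lev(2,5) l by (auto simp: sorted_append l_def cong: map_cong)
 moreover have "\<forall>v\<in>set (seg @ [w]) - {hd (seg @ [w])}. (par(w := seg ! i)) v \<in> set (seg @ [w]) \<and>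
   v \<in> nb ((par(w := seg ! i)) v) \<and> l v = Suc (l ((par(w := seg ! i)) v))"
  using lev(3) l nth[of i] w seg by (auto simp: l_def)
 moreover have "\<forall>j<i. \<forall>v\<in>nb ((seg @ [w]) ! j) \<inter> U.
   v \<in> set (seg @ [w]) \<and> l v \<le> Suc (l ((seg @ [w]) ! j))"
  using lev(4) l nth i by (auto simp: nth_append)
 moreover have "\<forall>v\<in>set (seg @ [w]). l v \<le> Suc (l ((seg @ [w]) ! i))"
  using lev(5) l nth[of i] i by (auto simp: nth_append l_def)
 ultimately show ?thesis
  unfolding bfs_state_def using seg w hd lev(1,6) i l
  by (intro conjI exI[of _ l]) auto
qed

text \<open>The queue is sorted by level, so an upper bound in terms of the current vertex also
  holds in terms of the next one.\<close>

lemma bfs_state_next: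
 assumes s: "bfs_state nb U seg i ys par" and i: "i < length seg" and ys: "nb (seg ! i) \<subseteq> ys"
 shows "bfs_state nb U seg (Suc i) {} par"
proof -
 obtain lev :: "'a \<Rightarrow> nat" where lev: "lev (hd seg) = 0" "sorted (map lev seg)"
  "\<forall>v\<in>set seg - {hd seg}. par v \<in> set seg \<and> v \<in> nb (par v) \<and> lev v = Suc (lev (par v))"
  "\<forall>j<i. \<forall>w\<in>nb (seg ! j) \<inter> U. w \<in> set seg \<and> lev w \<le> Suc (lev (seg ! j))"
  "\<forall>v\<in>set seg. lev v \<le> Suc (lev (seg ! i))" "ys \<inter> U \<subseteq> set seg"
  using s i unfolding bfs_state_def by blast
 have "\<forall>j<Suc i. \<forall>w\<in>nb (seg ! j) \<inter> U. w \<in> set seg \<and> lev w \<le> Suc (lev (seg ! j))"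
  using lev(4-6) ys by (auto simp: less_Suc_eq)
 moreover have "lev (seg ! i) \<le> lev (seg ! Suc i)" if "Suc i < length seg"
  using sorted_nth_mono[OF lev(2), of i "Suc i"] that by simp
 then have "Suc i < length seg \<longrightarrow> (\<forall>v\<in>set seg. lev v \<le> Suc (lev (seg ! Suc i)))"
  using lev(5) by (metis Suc_le_mono order_trans)
 ultimately show ?thesis using s lev i unfolding bfs_state_def
  by (intro conjI exI[of _ lev]) auto
qed

lemma bfs_state_final:
 assumes s: "bfs_state nb U seg (length seg) ys par"
 shows "bfs_tree nb (set seg) (hd seg) par" "\<And>u w. u \<in> set seg \<Longrightarrow> w \<in> nb u \<Longrightarrow> w \<in> U \<Longrightarrow> w \<in> set seg"
proof -
 obtain lev :: "'a \<Rightarrow> nat" where lev: "lev (hd seg) = 0"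
  "\<forall>v\<in>set seg - {hd seg}. par v \<in> set seg \<and> v \<in> nb (par v) \<and> lev v = Suc (lev (par v))"
  "\<forall>j<length seg. \<forall>w\<in>nb (seg ! j) \<inter> U. w \<in> set seg \<and> lev w \<le> Suc (lev (seg ! j))"
  using s unfolding bfs_state_def by blast
 have *: "w \<in> set seg \<and> lev w \<le> Suc (lev u)" if "u \<in> set seg" "w \<in> nb u" "w \<in> U" for u w
  using lev(3) that by (metis IntI in_set_conv_nth)
 then show "\<And>u w. u \<in> set seg \<Longrightarrow> w \<in> nb u \<Longrightarrow> w \<in> U \<Longrightarrow> w \<in> set seg" by blast
 have U: "set seg \<subseteq> U" "par (hd seg) = hd seg" "seg \<noteq> []" using s by (auto simp: bfs_state_def)
 have "\<forall>u\<in>set seg. \<forall>w\<in>nb u \<inter> set seg. lev w \<le> Suc (lev u)" using * U(1) by blast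
 then show "bfs_tree nb (set seg) (hd seg) par" unfolding bfs_tree_def using lev U
  by (intro conjI exI[of _ lev]) auto
qed

text \<open>The root is its own parent, so a walk with more steps than needed just stays there. This
  lets the program follow parents for a fixed number of steps without recognising the root.\<close>

definition walk :: "nat \<Rightarrow> ('a \<Rightarrow> 'a) \<Rightarrow> 'a \<Rightarrow> 'a set" where
 "walk d par c = (\<lambda>i. (par ^^ i) c) ` {..<d}"

section \<open>Branches of the search for a backdoor\<close>

text \<open>
 Vertices are numbered consecutively, the nv variables come first. A stage of a branch of the search
 is a component with a breadth-first search tree whose root is a clause.
\<close>

locale numbered_formula = formula G for G :: "(nat, nat) igraph" +
 fixes nv n :: nat
 assumes nv: "vars G = {..<nv}" and nc: "clauses G = {..<n - nv}" and nv_le: "nv \<le> n"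
begin

definition dec :: "nat \<Rightarrow> nat + nat" where
 "dec v = (if v < nv then Inl v else Inr (v - nv))"

definition nb :: "nat \<Rightarrow> nat set" where
 "nb u = {w. (dec u, dec w) \<in> adjacency G}"

definition gr :: "nat set \<Rightarrow> (nat, nat) igraph" where
 "gr U = induced G (dec ` U)"

lemma dec_inj: "dec u = dec w \<longleftrightarrow> u = w"
 by (auto simp: dec_def split: if_splits)

lemma dec_image_iff: "dec u \<in> dec ` U \<longleftrightarrow> u \<in> U"
 by (auto simp: dec_inj)

lemma Inl_dec: "Inl x \<in> dec ` U \<longleftrightarrow> x < nv \<and> x \<in> U"
 by (auto simp: dec_def image_iff split: if_splits)

lemma Inr_dec: "Inr c \<in> dec ` U \<longleftrightarrow> nv + c \<in> U"
 by (auto simp: dec_def image_iff split: if_splits intro!: bexI[of _ "nv + c"])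

lemma verts_dec: "verts G = dec ` {..<n}"
proof -
 have "v \<in> verts G \<longleftrightarrow> v \<in> dec ` {..<n}" for v
  using nv_le by (cases v) (auto simp: Inl_dec Inr_dec verts_def nv nc)
 then show ?thesis by blast
qed

lemma nb_sym: "w \<in> nb u \<longleftrightarrow> u \<in> nb w"
 using sym_adjacency[of G] by (auto simp: nb_def sym_def)

lemma nb_less: "w \<in> nb u \<Longrightarrow> u < n \<and> w < n"
proof -
 assume "w \<in> nb u"
 then have "dec u \<in> verts G" "dec w \<in> verts G"
  using incident_verts by (auto simp: nb_def adjacency_iff)
 then show ?thesis by (auto simp: verts_dec dec_inj)
qed

lemma nb_type: "w \<in> nb u \<Longrightarrow> w < nv \<longleftrightarrow> \<not> u < nv"
 by (auto simp: nb_def adjacency_iff dec_def split: if_splits)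

lemma nb_incident: "x < nv \<Longrightarrow> \<not> c < nv \<Longrightarrow> c \<in> nb x \<longleftrightarrow> incident G x (c - nv)"
 by (auto simp: nb_def adjacency_iff dec_def)

definition edgy :: "nat set \<Rightarrow> bool" where
 "edgy K \<longleftrightarrow> (\<exists>u\<in>K. \<exists>w\<in>K. w \<in> nb u)"

lemma edgeless_dec: "edgeless (dec ` U) \<longleftrightarrow> \<not> edgy U"
proof
 assume *: "\<not> edgy U"
 show "edgeless (dec ` U)"
  unfolding edgeless_def
 proof (intro allI impI)
  fix x c assume "Inl x \<in> dec ` U" "Inr c \<in> dec ` U"
  then show "\<not> incident G x c"
   using * nb_incident[of x "nv + c"] by (auto simp: Inl_dec Inr_dec edgy_def)
 qed
next
 assume *: "edgeless (dec ` U)"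
 have False if "u \<in> U" "w \<in> U" "w \<in> nb u" "u < nv" for u w
  using * that nb_incident[of u w] nb_type[OF that(3)]
  by (auto simp: edgeless_def Inl_dec Inr_dec)
 then show "\<not> edgy U" unfolding edgy_def using nb_type nb_sym by blast
qed

type_synonym stage = "nat set \<times> nat \<times> (nat \<Rightarrow> nat)"

text \<open>The path starts at the root clause of stage j but follows the tree of stage
  \<open>pre j\<close>. For j = 0 this is the stage itself and the path is the root alone.\<close>

definition marked :: "nat \<Rightarrow> stage list \<Rightarrow> nat \<Rightarrow> nat set" where
 "marked d stg j = walk d (snd (snd (stg ! pre j))) (fst (snd (stg ! j)))"

definition hits :: "nat \<Rightarrow> nat set \<Rightarrow> bool" where
 "hits x M \<longleftrightarrow> x < nv \<and> (\<exists>c\<in>M. c \<in> nb x)"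

definition stage_ok :: "stage \<Rightarrow> bool" where
 "stage_ok s \<longleftrightarrow> reduct G (dec ` fst s) (verts G) \<and> nv \<le> fst (snd s) \<and> edgy (fst s) \<and>
   bfs_tree nb (fst s) (fst (snd s)) (snd (snd s))"

text \<open>The invariant of a branch that has assigned X and is left with U. It collects what
  \<open>stages\<close> needs and what does not depend on the assumption that the depth is at most
  k.\<close>

definition hist :: "nat \<Rightarrow> stage list \<Rightarrow> nat set \<Rightarrow> nat set \<Rightarrow> bool" where
 "hist d stg X U \<longleftrightarrow>
   reduct G (dec ` U) (verts G) \<and> finite X \<and> X \<inter> U = {} \<and>
   (\<forall>x\<in>X. \<exists>j<length stg. hits x (marked d stg j)) \<and>
   (\<forall>j<length stg. stage_ok (stg ! j) \<and> reduct G (dec ` U) (dec ` fst (stg ! j))) \<and>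
   (\<forall>i j. i < j \<longrightarrow> j < length stg \<longrightarrow>
    reduct G (dec ` fst (stg ! j)) (dec ` fst (stg ! i)) \<and>
    (\<forall>x\<in>fst (stg ! j). \<not> hits x (marked d stg i)))"

lemma histD:
 assumes "hist d stg X U"
 shows "reduct G (dec ` U) (verts G)" "finite X" "X \<inter> U = {}"
  "\<And>x. x \<in> X \<Longrightarrow> \<exists>j<length stg. hits x (marked d stg j)"
  "\<And>j. j < length stg \<Longrightarrow> stage_ok (stg ! j)"
  "\<And>j. j < length stg \<Longrightarrow> reduct G (dec ` U) (dec ` fst (stg ! j))"
  "\<And>i j. i < j \<Longrightarrow> j < length stg \<Longrightarrow> reduct G (dec ` fst (stg ! j)) (dec ` fst (stg ! i))"
  "\<And>i j x. i < j \<Longrightarrow> j < length stg \<Longrightarrow> x \<in> fst (stg ! j) \<Longrightarrow> \<not> hits x (marked d stg i)"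
 using assms unfolding hist_def by blast+

definition closed_in :: "nat set \<Rightarrow> nat set \<Rightarrow> bool" where
 "closed_in K U \<longleftrightarrow> K \<subseteq> U \<and> (\<forall>u\<in>K. \<forall>w\<in>nb u \<inter> U. w \<in> K)"

lemma closed_in_reduct:
 assumes "closed_in K U" shows "reduct G (dec ` K) (dec ` U)"
 unfolding reduct_def
proof (intro conjI allI impI)
 show "dec ` K \<subseteq> dec ` U" using assms by (auto simp: closed_in_def)
 fix x assume x: "Inl x \<in> dec ` U - dec ` K"
 have "\<not> incident G x c" if "Inr c \<in> dec ` K" for c
  using assms x that nb_incident[of x "nv + c"] nb_sym[of x "nv + c"]
  by (auto simp: closed_in_def Inl_dec Inr_dec)
 then show "\<exists>s. \<forall>c. Inr c \<in> dec ` K \<longrightarrow> (x, c) \<notin> edges G s"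
  by (auto simp: incident_def)
qed

lemma reduct_subset: "reduct G (dec ` K) (dec ` U) \<Longrightarrow> K \<subseteq> U"
 by (simp add: reduct_def inj_image_subset_iff inj_def dec_inj)

lemma hist_reduct:
 assumes "hist d stg X U" "reduct G (dec ` K) (dec ` U)" shows "hist d stg X K"
 unfolding hist_def
 using histD[OF assms(1)] reduct_subset[OF assms(2)] reduct_trans[OF assms(2)] by auto

lemma marked_append: "j < length stg \<Longrightarrow> marked d (stg @ [s]) j = marked d stg j"
 using pre_less[of j] by (cases "j = 0") (auto simp: marked_def nth_append pre_0)

lemma hist_Nil: "hist d [] {} {..<n}"
 by (simp add: hist_def verts_dec reduct_refl)

text \<open>Only the last stage has to be checked for neighbours of marked clauses: the components
  shrink, and that of the last stage already contained none for the stages before it.\<close>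

lemma hist_stage:
 assumes h: "hist d stg X K" and r: "nv \<le> r" "edgy K" "bfs_tree nb K r par"
  and no: "stg \<noteq> [] \<Longrightarrow> \<forall>x\<in>K. \<not> hits x (marked d stg (length stg - 1))"
 shows "hist d (stg @ [(K, r, par)]) X K"
proof -
 let ?s = "stg @ [(K, r, par)]"
 have no': "\<not> hits x (marked d stg i)" if "i < length stg" "x \<in> K" for i x
 proof (cases "i = length stg - 1")
  case True
  moreover have "stg \<noteq> []" using that by auto
  ultimately show ?thesis using no that by blast
 next
  case False
  then have i: "i < length stg - 1" "length stg - 1 < length stg" using that by auto
  have "x \<in> fst (stg ! (length stg - 1))"
   using reduct_subset[OF histD(6)[OF h i(2)]] that by blast
  then show ?thesis by (rule histD(8)[OF h i])
 qed
 have "stage_ok (K, r, par)" using r histD(1)[OF h] by (simp add: stage_ok_def)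
 then have "stage_ok (?s ! j) \<and> reduct G (dec ` K) (dec ` fst (?s ! j))" if "j < length ?s" for j
  using histD(5,6)[OF h, of j] that reduct_refl by (auto simp: nth_append less_Suc_eq)
 moreover have "\<exists>j<length ?s. hits x (marked d ?s j)" if "x \<in> X" for x
  using histD(4)[OF h that] marked_append[of _ stg d "(K, r, par)"]
  by (metis length_append_singleton less_Suc_eq)
 moreover have "reduct G (dec ` fst (?s ! j)) (dec ` fst (?s ! i)) \<and>
    (\<forall>x\<in>fst (?s ! j). \<not> hits x (marked d ?s i))" if "i < j" "j < length ?s" for i j
 proof (cases "j < length stg")
  case True
  then show ?thesis
   using histD(7,8)[OF h that(1) True] that marked_append[of i stg] by (simp add: nth_append)
 next
  case False
  then have "j = length stg" "i < length stg" using that by auto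
  then show ?thesis using histD(6)[OF h] no' marked_append[of i stg] by (simp add: nth_append)
 qed
 ultimately show ?thesis unfolding hist_def using histD(1-3)[OF h] by simp
qed

definition sat :: "nat \<Rightarrow> sign \<Rightarrow> nat set" where
 "sat x s = {c. nv \<le> c \<and> (x, c - nv) \<in> edges G s}"

lemma dec_setvar: "x < nv \<Longrightarrow> dec ` (U - {x} - sat x s) = setvar G (dec ` U) x s"
proof -
 assume x: "x < nv"
 have "v \<in> dec ` (U - {x} - sat x s) \<longleftrightarrow> v \<in> setvar G (dec ` U) x s" for v
  using x by (cases v) (auto simp: setvar_def Inl_dec Inr_dec sat_def)
 then show ?thesis by blast
qed

lemma setvar_reduct: "x \<in> U \<Longrightarrow> x < nv \<Longrightarrow> reduct G (dec ` (U - {x} - sat x s)) (dec ` U)"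
proof -
 assume x: "x \<in> U" "x < nv"
 show ?thesis
  unfolding dec_setvar[OF x(2)] reduct_def
 proof (intro conjI allI impI)
  show "setvar G (dec ` U) x s \<subseteq> dec ` U" by (auto simp: setvar_def)
  fix y assume "Inl y \<in> dec ` U - setvar G (dec ` U) x s"
  then have "y = x" by (auto simp: setvar_def)
  then show "\<exists>t. \<forall>c. Inr c \<in> setvar G (dec ` U) x s \<longrightarrow> (y, c) \<notin> edges G t"
   by (intro exI[of _ s]) (auto simp: setvar_def)
 qed
qed

lemma hist_assign:
 assumes h: "hist d stg X U" and x: "x \<in> U" "hits x (marked d stg (length stg - 1))" "stg \<noteq> []"
 shows "hist d stg (insert x X) (U - {x} - sat x s)"
proof -
 have h': "hist d stg X (U - {x} - sat x s)"
  by (rule hist_reduct[OF h setvar_reduct]) (use x in \<open>auto simp: hits_def\<close>)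
 have "\<exists>j<length stg. hits x (marked d stg j)"
  using x by (intro exI[of _ "length stg - 1"]) simp
 then show ?thesis unfolding hist_def using histD[OF h'] by auto
qed

text \<open>An edge provides a second vertex, and its ancestor just below the root is a neighbour of
  the root.\<close>

lemma bfs_tree_root_nb:
 assumes "bfs_tree nb K r par" "edgy K" shows "\<exists>x\<in>K. x \<in> nb r"
proof -
 obtain lev where lev:
  "\<And>v. v \<in> K \<Longrightarrow> v \<noteq> r \<Longrightarrow> par v \<in> K \<and> v \<in> nb (par v) \<and> lev v = Suc (lev (par v))"
  using assms(1) unfolding bfs_tree_def by blast
 obtain u w where uw: "u \<in> K" "w \<in> K" "w \<in> nb u" using assms(2) by (auto simp: edgy_def)
 then have "u \<noteq> w" using nb_type by blast
 then obtain y where y: "y \<in> K" "y \<noteq> r" using uw by metis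
 have "\<exists>x\<in>K. x \<in> nb r" if "y \<in> K" "y \<noteq> r" for y
  using that
 proof (induction "lev y" arbitrary: y rule: less_induct)
  case less
  then show ?case using lev[of y] by (metis lessI)
 qed
 then show ?thesis using y by blast
qed

text \<open>Levels drop by one at each step of the path and change by at most one along every edge.
  Two clauses on the path that are not consecutive differ by at least four levels, so no variable is
  adjacent to both. Hence the path is induced and \<open>sr_ge_path\<close> bounds its
  length.\<close>

lemma marked_path:
 assumes sr: "sr (verts G) \<le> enat k" and d: "2 ^ (k + 2) \<le> d + 2"
  and K: "reduct G (dec ` K) (verts G)" "edgy K" and t: "bfs_tree nb K r par" and r: "nv \<le> r" and c: "c \<in> K" "nv \<le> c"
 shows "walk d par c \<subseteq> K" "r \<in> walk d par c" "linked G (dec ` walk d par c)"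
  "\<exists>C. finite C \<and> card C \<le> 2 ^ Suc k - 2 \<and> (\<forall>c'. Inr c' \<in> dec ` walk d par c \<longrightarrow> c' \<in> C)"
proof -
 obtain lev where rK: "r \<in> K" "par r = r" and lev: "lev r = (0::nat)"
  "\<And>v. v \<in> K \<Longrightarrow> v \<noteq> r \<Longrightarrow> par v \<in> K \<and> v \<in> nb (par v) \<and> lev v = Suc (lev (par v))"
  "\<And>u w. u \<in> K \<Longrightarrow> w \<in> nb u \<Longrightarrow> w \<in> K \<Longrightarrow> lev w \<le> Suc (lev u)"
  using t unfolding bfs_tree_def by blast
 define v where "v i = (par ^^ i) c" for i
 have vS: "v (Suc i) = par (v i)" and v0: "v 0 = c" for i by (simp_all add: v_def)
 have vK: "v i \<in> K" for i
 proof (induction i)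
  case (Suc i)
  then show ?case using lev(2)[of "v i"] rK by (cases "v i = r") (simp_all add: vS)
 qed (simp add: v0 c)
 have lev0: "u = r" if "u \<in> K" "lev u = 0" for u using lev(2)[OF that(1)] that(2) by auto
 define L where "L = lev c"
 have levv: "lev (v i) = L - i" for i
 proof (induction i)
  case (Suc i)
  then show ?case using lev(2)[OF vK[of i]] lev(1) rK by (cases "v i = r") (auto simp: vS)
 qed (simp add: v0 L_def)
 have vL: "v i = r" if "L \<le> i" for i using lev0[OF vK] levv that by simp
 have vne: "v i \<noteq> r" if "i < L" for i using levv[of i] lev(1) that by auto
 have step: "v i \<in> nb (v (Suc i))" if "i < L" for i using lev(2)[OF vK vne[OF that]] by (simp add: vS)
 have type: "nv \<le> v i \<longleftrightarrow> even i" if "i \<le> L" for i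
  using that
 proof (induction i)
  case (Suc i)
  then show ?case using nb_type[OF step[of i]] by auto
 qed (simp add: v0 c)
 have evL: "even L" using type[of L] vL[of L] r by simp
 \<comment> \<open>The path has positions 0 to L with a clause at both ends, and its clauses are the
   even positions.\<close>
 define b where "b = L div 2 + 1"
 define q where "q j = v (2 * j) - nv" for j
 have b2: "2 * j \<le> L" if "j < b" for j using that evL by (auto simp: b_def)
 have nvq: "nv \<le> v (2 * j)" if "j < b" for j using type[of "2 * j"] b2[OF that] by simp
 have qd: "Inr (q j) = dec (v (2 * j))" if "j < b" for j using nvq[OF that] by (simp add: q_def dec_def)
 have inc: "incident G x (q j)" if "x < nv" "v (2 * j) \<in> nb x" "j < b" for x j
  using nb_incident[of x "v (2 * j)"] nvq[OF that(3)] that by (simp add: q_def)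
 have inc': "v (2 * j) \<in> nb x" if "x < nv" "incident G x (q j)" "j < b" for x j
  using nb_incident[of x "v (2 * j)"] nvq[OF that(3)] that by (simp add: q_def)
 have odd: "v (Suc (2 * j)) < nv" if "Suc j < b" for j
  using type[of "Suc (2 * j)"] b2[OF that] by simp
 have share: "\<exists>x. Inl x \<in> dec ` K \<and> incident G x (q j) \<and> incident G x (q (Suc j))" if "Suc j < b" for j
 proof (intro exI conjI)
  show "Inl (v (Suc (2 * j))) \<in> dec ` K" using odd[OF that] vK by (simp add: Inl_dec)
  show "incident G (v (Suc (2 * j))) (q j)"
   using step[of "2 * j"] b2[OF that] that by (intro inc odd) auto
  show "incident G (v (Suc (2 * j))) (q (Suc j))"
   using step[of "Suc (2 * j)"] b2[OF that] that by (intro inc odd) (auto simp: nb_sym)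
 qed
 have rnb: "\<exists>x\<in>K. x \<in> nb r" by (rule bfs_tree_root_nb[OF t K(2)])
 \<comment> \<open>Every clause but the last shares a variable with its successor. The last one is
   the root, which has a neighbour because K has an edge.\<close>
 have nonempty: "\<exists>x. Inl x \<in> dec ` K \<and> incident G x (q j)" if j: "j < b" for j
 proof (cases "Suc j < b")
  case True
  then show ?thesis using share by blast
 next
  case False
  then have "2 * j = L" using j evL by (auto simp: b_def)
  then have vr: "v (2 * j) = r" using vL by simp
  obtain x where x: "x \<in> K" "x \<in> nb r" using rnb by blast
  then have "x < nv" using nb_type r by (meson not_less)
  then show ?thesis using x inc[of x j] j vr nb_sym by (auto simp: Inl_dec)
 qed
 have noshare: "\<not> incident G x (q l)"
  if "j + 2 \<le> l" "l < b" "Inl x \<in> dec ` K" "incident G x (q j)" for j l x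
 proof
  assume *: "incident G x (q l)"
  have x: "x \<in> K" "x < nv" using that(3) by (simp_all add: Inl_dec)
  have "lev x \<le> Suc (lev (v (2 * l)))"
   using lev(3)[OF vK _ x(1)] inc'[OF x(2) * that(2)] nb_sym by blast
  moreover have "lev (v (2 * j)) \<le> Suc (lev x)"
   using lev(3)[OF x(1) _ vK] inc'[OF x(2) that(4)] that by simp
  ultimately show False using levv[of "2 * l"] levv[of "2 * j"] b2[OF that(2)] that(1) by linarith
 qed
 have b: "b \<le> 2 ^ Suc k - 2"
 proof (rule ccontr)
  assume "\<not> ?thesis"
  then have "2 ^ Suc k \<le> b - 0 + 1" by simp
  then have "enat (Suc k) \<le> sr (dec ` K)"
   by (rule sr_ge_path[of 0 b q, rotated 3])
     (use share nonempty noshare in \<open>auto simp: qd dec_image_iff vK\<close>)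
  also have "\<dots> \<le> enat k" using sr_reduct_mono[OF K(1)] sr by (rule order_trans)
  finally show False by simp
 qed
 \<comment> \<open>\<open>L = 2 * b - 2\<close> is at most \<open>2 ^ (k + 2) - 6\<close>, so the d
   marked vertices include the root.\<close>
 have Ld: "L < d" using b d by (auto simp: b_def)
 have w: "walk d par c = v ` {..<d}" by (simp add: walk_def v_def)
 have vmin: "v i = v (min i L)" for i using vL by (simp add: min_def)
 have w': "walk d par c = v ` {..L}"
  unfolding w using Ld vmin by (fastforce simp: image_iff min_def)
 show "walk d par c \<subseteq> K" using vK by (auto simp: w)
 show "r \<in> walk d par c" unfolding w' using vL[of L] by (metis atMost_iff imageI order_refl)
 have "linked G (dec ` v ` {..i})" if "i \<le> L" for i
  using that
 proof (induction i)
  case 0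
  then show ?case by (simp add: linked_singleton)
 next
  case (Suc i)
  have "(dec (v i), dec (v (Suc i))) \<in> adjacency G" "(dec (v (Suc i)), dec (v i)) \<in> adjacency G"
   using step[of i] Suc.prems nb_sym by (simp_all add: nb_def)
  then have "linked G {dec (v i), dec (v (Suc i))}"
   unfolding linked_def by (auto intro!: r_into_rtrancl)
  then have "linked G (dec ` v ` {..i} \<union> {dec (v i), dec (v (Suc i))})"
   using Suc by (intro linked_Un) auto
  moreover have "dec ` v ` {..i} \<union> {dec (v i), dec (v (Suc i))} = dec ` v ` {..Suc i}"
   by (auto simp: atMost_Suc)
  ultimately show ?case by simp
 qed
 then show "linked G (dec ` walk d par c)" by (simp add: w')
 have "c' \<in> q ` {..<b}" if "Inr c' \<in> dec ` walk d par c" for c'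
 proof -
  have "nv + c' \<in> v ` {..L}" using that by (simp only: Inr_dec w')
  then obtain i where "nv + c' = v i" "i \<in> {..L}" by (rule imageE)
  then have i: "i \<le> L" "v i = nv + c'" by simp_all
  then have "even i" using type[of i] by simp
  then have "c' = q (i div 2)" "i div 2 < b" using i by (auto simp: q_def b_def)
  then show ?thesis by blast
 qed
 moreover have "card (q ` {..<b}) \<le> b" using card_image_le[of "{..<b}" q] by simp
 ultimately show "\<exists>C. finite C \<and> card C \<le> 2 ^ Suc k - 2 \<and> (\<forall>c'. Inr c' \<in> dec ` walk d par c \<longrightarrow> c' \<in> C)"
  using b by (intro exI[of _ "q ` {..<b}"]) auto
qed

lemma hits_nbrs: "hits x M \<longleftrightarrow> x \<in> nbrs (dec ` M)"
proof
 assume "hits x M"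
 then obtain c where "x < nv" "c \<in> M" "c \<in> nb x" by (auto simp: hits_def)
 then show "x \<in> nbrs (dec ` M)"
  using nb_type[of c x] nb_incident[of x c] by (auto simp: nbrs_def Inr_dec intro!: exI[of _ "c - nv"])
next
 assume "x \<in> nbrs (dec ` M)"
 then obtain c where c: "nv + c \<in> M" "incident G x c" by (auto simp: nbrs_def Inr_dec)
 then have "x < nv" using incident_verts nv by (force simp: verts_def)
 then show "hits x M" using c nb_incident[of x "nv + c"] by (auto simp: hits_def)
qed

text \<open>Degrees and path lengths are bounded only if the depth is at most k, so this is assumed
  for a contradiction. The invariant then yields \<open>stages\<close>, and counting does the
  rest.\<close>

lemma hist_exhausted:
 assumes h: "hist (2 * k * 4 ^ k) stg X U" "card X = 2 * k * 4 ^ k" and U: "edgy U"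
 shows "enat k < srbd class0 G"
proof (rule ccontr)
 assume "\<not> ?thesis"
 moreover have "sr (verts G) = srbd class0 G"
 proof -
  have "induced G (verts G) = G" using ig
   by (intro igraph.equality) (auto simp: induced_def verts_def incidence_graph_def)
  then show ?thesis by (simp add: sr_def)
 qed
 ultimately have sr: "sr (verts G) \<le> enat k" by simp
 let ?d = "2 * k * 4 ^ k"
 have neU: "\<not> edgeless (dec ` U)" using U edgeless_dec by blast
 have redU: "reduct G (dec ` U) (verts G)" by (rule histD(1)[OF h(1)])
 have "enat 1 \<le> enat k"
  using sr_ge_1[OF neU] sr_reduct_mono[OF redU] sr by (meson order_trans)
 then have k: "1 \<le> k" by simp
 define A where "A j = dec ` fst (stg ! j)" for j
 define r where "r j = fst (snd (stg ! j))" for j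
 define M where "M j = dec ` marked ?d stg j" for j
 have hitsM: "hits x (marked ?d stg j) \<longleftrightarrow> x \<in> nbrs (M j)" for x j
  by (simp add: hits_nbrs M_def)
 have ok: "stage_ok (stg ! j)" if "j < length stg" for j using histD(5)[OF h(1) that] .
 have Ared: "reduct G (A j) (verts G)" "nv \<le> r j" "edgy (fst (stg ! j))"
   "bfs_tree nb (fst (stg ! j)) (r j) (snd (snd (stg ! j)))" if "j < length stg" for j
  using ok[OF that] by (simp_all add: stage_ok_def A_def r_def)
 have dr: "Inr (r j - nv) = dec (r j)" if "j < length stg" for j
  using Ared(2)[OF that] by (simp add: dec_def)
 have rK: "r j \<in> fst (stg ! j)" if "j < length stg" for j
  using Ared(4)[OF that] by (simp add: bfs_tree_def)
 have pre: "pre j < length stg" "r j \<in> fst (stg ! pre j)" if "j < length stg" for j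
 proof -
  have le: "j = 0 \<or> pre j < j" using pre_less by blast
  then show "pre j < length stg" using that by (auto simp: pre_0)
  show "r j \<in> fst (stg ! pre j)"
   using le
  proof
   assume "pre j < j"
   then show ?thesis using reduct_subset[OF histD(7)[OF h(1) _ that]] rK[OF that] by blast
  qed (use rK[OF that] in \<open>simp add: pre_0\<close>)
 qed
 \<comment> \<open>The budget doubles as the number of vertices marked per stage, so it has to
   exceed the length of an induced path. This needs k to be positive, which follows from the
   remaining edge.\<close>
 have "(2::nat) * 2 ^ (k + 1) \<le> 2 * k * 4 ^ k"
 proof -
  have "(2::nat) ^ (k + 1) \<le> 2 ^ (k + k)" using k by (intro power_increasing) auto
  also have "\<dots> = 4 ^ k" by (simp add: power_add flip: power_mult_distrib)
  also have "\<dots> \<le> k * 4 ^ k" using k by simp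
  finally show ?thesis by simp
 qed
 then have d: "2 ^ (k + 2) \<le> ?d + 2" by simp
 have path: "marked ?d stg j \<subseteq> fst (stg ! pre j)" "r (pre j) \<in> marked ?d stg j" "linked G (M j)"
   "\<exists>C. finite C \<and> card C \<le> 2 ^ Suc k - 2 \<and> (\<forall>c'. Inr c' \<in> M j \<longrightarrow> c' \<in> C)"
  if j: "j < length stg" for j
  using marked_path[OF sr d _ Ared(3,4,2)[OF pre(1)[OF j]] pre(2)[OF j] Ared(2)[OF j]]
   Ared(1)[OF pre(1)[OF j]]
  by (simp_all add: A_def M_def marked_def r_def)
 have d0: "0 < ?d" using k by simp
 have rM: "r j \<in> marked ?d stg j" for j
  unfolding marked_def walk_def r_def using d0 by (intro image_eqI[of _ _ 0]) auto
 have "stages k (length stg) A (\<lambda>j. r j - nv) M"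
  unfolding stages_def
 proof (intro conjI allI impI)
  fix j assume j: "j < length stg"
  show "reduct G (A j) (verts G)" by (rule Ared(1)[OF j])
  then show "A j \<subseteq> verts G" by (simp add: reduct_def)
  show "Inr (r j - nv) \<in> A j \<inter> M j" using rK[OF j] rM by (simp add: dr[OF j] A_def M_def)
  obtain y where y: "y \<in> fst (stg ! j)" "y \<in> nb (r j)"
   using bfs_tree_root_nb[OF Ared(4,3)[OF j]] by blast
  then have "y < nv" using nb_type Ared(2)[OF j] by (meson not_less)
  then show "\<exists>x. Inl x \<in> A j \<and> incident G x (r j - nv)"
   using y nb_incident[of y "r j"] Ared(2)[OF j] nb_sym[of y "r j"]
   by (intro exI[of _ y]) (simp add: A_def Inl_dec)
  obtain C where C: "finite C" "card C \<le> 2 ^ Suc k - 2" "\<And>c'. Inr c' \<in> M j \<Longrightarrow> c' \<in> C"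
   using path(4)[OF j] by blast
  show "finite (nbrs (M j))" by (rule card_nbrs_le(1)[OF sr C(1,3)])
  have "card (nbrs (M j)) \<le> k * card C" by (rule card_nbrs_le(2)[OF sr C(1,3)])
  also have "\<dots> \<le> k * (2 ^ Suc k - 2)" using C(2) by (rule mult_le_mono2)
  finally show "card (nbrs (M j)) \<le> k * (2 ^ Suc k - 2)" .
 next
  fix i j assume ij: "i < j" "j < length stg"
  show "reduct G (A j) (A i)" using histD(7)[OF h(1) ij] by (simp add: A_def)
  fix x assume "Inl x \<in> A j"
  then show "x \<notin> nbrs (M i)" using histD(8)[OF h(1) ij, of x] by (simp add: hitsM A_def Inl_dec)
 next
  fix j assume j: "0 < j" "j < length stg"
  show "M j \<subseteq> A (pre j)" using path(1)[OF j(2)] by (auto simp: M_def A_def)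
  show "linked G (M j)" by (rule path(3)[OF j(2)])
  show "Inr (r (pre j) - nv) \<in> M j"
   using path(2)[OF j(2)] dr[OF pre(1)[OF j(2)]] by (simp add: M_def)
 qed
 moreover have "X \<subseteq> (\<Union>j<length stg. nbrs (M j))"
  using histD(4)[OF h(1)] by (auto simp: hitsM)
 ultimately show False using sr_stages_exhausted[OF _ _ h(2) redU neU] sr by (metis leD)
qed

end

section \<open>Weakest preconditions with running times\<close>

text \<open>Total correctness: a run has to exist. As execution is deterministic, it is the only
  one, and its running time is handed to the postcondition.\<close>

definition wp :: "program \<Rightarrow> com \<Rightarrow> (nat \<Rightarrow> state \<Rightarrow> bool) \<Rightarrow> state \<Rightarrow> bool" where
 "wp P c Q Z \<longleftrightarrow> (\<exists>t Z'. exec P c Z t Z' \<and> Q t Z')"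

fun block :: "com list \<Rightarrow> com" where
 "block [] = Skip"
| "block (c # cs) = Seq c (block cs)"

lemma wp_mono: "wp P c Q Z \<Longrightarrow> (\<And>t Z'. Q t Z' \<Longrightarrow> Q' t Z') \<Longrightarrow> wp P c Q' Z"
 unfolding wp_def by blast

lemma wp_Skip: "Q 1 Z \<Longrightarrow> wp P Skip Q Z"
 unfolding wp_def by (blast intro: exec.Skip)

lemma wp_Const: "Q 1 (set_reg r c Z) \<Longrightarrow> wp P (Const r c) Q Z"
 unfolding wp_def by (blast intro: exec.Const)

lemma wp_Add: "Q 1 (set_reg r (regs Z a + regs Z b) Z) \<Longrightarrow> wp P (Add r a b) Q Z"
 unfolding wp_def by (blast intro: exec.Add)

lemma wp_Sub: "Q 1 (set_reg r (regs Z a - regs Z b) Z) \<Longrightarrow> wp P (Sub r a b) Q Z"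
 unfolding wp_def by (blast intro: exec.Sub)

lemma wp_Load: "Q 1 (set_reg r (mem Z (regs Z a)) Z) \<Longrightarrow> wp P (Load r a) Q Z"
 unfolding wp_def by (blast intro: exec.Load)

lemma wp_Store: "Q 1 (Z\<lparr>mem := (mem Z)(regs Z a := regs Z r)\<rparr>) \<Longrightarrow> wp P (Store a r) Q Z"
 unfolding wp_def by (blast intro: exec.Store)

lemma wp_Write: "Q 1 (Z\<lparr>out_tape := out_tape Z @ [regs Z r]\<rparr>) \<Longrightarrow> wp P (Write r) Q Z"
 unfolding wp_def by (blast intro: exec.Write)

lemma wp_Seq: "wp P c1 (\<lambda>t1. wp P c2 (\<lambda>t2. Q (t1 + t2))) Z \<Longrightarrow> wp P (Seq c1 c2) Q Z"
 unfolding wp_def by (blast intro: exec.Seq)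

lemma wp_block_Nil: "Q 1 Z \<Longrightarrow> wp P (block []) Q Z"
 by (simp add: wp_Skip)

lemma wp_block_Cons:
 "wp P c (\<lambda>t1. wp P (block cs) (\<lambda>t2. Q (t1 + t2))) Z \<Longrightarrow> wp P (block (c # cs)) Q Z"
 by (simp add: wp_Seq)

lemma wp_IfNZ:
 assumes "regs Z r \<noteq> 0 \<Longrightarrow> wp P c1 (\<lambda>t. Q (1 + t)) Z"
  and "regs Z r = 0 \<Longrightarrow> wp P c2 (\<lambda>t. Q (1 + t)) Z"
 shows "wp P (IfNZ r c1 c2) Q Z"
 using assms unfolding wp_def by (metis exec.IfTrue exec.IfFalse)

lemma wp_Call: "i < length P \<Longrightarrow> wp P (P ! i) (\<lambda>t. Q (1 + t)) Z \<Longrightarrow> wp P (Call i) Q Z"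
 unfolding wp_def by (blast intro: exec.Call)

text \<open>The potential pays for an iteration together with its test; the additional unit at the
  end is for the failing test.\<close>

lemma wp_WhileNZ:
 fixes \<Phi> :: "state \<Rightarrow> nat"
 assumes "I Z"
  and step: "\<And>Z. I Z \<Longrightarrow> regs Z r \<noteq> 0 \<Longrightarrow> wp P c (\<lambda>t Z'. I Z' \<and> t + 1 + \<Phi> Z' \<le> \<Phi> Z) Z"
  and final: "\<And>t Z'. I Z' \<Longrightarrow> regs Z' r = 0 \<Longrightarrow> t + \<Phi> Z' \<le> \<Phi> Z + 1 \<Longrightarrow> Q t Z'"
 shows "wp P (WhileNZ r c) Q Z"
proof -
 have "\<exists>t Z'. exec P (WhileNZ r c) Z t Z' \<and> I Z' \<and> regs Z' r = 0 \<and> t + \<Phi> Z' \<le> \<Phi> Z + 1" if "I Z" for Z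
  using that
 proof (induction "\<Phi> Z" arbitrary: Z rule: less_induct)
  case less
  show ?case
  proof (cases "regs Z r = 0")
   case True
   then show ?thesis using less.prems exec.WhileFalse[OF True, of P c]
    by (intro exI[of _ 1] exI[of _ Z]) simp
  next
   case False
   obtain t1 Z1 where 1: "exec P c Z t1 Z1" "I Z1" "t1 + 1 + \<Phi> Z1 \<le> \<Phi> Z"
    using step[OF less.prems False] unfolding wp_def by blast
   have lt: "\<Phi> Z1 < \<Phi> Z" using 1(3) by simp
   obtain t2 Z2 where 2: "exec P (WhileNZ r c) Z1 t2 Z2" "I Z2" "regs Z2 r = 0" "t2 + \<Phi> Z2 \<le> \<Phi> Z1 + 1"
    using less.hyps[OF lt 1(2)] by blast
   show ?thesis using exec.WhileTrue[OF False 1(1) 2(1)] 1(3) 2 by (intro exI[of _ "1 + t1 + t2"] exI[of _ Z2]) auto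
  qed
 qed
 then show ?thesis using assms(1) final unfolding wp_def by blast
qed

lemmas wp_basic = wp_Skip wp_Const wp_Add wp_Sub wp_Load wp_Store wp_Write wp_Seq wp_block_Nil wp_block_Cons

section \<open>The program\<close>

text \<open>
 Registers below 20 keep their values in the subroutines unless stated otherwise; the remaining ones
 are scratch registers.
\<close>

abbreviation (input) "rONE \<equiv> 0 :: reg"
abbreviation (input) "rNV \<equiv> 1 :: reg"
abbreviation (input) "rN \<equiv> 2 :: reg"
abbreviation (input) "rHD \<equiv> 3 :: reg"
text \<open>\<open>rMK\<close> points to the array of marks, \<open>rPR\<close> to the table of
  \<open>pre\<close>, \<open>rFT\<close> to the table of stage frames. \<open>rW\<close> is the
  width of a frame, \<open>rDD\<close> the whole budget, \<open>rB\<close> the current frame,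
  \<open>rBUD\<close> the rest of the budget, \<open>rST\<close> the number of stages and
  \<open>rSH\<close> the root clause of the last stage.\<close>

abbreviation (input) "rMK \<equiv> 4 :: reg"
abbreviation (input) "rPR \<equiv> 5 :: reg"
abbreviation (input) "rFT \<equiv> 6 :: reg"
abbreviation (input) "rW \<equiv> 7 :: reg"
abbreviation (input) "rDD \<equiv> 8 :: reg"
abbreviation (input) "rB \<equiv> 9 :: reg"
abbreviation (input) "rBUD \<equiv> 10 :: reg"
abbreviation (input) "rST \<equiv> 11 :: reg"
abbreviation (input) "rSH \<equiv> 12 :: reg"
text \<open>The latest stamp. A set of vertices is represented by the array entries that carry a
  certain stamp, so arrays are reused without being cleared.\<close>

abbreviation (input) "rUID \<equiv> 13 :: reg"
text \<open>\<open>rOB\<close> and \<open>rOUT\<close> delimit the output buffer, \<open>rSB\<close>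
  and \<open>rSE\<close> the list of vertices handed to a call, \<open>rSS\<close> and
  \<open>rSD\<close> the segment of the component that is treated next.\<close>

abbreviation (input) "rOUT \<equiv> 14 :: reg"
abbreviation (input) "rFAIL \<equiv> 15 :: reg"
abbreviation (input) "rSB \<equiv> 16 :: reg"
abbreviation (input) "rSE \<equiv> 17 :: reg"
abbreviation (input) "rZ \<equiv> 18 :: reg"
abbreviation (input) "rOB \<equiv> 19 :: reg"
abbreviation (input) "rE \<equiv> 20 :: reg"
abbreviation (input) "rA \<equiv> 21 :: reg"
abbreviation (input) "rT \<equiv> 22 :: reg"
abbreviation (input) "rG \<equiv> 23 :: reg"
abbreviation (input) "rQ \<equiv> 24 :: reg"
abbreviation (input) "rR \<equiv> 25 :: reg"
abbreviation (input) "rV \<equiv> 26 :: reg"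
abbreviation (input) "rI \<equiv> 27 :: reg"
abbreviation (input) "rL \<equiv> 28 :: reg"
abbreviation (input) "rA0 \<equiv> 29 :: reg"
abbreviation (input) "rE0 \<equiv> 30 :: reg"
abbreviation (input) "rVIS \<equiv> 31 :: reg"
abbreviation (input) "rQH \<equiv> 32 :: reg"
abbreviation (input) "rQT \<equiv> 33 :: reg"
abbreviation (input) "rCNT \<equiv> 34 :: reg"
abbreviation (input) "rU \<equiv> 35 :: reg"
abbreviation (input) "rC \<equiv> 36 :: reg"
abbreviation (input) "rS0 \<equiv> 37 :: reg"
abbreviation (input) "rX \<equiv> 38 :: reg"
abbreviation (input) "rH \<equiv> 39 :: reg"
abbreviation (input) "rK \<equiv> 40 :: reg"
abbreviation (input) "rF \<equiv> 41 :: reg"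
abbreviation (input) "rP \<equiv> 42 :: reg"
abbreviation (input) "rFND \<equiv> 43 :: reg"
abbreviation (input) "rXV \<equiv> 44 :: reg"
abbreviation (input) "rSS \<equiv> 45 :: reg"
abbreviation (input) "rSD \<equiv> 46 :: reg"
abbreviation (input) "rLL \<equiv> 47 :: reg"

definition neq :: "reg \<Rightarrow> reg \<Rightarrow> com" where
 "neq a b = block [Sub rQ a b, Sub rR b a, Add rQ rQ rR]"

definition put :: "reg \<Rightarrow> com" where
 "put r = block [Store rOUT r, Add rOUT rOUT rONE]"

definition for_seg :: "com \<Rightarrow> com" where
 "for_seg c = block [Add rI rA0 rZ, Sub rL rE0 rI,
   WhileNZ rL (block [Load rV rI, Add rI rI rONE, c, Sub rL rE0 rI])]"

definition for_adj :: "reg \<Rightarrow> com \<Rightarrow> com" where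
 "for_adj v c = block [Add rE rHD v, Load rE rE,
   WhileNZ rE (block [Add rA rE rONE, Load rT rA, Add rA rA rONE, Load rG rA, c, Load rE rE])]"

definition if_sign :: "nat \<Rightarrow> com \<Rightarrow> com" where
 "if_sign s c = (if s = 0 then IfNZ rG Skip c else IfNZ rG c Skip)"

definition visit :: "reg \<Rightarrow> reg \<Rightarrow> com" where
 "visit v p = block [Add rA rB v, Store rA rVIS, Add rA rA rN, Store rA p, Store rQT v, Add rQT rQT rONE]"

definition bfs :: com where
 "bfs = block [Add rS0 rQT rZ, visit rV rV, Sub rC rQT rQH,
   WhileNZ rC (block [Load rU rQH, Add rQH rQH rONE,
    for_adj rU (block [Add rA rB rT, Load rA rA, neq rA rUID, IfNZ rQ Skip (visit rT rU)]),
    Sub rC rQT rQH]),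
   Add rA rS0 rN, Store rA rQT, Add rCNT rCNT rONE]"

definition scan :: "reg \<Rightarrow> com" where
 "scan thr = block [Add rA0 rSB rZ, Add rE0 rSE rZ,
   for_seg (block [Add rA rB rV, Load rA rA, neq rA rUID,
    IfNZ rQ Skip (block [Add rX rV rONE, Sub rX rX thr, IfNZ rX bfs Skip])])]"

text \<open>The first pass starts searches only at clauses, so the second finds nothing but isolated
  variables. In this way a component with an edge is always rooted at a clause, as stages
  require.\<close>

definition split_comps :: com where
 "split_comps = block [Add rVIS rUID rONE, Add rQT rB rN, Add rQT rQT rN, Add rQH rQT rZ, Const rCNT 0,
   scan rNV, scan rZ, Add rUID rVIS rZ]"

definition emit_list :: "com \<Rightarrow> com" where
 "emit_list c = block [Add rH rOUT rZ, Add rOUT rOUT rONE, Const rK 0, for_seg c, Store rH rK]"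

definition emit_vars :: com where
 "emit_vars = emit_list (block [Sub rX rNV rV, IfNZ rX (block [put rV, Add rK rK rONE]) Skip])"

definition emit_clauses :: com where
 "emit_clauses = emit_list (block [Sub rX rNV rV,
   IfNZ rX Skip (block [Sub rX rV rNV, put rX, Add rK rK rONE])])"

definition emit_edges :: "nat \<Rightarrow> com" where
 "emit_edges s = emit_list (block [Sub rX rNV rV,
   IfNZ rX (for_adj rV (if_sign s (block [Add rA rB rT, Load rA rA, neq rA rVIS,
    IfNZ rQ Skip (block [put rV, Sub rX rT rNV, put rX, Add rK rK rONE])]))) Skip])"

definition emit :: com where
 "emit = block [put rZ, emit_vars, emit_clauses, emit_edges 0, emit_edges 1]"

text \<open>The entry at \<open>rPR + rST\<close> is one more than the number of the parent stage,
  which is its index in the table at \<open>rFT\<close>. The frame found there has its parent array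
  at offset n. The path is marked anew with a fresh stamp at each call, as the recursion overwrites
  the marks.\<close>

definition pick :: com where
 "pick = block [Add rUID rUID rONE, Add rA rPR rST, Load rA rA, Add rA rFT rA, Load rF rA, Add rF rF rN,
   Add rU rSH rZ, Add rC rDD rZ,
   WhileNZ rC (block [Add rA rMK rU, Store rA rUID, Add rA rF rU, Load rU rA, Sub rC rC rONE]),
   Add rA0 rSS rZ, Add rE0 rSD rZ, Const rFND 0,
   for_seg (block [Sub rX rNV rV,
    IfNZ rX (for_adj rV (block [Add rA rMK rT, Load rA rA, neq rA rUID,
     IfNZ rQ Skip (block [Add rXV rV rZ, Const rFND 1])])) Skip])]"

text \<open>Only the address of the current frame is recorded. Its parent array is the search tree
  of the stage and stays intact while the stage belongs to the branch, because deeper calls work in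
  later frames.\<close>

definition new_stage :: com where
 "new_stage = block [Add rST rST rONE, Add rA rFT rST, Store rA rB, Load rSH rSS, pick]"

definition choose_var :: com where
 "choose_var = block [Const rFND 0, IfNZ rST pick Skip, IfNZ rFND Skip new_stage]"

fun save :: "reg list \<Rightarrow> com" where
 "save [] = Skip"
| "save (r # rs) = block [Store rP r, Add rP rP rONE, save rs]"

fun restore :: "reg list \<Rightarrow> com" where
 "restore [] = Skip"
| "restore (r # rs) = block [Load r rP, Add rP rP rONE, restore rs]"

definition locals :: "nat \<Rightarrow> com" where
 "locals j = block [Const rP j, Add rP rP rB, Add rP rP rN, Add rP rP rN, Add rP rP rN, Add rP rP rN]"

text \<open>The remaining vertices get a new stamp in the next frame. Vertices are removed by
  writing 0, which is never a current stamp.\<close>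

definition child :: "nat \<Rightarrow> com" where
 "child s = block [Add rUID rUID rONE, Add rF rB rW, Add rA0 rSS rZ, Add rE0 rSD rZ,
   for_seg (block [Add rA rF rV, Store rA rUID]),
   Add rA rF rXV, Store rA rZ,
   for_adj rXV (if_sign s (block [Add rA rF rT, Store rA rZ])),
   Add rSB rSS rZ, Add rSE rSD rZ, Add rB rF rZ, Call 1, Sub rB rB rW]"

text \<open>Registers are global, so what is needed after a recursive call is kept in the frame.
  These values start at word 8 of the local area; the seven of \<open>node_locals\<close> start at
  word 0, so both sets can be stored at once.\<close>

definition tail_locals :: "reg list" where "tail_locals = [rSS, rSD, rXV, rST, rSH]"

text \<open>The label of the component has already been written. What follows is its number of
  children 1, the label \<open>1, x\<close> of the variable node and the number 2 of the children of
  that node.\<close>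

definition branch :: com where
 "branch = block [choose_var, put rONE, put rONE, put rXV, Const rX 2, put rX, Sub rBUD rBUD rONE,
   locals 8, save tail_locals, child 0, locals 8, restore tail_locals, child 1, Add rBUD rBUD rONE]"

text \<open>A failure only sets a flag. The recursion goes on and its output is discarded in the
  end, so the time bound needs no case for it.\<close>

definition tail :: com where
 "tail = block [Sub rX rSD rSS, Sub rX rX rONE, IfNZ rX (IfNZ rBUD branch (Add rFAIL rONE rZ)) (put rZ)]"

definition node_locals :: "reg list" where "node_locals = [rVIS, rQT, rCNT, rST, rSH, rSS, rSD]"

text \<open>If there is exactly one component, the label written for the whole graph is also that of
  the component, so neither a number of children nor a second label is written. The empty graph has
  no component; its count 0 makes it a leaf.\<close>

definition node :: com where
 "node = block [split_comps, Add rA0 rB rN, Add rA0 rA0 rN, Add rE0 rQT rZ, emit,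
   neq rCNT rONE, IfNZ rQ (put rCNT) Skip,
   Add rSS rB rN, Add rSS rSS rN, Sub rLL rQT rSS,
   WhileNZ rLL (block [Add rA rSS rN, Load rSD rA, locals 0, save node_locals,
    neq rCNT rONE, IfNZ rQ (block [Add rA0 rSS rZ, Add rE0 rSD rZ, emit]) Skip,
    tail, locals 0, restore node_locals, Add rSS rSD rZ, Sub rLL rQT rSS])]"

definition add_cell :: "reg \<Rightarrow> reg \<Rightarrow> nat \<Rightarrow> com" where
 "add_cell u w s = block [Add rA rHD u, Load rX rA, Store rA rP, Store rP rX, Add rP rP rONE,
   Store rP w, Add rP rP rONE, Const rX s, Store rP rX, Add rP rP rONE]"

definition read_edges :: "nat \<Rightarrow> com" where
 "read_edges s = block [Sub rL rE0 rI,
   WhileNZ rL (block [Load rU rI, Add rI rI rONE, Load rV rI, Add rI rI rONE, Add rV rV rNV,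
    add_cell rU rV s, add_cell rV rU s, Sub rL rE0 rI])]"

text \<open>The table grows by doubling: the entry for m yields those for 2m and 2m + 1. Entries are
  stored increased by one, so doubling is \<open>x + x - 1\<close>, and the entry for 2m + 1 is
  again 2m + 1.\<close>

definition fill_pre :: com where
 "fill_pre = block [Add rI rPR rONE, Add rF rPR rONE, Store rI rONE, Const rU 1, Add rC rDD rZ,
   WhileNZ rC (block [Load rX rI, Add rX rX rX, Sub rX rX rONE, Store rF rX, Add rF rF rONE,
    Store rF rU, Add rF rF rONE, Add rU rU rONE, Add rU rU rONE, Add rI rI rONE, Sub rC rC rONE])]"

definition parse :: com where
 "parse = block [Const rONE 1, Load rK rZ, Add rDD rK rK, Add rC rK rZ,
   WhileNZ rC (block [Add rDD rDD rDD, Add rDD rDD rDD, Sub rC rC rONE]),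
   Load rNV rONE, Add rA rNV rONE, Add rA rA rONE, Load rN rA, Add rA rA rONE, Add rA rA rN,
   Add rN rN rNV, Load rX rA, Add rI rA rONE, Add rE0 rX rX, Add rE0 rE0 rI,
   Load rX rE0, Add rF rE0 rONE, Add rHD rX rX, Add rHD rHD rF, Add rP rHD rN,
   read_edges 0, Add rI rF rZ, Add rE0 rHD rZ, read_edges 1, Add rPR rP rZ]"

text \<open>The list of all vertices is placed before the first frame, so the outermost call finds
  its input in the same form as any other. The output buffer starts after all frames, and its
  address provides a first stamp larger than any address in use.\<close>

definition layout :: com where
 "layout = block [Add rFT rPR rDD, Add rFT rFT rDD, Add rFT rFT rONE,
   Add rMK rFT rDD, Add rMK rMK rONE, Add rMK rMK rONE, Add rSB rMK rN, Add rSE rSB rN, Add rB rSE rZ,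
   Const rW 16, Add rW rW rN, Add rW rW rN, Add rW rW rN, Add rW rW rN,
   Add rOUT rB rZ, Add rC rDD rONE, Add rC rC rONE, WhileNZ rC (block [Add rOUT rOUT rW, Sub rC rC rONE]),
   Add rOB rOUT rZ, Add rUID rOUT rONE, Add rBUD rDD rZ,
   Const rI 0, Sub rL rN rI,
   WhileNZ rL (block [Add rA rSB rI, Store rA rI, Add rA rB rI, Store rA rUID, Add rI rI rONE, Sub rL rN rI])]"

text \<open>The output is buffered in memory: the lengths in the code of a graph precede the lists
  but are known only after them, and the first word of the answer depends on the final failure
  flag.\<close>

definition report :: com where
 "report = IfNZ rFAIL (Write rZ) (block [Write rONE, Sub rL rOUT rOB,
   WhileNZ rL (block [Load rX rOB, Write rX, Add rOB rOB rONE, Sub rL rOUT rOB])])"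

definition backdoor_program :: program where
 "backdoor_program = [block [parse, fill_pre, layout, Call 1, report], node]"

section \<open>Memory layout\<close>

text \<open>Linked lists with cells (next, target, sign), terminated by the null pointer.\<close>

fun cells :: "(nat \<Rightarrow> nat) \<Rightarrow> nat \<Rightarrow> nat \<Rightarrow> (nat \<times> nat) list \<Rightarrow> bool" where
 "cells m b p [] \<longleftrightarrow> p = 0"
| "cells m b p (x # xs) \<longleftrightarrow> p \<noteq> 0 \<and> p + 2 < b \<and> m (p + 1) = fst x \<and> m (p + 2) = snd x \<and>
   cells m b (m p) xs"

definition same :: "nat set \<Rightarrow> reg set \<Rightarrow> state \<Rightarrow> state \<Rightarrow> bool" where
 "same A R Z Z' \<longleftrightarrow> (\<forall>a. a \<notin> A \<longrightarrow> mem Z' a = mem Z a) \<and>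
   (\<forall>r. r \<notin> R \<longrightarrow> regs Z' r = regs Z r) \<and> out_tape Z' = out_tape Z"

definition wrote :: "nat list \<Rightarrow> state \<Rightarrow> state \<Rightarrow> bool" where
 "wrote us Z Z' \<longleftrightarrow> regs Z' rOUT = regs Z rOUT + length us \<and>
   (\<forall>i<length us. mem Z' (regs Z rOUT + i) = us ! i)"

definition list_at :: "(nat \<Rightarrow> nat) \<Rightarrow> nat \<Rightarrow> nat list \<Rightarrow> bool" where
 "list_at m a xs \<longleftrightarrow> (\<forall>i<length xs. m (a + i) = xs ! i)"

lemma same_refl: "same A R Z Z"
 by (simp add: same_def)

lemma same_trans: "same A R Z Z1 \<Longrightarrow> same A R Z1 Z2 \<Longrightarrow> same A R Z Z2"
 by (simp add: same_def)

lemma same_mono: "same A R Z Z' \<Longrightarrow> A \<subseteq> A' \<Longrightarrow> R \<subseteq> R' \<Longrightarrow> same A' R' Z Z'"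
 unfolding same_def by blast

lemma same_mem: "same A R Z Z' \<Longrightarrow> a \<notin> A \<Longrightarrow> mem Z' a = mem Z a"
 by (simp add: same_def)

lemma same_reg: "same A R Z Z' \<Longrightarrow> r \<notin> R \<Longrightarrow> regs Z' r = regs Z r"
 by (simp add: same_def)

lemma list_at_append: "list_at m a (xs @ ys) \<longleftrightarrow> list_at m a xs \<and> list_at m (a + length xs) ys"
proof -
 have "m (a + length xs + i) = ys ! i" if "\<forall>i<length xs + length ys. m (a + i) = (xs @ ys) ! i" "i < length ys" for i
  using that(1)[rule_format, of "length xs + i"] that(2) by (simp add: add.assoc)
 moreover have "m (a + i) = (xs @ ys) ! i"
  if "\<forall>i<length xs. m (a + i) = xs ! i" "\<forall>i<length ys. m (a + length xs + i) = ys ! i"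
   "i < length xs + length ys" for i
 proof (cases "i < length xs")
  case False
  then show ?thesis using that(2)[rule_format, of "i - length xs"] that(3) by (simp add: nth_append)
 qed (use that in \<open>simp add: nth_append\<close>)
 ultimately show ?thesis unfolding list_at_def by (auto simp: nth_append)
qed

lemma list_at_Cons: "list_at m a (x # xs) \<longleftrightarrow> m a = x \<and> list_at m (Suc a) xs"
 using list_at_append[of m a "[x]" xs] by (auto simp: list_at_def)

lemma list_at_Nil: "list_at m a []"
 by (simp add: list_at_def)

lemma list_at_cong: "list_at m a xs \<Longrightarrow> (\<And>i. a \<le> i \<Longrightarrow> i < a + length xs \<Longrightarrow> m' i = m i) \<Longrightarrow> list_at m' a xs"
 by (simp add: list_at_def)

lemma wrote_list_at: "wrote us Z Z' \<longleftrightarrow>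
  regs Z' rOUT = regs Z rOUT + length us \<and> list_at (mem Z') (regs Z rOUT) us"
 by (simp add: wrote_def list_at_def)

lemma wrote_trans:
 assumes "wrote us Z Z1" "wrote vs Z1 Z2" "same A R Z1 Z2" "\<And>a. a \<in> A \<Longrightarrow> a < regs Z rOUT \<or> regs Z1 rOUT \<le> a"
 shows "wrote (us @ vs) Z Z2"
proof -
 have "list_at (mem Z2) (regs Z rOUT) us"
  by (rule list_at_cong[of "mem Z1"])
    (use assms in \<open>auto simp: wrote_list_at intro!: same_mem[OF assms(3)] dest: assms(4)\<close>)
 then show ?thesis using assms(1,2) by (simp add: wrote_list_at list_at_append)
qed

lemma wrote_Nil: "regs Z' rOUT = regs Z rOUT \<Longrightarrow> wrote [] Z Z'"
 by (simp add: wrote_def)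

text \<open>
 The frame of the recursion at address B consists of four arrays, each indexed by the vertices or by
 their position in the queue: stamps, parents, queue, ends of the segments in the queue.
 It ends with 16 words for local variables.
\<close>

locale machine = numbered_formula +
 fixes k D HD PR FT MK FB EN :: nat and m0 :: "nat \<Rightarrow> nat" and adj :: "nat \<Rightarrow> (nat \<times> nat) list"
 assumes D: "D = 2 * k * 4 ^ k"
  and static: "HD + n \<le> FT" "PR + 2 * D < FT"
  and MK: "MK = FT + D + 2" and FB: "FB = MK + n + n" and EN: "EN = FB + (D + 2) * (4 * n + 16)"
  and cells: "u < n \<Longrightarrow> cells m0 FT (m0 (HD + u)) (adj u)"
  and adj_iff: "u < n \<Longrightarrow> (w, s) \<in> set (adj u) \<longleftrightarrow> w \<in> nb u \<and>
   s = (if (min u w, max u w - nv) \<in> pos_edges G then 0 else 1)"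
  and adj_distinct: "u < n \<Longrightarrow> distinct (map fst (adj u))"
  and pre_table: "1 \<le> t \<Longrightarrow> t \<le> 2 * D \<Longrightarrow> m0 (PR + t) = Suc (pre (t - 1))"
begin

abbreviation W :: nat where "W \<equiv> 4 * n + 16"

definition const_regs :: "(reg \<Rightarrow> nat) \<Rightarrow> bool" where
 "const_regs R \<longleftrightarrow> R rONE = 1 \<and> R rNV = nv \<and> R rN = n \<and> R rHD = HD \<and> R rMK = MK \<and> R rPR = PR \<and>
   R rFT = FT \<and> R rW = W \<and> R rDD = D \<and> R rZ = 0"

definition stat :: "state \<Rightarrow> bool" where
 "stat Z \<longleftrightarrow> const_regs (regs Z) \<and> (\<forall>a<FT. mem Z a = m0 a)"

text \<open>Frames hold stamps, vertices, addresses and saved registers side by side. Bounding them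
  all by the current stamp guarantees that the next stamp occurs nowhere.\<close>

definition fresh :: "state \<Rightarrow> bool" where
 "fresh Z \<longleftrightarrow> EN \<le> regs Z rUID \<and> (\<forall>a. MK \<le> a \<longrightarrow> a < EN \<longrightarrow> mem Z a \<le> regs Z rUID)"

text \<open>The cost of treating a vertex once, including its adjacency list. Over all vertices this
  sums up to the number of vertices plus twice the number of edges.\<close>

definition wt :: "nat \<Rightarrow> nat" where "wt u = 1 + length (adj u)"

definition wts :: "nat list \<Rightarrow> nat" where "wts xs = sum_list (map wt xs)"

lemma wts_simps: "wts [] = 0" "wts (x # xs) = wt x + wts xs" "wts (xs @ ys) = wts xs + wts ys"
 by (simp_all add: wts_def)

lemma length_le_wts: "length xs \<le> wts xs"
 by (induction xs) (auto simp: wts_simps wt_def)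

lemma FT_MK: "FT < MK" "MK \<le> FB" "FB \<le> EN" "MK \<le> EN"
 by (auto simp: MK FB EN)

lemma stat_regs:
 assumes "stat Z"
 shows "regs Z rONE = 1" "regs Z (Suc 0) = nv" "regs Z rN = n" "regs Z rHD = HD" "regs Z rMK = MK"
  "regs Z rPR = PR" "regs Z rFT = FT" "regs Z rW = W" "regs Z rDD = D" "regs Z rZ = 0"
 using assms by (simp_all add: stat_def const_regs_def)

lemma stat_same:
 assumes "stat Z" "same A R Z Z'" "\<And>a. a \<in> A \<Longrightarrow> FT \<le> a" "R \<inter> {0, 1, 2, 3, 4, 5, 6, 7, 8, 18} = {}"
 shows "stat Z'"
proof -
 have "regs Z' r = regs Z r" if "r \<in> {0, 1, 2, 3, 4, 5, 6, 7, 8, 18}" for r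
  using assms(2,4) that unfolding same_def by blast
 moreover have "mem Z' a = mem Z a" if "a < FT" for a
  using assms(2,3) that unfolding same_def by (meson not_le)
 ultimately show ?thesis using assms(1) by (simp add: stat_def const_regs_def)
qed

text \<open>Besides a fixed cost per element there is a potential for work that is not evenly
  distributed: in the search for components, one element may trigger the traversal of many others.
  The rule \<open>upd\<close> says that the invariant ignores the registers of the loop
  itself.\<close>

lemma wp_for_seg:
 fixes \<Phi> :: "state \<Rightarrow> nat"
 assumes r: "regs Z rA0 = a" and init: "I [] Z"
  and I: "\<And>ys Z. I ys Z \<Longrightarrow> regs Z rZ = 0 \<and> regs Z rONE = 1 \<and> list_at (mem Z) a xs \<and> regs Z rE0 = a + length xs"
  and upd: "\<And>ys Z r x. I ys Z \<Longrightarrow> r \<in> {rI, rL, rV} \<Longrightarrow> I ys (set_reg r x Z) \<and> \<Phi> (set_reg r x Z) = \<Phi> Z"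
  and body: "\<And>ys v zs Z. xs = ys @ v # zs \<Longrightarrow> I ys Z \<Longrightarrow> regs Z rV = v \<Longrightarrow>
   wp P c (\<lambda>t Z'. I (ys @ [v]) Z' \<and> regs Z' rI = regs Z rI \<and> t + \<Phi> Z' \<le> cost v + \<Phi> Z) Z"
  and fin: "\<And>t Z'. I xs Z' \<Longrightarrow> t + \<Phi> Z' \<le> sum_list (map cost xs) + 6 * length xs + 4 + \<Phi> Z \<Longrightarrow> Q t Z'"
 shows "wp P (for_seg c) Q Z"
proof -
 let ?I = "\<lambda>Z. \<exists>ys zs. xs = ys @ zs \<and> I ys Z \<and> regs Z rI = a + length ys \<and> regs Z rL = length zs"
 let ?\<Phi> = "\<lambda>Z. (\<Sum>v\<leftarrow>drop (regs Z rI - a) xs. cost v + 6) + \<Phi> Z"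
 let ?s1 = "set_reg rI (regs Z rA0 + regs Z rZ) Z"
 let ?s2 = "set_reg rL (regs ?s1 rE0 - regs ?s1 rI) ?s1"
 have I1: "I [] ?s2" "\<Phi> ?s2 = \<Phi> Z" using upd init by (metis insertCI)+
 have s2: "regs ?s2 rI = a" "regs ?s2 rL = length xs"
  using I[OF init] r by (simp_all add: set_reg_def)
 show ?thesis unfolding for_seg_def
 proof (intro wp_basic)
  show "wp P (WhileNZ rL (block [Load rV rI, Add rI rI rONE, c, Sub rL rE0 rI]))
    (\<lambda>t1. wp P (block []) (\<lambda>t2. Q (1 + (1 + (t1 + t2))))) ?s2"
  proof (rule wp_WhileNZ[where I = ?I and \<Phi> = ?\<Phi>])
   show "?I ?s2" using I1 s2 by (intro exI[of _ "[]"] exI[of _ xs]) simp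
  next
   fix Y assume "?I Y" "regs Y rL \<noteq> 0"
   then obtain ys v zs where *: "xs = ys @ v # zs" "I ys Y" "regs Y rI = a + length ys"
    by (metis length_greater_0_conv neq_Nil_conv neq0_conv)
   let ?t1 = "set_reg rV (mem Y (regs Y rI)) Y"
   let ?t2 = "set_reg rI (regs ?t1 rI + regs ?t1 rONE) ?t1"
   have I2: "I ys ?t2" "\<Phi> ?t2 = \<Phi> Y" using upd *(2) by (metis insertCI)+
   have "list_at (mem Y) a xs" using I[OF *(2)] by simp
   then have v: "regs ?t2 rV = v" using *(1,3) by (simp add: set_reg_def list_at_append list_at_Cons)
   have i: "regs ?t2 rI = Suc (regs Y rI)" using I[OF *(2)] by (simp add: set_reg_def)
   show "wp P (block [Load rV rI, Add rI rI rONE, c, Sub rL rE0 rI])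
     (\<lambda>t Z'. ?I Z' \<and> t + 1 + ?\<Phi> Z' \<le> ?\<Phi> Y) Y"
   proof (intro wp_basic)
    show "wp P c (\<lambda>t1. wp P (block [Sub rL rE0 rI])
     (\<lambda>t2 Z'. ?I Z' \<and> 1 + (1 + (t1 + t2)) + 1 + ?\<Phi> Z' \<le> ?\<Phi> Y)) ?t2"
    proof (rule wp_mono[OF body[OF *(1) I2(1) v]])
     fix t Z' assume b: "I (ys @ [v]) Z' \<and> regs Z' rI = regs ?t2 rI \<and> t + \<Phi> Z' \<le> cost v + \<Phi> ?t2"
     let ?u = "set_reg rL (regs Z' rE0 - regs Z' rI) Z'"
     have u: "I (ys @ [v]) ?u" "\<Phi> ?u = \<Phi> Z'" using upd b by (metis insertCI)+
     have r: "regs ?u rI = a + length (ys @ [v])" "regs ?u rL = length zs"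
      using b i *(3) I[of "ys @ [v]" Z'] *(1) by (simp_all add: set_reg_def)
     have "?I ?u" using u r *(1) by (intro exI[of _ "ys @ [v]"] exI[of _ zs]) simp
     moreover have "drop (regs ?u rI - a) xs = zs" "drop (regs Y rI - a) xs = v # zs"
      using r *(1,3) by simp_all
     ultimately show "wp P (block [Sub rL rE0 rI])
       (\<lambda>t2 Z'. ?I Z' \<and> 1 + (1 + (t + t2)) + 1 + ?\<Phi> Z' \<le> ?\<Phi> Y) Z'"
      using b u I2 by (intro wp_basic conjI) (simp_all only: list.map sum_list.Cons, simp)
    qed
   qed
  next
   fix t Z' assume "?I Z'" "regs Z' rL = 0" and t: "t + ?\<Phi> Z' \<le> ?\<Phi> ?s2 + 1"
   then have "I xs Z'" by auto
   moreover have "?\<Phi> ?s2 = sum_list (map cost xs) + 6 * length xs + \<Phi> Z"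
    using s2 I1 by (simp add: sum_list_addf sum_list_triv)
   ultimately show "wp P (block []) (\<lambda>t2. Q (1 + (1 + (t + t2)))) Z'"
    using t by (intro wp_basic fin) simp_all
  qed
 qed
qed

lemma wp_for_adj:
 assumes u: "u < n" "regs Z v = u" and init: "I [] Z"
  and stat: "\<And>ys Z. I ys Z \<Longrightarrow> stat Z"
  and upd: "\<And>ys Z r x. I ys Z \<Longrightarrow> r \<in> {rE, rA, rT, rG} \<Longrightarrow> I ys (set_reg r x Z)"
  and body: "\<And>ys w s zs Z. adj u = ys @ (w, s) # zs \<Longrightarrow> I ys Z \<Longrightarrow> regs Z rT = w \<Longrightarrow> regs Z rG = s \<Longrightarrow>
   wp P c (\<lambda>t Z'. I (ys @ [(w, s)]) Z' \<and> regs Z' rE = regs Z rE \<and> t \<le> cost) Z"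
  and fin: "\<And>t Z'. I (adj u) Z' \<Longrightarrow> t \<le> (cost + 7) * length (adj u) + 4 \<Longrightarrow> Q t Z'"
 shows "wp P (for_adj v c) Q Z"
proof -
 let ?I = "\<lambda>Z. \<exists>ys zs. adj u = ys @ zs \<and> I ys Z \<and> cells m0 FT (regs Z rE) zs"
 \<comment> \<open>The potential must be a function of the state, but the list behind a pointer is
   only given by a relation. The relation determines the length, so it can be selected.\<close>
 define len where "len p = (SOME l. \<forall>zs. cells m0 FT p zs \<longrightarrow> length zs = l)" for p
 have uniq: "length zs = length zs'" if "cells m0 FT p zs" "cells m0 FT p zs'" for p zs zs'
  using that
 proof (induction zs arbitrary: p zs')
  case Nil
  then show ?case by (cases zs') auto
 next
  case (Cons x zs)
  then show ?case by (cases zs') auto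
 qed
 have len: "len p = length zs" if "cells m0 FT p zs" for p zs
  using someI[of "\<lambda>l. \<forall>zs. cells m0 FT p zs \<longrightarrow> length zs = l" "length zs"] uniq that
  unfolding len_def by metis
 let ?\<Phi> = "\<lambda>Z. (cost + 7) * len (regs Z rE)"
 let ?s1 = "set_reg rE (regs Z rHD + regs Z v) Z"
 let ?s2 = "set_reg rE (mem ?s1 (regs ?s1 rE)) ?s1"
 have s2: "I [] ?s2" using upd init by (metis insertCI)
 have e: "cells m0 FT (regs ?s2 rE) (adj u)"
  using cells[OF u(1)] stat[OF init] static(1) u by (simp add: set_reg_def stat_def const_regs_def)
 show ?thesis unfolding for_adj_def
 proof (intro wp_basic)
  show "wp P (WhileNZ rE (block [Add rA rE rONE, Load rT rA, Add rA rA rONE, Load rG rA, c, Load rE rE]))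
    (\<lambda>t1. wp P (block []) (\<lambda>t2. Q (1 + (1 + (t1 + t2))))) ?s2"
  proof (rule wp_WhileNZ[where I = ?I and \<Phi> = ?\<Phi>])
   show "?I ?s2" using s2 e by (intro exI[of _ "[]"] exI[of _ "adj u"]) simp
  next
   fix Y assume "?I Y" "regs Y rE \<noteq> 0"
   then obtain ys w s zs where *: "adj u = ys @ (w, s) # zs" "I ys Y" "cells m0 FT (regs Y rE) ((w, s) # zs)"
    by (metis cells.simps(1) neq_Nil_conv surj_pair)
   let ?p = "regs Y rE"
   have p: "?p + 2 < FT" "m0 (?p + 1) = w" "m0 (?p + 2) = s" "cells m0 FT (m0 ?p) zs" using *(3) by auto
   let ?t1 = "set_reg rA (regs Y rE + regs Y rONE) Y"
   let ?t2 = "set_reg rT (mem ?t1 (regs ?t1 rA)) ?t1"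
   let ?t3 = "set_reg rA (regs ?t2 rA + regs ?t2 rONE) ?t2"
   let ?t4 = "set_reg rG (mem ?t3 (regs ?t3 rA)) ?t3"
   have I4: "I ys ?t4" using upd *(2) by (metis insertCI)
   have t4: "regs ?t4 rT = w" "regs ?t4 rG = s" "regs ?t4 rE = ?p"
    using stat[OF *(2)] p by (simp_all add: set_reg_def stat_def const_regs_def)
   show "wp P (block [Add rA rE rONE, Load rT rA, Add rA rA rONE, Load rG rA, c, Load rE rE])
     (\<lambda>t Z'. ?I Z' \<and> t + 1 + ?\<Phi> Z' \<le> ?\<Phi> Y) Y"
   proof (intro wp_basic)
    show "wp P c (\<lambda>t1. wp P (block [Load rE rE])
     (\<lambda>t2 Z'. ?I Z' \<and> 1 + (1 + (1 + (1 + (t1 + t2)))) + 1 + ?\<Phi> Z' \<le> ?\<Phi> Y)) ?t4"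
    proof (rule wp_mono[OF body[OF *(1) I4 t4(1,2)]])
     fix t Z' assume b: "I (ys @ [(w, s)]) Z' \<and> regs Z' rE = regs ?t4 rE \<and> t \<le> cost"
     let ?u = "set_reg rE (mem Z' (regs Z' rE)) Z'"
     have "I (ys @ [(w, s)]) ?u" using upd b by (metis insertCI)
     moreover have c: "cells m0 FT (regs ?u rE) zs"
      using b stat[of "ys @ [(w, s)]" Z'] p t4(3) by (simp add: set_reg_def stat_def)
     ultimately have "?I ?u" using *(1) by (intro exI[of _ "ys @ [(w, s)]"] exI[of _ zs]) simp
     moreover have "len ?p = Suc (len (regs ?u rE))" using len[OF *(3)] len[OF c] by simp
     ultimately show "wp P (block [Load rE rE])
      (\<lambda>t2 Z'. ?I Z' \<and> 1 + (1 + (1 + (1 + (t + t2)))) + 1 + ?\<Phi> Z' \<le> ?\<Phi> Y) Z'"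
      using b by (intro wp_basic conjI) simp_all
    qed
   qed
  next
   fix t Z' assume *: "?I Z'" "regs Z' rE = 0" and t: "t + ?\<Phi> Z' \<le> ?\<Phi> ?s2 + 1"
   then obtain ys zs where "adj u = ys @ zs" "I ys Z'" "cells m0 FT 0 zs" by auto
   then have "I (adj u) Z'" by (cases zs) auto
   then show "wp P (block []) (\<lambda>t2. Q (1 + (1 + (t + t2)))) Z'"
    using t len[OF e] by (intro wp_basic fin) simp_all
  qed
 qed
qed

end

text \<open>Each basic command has exactly one run, so the rules are equivalences and straight-line
  code can be executed symbolically by rewriting.\<close>

lemma wp_eqs:
 "wp P Skip Q Z \<longleftrightarrow> Q (Suc 0) Z"
 "wp P (Const r c) Q Z \<longleftrightarrow> Q (Suc 0) (set_reg r c Z)"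
 "wp P (Add r a b) Q Z \<longleftrightarrow> Q (Suc 0) (set_reg r (regs Z a + regs Z b) Z)"
 "wp P (Sub r a b) Q Z \<longleftrightarrow> Q (Suc 0) (set_reg r (regs Z a - regs Z b) Z)"
 "wp P (Load r a) Q Z \<longleftrightarrow> Q (Suc 0) (set_reg r (mem Z (regs Z a)) Z)"
 "wp P (Store a r) Q Z \<longleftrightarrow> Q (Suc 0) (Z\<lparr>mem := (mem Z)(regs Z a := regs Z r)\<rparr>)"
 "wp P (Write r) Q Z \<longleftrightarrow> Q (Suc 0) (Z\<lparr>out_tape := out_tape Z @ [regs Z r]\<rparr>)"
 unfolding wp_def by (auto elim: exec.cases intro: exec.intros[unfolded One_nat_def])

lemma wp_Seq_eq: "wp P (Seq c1 c2) Q Z \<longleftrightarrow> wp P c1 (\<lambda>t1. wp P c2 (\<lambda>t2. Q (t1 + t2))) Z"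
proof
 assume "wp P (Seq c1 c2) Q Z"
 then obtain t Z' where "exec P (Seq c1 c2) Z t Z'" "Q t Z'" unfolding wp_def by blast
 then show "wp P c1 (\<lambda>t1. wp P c2 (\<lambda>t2. Q (t1 + t2))) Z"
  unfolding wp_def by (cases rule: exec.cases) auto
qed (rule wp_Seq)

lemma wp_IfNZ_eq: "wp P (IfNZ r c1 c2) Q Z \<longleftrightarrow>
   (if regs Z r \<noteq> 0 then wp P c1 (\<lambda>t. Q (Suc t)) Z else wp P c2 (\<lambda>t. Q (Suc t)) Z)"
proof
 assume "wp P (IfNZ r c1 c2) Q Z"
 then obtain t Z' where "exec P (IfNZ r c1 c2) Z t Z'" "Q t Z'" unfolding wp_def by blast
 then show "if regs Z r \<noteq> 0 then wp P c1 (\<lambda>t. Q (Suc t)) Z else wp P c2 (\<lambda>t. Q (Suc t)) Z"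
  unfolding wp_def by (cases rule: exec.cases) auto
qed (auto intro!: wp_IfNZ split: if_splits)

lemmas wp_simps = wp_eqs wp_Seq_eq wp_IfNZ_eq

context machine
begin

section \<open>Writing the code of a graph\<close>

definition lab_edges :: "nat set \<Rightarrow> nat \<Rightarrow> nat \<Rightarrow> nat list" where
 "lab_edges U s v = (if v < nv
   then concat (map (\<lambda>(w, s'). if s' = s \<and> w \<in> U then [v, w - nv] else []) (adj v)) else [])"

text \<open>The program tests only whether the clause of an edge is in U. This is the right filter
  when xs is closed in U, as a remaining neighbour then belongs to xs. An edge takes two words,
  which explains the division.\<close>

definition lab :: "nat set \<Rightarrow> nat list \<Rightarrow> nat list" where
 "lab U xs =
   (let vs = concat (map (\<lambda>v. if v < nv then [v] else []) xs);
     cs = concat (map (\<lambda>v. if v < nv then [] else [v - nv]) xs);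
     es = \<lambda>s. concat (map (lab_edges U s) xs)
   in 0 # length vs # vs @ length cs # cs @ length (es 0) div 2 # es 0 @ length (es 1) div 2 # es 1)"

abbreviation (input) emit_regs :: "reg set" where
 "emit_regs \<equiv> {rOUT, rE, rA, rT, rG, rQ, rR, rV, rI, rL, rX, rH, rK}"

definition emit_ok :: "nat set \<Rightarrow> nat list \<Rightarrow> nat \<Rightarrow> state \<Rightarrow> bool" where
 "emit_ok U xs a Z \<longleftrightarrow> stat Z \<and> regs Z rA0 = a \<and> regs Z rE0 = a + length xs \<and> list_at (mem Z) a xs \<and>
   a + length xs \<le> EN \<and> EN \<le> regs Z rOUT \<and> regs Z rB + n \<le> EN \<and> set xs \<subseteq> {..<n} \<and>
   (\<forall>c<n. mem Z (regs Z rB + c) = regs Z rVIS \<longleftrightarrow> c \<in> U)"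

lemma emit_ok_same:
 assumes "emit_ok U xs a Z" "same {EN..} emit_regs Z Z'" "EN \<le> regs Z' rOUT"
 shows "emit_ok U xs a Z'"
proof -
 have m: "mem Z' b = mem Z b" if "b < EN" for b using assms(2) that by (simp add: same_def)
 have r: "regs Z' rA0 = regs Z rA0" "regs Z' rE0 = regs Z rE0" "regs Z' rB = regs Z rB"
  "regs Z' rVIS = regs Z rVIS" using assms(2) by (simp_all add: same_def)
 have "stat Z'" by (rule stat_same[OF _ assms(2)]) (use assms(1) FT_MK in \<open>auto simp: emit_ok_def\<close>)
 moreover have "list_at (mem Z') a xs"
  by (rule list_at_cong[of "mem Z"]) (use assms(1) in \<open>auto simp: emit_ok_def intro!: m\<close>)
 ultimately show ?thesis using assms(1,3) m unfolding emit_ok_def r by simp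
qed

lemma set_reg_same: "r \<in> R \<Longrightarrow> same A R Z (set_reg r x Z)"
 by (simp add: same_def set_reg_def)

lemma wrote_set_reg: "wrote us Z Z' \<Longrightarrow> r \<noteq> rOUT \<Longrightarrow> wrote us Z (set_reg r x Z')"
 by (simp add: wrote_def set_reg_def)

lemma wp_put:
 assumes "stat Z" "r \<noteq> rOUT"
  and "\<And>Z'. same {regs Z rOUT} {rOUT} Z Z' \<Longrightarrow> wrote [regs Z r] Z Z' \<Longrightarrow> Q (Suc (Suc (Suc 0))) Z'"
 shows "wp P (put r) Q Z"
 unfolding put_def
 by (intro wp_basic) (use assms in \<open>simp add: set_reg_def same_def wrote_def stat_regs\<close>)

definition emits :: "reg set \<Rightarrow> nat list \<Rightarrow> state \<Rightarrow> state \<Rightarrow> bool" where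
 "emits R us Z Z' \<longleftrightarrow> same {regs Z rOUT..} R Z Z' \<and> wrote us Z Z'"

lemma emits_trans:
 assumes "emits R us Z Z1" "emits R vs Z1 Z2" shows "emits R (us @ vs) Z Z2"
proof -
 have le: "regs Z rOUT \<le> regs Z1 rOUT" using assms(1) by (simp add: emits_def wrote_def)
 have "same {regs Z rOUT..} R Z Z1" using assms(1) by (simp add: emits_def)
 moreover have "same {regs Z rOUT..} R Z1 Z2"
  by (rule same_mono[of "{regs Z1 rOUT..}" R]) (use assms(2) le in \<open>simp_all add: emits_def\<close>)
 ultimately have "same {regs Z rOUT..} R Z Z2" by (rule same_trans)
 moreover have "wrote (us @ vs) Z Z2"
  by (rule wrote_trans[of _ _ Z1 _ _ "{regs Z1 rOUT..}" R]) (use assms in \<open>simp_all add: emits_def\<close>)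
 ultimately show ?thesis by (simp add: emits_def)
qed

lemma emits_refl: "emits R [] Z Z"
 by (simp add: emits_def same_refl wrote_def)

lemma emits_set_reg: "emits R us Z Z' \<Longrightarrow> r \<in> R \<Longrightarrow> r \<noteq> rOUT \<Longrightarrow> emits R us Z (set_reg r x Z')"
 unfolding emits_def by (blast intro: same_trans set_reg_same wrote_set_reg)

lemma emits_mono: "emits R us Z Z' \<Longrightarrow> R \<subseteq> R' \<Longrightarrow> emits R' us Z Z'"
 unfolding emits_def by (blast intro: same_mono)

lemma emits_reg: "emits R us Z Z' \<Longrightarrow> r \<notin> R \<Longrightarrow> regs Z' r = regs Z r"
 by (simp add: emits_def same_def)

lemma emits_OUT: "emits R us Z Z' \<Longrightarrow> regs Z' rOUT = regs Z rOUT + length us"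
 by (simp add: emits_def wrote_def)

lemma emit_ok_emits:
 assumes "emit_ok U xs a Z" "emits R us Z Z'" "R \<subseteq> emit_regs" shows "emit_ok U xs a Z'"
proof -
 have EN: "EN \<le> regs Z rOUT" using assms(1) by (simp add: emit_ok_def)
 have "same {EN..} emit_regs Z Z'"
  by (rule same_mono[of "{regs Z rOUT..}" R]) (use assms(2,3) EN in \<open>simp_all add: emits_def\<close>)
 then show ?thesis
  by (rule emit_ok_same[OF assms(1)]) (use EN assms(2) in \<open>simp add: emits_OUT\<close>)
qed

lemma wp_put':
 assumes "stat Z" "r \<noteq> rOUT" "\<And>Z'. emits {rOUT} [regs Z r] Z Z' \<Longrightarrow> stat Z' \<Longrightarrow> Q (Suc (Suc (Suc 0))) Z'"
  and "EN \<le> regs Z rOUT"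
 shows "wp P (put r) Q Z"
proof (rule wp_put[OF assms(1,2)])
 fix Z' assume s: "same {regs Z rOUT} {rOUT} Z Z'" "wrote [regs Z r] Z Z'"
 have "emits {rOUT} [regs Z r] Z Z'" unfolding emits_def using s by (auto intro: same_mono)
 moreover have "stat Z'" by (rule stat_same[OF assms(1) s(1)]) (use assms(4) FT_MK in auto)
 ultimately show "Q (Suc (Suc (Suc 0))) Z'" by (rule assms(3))
qed

abbreviation (input) body_regs :: "reg set" where
 "body_regs \<equiv> {rOUT, rE, rA, rT, rG, rQ, rR, rX, rK}"

text \<open>For vertex v the body writes the words \<open>f v\<close> and counts \<open>g v\<close>
  entries. The sum of the counts is stored in a cell that was reserved before the list.\<close>

lemma wp_emit_list:
 assumes ok: "emit_ok U xs a Z"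
  and body: "\<And>v Z. emit_ok U xs a Z \<Longrightarrow> regs Z rV = v \<Longrightarrow> v < n \<Longrightarrow>
   wp P c (\<lambda>t Z'. emits body_regs (f v) Z Z' \<and> regs Z' rK = regs Z rK + g v \<and> t \<le> cost v) Z"
  and Q: "\<And>t Z'. emit_ok U xs a Z' \<Longrightarrow>
   emits emit_regs (sum_list (map g xs) # concat (map f xs)) Z Z' \<Longrightarrow>
   t \<le> sum_list (map cost xs) + 6 * length xs + 9 \<Longrightarrow> Q t Z'"
 shows "wp P (emit_list c) Q Z"
proof -
 let ?h = "regs Z rOUT"
 let ?s3 = "set_reg rK 0 (set_reg rOUT (Suc ?h) (set_reg rH ?h Z))"
 let ?I = "\<lambda>ys Z'. emit_ok U xs a Z' \<and> same {?h..} emit_regs Z Z' \<and> wrote (concat (map f ys)) ?s3 Z' \<and>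
  regs Z' rH = ?h \<and> regs Z' rK = sum_list (map g ys)"
 have EN: "EN \<le> ?h" using ok by (simp add: emit_ok_def)
 have st: "stat Z" using ok by (simp add: emit_ok_def)
 have s3: "same {?h..} emit_regs Z ?s3" by (simp add: same_def set_reg_def)
 then have ok3: "emit_ok U xs a ?s3"
  using EN by (intro emit_ok_same[OF ok]) (auto elim: same_mono simp: set_reg_def)
 have upd: "?I ys (set_reg r x Y)" if I: "?I ys Y" and r: "r \<in> {rI, rL, rV}" for ys Y r x
 proof -
  have t: "emit_ok U xs a Y" "same {?h..} emit_regs Z Y" "wrote (concat (map f ys)) ?s3 Y"
   "regs Y rH = ?h" "regs Y rK = sum_list (map g ys)" using I by blast+
  have rr: "r \<in> emit_regs" "r \<noteq> rOUT" "r \<noteq> rH" "r \<noteq> rK" using r by auto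
  show ?thesis
  proof (intro conjI)
   show "emit_ok U xs a (set_reg r x Y)"
    by (rule emit_ok_same[OF t(1) set_reg_same[OF rr(1)]]) (use t(1) rr(2) in \<open>simp add: emit_ok_def set_reg_def\<close>)
   show "same {?h..} emit_regs Z (set_reg r x Y)" by (rule same_trans[OF t(2) set_reg_same[OF rr(1)]])
   show "wrote (concat (map f ys)) ?s3 (set_reg r x Y)" by (rule wrote_set_reg[OF t(3) rr(2)])
  qed (use t(4,5) rr in \<open>simp_all add: set_reg_def\<close>)
 qed
 have "wp P (for_seg c) (\<lambda>t Z'. ?I xs Z' \<and> t \<le> sum_list (map cost xs) + 6 * length xs + 4) ?s3"
 proof (rule wp_for_seg[where I = ?I and \<Phi> = "\<lambda>_. 0" and cost = cost and a = a])
  show "regs ?s3 rA0 = a" using ok by (simp add: set_reg_def emit_ok_def)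
  show "?I [] ?s3" using ok3 s3 by (simp add: set_reg_def wrote_def)
  show "regs Y rZ = 0 \<and> regs Y rONE = 1 \<and> list_at (mem Y) a xs \<and> regs Y rE0 = a + length xs" if "?I ys Y" for ys Y
   using that by (simp add: emit_ok_def stat_regs)
  show "?I ys (set_reg r x Y) \<and> (0::nat) = 0" if "?I ys Y" "r \<in> {rI, rL, rV}" for ys Y r x
   using upd[OF that] by blast
 next
  fix ys v zs Y assume xs: "xs = ys @ v # zs" and I: "?I ys Y" and v: "regs Y rV = v"
  have t: "emit_ok U xs a Y" "same {?h..} emit_regs Z Y" "wrote (concat (map f ys)) ?s3 Y"
   "regs Y rH = ?h" "regs Y rK = sum_list (map g ys)" using I by blast+
  have "set xs \<subseteq> {..<n}" using t(1) by (simp add: emit_ok_def)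
  then have vn: "v < n" using xs by simp
  have h: "?h \<le> regs Y rOUT" "Suc ?h \<le> regs Y rOUT" using t(3) by (simp_all add: wrote_def set_reg_def)
  show "wp P c (\<lambda>t Z'. ?I (ys @ [v]) Z' \<and> regs Z' rI = regs Y rI \<and> t + 0 \<le> cost v + 0) Y"
  proof (rule wp_mono[OF body[OF t(1) v vn]], elim conjE)
   fix l Z' assume e: "emits body_regs (f v) Y Z'" "regs Z' rK = regs Y rK + g v" "l \<le> cost v"
   then have b: "same {regs Y rOUT..} body_regs Y Z'" "wrote (f v) Y Z'"
    "regs Z' rK = regs Y rK + g v" "l \<le> cost v" by (simp_all add: emits_def)
   have s: "same {?h..} emit_regs Y Z'" by (rule same_mono[OF b(1)]) (use h in simp, blast)
   then have "same {EN..} emit_regs Y Z'" by (rule same_mono) (use EN in simp_all)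
   moreover have "EN \<le> regs Z' rOUT" using b(2) h EN by (simp add: wrote_def)
   ultimately have e: "emit_ok U xs a Z'" by (rule emit_ok_same[OF t(1)])
   have w: "wrote (concat (map f ys) @ f v) ?s3 Z'"
    by (rule wrote_trans[OF t(3) b(2,1)]) simp
   have "regs Z' rH = regs Y rH" "regs Z' rI = regs Y rI"
    by (rule same_reg[OF b(1)], simp)+
   then show "?I (ys @ [v]) Z' \<and> regs Z' rI = regs Y rI \<and> l + 0 \<le> cost v + 0"
    using b(3,4) e w same_trans[OF t(2) s] t(4,5) by simp
  qed
 qed simp
 note loop = this
 show ?thesis unfolding emit_list_def
 proof (intro wp_basic)
  have eq: "set_reg rK 0 (set_reg rOUT (regs (set_reg rH (regs Z rOUT + regs Z rZ) Z) rOUT +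
    regs (set_reg rH (regs Z rOUT + regs Z rZ) Z) rONE) (set_reg rH (regs Z rOUT + regs Z rZ) Z)) = ?s3"
   using stat_regs[OF st] by (simp add: set_reg_def)
  show "wp P (for_seg c) (\<lambda>t1. wp P (block [Store rH rK]) (\<lambda>t2. Q (1 + (1 + (1 + (t1 + t2))))))
    (set_reg rK 0 (set_reg rOUT (regs (set_reg rH (regs Z rOUT + regs Z rZ) Z) rOUT +
    regs (set_reg rH (regs Z rOUT + regs Z rZ) Z) rONE) (set_reg rH (regs Z rOUT + regs Z rZ) Z)))"
   unfolding eq
  proof (rule wp_mono[OF loop], elim conjE)
   fix t Z' assume I: "emit_ok U xs a Z'" "same {?h..} emit_regs Z Z'" "wrote (concat (map f xs)) ?s3 Z'"
    "regs Z' rH = ?h" "regs Z' rK = sum_list (map g xs)"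
    "t \<le> sum_list (map cost xs) + 6 * length xs + 4"
   let ?u = "Z'\<lparr>mem := (mem Z')(regs Z' rH := regs Z' rK)\<rparr>"
   have su: "same {?h} {} Z' ?u" using I(4) by (simp add: same_def)
   have "same {EN..} emit_regs Z' ?u" by (rule same_mono[OF su]) (use EN in auto)
   then have "emit_ok U xs a ?u"
    by (rule emit_ok_same[OF I(1)]) (use I(1) in \<open>simp add: emit_ok_def\<close>)
   moreover have "same {?h..} emit_regs Z ?u"
    by (rule same_trans[OF I(2)], rule same_mono[OF su]) auto
   moreover have "list_at (mem ?u) (Suc ?h) (concat (map f xs))"
    by (rule list_at_cong[of "mem Z'"]) (use I(3,4) in \<open>simp_all add: wrote_list_at set_reg_def\<close>)
   then have "wrote (sum_list (map g xs) # concat (map f xs)) Z ?u"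
    using I(3-5) by (simp add: wrote_list_at list_at_Cons set_reg_def)
   ultimately show "wp P (block [Store rH rK]) (\<lambda>t2. Q (1 + (1 + (1 + (t + t2))))) Z'"
    using I(6) by (intro wp_basic Q) (simp_all add: emits_def)
  qed
 qed
qed

lemma emits_intro:
 assumes "\<And>a. a < regs Z rOUT \<Longrightarrow> mem Z' a = mem Z a" "\<And>r. r \<notin> R \<Longrightarrow> regs Z' r = regs Z r"
  "out_tape Z' = out_tape Z" "regs Z' rOUT = regs Z rOUT + length us"
  "list_at (mem Z') (regs Z rOUT) us"
 shows "emits R us Z Z'"
 using assms by (simp add: emits_def same_def wrote_list_at)

lemma wp_emit_vars:
 assumes ok: "emit_ok U xs a Z"
  and Q: "\<And>t Z'. emits emit_regs (sum_list (map (\<lambda>v. if v < nv then 1 else 0) xs) #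
    concat (map (\<lambda>v. if v < nv then [v] else []) xs)) Z Z' \<Longrightarrow> t \<le> 16 * length xs + 9 \<Longrightarrow> Q t Z'"
 shows "wp P emit_vars Q Z"
 unfolding emit_vars_def
proof (rule wp_emit_list[OF ok, where cost = "\<lambda>_. 10"])
 fix v Y assume *: "emit_ok U xs a Y" "regs Y rV = v" "v < n"
 then have "stat Y" by (simp add: emit_ok_def)
 from stat_regs[OF this]
 show "wp P (block [Sub rX rNV rV, IfNZ rX (block [put rV, Add rK rK rONE]) Skip])
   (\<lambda>t Z'. emits body_regs (if v < nv then [v] else []) Y Z' \<and>
     regs Z' rK = regs Y rK + (if v < nv then 1 else 0) \<and> t \<le> 10) Y"
  by (auto simp: wp_simps put_def set_reg_def * list_at_Cons list_at_Nil intro!: emits_intro split: if_splits)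
qed (use Q in \<open>simp add: sum_list_triv\<close>)

lemma wp_emit_clauses:
 assumes ok: "emit_ok U xs a Z"
  and Q: "\<And>t Z'. emits emit_regs (sum_list (map (\<lambda>v. if v < nv then 0 else 1) xs) #
    concat (map (\<lambda>v. if v < nv then [] else [v - nv]) xs)) Z Z' \<Longrightarrow> t \<le> 18 * length xs + 9 \<Longrightarrow> Q t Z'"
 shows "wp P emit_clauses Q Z"
 unfolding emit_clauses_def
proof (rule wp_emit_list[OF ok, where cost = "\<lambda>_. 12"])
 fix v Y assume *: "emit_ok U xs a Y" "regs Y rV = v" "v < n"
 then have "stat Y" by (simp add: emit_ok_def)
 from stat_regs[OF this]
 show "wp P (block [Sub rX rNV rV, IfNZ rX Skip (block [Sub rX rV rNV, put rX, Add rK rK rONE])])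
   (\<lambda>t Z'. emits body_regs (if v < nv then [] else [v - nv]) Y Z' \<and>
     regs Z' rK = regs Y rK + (if v < nv then 0 else 1) \<and> t \<le> 12) Y"
  by (auto simp: wp_simps put_def set_reg_def * list_at_Cons list_at_Nil intro!: emits_intro split: if_splits)
qed (use Q in \<open>simp add: sum_list_triv\<close>)

abbreviation (input) edge_regs :: "reg set" where
 "edge_regs \<equiv> {rOUT, rA, rQ, rR, rX, rK}"

lemma emit_ok_stat: "emit_ok U xs a Z \<Longrightarrow> stat Z"
 by (simp add: emit_ok_def)

lemma wp_emit_edge:
 assumes ok: "emit_ok U xs a Z" and v: "regs Z rV = v" and w: "regs Z rT = w" "w < n"
 shows "wp P (block [Add rA rB rT, Load rA rA, neq rA rVIS,
    IfNZ rQ Skip (block [put rV, Sub rX rT rNV, put rX, Add rK rK rONE])])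
   (\<lambda>t Z'. emits edge_regs (if w \<in> U then [v, w - nv] else []) Z Z' \<and>
    regs Z' rK = regs Z rK + (if w \<in> U then 1 else 0) \<and> t \<le> 20) Z"
proof -
 have "mem Z (regs Z rB + w) = regs Z rVIS \<longleftrightarrow> w \<in> U" using ok w by (simp add: emit_ok_def)
 then show ?thesis using stat_regs[OF emit_ok_stat[OF ok]]
  by (auto simp: wp_simps put_def neq_def set_reg_def v w(1) list_at_Cons list_at_Nil intro!: emits_intro split: if_splits)
qed

lemma wp_emit_edges:
 assumes ok: "emit_ok U xs a Z" and s: "s \<in> {0, 1}"
  and Q: "\<And>t Z'. emits emit_regs (sum_list (map (\<lambda>v. length (lab_edges U s v) div 2) xs) #
    concat (map (lab_edges U s) xs)) Z Z' \<Longrightarrow> t \<le> 40 * wts xs + 9 \<Longrightarrow> Q t Z'"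
 shows "wp P (emit_edges s) Q Z"
 unfolding emit_edges_def
proof (rule wp_emit_list[OF ok, where cost = "\<lambda>v. 30 * length (adj v) + 10"])
 fix v Y assume *: "emit_ok U xs a Y" "regs Y rV = v" "v < n"
 let ?e = "\<lambda>(w, s'). if s' = s \<and> w \<in> U then [v, w - nv] else []"
 let ?g = "\<lambda>(w, s'). if s' = s \<and> w \<in> U then 1 else (0::nat)"
 let ?I = "\<lambda>ys Z'. emits body_regs (concat (map ?e ys)) Y Z' \<and> regs Z' rK = regs Y rK + sum_list (map ?g ys)"
 let ?s = "set_reg rX (nv - v) Y"
 have okI: "emit_ok U xs a N" if "?I ys N" for ys N
  by (rule emit_ok_emits[OF *(1) conjunct1[OF that]]) blast
 have loop: "wp P (for_adj rV (if_sign s (block [Add rA rB rT, Load rA rA, neq rA rVIS,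
    IfNZ rQ Skip (block [put rV, Sub rX rT rNV, put rX, Add rK rK rONE])])))
   (\<lambda>t Z'. ?I (adj v) Z' \<and> t \<le> (23 + 7) * length (adj v) + 4) ?s"
 proof (rule wp_for_adj[OF *(3), where I = ?I and cost = 23])
  show "regs ?s rV = v" using *(2) by (simp add: set_reg_def)
  show "?I [] ?s" by (simp add: emits_set_reg emits_refl) (simp add: set_reg_def)
  show "stat N" if "?I ys N" for ys N by (rule emit_ok_stat[OF okI[OF that]])
  show "?I ys (set_reg r x N)" if "?I ys N" "r \<in> {rE, rA, rT, rG}" for ys N r x
  proof
   show "emits body_regs (concat (map ?e ys)) Y (set_reg r x N)"
    by (rule emits_set_reg[OF conjunct1[OF that(1)]]) (use that(2) in auto)
   show "regs (set_reg r x N) rK = regs Y rK + sum_list (map ?g ys)"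
    using that by (auto simp: set_reg_def)
  qed
 next
  fix ys w s' zs N assume a: "adj v = ys @ (w, s') # zs" and I: "?I ys N"
   and r: "regs N rT = w" "regs N rG = s'"
  have "(w, s') \<in> set (adj v)" by (simp add: a)
  then have w: "w < n" "s' \<in> {0, 1}" using adj_iff[OF *(3)] nb_less by (auto split: if_splits)
  have v: "regs N rV = v" using emits_reg[OF conjunct1[OF I], of rV] *(2) by simp
  have step: "?I (ys @ [(w, s')]) N'" if e: "emits edge_regs (?e (w, s')) N N'"
    "regs N' rK = regs N rK + ?g (w, s')" for N'
  proof
   have "emits body_regs (concat (map ?e ys) @ ?e (w, s')) Y N'"
    by (rule emits_trans[OF conjunct1[OF I] emits_mono[OF e(1)]]) blast
   then show "emits body_regs (concat (map ?e (ys @ [(w, s')]))) Y N'" by simp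
   show "regs N' rK = regs Y rK + sum_list (map ?g (ys @ [(w, s')]))" using e(2) I by simp
  qed
  let ?b = "block [Add rA rB rT, Load rA rA, neq rA rVIS,
    IfNZ rQ Skip (block [put rV, Sub rX rT rNV, put rX, Add rK rK rONE])]"
  show "wp P (if_sign s ?b) (\<lambda>t Z'. ?I (ys @ [(w, s')]) Z' \<and> regs Z' rE = regs N rE \<and> t \<le> 23) N"
  proof (cases "s' = s")
   case True
   have "wp P ?b (\<lambda>t Z'. ?I (ys @ [(w, s')]) Z' \<and> regs Z' rE = regs N rE \<and> Suc t \<le> 23) N"
   proof (rule wp_mono[OF wp_emit_edge[OF okI[OF I] v r(1) w(1)]], elim conjE)
    fix t :: nat and N' assume e: "emits edge_regs (if w \<in> U then [v, w - nv] else []) N N'"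
     "regs N' rK = regs N rK + (if w \<in> U then 1 else 0)" "t \<le> 20"
    have "?I (ys @ [(w, s')]) N'" by (rule step) (use e True in simp_all)
    moreover have "regs N' rE = regs N rE" by (rule emits_reg[OF e(1)]) simp
    ultimately show "?I (ys @ [(w, s')]) N' \<and> regs N' rE = regs N rE \<and> Suc t \<le> 23"
     using e(3) by simp
   qed
   then show ?thesis using True r s by (auto simp: if_sign_def wp_simps)
  next
   case False
   then have "?I (ys @ [(w, s')]) N" by (intro step) (simp_all add: emits_refl)
   then show ?thesis using False r s w(2) by (auto simp: if_sign_def wp_simps)
  qed
 qed blast
 have sum: "length (concat (map ?e zs)) div 2 = sum_list (map ?g zs)" for zs
 proof -
  have "length (concat (map ?e zs)) = 2 * sum_list (map ?g zs)" by (induction zs) auto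
  then show ?thesis by simp
 qed
 let ?c = "for_adj rV (if_sign s (block [Add rA rB rT, Load rA rA, neq rA rVIS,
    IfNZ rQ Skip (block [put rV, Sub rX rT rNV, put rX, Add rK rK rONE])]))"
 have st: "regs Y (Suc 0) = nv" using stat_regs(2)[OF emit_ok_stat[OF *(1)]] .
 have "wp P ?c (\<lambda>t Z'. emits body_regs (lab_edges U s v) Y Z' \<and>
   regs Z' rK = regs Y rK + length (lab_edges U s v) div 2 \<and> t + 6 \<le> 30 * length (adj v) + 10) ?s" if "v < nv"
  by (rule wp_mono[OF loop]) (use that in \<open>simp add: lab_edges_def sum\<close>)
 moreover have "emits body_regs [] Y ?s" by (simp add: emits_set_reg emits_refl)
 ultimately show "wp P (block [Sub rX rNV rV, IfNZ rX ?c Skip])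
   (\<lambda>t Z'. emits body_regs (lab_edges U s v) Y Z' \<and>
   regs Z' rK = regs Y rK + length (lab_edges U s v) div 2 \<and> t \<le> 30 * length (adj v) + 10) Y"
  using *(2) st by (auto simp: wp_simps lab_edges_def set_reg_def elim!: wp_mono)
next
 fix t Z' assume e: "emits emit_regs (sum_list (map (\<lambda>v. length (lab_edges U s v) div 2) xs) #
    concat (map (lab_edges U s) xs)) Z Z'"
  and t: "t \<le> (\<Sum>v\<leftarrow>xs. 30 * length (adj v) + 10) + 6 * length xs + 9"
 have "(\<Sum>v\<leftarrow>xs. 30 * length (adj v) + 10) + 6 * length xs \<le> 40 * wts xs"
  by (induction xs) (auto simp: wts_simps wt_def)
 then show "Q t Z'" using t by (intro Q[OF e]) simp
qed

lemma wp_emit: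
 assumes ok: "emit_ok U xs a Z"
  and Q: "\<And>t Z'. emits emit_regs (lab U xs) Z Z' \<Longrightarrow> emit_ok U xs a Z' \<Longrightarrow> t \<le> 120 * wts xs + 50 \<Longrightarrow> Q t Z'"
 shows "wp P emit Q Z"
 unfolding emit_def
proof (simp only: block.simps wp_Seq_eq, rule wp_put'[OF emit_ok_stat[OF ok]])
 have sub: "{rOUT} \<subseteq> emit_regs" by blast
 fix Z0 assume e0: "emits {rOUT} [regs Z rZ] Z Z0"
 have ok0: "emit_ok U xs a Z0" by (rule emit_ok_emits[OF ok e0 sub])
 have z: "regs Z rZ = 0" using stat_regs[OF emit_ok_stat[OF ok]] by simp
 note sr = subset_refl[of emit_regs]
 have len: "length xs \<le> wts xs" by (rule length_le_wts)
 show "wp P (Seq emit_vars (Seq emit_clauses (Seq (emit_edges 0) (Seq (emit_edges 1) Skip))))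
   (\<lambda>t. Q (Suc (Suc (Suc 0)) + t)) Z0"
 proof (simp only: wp_Seq_eq, rule wp_emit_vars[OF ok0])
  fix t1 Z1 assume e1: "emits emit_regs (sum_list (map (\<lambda>v. if v < nv then 1 else 0) xs) #
    concat (map (\<lambda>v. if v < nv then [v] else []) xs)) Z0 Z1" and t1: "t1 \<le> 16 * length xs + 9"
  have ok1: "emit_ok U xs a Z1" by (rule emit_ok_emits[OF ok0 e1 sr])
  show "wp P (Seq emit_clauses (Seq (emit_edges 0) (Seq (emit_edges 1) Skip)))
    (\<lambda>t. Q (Suc (Suc (Suc 0)) + (t1 + t))) Z1"
  proof (simp only: wp_Seq_eq, rule wp_emit_clauses[OF ok1])
   fix t2 Z2 assume e2: "emits emit_regs (sum_list (map (\<lambda>v. if v < nv then 0 else 1) xs) #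
    concat (map (\<lambda>v. if v < nv then [] else [v - nv]) xs)) Z1 Z2" and t2: "t2 \<le> 18 * length xs + 9"
   have ok2: "emit_ok U xs a Z2" by (rule emit_ok_emits[OF ok1 e2 sr])
   show "wp P (Seq (emit_edges 0) (Seq (emit_edges 1) Skip))
     (\<lambda>t. Q (Suc (Suc (Suc 0)) + (t1 + (t2 + t)))) Z2"
   proof (simp only: wp_Seq_eq, rule wp_emit_edges[OF ok2])
    fix t3 Z3 assume e3: "emits emit_regs (sum_list (map (\<lambda>v. length (lab_edges U 0 v) div 2) xs) #
     concat (map (lab_edges U 0) xs)) Z2 Z3" and t3: "t3 \<le> 40 * wts xs + 9"
    have ok3: "emit_ok U xs a Z3" by (rule emit_ok_emits[OF ok2 e3 sr])
    show "wp P (Seq (emit_edges 1) Skip) (\<lambda>t. Q (Suc (Suc (Suc 0)) + (t1 + (t2 + (t3 + t))))) Z3"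
    proof (simp only: wp_Seq_eq, rule wp_emit_edges[OF ok3])
     fix t4 Z4 assume e4: "emits emit_regs (sum_list (map (\<lambda>v. length (lab_edges U 1 v) div 2) xs) #
      concat (map (lab_edges U 1) xs)) Z3 Z4" and t4: "t4 \<le> 40 * wts xs + 9"
     have ok4: "emit_ok U xs a Z4" by (rule emit_ok_emits[OF ok3 e4 sr])
     have even: "(\<Sum>v\<leftarrow>xs. length (lab_edges U s v) div 2) = length (concat (map (lab_edges U s) xs)) div 2" for s
     proof -
      have "even (length (concat (map (\<lambda>(w, s'). if s' = s \<and> w \<in> U then [v, w - nv] else []) ys)))" for v ys
       by (induction ys) auto
      then have "even (length (lab_edges U s v))" for v by (simp add: lab_edges_def)
      then show ?thesis by (induction xs) (simp_all add: div_plus_div_distrib_dvd_left)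
     qed
     have vs: "(\<Sum>v\<leftarrow>xs. if v < nv then 1 else 0) = length (concat (map (\<lambda>v. if v < nv then [v] else []) xs))"
      "(\<Sum>v\<leftarrow>xs. if v < nv then 0 else 1) = length (concat (map (\<lambda>v. if v < nv then [] else [v - nv]) xs))"
      by (induction xs) auto
     have "emits emit_regs (lab U xs) Z Z4"
      using emits_trans[OF emits_trans[OF emits_trans[OF emits_trans[OF emits_mono[OF e0 sub] e1] e2] e3] e4]
      unfolding lab_def Let_def vs even z by simp
     then have "Q (Suc (Suc (Suc 0)) + (t1 + (t2 + (t3 + (t4 + Suc 0))))) Z4"
      by (rule Q[OF _ ok4]) (use t1 t2 t3 t4 len in linarith)
     then show "wp P Skip (\<lambda>t. Q (Suc (Suc (Suc 0)) + (t1 + (t2 + (t3 + (t4 + t)))))) Z4"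
      by (simp only: wp_eqs)
    qed simp
   qed simp
  qed
 qed
qed (use ok in \<open>simp_all add: emit_ok_def\<close>)

end

text \<open>The same equations without the state argument: they also rewrite inside postconditions,
  where the code after a subroutine stands applied to no state.\<close>

lemma wp_funs:
 "wp P Skip Q = Q (Suc 0)"
 "wp P (Const r c) Q = (\<lambda>Z. Q (Suc 0) (set_reg r c Z))"
 "wp P (Add r a b) Q = (\<lambda>Z. Q (Suc 0) (set_reg r (regs Z a + regs Z b) Z))"
 "wp P (Sub r a b) Q = (\<lambda>Z. Q (Suc 0) (set_reg r (regs Z a - regs Z b) Z))"
 "wp P (Load r a) Q = (\<lambda>Z. Q (Suc 0) (set_reg r (mem Z (regs Z a)) Z))"
 "wp P (Store a r) Q = (\<lambda>Z. Q (Suc 0) (Z\<lparr>mem := (mem Z)(regs Z a := regs Z r)\<rparr>))"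
 "wp P (Write r) Q = (\<lambda>Z. Q (Suc 0) (Z\<lparr>out_tape := out_tape Z @ [regs Z r]\<rparr>))"
 "wp P (Seq c1 c2) Q = wp P c1 (\<lambda>t1. wp P c2 (\<lambda>t2. Q (t1 + t2)))"
 "wp P (IfNZ r c1 c2) Q =
   (\<lambda>Z. if regs Z r \<noteq> 0 then wp P c1 (\<lambda>t. Q (Suc t)) Z else wp P c2 (\<lambda>t. Q (Suc t)) Z)"
 by (intro ext; simp only: wp_eqs wp_Seq_eq wp_IfNZ_eq)+

lemma add_numeral_Suc: "(x :: nat) + numeral k = Suc (x + pred_numeral k)"
 by (simp add: numeral_eq_Suc)

text \<open>The potential is a parameter of the invariant instead of a function of the state, so it
  may depend on data that is only asserted to exist, such as the queue or the output.\<close>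

lemma wp_WhileNZ':
 fixes I :: "nat \<Rightarrow> state \<Rightarrow> bool"
 assumes init: "I p Z"
  and step: "\<And>p Z. I p Z \<Longrightarrow> regs Z r \<noteq> 0 \<Longrightarrow> wp P c (\<lambda>t Z'. \<exists>p'. I p' Z' \<and> t + 1 + p' \<le> p) Z"
  and final: "\<And>p' t Z'. I p' Z' \<Longrightarrow> regs Z' r = 0 \<Longrightarrow> t + p' \<le> p + 1 \<Longrightarrow> Q t Z'"
 shows "wp P (WhileNZ r c) Q Z"
proof -
 have "\<exists>t Z' p'. exec P (WhileNZ r c) Z t Z' \<and> I p' Z' \<and> regs Z' r = 0 \<and> t + p' \<le> p + 1" if "I p Z" for p Z
  using that
 proof (induction p arbitrary: Z rule: less_induct)
  case (less p)
  show ?case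
  proof (cases "regs Z r = 0")
   case True
   then show ?thesis using less.prems exec.WhileFalse[OF True, of P c]
    by (intro exI[of _ 1] exI[of _ Z] exI[of _ p]) simp
  next
   case False
   obtain t1 Z1 p1 where 1: "exec P c Z t1 Z1" "I p1 Z1" "t1 + 1 + p1 \<le> p"
    using step[OF less.prems False] unfolding wp_def by blast
   have lt: "p1 < p" using 1(3) by simp
   obtain t2 Z2 p2 where 2: "exec P (WhileNZ r c) Z1 t2 Z2" "I p2 Z2" "regs Z2 r = 0" "t2 + p2 \<le> p1 + 1"
    using less.IH[OF lt 1(2)] by blast
   show ?thesis using exec.WhileTrue[OF False 1(1) 2(1)] 1(3) 2
    by (intro exI[of _ "1 + t1 + t2"] exI[of _ Z2] exI[of _ p2]) auto
  qed
 qed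
 then show ?thesis using init final unfolding wp_def by blast
qed

section \<open>Splitting a graph into its components\<close>

text \<open>The address of the end of each segment is stored at the position of its start, in another array.\<close>

fun segs_at :: "(nat \<Rightarrow> nat) \<Rightarrow> nat \<Rightarrow> nat \<Rightarrow> nat list list \<Rightarrow> bool" where
 "segs_at m d a [] \<longleftrightarrow> True"
| "segs_at m d a (l # ls) \<longleftrightarrow> m (a + d) = a + length l \<and> segs_at m d (a + length l) ls"

lemma segs_at_append:
 "segs_at m d a (ls @ ls') \<longleftrightarrow> segs_at m d a ls \<and> segs_at m d (a + length (concat ls)) ls'"
 by (induction ls arbitrary: a) (auto simp: add.assoc)

lemma segs_at_cong:
 "segs_at m d a ls \<Longrightarrow> [] \<notin> set ls \<Longrightarrow> (\<And>i. a + d \<le> i \<Longrightarrow> i < a + d + length (concat ls) \<Longrightarrow> m' i = m i) \<Longrightarrow>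
  segs_at m' d a ls"
proof (induction ls arbitrary: a)
 case (Cons l ls)
 have "segs_at m' d (a + length l) ls"
  by (rule Cons.IH) (use Cons.prems in auto)
 then show ?case using Cons.prems by (cases l) auto
qed simp

context machine
begin

definition par_at :: "state \<Rightarrow> nat \<Rightarrow> nat \<Rightarrow> nat" where
 "par_at Z B v = mem Z (B + n + v)"

definition comp_ok :: "nat set \<Rightarrow> (nat \<Rightarrow> nat) \<Rightarrow> nat list \<Rightarrow> bool" where
 "comp_ok U par l \<longleftrightarrow> l \<noteq> [] \<and> closed_in (set l) U \<and> bfs_tree nb (set l) (hd l) par"

text \<open>The stamp u means waiting and \<open>Suc u\<close> means visited. The queue consists of
  the finished components \<open>ls\<close>, each a contiguous segment, followed by the component
  \<open>seg\<close> under construction.\<close>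

definition split_inv :: "nat \<Rightarrow> nat \<Rightarrow> nat set \<Rightarrow> nat list list \<Rightarrow> nat list \<Rightarrow> state \<Rightarrow> bool" where
 "split_inv B u U ls seg Z \<longleftrightarrow>
   stat Z \<and> regs Z rB = B \<and> FB \<le> B \<and> B + W \<le> EN \<and> EN \<le> u \<and> regs Z rUID = u \<and> regs Z rVIS = Suc u \<and>
   (\<forall>a. MK \<le> a \<longrightarrow> a < EN \<longrightarrow> mem Z a \<le> Suc u) \<and>
   U \<subseteq> {..<n} \<and> distinct (concat ls @ seg) \<and> set (concat ls @ seg) \<subseteq> U \<and>
   list_at (mem Z) (B + n + n) (concat ls @ seg) \<and> regs Z rQT = B + n + n + length (concat ls @ seg) \<and>
   (\<forall>v<n. (mem Z (B + v) = u \<longleftrightarrow> v \<in> U - set (concat ls @ seg)) \<and>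
    (mem Z (B + v) = Suc u \<longleftrightarrow> v \<in> set (concat ls @ seg))) \<and>
   (\<forall>l\<in>set ls. comp_ok U (par_at Z B) l) \<and>
   segs_at (mem Z) n (B + n + n) ls \<and> regs Z rCNT = length ls"

lemma bfs_tree_cong:
 assumes "bfs_tree nb' K r par" "\<And>v. v \<in> K \<Longrightarrow> par' v = par v" shows "bfs_tree nb' K r par'"
proof -
 obtain lev :: "'a \<Rightarrow> nat" where lev: "r \<in> K" "par r = r" "lev r = 0"
  "\<And>v. v \<in> K - {r} \<Longrightarrow> par v \<in> K \<and> v \<in> nb' (par v) \<and> lev v = Suc (lev (par v))"
  "\<And>u w. u \<in> K \<Longrightarrow> w \<in> nb' u \<inter> K \<Longrightarrow> lev w \<le> Suc (lev u)"
  using assms(1) unfolding bfs_tree_def by blast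
 show ?thesis unfolding bfs_tree_def
  using lev assms(2) by (intro conjI exI[of _ lev] ballI) simp_all
qed

lemma comp_ok_cong:
 assumes "comp_ok U par l" "\<And>v. v \<in> set l \<Longrightarrow> par' v = par v" shows "comp_ok U par' l"
 using assms(1) bfs_tree_cong[OF _ assms(2)] by (simp add: comp_ok_def)

lemma split_inv_length:
 assumes "split_inv B u U ls seg Z" shows "length (concat ls @ seg) \<le> n"
proof -
 have "card (set (concat ls @ seg)) \<le> card {..<n}"
  by (rule card_mono) (use assms in \<open>unfold split_inv_def, blast+\<close>)
 moreover have "distinct (concat ls @ seg)" using assms unfolding split_inv_def by blast
 ultimately show ?thesis using distinct_card[of "concat ls @ seg"] by simp
qed

lemma split_inv_regs:
 assumes "split_inv B u U ls seg Z" "same {} R Z Z'"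
  "R \<inter> {0, 1, 2, 3, 4, 5, 6, 7, 8, 9, 13, 18, 31, 33, 34} = {}"
 shows "split_inv B u U ls seg Z'"
proof -
 have "regs Z' r = regs Z r" if "r \<in> {0, 1, 2, 3, 4, 5, 6, 7, 8, 9, 13, 18, 31, 33, 34}" for r
  using assms(2,3) that unfolding same_def by blast
 then have r: "regs Z' rB = regs Z rB" "regs Z' rUID = regs Z rUID" "regs Z' rVIS = regs Z rVIS"
  "regs Z' rQT = regs Z rQT" "regs Z' rCNT = regs Z rCNT" by simp_all
 have m: "mem Z' = mem Z" using assms(2) by (auto simp: same_def)
 have "stat Z" using assms(1) by (simp add: split_inv_def)
 then have "stat Z'" by (rule stat_same[OF _ assms(2)]) (use assms(3) in auto)
 with assms(1) show ?thesis unfolding split_inv_def r m par_at_def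
  by (elim conjE) (intro conjI; assumption)
qed

lemma split_inv_visit:
 assumes inv: "split_inv B u U ls seg Z" and w: "w \<in> U" "w \<notin> set (concat ls @ seg)" "p < n"
  and m: "mem Z' = (mem Z)(B + w := Suc u, B + n + w := p, B + n + n + length (concat ls @ seg) := w)"
  and r: "\<And>r. r \<noteq> rA \<Longrightarrow> r \<noteq> rQT \<Longrightarrow> regs Z' r = regs Z r" "regs Z' rQT = Suc (regs Z rQT)"
 shows "split_inv B u U ls (seg @ [w]) Z'"
  "\<And>v. v < n \<Longrightarrow> par_at Z' B v = ((par_at Z B)(w := p)) v"
proof -
 let ?L = "concat ls @ seg"
 have I: "stat Z" "regs Z rB = B" "FB \<le> B" "B + W \<le> EN" "EN \<le> u" "regs Z rUID = u" "regs Z rVIS = Suc u"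
   "\<And>a. MK \<le> a \<Longrightarrow> a < EN \<Longrightarrow> mem Z a \<le> Suc u"
   "U \<subseteq> {..<n}" "distinct ?L" "set ?L \<subseteq> U"
   "list_at (mem Z) (B + n + n) ?L" "regs Z rQT = B + n + n + length ?L"
   "\<And>v. v < n \<Longrightarrow> mem Z (B + v) = u \<longleftrightarrow> v \<in> U - set ?L"
   "\<And>v. v < n \<Longrightarrow> mem Z (B + v) = Suc u \<longleftrightarrow> v \<in> set ?L"
   "\<And>l. l \<in> set ls \<Longrightarrow> comp_ok U (par_at Z B) l"
   "segs_at (mem Z) n (B + n + n) ls" "regs Z rCNT = length ls"
  using inv unfolding split_inv_def by blast+
 have wn: "w < n" using w I(9) by auto
 have "card (set (?L @ [w])) \<le> card {..<n}" by (rule card_mono) (use I(9,11) wn in auto)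
 moreover have "card (set (?L @ [w])) = length (?L @ [w])"
  by (rule distinct_card) (use I(10) w(2) in simp)
 ultimately have len: "length ?L < n" by simp
 have st: "stat Z'"
 proof -
  have "mem Z' a = mem Z a" if "a < FT" for a using that I(3) FT_MK by (simp add: m)
  then show ?thesis using I(1) r(1) by (simp add: stat_def const_regs_def)
 qed
 have le: "mem Z' a \<le> Suc u" if "MK \<le> a" "a < EN" for a
  using I(8)[OF that] I(4,5) w(3) wn by (simp add: m)
 show par: "par_at Z' B v = ((par_at Z B)(w := p)) v" if "v < n" for v
  using that wn len by (simp add: m par_at_def)
 have "list_at (mem Z') (B + n + n) ?L"
  by (rule list_at_cong[OF I(12)]) (use wn in \<open>simp add: m\<close>)
 moreover have "list_at (mem Z') (B + n + n + length ?L) [w]"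
  by (simp add: list_at_Cons list_at_Nil m)
 ultimately have list: "list_at (mem Z') (B + n + n) (?L @ [w])"
  by (simp only: list_at_append[of "mem Z'" _ ?L "[w]"])
 have ne: "[] \<notin> set ls" using I(16) by (auto simp: comp_ok_def)
 have segs: "segs_at (mem Z') n (B + n + n) ls"
  by (rule segs_at_cong[OF I(17) ne]) (use wn len in \<open>simp add: m\<close>)
 have comp: "comp_ok U (par_at Z' B) l" if "l \<in> set ls" for l
 proof (rule comp_ok_cong[OF I(16)[OF that]])
  fix v assume "v \<in> set l"
  then have "v \<noteq> w" "v < n" using that w I(9,11) by auto
  then show "par_at Z' B v = par_at Z B v" by (simp add: par)
 qed
 have stamps: "(mem Z' (B + v) = u \<longleftrightarrow> v \<in> U - set (?L @ [w])) \<and> (mem Z' (B + v) = Suc u \<longleftrightarrow> v \<in> set (?L @ [w]))"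
  if "v < n" for v
  using that I(14,15)[OF that] wn len w by (auto simp: m)
 have r': "regs Z' rB = B" "regs Z' rUID = u" "regs Z' rVIS = Suc u" "regs Z' rCNT = length ls"
  "regs Z' rQT = B + n + n + length (?L @ [w])"
  using r I(2,6,7,13,18) by simp_all
 have d: "distinct (?L @ [w])" "set (?L @ [w]) \<subseteq> U" using I(10,11) w(1,2) by simp_all
 have le': "\<forall>a. MK \<le> a \<longrightarrow> a < EN \<longrightarrow> mem Z' a \<le> Suc u" using le by blast
 have stamps': "\<forall>v<n. (mem Z' (B + v) = u \<longleftrightarrow> v \<in> U - set (?L @ [w])) \<and>
   (mem Z' (B + v) = Suc u \<longleftrightarrow> v \<in> set (?L @ [w]))" using stamps by blast
 have comp': "\<forall>l\<in>set ls. comp_ok U (par_at Z' B) l" using comp by blast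
 show "split_inv B u U ls (seg @ [w]) Z'"
  unfolding split_inv_def append_assoc[symmetric]
  by (intro conjI st r' d le' stamps' comp' segs list I(3-5,9))
qed

abbreviation (input) bfs_regs :: "reg set" where
 "bfs_regs \<equiv> {rE, rA, rT, rG, rQ, rR, rC, rU, rQH, rQT, rS0, rCNT}"

lemma wp_visit:
 assumes inv: "split_inv B u U ls seg Z" and w: "regs Z vr = w" "w \<in> U" "w \<notin> set (concat ls @ seg)"
  and p: "regs Z pr = p" "p < n" and ne: "vr \<notin> {rA, rQT}" "pr \<notin> {rA, rQT}"
 shows "wp P (visit vr pr) (\<lambda>t Z'. split_inv B u U ls (seg @ [w]) Z' \<and> same {B..<B + W} {rA, rQT} Z Z' \<and>
  (\<forall>v<n. par_at Z' B v = ((par_at Z B)(w := p)) v) \<and> t \<le> 7) Z"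
proof -
 have I: "stat Z" "regs Z rB = B" "regs Z rVIS = Suc u" "U \<subseteq> {..<n}"
  "regs Z rQT = B + n + n + length (concat ls @ seg)"
  using inv unfolding split_inv_def by blast+
 have len: "length (concat ls @ seg) \<le> n" by (rule split_inv_length[OF inv])
 have wn: "w < n" using w(2) I(4) by auto
 let ?s = "Z\<lparr>regs := (regs Z)(rA := B + w + n, rQT := Suc (regs Z rQT)),
  mem := (mem Z)(B + w := Suc u, B + n + w := p, B + n + n + length (concat ls @ seg) := w)\<rparr>"
 have m: "mem ?s = (mem Z)(B + w := Suc u, B + n + w := p, B + n + n + length (concat ls @ seg) := w)" by simp
 have r: "regs ?s rQT = Suc (regs Z rQT)" by simp
 have r': "regs ?s r = regs Z r" if "r \<noteq> rA" "r \<noteq> rQT" for r using that by simp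
 note v = split_inv_visit[OF inv w(2,3) p(2) m r' r]
 have "same {B..<B + W} {rA, rQT} Z ?s" using wn len by (auto simp: same_def)
 moreover have "wp P (visit vr pr) (\<lambda>t Z'. Z' = ?s \<and> t \<le> 7) Z"
  using w p ne stat_regs[OF I(1)] I(2,3,5)
  by (simp add: visit_def wp_simps set_reg_def add.commute add.left_commute)
 ultimately show ?thesis using v by (elim wp_mono) simp
qed

lemma split_invD:
 assumes "split_inv B u U ls seg Z"
 shows "stat Z" "regs Z rB = B" "FB \<le> B" "B + W \<le> EN" "EN \<le> u" "regs Z rUID = u" "regs Z rVIS = Suc u"
  "\<And>a. MK \<le> a \<Longrightarrow> a < EN \<Longrightarrow> mem Z a \<le> Suc u"
  "U \<subseteq> {..<n}" "finite U" "distinct (concat ls @ seg)" "set (concat ls @ seg) \<subseteq> U"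
  "list_at (mem Z) (B + n + n) (concat ls @ seg)" "regs Z rQT = B + n + n + length (concat ls @ seg)"
  "\<And>v. v < n \<Longrightarrow> mem Z (B + v) = u \<longleftrightarrow> v \<in> U - set (concat ls @ seg)"
  "\<And>v. v < n \<Longrightarrow> mem Z (B + v) = Suc u \<longleftrightarrow> v \<in> set (concat ls @ seg)"
  "\<And>l. l \<in> set ls \<Longrightarrow> comp_ok U (par_at Z B) l"
  "segs_at (mem Z) n (B + n + n) ls" "regs Z rCNT = length ls"
 using assms finite_subset[of U "{..<n}"] unfolding split_inv_def by (blast | simp)+

lemma nb_subset_adj: "u < n \<Longrightarrow> nb u \<subseteq> fst ` set (adj u)"
 using adj_iff by force

definition weight :: "nat set \<Rightarrow> nat" where "weight A = (\<Sum>v\<in>A. wt v)"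

lemma weight_remove: "finite A \<Longrightarrow> v \<in> A \<Longrightarrow> weight A = wt v + weight (A - {v})"
 unfolding weight_def by (rule sum.remove)

lemma weight_set: "distinct xs \<Longrightarrow> weight (set xs) = wts xs"
 by (simp add: weight_def wts_def sum_list_distinct_conv_sum_set)

lemma weight_Diff: "finite A \<Longrightarrow> B \<subseteq> A \<Longrightarrow> weight A = weight B + weight (A - B)"
 unfolding weight_def by (metis sum.subset_diff add.commute)

text \<open>The search is described in U without the finished components. That these have no edge to
  the new one is shown only when it is complete.\<close>

definition bfs_inv :: "nat \<Rightarrow> nat \<Rightarrow> nat set \<Rightarrow> nat list list \<Rightarrow> nat \<Rightarrow> nat list \<Rightarrow> nat \<Rightarrow> nat set \<Rightarrow> state \<Rightarrow> state \<Rightarrow> bool" where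
 "bfs_inv B u U ls r seg i ys Z0 Z \<longleftrightarrow> split_inv B u U ls seg Z \<and>
   bfs_state nb (U - set (concat ls)) seg i ys (par_at Z B) \<and> hd seg = r \<and>
   regs Z rS0 = B + n + n + length (concat ls) \<and> same {B..<B + W} bfs_regs Z0 Z"

lemma bfs_inv_regs:
 assumes "bfs_inv B u U ls r seg i ys Z0 Z" "same {} {rE, rA, rT, rG, rQ, rR, rC, rU, rQH} Z Z'"
 shows "bfs_inv B u U ls r seg i ys Z0 Z'"
proof -
 have "split_inv B u U ls seg Z" using assms(1) by (simp add: bfs_inv_def)
 then have "split_inv B u U ls seg Z'" by (rule split_inv_regs[OF _ assms(2)]) simp
 moreover have "par_at Z' B = par_at Z B" using assms(2) by (auto simp: par_at_def same_def)
 moreover have "same {B..<B + W} bfs_regs Z0 Z'"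
  by (rule same_trans[of _ _ _ Z]) (use assms in \<open>auto simp: bfs_inv_def elim: same_mono\<close>)
 moreover have "regs Z' rS0 = regs Z rS0" using assms(2) by (simp add: same_def)
 ultimately show ?thesis using assms(1) by (simp add: bfs_inv_def)
qed

text \<open>Visiting moves a vertex from the waiting ones to the unprocessed part of the queue. The
  sum of the two weights is unchanged, so it can serve as potential of the search.\<close>

lemma wp_bfs_edge:
 assumes inv: "bfs_inv B u U ls r seg i ys Z0 Z" and i: "i < length seg" and w: "w \<in> nb (seg ! i)"
  and reg: "regs Z rT = w" "regs Z rU = seg ! i"
 shows "wp P (block [Add rA rB rT, Load rA rA, neq rA rUID, IfNZ rQ Skip (visit rT rU)])
  (\<lambda>t Z'. \<exists>seg'. bfs_inv B u U ls r seg' i (insert w ys) Z0 Z' \<and> t \<le> 20 \<and>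
    same {B..<B + W} {rA, rQT, rQ, rR} Z Z' \<and> take (length seg) seg' = seg \<and> length seg \<le> length seg' \<and>
    weight (U - set (concat ls) - set seg') + wts (drop (Suc i) seg') =
    weight (U - set (concat ls) - set seg) + wts (drop (Suc i) seg)) Z"
proof -
 let ?U = "U - set (concat ls)"
 have inv': "split_inv B u U ls seg Z" "bfs_state nb ?U seg i ys (par_at Z B)" using inv by (simp_all add: bfs_inv_def)
 have wn: "w < n" "seg ! i < n" using nb_less[OF w] by simp_all
 have I: "stat Z" "regs Z rB = B" "regs Z rUID = u" "mem Z (B + w) = u \<longleftrightarrow> w \<in> U - set (concat ls @ seg)" "finite U"
  using split_invD[OF inv'(1)] wn by blast+
 let ?m = "mem Z (B + w)"
 let ?s = "Z\<lparr>regs := (regs Z)(rA := ?m, rR := u - ?m, rQ := ?m - u + (u - ?m))\<rparr>"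
 have s: "same {} {rE, rA, rT, rG, rQ, rR, rC, rU, rQH} Z ?s" "same {} {rA, rQ, rR} Z ?s" by (auto simp: same_def)
 have inv_s: "bfs_inv B u U ls r seg i ys Z0 ?s" by (rule bfs_inv_regs[OF inv s(1)])
 have start: "wp P (block [Add rA rB rT, Load rA rA, neq rA rUID, IfNZ rQ Skip (visit rT rU)]) Q Z \<longleftrightarrow>
   (if ?m = u then wp P (visit rT rU) (\<lambda>t. Q (Suc (Suc (Suc (Suc (Suc (Suc (Suc (Suc t))))))))) ?s
   else Q (Suc (Suc (Suc (Suc (Suc (Suc (Suc (Suc (Suc 0))))))))) ?s)" for Q
  using I(2,3) reg by (auto simp: wp_funs neq_def set_reg_def)
 show ?thesis
 proof (cases "?m = u")
  case False
  have "bfs_state nb ?U seg i (insert w ys) (par_at ?s B)"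
   by (rule bfs_state_skip) (use inv_s False I(4) in \<open>auto simp: bfs_inv_def\<close>)
  then have "bfs_inv B u U ls r seg i (insert w ys) Z0 ?s" using inv_s by (simp add: bfs_inv_def)
  moreover have "same {B..<B + W} {rA, rQT, rQ, rR} Z ?s" by (rule same_mono[OF s(2)]) auto
  ultimately show ?thesis unfolding start using False by (auto intro!: exI[of _ seg])
 next
  case True
  then have wU: "w \<in> U" "w \<notin> set (concat ls @ seg)" using I(4) by auto
  have sp: "split_inv B u U ls seg ?s" using inv_s by (simp add: bfs_inv_def)
  have "wp P (visit rT rU) (\<lambda>t Z'. split_inv B u U ls (seg @ [w]) Z' \<and> same {B..<B + W} {rA, rQT} ?s Z' \<and>
    (\<forall>v<n. par_at Z' B v = ((par_at ?s B)(w := seg ! i)) v) \<and> t \<le> 7) ?s"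
   by (rule wp_visit[OF sp _ wU _ wn(2)]) (use reg in simp_all)
  then show ?thesis unfolding start if_P[OF True]
  proof (rule wp_mono, elim conjE)
   fix t :: nat and Z' assume a: "split_inv B u U ls (seg @ [w]) Z'" "same {B..<B + W} {rA, rQT} ?s Z'"
    "\<forall>v<n. par_at Z' B v = ((par_at ?s B)(w := seg ! i)) v" "t \<le> 7"
   have b: "bfs_state nb ?U (seg @ [w]) i (insert w ys) ((par_at ?s B)(w := seg ! i))"
    by (rule bfs_state_visit) (use inv_s i w wU in \<open>auto simp: bfs_inv_def\<close>)
   have "set (seg @ [w]) \<subseteq> {..<n}" using a(1) unfolding split_inv_def by auto
   then have "bfs_state nb ?U (seg @ [w]) i (insert w ys) (par_at Z' B)"
    by (intro bfs_state_cong[OF b]) (use a(3) in auto)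
   moreover have sg: "seg \<noteq> []" using i by auto
   moreover have "same {B..<B + W} bfs_regs Z0 ?s" using inv_s by (simp add: bfs_inv_def)
   then have "same {B..<B + W} bfs_regs Z0 Z'"
    by (rule same_trans) (rule same_mono[OF a(2)], auto)
   moreover have "regs Z' rS0 = B + n + n + length (concat ls)"
    using same_reg[OF a(2), of rS0] inv_s by (simp add: bfs_inv_def)
   ultimately have "bfs_inv B u U ls r (seg @ [w]) i (insert w ys) Z0 Z'"
    using a(1) inv by (simp add: bfs_inv_def)
   moreover have "same {B..<B + W} {rA, rQT, rQ, rR} Z Z'"
    by (rule same_trans[of _ _ _ ?s]) (rule same_mono[OF s(2)] same_mono[OF a(2)], auto)+
   moreover have "weight (?U - set seg) = wt w + weight (?U - set (seg @ [w]))"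
   proof -
    have "?U - set (seg @ [w]) = ?U - set seg - {w}" by auto
    then show ?thesis using weight_remove[of "?U - set seg" w] I(5) wU by simp
   qed
   moreover have "wts (drop (Suc i) (seg @ [w])) = wts (drop (Suc i) seg) + wt w"
    using i by (simp add: wts_simps)
   ultimately show "\<exists>seg'. bfs_inv B u U ls r seg' i (insert w ys) Z0 Z' \<and>
     Suc (Suc (Suc (Suc (Suc (Suc (Suc (Suc t))))))) \<le> 20 \<and>
     same {B..<B + W} {rA, rQT, rQ, rR} Z Z' \<and> take (length seg) seg' = seg \<and> length seg \<le> length seg' \<and>
     weight (?U - set seg') + wts (drop (Suc i) seg') = weight (?U - set seg) + wts (drop (Suc i) seg)"
    using a(4) by (intro exI[of _ "seg @ [w]"]) simp
  qed
 qed
qed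

lemma split_inv_close:
 assumes inv: "split_inv B u U ls seg Z" and c: "comp_ok U (par_at Z B) seg"
  and m: "mem Z' = (mem Z)(B + n + n + length (concat ls) + n := B + n + n + length (concat ls @ seg))"
  and r: "\<And>r. r \<noteq> rA \<Longrightarrow> r \<noteq> rCNT \<Longrightarrow> regs Z' r = regs Z r" "regs Z' rCNT = Suc (length ls)"
 shows "split_inv B u U (ls @ [seg]) [] Z'"
proof -
 note I = split_invD[OF inv]
 have seg: "seg \<noteq> []" using c by (simp add: comp_ok_def)
 have len: "length (concat ls) < n" using split_inv_length[OF inv] seg by (cases seg) auto
 have FTB: "FT < B" using I(3) FT_MK by linarith
 have st: "stat Z'"
 proof -
  have "mem Z' a = mem Z a" if "a < FT" for a using that FTB by (simp add: m)
  then show ?thesis using I(1) r(1) by (simp add: stat_def const_regs_def)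
 qed
 have le: "\<forall>a. MK \<le> a \<longrightarrow> a < EN \<longrightarrow> mem Z' a \<le> Suc u"
  using I(8) I(4,5) split_inv_length[OF inv] by (simp add: m)
 have par: "par_at Z' B v = par_at Z B v" if "v < n" for v using that by (simp add: m par_at_def)
 have list: "list_at (mem Z') (B + n + n) (concat (ls @ [seg]) @ [])"
  by (rule list_at_cong[of "mem Z"]) (use I(13) split_inv_length[OF inv] in \<open>simp_all add: m\<close>)
 have stamps: "\<forall>v<n. (mem Z' (B + v) = u \<longleftrightarrow> v \<in> U - set (concat (ls @ [seg]) @ [])) \<and>
   (mem Z' (B + v) = Suc u \<longleftrightarrow> v \<in> set (concat (ls @ [seg]) @ []))"
  using I(15,16) by (simp add: m)
 have ne: "[] \<notin> set ls" using I(17) by (auto simp: comp_ok_def)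
 have comp: "\<forall>l\<in>set (ls @ [seg]). comp_ok U (par_at Z' B) l"
 proof
  fix l assume l: "l \<in> set (ls @ [seg])"
  then have "comp_ok U (par_at Z B) l" using I(17) c by auto
  moreover have "set l \<subseteq> U" using l I(12) by auto
  ultimately show "comp_ok U (par_at Z' B) l" using comp_ok_cong par I(9) by (meson lessThan_iff subset_iff)
 qed
 have "segs_at (mem Z') n (B + n + n) ls"
  by (rule segs_at_cong[OF I(18) ne]) (simp add: m)
 then have segs: "segs_at (mem Z') n (B + n + n) (ls @ [seg])"
  by (simp add: segs_at_append m)
 have d: "distinct (concat (ls @ [seg]) @ [])" "set (concat (ls @ [seg]) @ []) \<subseteq> U" using I(11,12) by simp_all
 have r': "regs Z' rB = B" "regs Z' rUID = u" "regs Z' rVIS = Suc u" "regs Z' rCNT = length (ls @ [seg])"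
  "regs Z' rQT = B + n + n + length (concat (ls @ [seg]) @ [])"
  using r I(2,6,7,14) by simp_all
 show ?thesis unfolding split_inv_def
  by (intro conjI st r' d le stamps comp segs list I(3-5,9))
qed

lemma wp_bfs:
 assumes inv: "split_inv B u U ls [] Z" and r: "regs Z rV = r" "r \<in> U" "r \<notin> set (concat ls)"
  and qh: "regs Z rQH = regs Z rQT"
 shows "wp P bfs (\<lambda>t Z'. \<exists>seg. split_inv B u U (ls @ [seg]) [] Z' \<and> hd seg = r \<and> seg \<noteq> [] \<and>
  regs Z' rQH = regs Z' rQT \<and> same {B..<B + W} bfs_regs Z Z' \<and> t \<le> 60 * wts seg) Z"
proof -
 let ?U = "U - set (concat ls)"
 note I = split_invD[OF inv]
 have rn: "r < n" using r(2) I(9) by auto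
 let ?q = "B + n + n + length (concat ls)"
 let ?s1 = "set_reg rS0 ?q Z"
 have s1: "same {} {rS0} Z ?s1" by (rule set_reg_same) simp
 have inv1: "split_inv B u U ls [] ?s1" by (rule split_inv_regs[OF inv s1]) simp
 define loop where "loop = WhileNZ rC (block [Load rU rQH, Add rQH rQH rONE,
    for_adj rU (block [Add rA rB rT, Load rA rA, neq rA rUID, IfNZ rQ Skip (visit rT rU)]), Sub rC rQT rQH])"
 \<comment> \<open>A vertex that is waiting or still unprocessed in the queue carries 30 units per
   unit of weight. With the empty queue this is 30 times the weight of all waiting vertices, so the
   search costs about 30 times the weight of what it reaches; the rest of the factor 60 absorbs the
   constants.\<close>
 define pot where "pot seg i = 30 * (weight (?U - set seg) + wts (drop i seg))" for seg i
 let ?J = "\<lambda>p Y. \<exists>seg i. bfs_inv B u U ls r seg i {} Z Y \<and> regs Y rQH = ?q + i \<and>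
  regs Y rC = length seg - i \<and> p = pot seg i"
 have visit: "wp P (visit rV rV) (\<lambda>t Y. ?J (pot [] 0) (set_reg rC (regs Y rQT - regs Y rQH) Y) \<and> t \<le> 7) ?s1"
 proof (rule wp_mono[OF wp_visit[OF inv1, of rV r rV r]])
  show "regs ?s1 rV = r" using r by (simp add: set_reg_def)
  then show "regs ?s1 rV = r" .
  show "r \<in> U" "r \<notin> set (concat ls @ [])" "r < n" using r rn by simp_all
  fix t Y assume a: "split_inv B u U ls ([] @ [r]) Y \<and> same {B..<B + W} {rA, rQT} ?s1 Y \<and>
   (\<forall>v<n. par_at Y B v = ((par_at ?s1 B)(r := r)) v) \<and> t \<le> 7"
  let ?t = "set_reg rC (regs Y rQT - regs Y rQH) Y"
  have "bfs_state nb ?U [r] 0 {} (par_at Y B)" using a r rn by (intro bfs_state_init) auto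
  moreover have "same {B..<B + W} bfs_regs Z Y"
   by (rule same_trans[of _ _ _ ?s1]) (use same_mono[OF s1] same_mono[OF conjunct1[OF conjunct2[OF a]]] in auto)
  moreover have "regs Y rS0 = ?q" using a by (auto simp: same_def set_reg_def)
  ultimately have "bfs_inv B u U ls r [r] 0 {} Z Y" using a by (simp add: bfs_inv_def)
  then have "bfs_inv B u U ls r [r] 0 {} Z ?t" by (rule bfs_inv_regs) (simp add: set_reg_same)
  moreover have "regs Y rQH = ?q" using a qh I(14) by (auto simp: same_def set_reg_def)
  moreover have "regs Y rQT = Suc ?q" using a split_invD(14)[of B u U ls "[r]" Y] by simp
  moreover have "pot [r] 0 = pot [] 0"
   using weight_remove[of ?U r] I(10) r by (simp add: pot_def wts_simps)
  ultimately show "?J (pot [] 0) ?t \<and> t \<le> 7"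
   using a by (intro conjI exI[of _ "[r]"] exI[of _ 0]) (simp_all add: set_reg_def)
 qed simp_all
 have while: "wp P loop (\<lambda>t Y. \<exists>seg. bfs_inv B u U ls r seg (length seg) {} Z Y \<and> regs Y rQH = ?q + length seg \<and>
   t + pot seg (length seg) \<le> pot [] 0 + 1) Y0" if "?J (pot [] 0) Y0" for Y0
  unfolding loop_def
 proof (rule wp_WhileNZ'[where I = ?J, OF that])
  fix p Y assume "?J p Y" and "regs Y rC \<noteq> 0"
  then obtain seg i where J: "bfs_inv B u U ls r seg i {} Z Y" "regs Y rQH = ?q + i"
   "i < length seg" "p = pot seg i" by auto
  let ?x = "seg ! i"
  have sp: "split_inv B u U ls seg Y" using J(1) by (simp add: bfs_inv_def)
  have "mem Y (?q + i) = ?x"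
   using split_invD(13)[OF sp] J(3) by (simp add: list_at_append) (simp add: list_at_def)
  then have x: "mem Y (regs Y rQH) = ?x" by (simp add: J(2))
  have "?x \<in> set seg" using J(3) by simp
  then have xn: "?x < n" using split_invD(9,12)[OF sp] by auto
  let ?s = "set_reg rQH (Suc (?q + i)) (set_reg rU ?x Y)"
  have Js: "bfs_inv B u U ls r seg i {} Z ?s"
   by (rule bfs_inv_regs[OF J(1)]) (simp add: same_def set_reg_def)
  let ?A = "\<lambda>ys N. \<exists>seg'. bfs_inv B u U ls r seg' i (fst ` set ys) Z N \<and> take (length seg) seg' = seg \<and>
   length seg \<le> length seg' \<and> regs N rQH = Suc (?q + i) \<and> regs N rU = ?x \<and>
   weight (?U - set seg') + wts (drop (Suc i) seg') = weight (?U - set seg) + wts (drop (Suc i) seg)"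
  have adj: "wp P (for_adj rU (block [Add rA rB rT, Load rA rA, neq rA rUID, IfNZ rQ Skip (visit rT rU)]))
   (\<lambda>t N. ?A (adj ?x) N \<and> t \<le> (20 + 7) * length (adj ?x) + 4) ?s"
  proof (rule wp_for_adj[OF xn, where I = ?A and cost = 20])
   show "regs ?s rU = ?x" by (simp add: set_reg_def)
   show "?A [] ?s" by (rule exI[of _ seg]) (use Js in \<open>simp add: set_reg_def\<close>)
   show "stat N" if "?A ys N" for ys N using that split_invD(1) unfolding bfs_inv_def by blast
   show "?A ys (set_reg q y N)" if A: "?A ys N" and q: "q \<in> {rE, rA, rT, rG}" for ys N q y
   proof -
    obtain seg' where seg': "bfs_inv B u U ls r seg' i (fst ` set ys) Z N" "take (length seg) seg' = seg"
     "length seg \<le> length seg'" "regs N rQH = Suc (?q + i)" "regs N rU = ?x"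
     "weight (?U - set seg') + wts (drop (Suc i) seg') = weight (?U - set seg) + wts (drop (Suc i) seg)"
     using A by blast
    have "bfs_inv B u U ls r seg' i (fst ` set ys) Z (set_reg q y N)"
     by (rule bfs_inv_regs[OF seg'(1) set_reg_same]) (use q in auto)
    then show ?thesis using seg' q by (intro exI[of _ seg']) (auto simp: set_reg_def)
   qed
  next
   fix ys w s zs N assume a: "adj ?x = ys @ (w, s) # zs" and A: "?A ys N" and reg: "regs N rT = w" "regs N rG = s"
   obtain seg' where seg': "bfs_inv B u U ls r seg' i (fst ` set ys) Z N" "take (length seg) seg' = seg"
    "length seg \<le> length seg'" "regs N rQH = Suc (?q + i)" "regs N rU = ?x"
    "weight (?U - set seg') + wts (drop (Suc i) seg') = weight (?U - set seg) + wts (drop (Suc i) seg)"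
    using A by blast
   have nth: "seg' ! i = ?x" using seg'(2) J(3) by (metis nth_take)
   have "(w, s) \<in> set (adj ?x)" by (simp add: a)
   then have w: "w \<in> nb (seg' ! i)" using adj_iff[OF xn] nth by simp
   have i': "i < length seg'" using J(3) seg'(3) by simp
   show "wp P (block [Add rA rB rT, Load rA rA, neq rA rUID, IfNZ rQ Skip (visit rT rU)])
    (\<lambda>t N'. ?A (ys @ [(w, s)]) N' \<and> regs N' rE = regs N rE \<and> t \<le> 20) N"
   proof (rule wp_mono[OF wp_bfs_edge[OF seg'(1) i' w reg(1)]])
    show "regs N rU = seg' ! i" using seg'(5) nth by simp
    fix t N' assume "\<exists>seg''. bfs_inv B u U ls r seg'' i (insert w (fst ` set ys)) Z N' \<and> t \<le> 20 \<and>
      same {B..<B + W} {rA, rQT, rQ, rR} N N' \<and> take (length seg') seg'' = seg' \<and> length seg' \<le> length seg'' \<and>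
      weight (?U - set seg'') + wts (drop (Suc i) seg'') = weight (?U - set seg') + wts (drop (Suc i) seg')"
    then obtain seg'' where b: "bfs_inv B u U ls r seg'' i (insert w (fst ` set ys)) Z N'" "t \<le> 20"
      "same {B..<B + W} {rA, rQT, rQ, rR} N N'" "take (length seg') seg'' = seg'" "length seg' \<le> length seg''"
      "weight (?U - set seg'') + wts (drop (Suc i) seg'') = weight (?U - set seg') + wts (drop (Suc i) seg')"
     by blast
    have "take (length seg) seg'' = seg" using b(4,5) seg'(2,3) by (metis min.absorb1 take_take)
    moreover have "regs N' rQH = Suc (?q + i)" "regs N' rU = ?x" "regs N' rE = regs N rE"
     using b(3) seg'(4,5) by (simp_all add: same_def)
    ultimately show "?A (ys @ [(w, s)]) N' \<and> regs N' rE = regs N rE \<and> t \<le> 20"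
     using b seg' by (intro conjI exI[of _ seg'']) simp_all
   qed
  qed blast
  have body: "wp P (block [Load rU rQH, Add rQH rQH rONE,
    for_adj rU (block [Add rA rB rT, Load rA rA, neq rA rUID, IfNZ rQ Skip (visit rT rU)]), Sub rC rQT rQH]) Q Y \<longleftrightarrow>
   wp P (for_adj rU (block [Add rA rB rT, Load rA rA, neq rA rUID, IfNZ rQ Skip (visit rT rU)]))
    (\<lambda>t N. Q (Suc (Suc (Suc (Suc t)))) (set_reg rC (regs N rQT - regs N rQH) N)) ?s" for Q
  proof -
   have "set_reg rQH (Suc (regs Y rQH)) (set_reg rU (mem Y (regs Y rQH)) Y) = ?s" using x unfolding J(2) by simp
   then show ?thesis using stat_regs(1)[OF split_invD(1)[OF sp]]
    by (simp only: block.simps wp_funs) (simp add: set_reg_def)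
  qed
  show "wp P (block [Load rU rQH, Add rQH rQH rONE,
    for_adj rU (block [Add rA rB rT, Load rA rA, neq rA rUID, IfNZ rQ Skip (visit rT rU)]), Sub rC rQT rQH])
    (\<lambda>t N. \<exists>p'. ?J p' N \<and> t + 1 + p' \<le> p) Y"
   unfolding body
  proof (rule wp_mono[OF adj], elim conjE exE)
   fix t :: nat and N seg' assume b: "bfs_inv B u U ls r seg' i (fst ` set (adj ?x)) Z N" "take (length seg) seg' = seg"
    "length seg \<le> length seg'" "regs N rQH = Suc (?q + i)" "regs N rU = ?x"
    "weight (?U - set seg') + wts (drop (Suc i) seg') = weight (?U - set seg) + wts (drop (Suc i) seg)"
    "t \<le> (20 + 7) * length (adj ?x) + 4"
   let ?t = "set_reg rC (regs N rQT - regs N rQH) N"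
   have nth: "seg' ! i = ?x" using b(2) J(3) by (metis nth_take)
   have "bfs_state nb ?U seg' (Suc i) {} (par_at N B)"
    by (rule bfs_state_next[of _ _ _ _ "fst ` set (adj ?x)"])
      (use b(1,3) J(3) nth nb_subset_adj[OF xn] in \<open>auto simp: bfs_inv_def\<close>)
   then have "bfs_inv B u U ls r seg' (Suc i) {} Z N" using b(1) by (simp add: bfs_inv_def)
   then have "bfs_inv B u U ls r seg' (Suc i) {} Z ?t" by (rule bfs_inv_regs) (simp add: set_reg_same)
   moreover have "regs N rQT = ?q + length seg'"
    using b(1) split_invD(14)[of B u U ls seg' N] by (simp add: bfs_inv_def)
   ultimately have "?J (pot seg' (Suc i)) ?t"
    using b(4) by (intro exI[of _ seg'] exI[of _ "Suc i"]) (simp add: set_reg_def)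
   moreover have "wts (drop i seg) = wt ?x + wts (drop (Suc i) seg)"
    using J(3) by (simp add: Cons_nth_drop_Suc[symmetric] wts_simps)
   then have "Suc (Suc (Suc (Suc t))) + 1 + pot seg' (Suc i) \<le> p"
    using b(6,7) J(4) by (simp add: pot_def wt_def)
   ultimately show "\<exists>p'. ?J p' ?t \<and> Suc (Suc (Suc (Suc t))) + 1 + p' \<le> p" by blast
  qed
 next
  fix p' t Y assume "?J p' Y" "regs Y rC = 0" and t: "t + p' \<le> pot [] 0 + 1"
  then obtain seg i where J: "bfs_inv B u U ls r seg i {} Z Y" "regs Y rQH = ?q + i" "length seg \<le> i" "p' = pot seg i"
   by auto
  have "i \<le> length seg" using J(1) by (simp add: bfs_inv_def bfs_state_def)
  then have "i = length seg" using J(3) by simp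
  then show "\<exists>seg. bfs_inv B u U ls r seg (length seg) {} Z Y \<and> regs Y rQH = ?q + length seg \<and>
   t + pot seg (length seg) \<le> pot [] 0 + 1" using J t by blast
 qed
 have bfs: "wp P bfs Q Z \<longleftrightarrow> wp P (visit rV rV) (\<lambda>t Y. wp P loop (\<lambda>t' Y'.
   Q (t + t' + 6) (Y'\<lparr>mem := (mem Y')(regs Y' rS0 + regs Y' rN := regs Y' rQT),
     regs := (regs Y')(rA := regs Y' rS0 + regs Y' rN, rCNT := regs Y' rCNT + regs Y' rONE)\<rparr>))
   (set_reg rC (regs Y rQT - regs Y rQH) Y)) ?s1" for Q
 proof -
  have "set_reg rS0 (regs Z rQT + regs Z rZ) Z = ?s1" using I(14) stat_regs[OF I(1)] by simp
  then show ?thesis unfolding bfs_def loop_def[symmetric]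
   by (simp only: block.simps wp_funs) (simp add: set_reg_def add_numeral_Suc)
 qed
 show ?thesis unfolding bfs
 proof (rule wp_mono[OF visit])
  fix t :: nat and Y assume v: "?J (pot [] 0) (set_reg rC (regs Y rQT - regs Y rQH) Y) \<and> t \<le> 7"
  show "wp P loop (\<lambda>t' Y'. \<exists>seg. split_inv B u U (ls @ [seg]) []
    (Y'\<lparr>mem := (mem Y')(regs Y' rS0 + regs Y' rN := regs Y' rQT),
     regs := (regs Y')(rA := regs Y' rS0 + regs Y' rN, rCNT := regs Y' rCNT + regs Y' rONE)\<rparr>) \<and> hd seg = r \<and> seg \<noteq> [] \<and>
    regs (Y'\<lparr>mem := (mem Y')(regs Y' rS0 + regs Y' rN := regs Y' rQT),
     regs := (regs Y')(rA := regs Y' rS0 + regs Y' rN, rCNT := regs Y' rCNT + regs Y' rONE)\<rparr>) rQH =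
    regs (Y'\<lparr>mem := (mem Y')(regs Y' rS0 + regs Y' rN := regs Y' rQT),
     regs := (regs Y')(rA := regs Y' rS0 + regs Y' rN, rCNT := regs Y' rCNT + regs Y' rONE)\<rparr>) rQT \<and>
    same {B..<B + W} bfs_regs Z (Y'\<lparr>mem := (mem Y')(regs Y' rS0 + regs Y' rN := regs Y' rQT),
     regs := (regs Y')(rA := regs Y' rS0 + regs Y' rN, rCNT := regs Y' rCNT + regs Y' rONE)\<rparr>) \<and> t + t' + 6 \<le> 60 * wts seg)
    (set_reg rC (regs Y rQT - regs Y rQH) Y)"
  proof (rule wp_mono[OF while[OF conjunct1[OF v]]], elim exE conjE)
   fix t' :: nat and Y' seg assume b: "bfs_inv B u U ls r seg (length seg) {} Z Y'" "regs Y' rQH = ?q + length seg"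
    "t' + pot seg (length seg) \<le> pot [] 0 + 1"
   let ?f = "Y'\<lparr>mem := (mem Y')(regs Y' rS0 + regs Y' rN := regs Y' rQT),
     regs := (regs Y')(rA := regs Y' rS0 + regs Y' rN, rCNT := regs Y' rCNT + regs Y' rONE)\<rparr>"
   have sp: "split_inv B u U ls seg Y'" and bs: "bfs_state nb ?U seg (length seg) {} (par_at Y' B)"
    and hd: "hd seg = r" and S0: "regs Y' rS0 = ?q" and sm: "same {B..<B + W} bfs_regs Z Y'"
    using b(1) by (simp_all add: bfs_inv_def)
   note T = split_invD[OF sp]
   have seg: "seg \<noteq> []" "set seg \<subseteq> ?U" "distinct seg" using bs by (simp_all add: bfs_state_def)
   \<comment> \<open>A neighbour w of x in a finished component is impossible: that component is
     closed in U, so it would contain x as well.\<close>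
   have cl: "w \<in> set seg" if h: "x \<in> set seg" "w \<in> nb x" "w \<in> U" for x w
   proof (cases "w \<in> ?U")
    case True
    then show ?thesis using bfs_state_final(2)[OF bs] h by blast
   next
    case False
    then obtain l where l: "l \<in> set ls" "w \<in> set l" using h(3) by auto
    then have "closed_in (set l) U" using T(17) by (simp add: comp_ok_def)
    then have "x \<in> set l" using l h seg(2) nb_sym unfolding closed_in_def by blast
    then show ?thesis using l h(1) seg(2) by auto
   qed
   have "comp_ok U (par_at Y' B) seg"
    unfolding comp_ok_def closed_in_def
    using seg cl bfs_state_final(1)[OF bs] by blast
   moreover have "regs Y' rN = n" "regs Y' rONE = 1" using stat_regs[OF T(1)] by simp_all
   ultimately have "split_inv B u U (ls @ [seg]) [] ?f"
    using S0 T(14,19) by (intro split_inv_close[OF sp]) (simp_all add: add.assoc)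
   moreover have len: "length (concat ls @ seg) \<le> n" by (rule split_inv_length[OF sp])
   have "0 < length seg" using seg(1) by simp
   then have "same {B..<B + W} bfs_regs Y' ?f"
    using S0 len stat_regs[OF T(1)] by (auto simp: same_def)
   then have "same {B..<B + W} bfs_regs Z ?f" by (rule same_trans[OF sm])
   moreover have "weight ?U = wts seg + weight (?U - set seg)"
    using weight_Diff[of ?U "set seg"] T(10) seg weight_set[OF seg(3)] by simp
   then have "t + t' + 6 \<le> 30 * wts seg + 20" using b(3) v by (simp add: pot_def wts_simps)
   moreover have "1 \<le> wts seg" using length_le_wts[of seg] \<open>0 < length seg\<close> by linarith
   then have "30 * wts seg + 20 \<le> 60 * wts seg" by linarith
   ultimately show "\<exists>seg. split_inv B u U (ls @ [seg]) [] ?f \<and> hd seg = r \<and> seg \<noteq> [] \<and>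
    regs ?f rQH = regs ?f rQT \<and> same {B..<B + W} bfs_regs Z ?f \<and> t + t' + 6 \<le> 60 * wts seg"
    using hd seg(1) b(2) T(14) by (intro exI[of _ seg]) simp
  qed
 qed
qed

abbreviation (input) scan_regs :: "reg set" where
 "scan_regs \<equiv> {rE, rA, rT, rG, rQ, rR, rC, rU, rQH, rQT, rS0, rCNT, rV, rI, rL, rX, rA0, rE0}"

text \<open>Searches are paid for by the weight of the waiting vertices, which appears on both sides
  of the time bound. The bounds of the two passes therefore add up to a linear one.\<close>

lemma wp_scan:
 assumes inv: "split_inv B u U ls0 [] Z" and qh: "regs Z rQH = regs Z rQT"
  and src: "regs Z rSB = a" "regs Z rSE = a + length xs" "list_at (mem Z) a xs" "a + length xs \<le> B" "set xs \<subseteq> {..<n}"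
  and thr: "thr \<in> {rNV, rZ}" "regs Z thr = th"
 shows "wp P (scan thr) (\<lambda>t Z'. \<exists>ls. split_inv B u U (ls0 @ ls) [] Z' \<and> regs Z' rQH = regs Z' rQT \<and>
  same {B..<B + W} scan_regs Z Z' \<and> (\<forall>l\<in>set ls. th \<le> hd l) \<and>
  (\<forall>v\<in>set xs. th \<le> v \<longrightarrow> v \<in> U \<longrightarrow> v \<in> set (concat (ls0 @ ls))) \<and>
  t + 60 * weight (U - set (concat (ls0 @ ls))) \<le> 60 * weight (U - set (concat ls0)) + 25 * length xs + 10) Z"
proof -
 note S = split_invD[OF inv]
 let ?s = "set_reg rE0 (a + length xs) (set_reg rA0 a Z)"
 let ?c = "block [Add rA rB rV, Load rA rA, neq rA rUID,
    IfNZ rQ Skip (block [Add rX rV rONE, Sub rX rX thr, IfNZ rX bfs Skip])]"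
 \<comment> \<open>Read off from the stamps, because the potential must be a function of the
   state.\<close>
 define \<Phi> where "\<Phi> Y = 60 * weight {v. v < n \<and> mem Y (B + v) = u}" for Y :: state
 have \<Phi>: "\<Phi> Y = 60 * weight (U - set (concat ls))" if "split_inv B u U ls [] Y" for ls Y
 proof -
  have "{v. v < n \<and> mem Y (B + v) = u} = U - set (concat ls)"
   using split_invD(9,15)[OF that] by auto
  then show ?thesis by (simp add: \<Phi>_def)
 qed
 let ?I = "\<lambda>ys Y. \<exists>ls. split_inv B u U (ls0 @ ls) [] Y \<and> regs Y rQH = regs Y rQT \<and>
  same {B..<B + W} scan_regs Z Y \<and> (\<forall>l\<in>set ls. th \<le> hd l) \<and>
  (\<forall>v\<in>set ys. th \<le> v \<longrightarrow> v \<in> U \<longrightarrow> v \<in> set (concat (ls0 @ ls))) \<and> regs Y rE0 = a + length xs"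
 have s: "same {} {rA0, rE0} Z ?s" by (simp add: same_def set_reg_def)
 have inv_s: "split_inv B u U ls0 [] ?s" by (rule split_inv_regs[OF inv s]) simp
 have loop: "wp P (for_seg ?c) (\<lambda>t Y. ?I xs Y \<and> t + \<Phi> Y \<le> sum_list (map (\<lambda>_. 18) xs) + 6 * length xs + 4 + \<Phi> ?s) ?s"
 proof (rule wp_for_seg[where I = ?I and \<Phi> = \<Phi> and a = a and cost = "\<lambda>_. 18"])
  show "regs ?s rA0 = a" by (simp add: set_reg_def)
  show "?I [] ?s"
   using inv_s qh same_mono[OF s, of "{B..<B + W}" scan_regs]
   by (intro exI[of _ "[]"]) (simp add: set_reg_def)
  show "regs Y rZ = 0 \<and> regs Y rONE = 1 \<and> list_at (mem Y) a xs \<and> regs Y rE0 = a + length xs" if I: "?I ys Y" for ys Y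
  proof -
   obtain ls where ls: "split_inv B u U (ls0 @ ls) [] Y" "same {B..<B + W} scan_regs Z Y" "regs Y rE0 = a + length xs"
    using I by blast
   have "list_at (mem Y) a xs"
    by (rule list_at_cong[OF src(3)]) (use src(4) in \<open>auto intro!: same_mem[OF ls(2)]\<close>)
   then show ?thesis using ls(3) stat_regs[OF split_invD(1)[OF ls(1)]] by simp
  qed
  show "?I ys (set_reg r x Y) \<and> \<Phi> (set_reg r x Y) = \<Phi> Y" if I: "?I ys Y" and r: "r \<in> {rI, rL, rV}" for ys Y r x
  proof -
   obtain ls where ls: "split_inv B u U (ls0 @ ls) [] Y" "regs Y rQH = regs Y rQT"
    "same {B..<B + W} scan_regs Z Y" "\<forall>l\<in>set ls. th \<le> hd l" "regs Y rE0 = a + length xs"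
    "\<forall>v\<in>set ys. th \<le> v \<longrightarrow> v \<in> U \<longrightarrow> v \<in> set (concat (ls0 @ ls))"
    using I by blast
   have "same {} {rI, rL, rV} Y (set_reg r x Y)" by (rule set_reg_same[OF r])
   then have "split_inv B u U (ls0 @ ls) [] (set_reg r x Y)" by (rule split_inv_regs[OF ls(1)]) simp
   moreover have "same {B..<B + W} scan_regs Z (set_reg r x Y)"
    by (rule same_trans[OF ls(3) set_reg_same]) (use r in auto)
   moreover have "regs (set_reg r x Y) rQH = regs (set_reg r x Y) rQT" "regs (set_reg r x Y) rE0 = a + length xs"
    "\<Phi> (set_reg r x Y) = \<Phi> Y"
    using r ls(2,5) by (auto simp: set_reg_def \<Phi>_def)
   ultimately show ?thesis using ls(4,6) by blast
  qed
 next
  fix ys v zs Y assume xs: "xs = ys @ v # zs" and I: "?I ys Y" and v: "regs Y rV = v"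
  obtain ls where ls: "split_inv B u U (ls0 @ ls) [] Y" "regs Y rQH = regs Y rQT"
   "same {B..<B + W} scan_regs Z Y" "\<forall>l\<in>set ls. th \<le> hd l" "regs Y rE0 = a + length xs"
   "\<forall>v\<in>set ys. th \<le> v \<longrightarrow> v \<in> U \<longrightarrow> v \<in> set (concat (ls0 @ ls))"
   using I by blast
  note T = split_invD[OF ls(1)]
  have vn: "v < n" using xs src(5) by simp
  let ?m = "mem Y (B + v)"
  let ?x = "Y\<lparr>regs := (regs Y)(rA := ?m, rR := u - ?m, rQ := ?m - u + (u - ?m))\<rparr>"
  let ?y = "set_reg rX (Suc v - th) ?x"
  have th: "regs Y thr = th" using same_reg[OF ls(3), of thr] thr by auto
  have start: "wp P ?c Q Y \<longleftrightarrow> (if ?m = u then if th \<le> v then wp P bfs (\<lambda>t. Q (t + 12)) ?y else Q (Suc (Suc (Suc (Suc (Suc (Suc (Suc (Suc (Suc (Suc (Suc (Suc (Suc 0))))))))))))) ?y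
    else Q (Suc (Suc (Suc (Suc (Suc (Suc (Suc (Suc (Suc 0))))))))) ?x)" for Q
   using T(2,6) stat_regs[OF T(1)] v th thr(1)
   by (auto simp: wp_funs neq_def set_reg_def add_numeral_Suc)
  have sx: "same {} {rA, rR, rQ} Y ?x" "same {} {rA, rR, rQ, rX} Y ?y" by (auto simp: same_def set_reg_def)
  have sx': "same {B..<B + W} scan_regs Z ?x" "same {B..<B + W} scan_regs Z ?y"
   using same_trans[OF ls(3) same_mono[OF sx(1), of "{B..<B + W}" scan_regs]]
    same_trans[OF ls(3) same_mono[OF sx(2), of "{B..<B + W}" scan_regs]] by simp_all
  have inv_x: "split_inv B u U (ls0 @ ls) [] ?x" "split_inv B u U (ls0 @ ls) [] ?y"
   by (rule split_inv_regs[OF ls(1) sx(1)], simp) (rule split_inv_regs[OF ls(1) sx(2)], simp)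
  have \<Phi>x: "\<Phi> ?x = \<Phi> Y" "\<Phi> ?y = \<Phi> Y" by (simp_all add: \<Phi>_def set_reg_def)
  have vU: "?m = u \<longleftrightarrow> v \<in> U \<and> v \<notin> set (concat (ls0 @ ls))" using T(15)[OF vn] by auto
  show "wp P ?c (\<lambda>t Y'. ?I (ys @ [v]) Y' \<and> regs Y' rI = regs Y rI \<and> t + \<Phi> Y' \<le> 18 + \<Phi> Y) Y"
  proof (cases "?m = u \<and> th \<le> v")
   case False
   have "?I (ys @ [v]) ?x"
    using inv_x(1) sx'(1) ls(2,4-6) False vU by (intro exI[of _ ls]) auto
   moreover have "?I (ys @ [v]) ?y"
    using inv_x(2) sx'(2) ls(2,4-6) False vU by (intro exI[of _ ls]) (auto simp: set_reg_def)
   ultimately show ?thesis unfolding start using False \<Phi>x by (auto simp: set_reg_def simp del: concat_append)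
  next
   case True
   have r: "regs ?y rV = v" "v \<in> U" "v \<notin> set (concat (ls0 @ ls))" "regs ?y rQH = regs ?y rQT"
    using v vU True ls(2) by (simp_all add: set_reg_def)
   have "wp P bfs (\<lambda>t Y'. ?I (ys @ [v]) Y' \<and> regs Y' rI = regs Y rI \<and> t + 12 + \<Phi> Y' \<le> 18 + \<Phi> Y) ?y"
   proof (rule wp_mono[OF wp_bfs[OF inv_x(2) r]], elim exE conjE)
    fix t :: nat and Y' seg assume b: "split_inv B u U ((ls0 @ ls) @ [seg]) [] Y'" "hd seg = v" "seg \<noteq> []"
     "regs Y' rQH = regs Y' rQT" "same {B..<B + W} bfs_regs ?y Y'" "t \<le> 60 * wts seg"
    have b1: "split_inv B u U (ls0 @ (ls @ [seg])) [] Y'" using b(1) by simp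
    have vs: "v \<in> set seg" using b(2,3) by auto
    have seg: "distinct seg" "set seg \<subseteq> U - set (concat (ls0 @ ls))"
     using split_invD(11,12)[OF b(1)] by auto
    have "weight (U - set (concat (ls0 @ ls))) = wts seg + weight (U - set (concat (ls0 @ ls)) - set seg)"
     using weight_Diff[OF _ seg(2)] T(10) weight_set[OF seg(1)] by simp
    moreover have "U - set (concat (ls0 @ ls)) - set seg = U - set (concat (ls0 @ (ls @ [seg])))" by auto
    ultimately have "weight (U - set (concat (ls0 @ ls))) = wts seg + weight (U - set (concat (ls0 @ (ls @ [seg]))))"
     by (simp only:)
    then have "t + 12 + \<Phi> Y' \<le> 18 + \<Phi> Y" using b(6) unfolding \<Phi>[OF b1] \<Phi>[OF ls(1)] by linarith
    moreover have "same {B..<B + W} scan_regs Z Y'"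
     by (rule same_trans[OF sx'(2)], rule same_mono[OF b(5)]) auto
    moreover have "regs Y' rE0 = a + length xs" "regs Y' rI = regs Y rI"
     using same_reg[OF b(5), of rE0] same_reg[OF b(5), of rI] ls(5) by (simp_all add: set_reg_def)
    moreover have "\<forall>w\<in>set (ys @ [v]). th \<le> w \<longrightarrow> w \<in> U \<longrightarrow> w \<in> set (concat (ls0 @ (ls @ [seg])))"
     using ls(6) vs by auto
    moreover have "\<forall>l\<in>set (ls @ [seg]). th \<le> hd l" using ls(4) b(2) True by auto
    ultimately show "?I (ys @ [v]) Y' \<and> regs Y' rI = regs Y rI \<and> t + 12 + \<Phi> Y' \<le> 18 + \<Phi> Y"
     using b1 b(4) by blast
   qed
   then show ?thesis unfolding start using True by (simp only: if_True conj_absorb simp_thms)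
  qed
 qed blast
 have start: "wp P (scan thr) Q Z \<longleftrightarrow> wp P (for_seg ?c) (\<lambda>t. Q (t + 3)) ?s" for Q
  using src stat_regs[OF S(1)] unfolding scan_def
  by (simp only: block.simps wp_funs) (simp add: set_reg_def add_numeral_Suc)
 show ?thesis unfolding start
 proof (rule wp_mono[OF loop], elim conjE exE)
  fix t :: nat and Y ls assume l: "split_inv B u U (ls0 @ ls) [] Y" "regs Y rQH = regs Y rQT"
   "same {B..<B + W} scan_regs Z Y" "\<forall>l\<in>set ls. th \<le> hd l"
   "\<forall>v\<in>set xs. th \<le> v \<longrightarrow> v \<in> U \<longrightarrow> v \<in> set (concat (ls0 @ ls))" 
   "t + \<Phi> Y \<le> sum_list (map (\<lambda>_. 18) xs) + 6 * length xs + 4 + \<Phi> ?s"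
  have "t + 3 + 60 * weight (U - set (concat (ls0 @ ls))) \<le> 60 * weight (U - set (concat ls0)) + 25 * length xs + 10"
   using l(6) unfolding \<Phi>[OF l(1)] \<Phi>[OF inv_s] sum_list_triv of_nat_id by linarith
  then show "\<exists>ls. split_inv B u U (ls0 @ ls) [] Y \<and> regs Y rQH = regs Y rQT \<and>
   same {B..<B + W} scan_regs Z Y \<and> (\<forall>l\<in>set ls. th \<le> hd l) \<and>
   (\<forall>v\<in>set xs. th \<le> v \<longrightarrow> v \<in> U \<longrightarrow> v \<in> set (concat (ls0 @ ls))) \<and>
   t + 3 + 60 * weight (U - set (concat (ls0 @ ls))) \<le> 60 * weight (U - set (concat ls0)) + 25 * length xs + 10"
   using l(1-5) by blast
 qed
qed

text \<open>The outcome of the splitting. The head of a component with an edge is a clause.\<close>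

definition comps :: "nat set \<Rightarrow> (nat \<Rightarrow> nat) \<Rightarrow> nat list list \<Rightarrow> bool" where
 "comps U par ls \<longleftrightarrow> distinct (concat ls) \<and> set (concat ls) = U \<and>
   (\<forall>l\<in>set ls. comp_ok U par l \<and> (edgy (set l) \<longrightarrow> nv \<le> hd l))"

definition frame_ok :: "nat \<Rightarrow> nat \<Rightarrow> nat set \<Rightarrow> nat list list \<Rightarrow> (nat \<Rightarrow> nat) \<Rightarrow> bool" where
 "frame_ok B u U ls m \<longleftrightarrow> comps U (\<lambda>v. m (B + n + v)) ls \<and> list_at m (B + n + n) (concat ls) \<and>
   segs_at m n (B + n + n) ls \<and> (\<forall>v<n. m (B + v) = u \<longleftrightarrow> v \<in> U)"

lemma wp_split_comps:
 assumes st: "stat Z" and fr: "fresh Z" and B: "regs Z rB = B" "FB \<le> B" "B + W \<le> EN" and U: "U \<subseteq> set xs"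
  and src: "regs Z rSB = a" "regs Z rSE = a + length xs" "list_at (mem Z) a xs" "a + length xs \<le> B" "set xs \<subseteq> {..<n}"
  and dist: "distinct xs"
  and stamps: "\<And>v. v < n \<Longrightarrow> mem Z (B + v) = regs Z rUID \<longleftrightarrow> v \<in> U"
 shows "wp P split_comps (\<lambda>t Z'. \<exists>ls. frame_ok B (Suc (regs Z rUID)) U ls (mem Z') \<and> stat Z' \<and> fresh Z' \<and>
  regs Z' rVIS = Suc (regs Z rUID) \<and> regs Z' rUID = Suc (regs Z rUID) \<and> regs Z' rCNT = length ls \<and>
  regs Z' rQT = B + n + n + length (concat ls) \<and> same {B..<B + W} ({rVIS, rUID} \<union> scan_regs) Z Z' \<and>
  t \<le> 110 * wts xs + 30) Z"
proof -
 let ?u = "regs Z rUID"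
 let ?s = "Z\<lparr>regs := (regs Z)(rVIS := Suc ?u, rQT := B + n + n, rQH := B + n + n, rCNT := 0)\<rparr>"
 have s: "same {} ({rVIS, rUID} \<union> scan_regs) Z ?s" by (simp add: same_def)
 have EN: "EN \<le> ?u" and le: "\<And>a. MK \<le> a \<Longrightarrow> a < EN \<Longrightarrow> mem Z a \<le> ?u" using fr by (simp_all add: fresh_def)
 have MKB: "MK \<le> B" using B FT_MK by linarith
 have nS: "mem Z (B + v) \<noteq> Suc ?u" if "v < n" for v
  using le[of "B + v"] MKB B(3) that by simp
 have Un: "U \<subseteq> {..<n}" using U src(5) by blast
 have "stat ?s" by (rule stat_same[OF st s]) auto
 then have inv: "split_inv B ?u U [] [] ?s"
  unfolding split_inv_def using B EN le nS stamps Un by (auto simp: list_at_Nil intro: le_SucI)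
 have r1: "regs ?s rNV = nv" using stat_regs(2)[OF st] by simp
 have sc1: "wp P (scan rNV) (\<lambda>t Z'. \<exists>ls. split_inv B ?u U ([] @ ls) [] Z' \<and> regs Z' rQH = regs Z' rQT \<and>
  same {B..<B + W} scan_regs ?s Z' \<and> (\<forall>l\<in>set ls. nv \<le> hd l) \<and>
  (\<forall>v\<in>set xs. nv \<le> v \<longrightarrow> v \<in> U \<longrightarrow> v \<in> set (concat ([] @ ls))) \<and>
  t + 60 * weight (U - set (concat ([] @ ls))) \<le> 60 * weight (U - set (concat [])) + 25 * length xs + 10) ?s"
  by (rule wp_scan[OF inv _ _ _ _ src(4,5) _ r1]) (use src in simp_all)
 have sc2: "wp P (scan rZ) (\<lambda>t Z'. \<exists>ls'. split_inv B ?u U (ls @ ls') [] Z' \<and> regs Z' rQH = regs Z' rQT \<and>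
  same {B..<B + W} scan_regs Y Z' \<and> (\<forall>l\<in>set ls'. 0 \<le> hd l) \<and>
  (\<forall>v\<in>set xs. 0 \<le> v \<longrightarrow> v \<in> U \<longrightarrow> v \<in> set (concat (ls @ ls'))) \<and>
  t + 60 * weight (U - set (concat (ls @ ls'))) \<le> 60 * weight (U - set (concat ls)) + 25 * length xs + 10) Y"
  if l: "split_inv B ?u U ls [] Y" "regs Y rQH = regs Y rQT" "same {B..<B + W} scan_regs ?s Y" for ls Y
 proof (rule wp_scan[OF l(1,2) _ _ _ src(4,5)])
  show "regs Y rSB = a" "regs Y rSE = a + length xs"
   using same_reg[OF l(3), of rSB] same_reg[OF l(3), of rSE] src by simp_all
  show "list_at (mem Y) a xs"
   by (rule list_at_cong[OF src(3)]) (use src(4) same_mem[OF l(3)] in auto)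
  show "regs Y rZ = 0" using stat_regs[OF split_invD(1)[OF l(1)]] by simp
 qed simp
 have body: "wp P split_comps Q Z \<longleftrightarrow> wp P (scan rNV) (\<lambda>t. wp P (scan rZ) (\<lambda>t' N.
   Q (t + t' + 7) (set_reg rUID (regs N rVIS + regs N rZ) N))) ?s" for Q
  using B(1) stat_regs[OF st] unfolding split_comps_def
  by (simp only: block.simps wp_funs) (simp add: set_reg_def add_numeral_Suc)
 show ?thesis unfolding body
 proof (rule wp_mono[OF sc1], elim exE conjE)
  fix t :: nat and Y ls assume l: "split_inv B ?u U ([] @ ls) [] Y" "regs Y rQH = regs Y rQT"
   "same {B..<B + W} scan_regs ?s Y" "\<forall>l\<in>set ls. nv \<le> hd l"
   "\<forall>v\<in>set xs. nv \<le> v \<longrightarrow> v \<in> U \<longrightarrow> v \<in> set (concat ([] @ ls))"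
   "t + 60 * weight (U - set (concat ([] @ ls))) \<le> 60 * weight (U - set (concat [])) + 25 * length xs + 10"
  have l1: "split_inv B ?u U ls [] Y" using l(1) by simp
  show "wp P (scan rZ) (\<lambda>t' N. \<exists>ls. frame_ok B (Suc ?u) U ls (mem (set_reg rUID (regs N rVIS + regs N rZ) N)) \<and>
    stat (set_reg rUID (regs N rVIS + regs N rZ) N) \<and> fresh (set_reg rUID (regs N rVIS + regs N rZ) N) \<and>
    regs (set_reg rUID (regs N rVIS + regs N rZ) N) rVIS = Suc ?u \<and>
    regs (set_reg rUID (regs N rVIS + regs N rZ) N) rUID = Suc ?u \<and>
    regs (set_reg rUID (regs N rVIS + regs N rZ) N) rCNT = length ls \<and>
    regs (set_reg rUID (regs N rVIS + regs N rZ) N) rQT = B + n + n + length (concat ls) \<and>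
    same {B..<B + W} ({rVIS, rUID} \<union> scan_regs) Z (set_reg rUID (regs N rVIS + regs N rZ) N) \<and>
    t + t' + 7 \<le> 110 * wts xs + 30) Y"
  proof (rule wp_mono[OF sc2[OF l1 l(2,3)]], elim exE conjE)
   fix t' :: nat and N ls' assume k: "split_inv B ?u U (ls @ ls') [] N" "same {B..<B + W} scan_regs Y N"
    "\<forall>v\<in>set xs. 0 \<le> v \<longrightarrow> v \<in> U \<longrightarrow> v \<in> set (concat (ls @ ls'))"
    "t' + 60 * weight (U - set (concat (ls @ ls'))) \<le> 60 * weight (U - set (concat ls)) + 25 * length xs + 10"
   note K = split_invD[OF k(1)]
   let ?f = "set_reg rUID (regs N rVIS + regs N rZ) N"
   have f: "?f = set_reg rUID (Suc ?u) N" using K(7) stat_regs[OF K(1)] by simp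
   have sf: "same {} {rUID} N ?f" by (rule set_reg_same) simp
   have all: "set (concat (ls @ ls')) = U" using k(3) K(12) U by auto
   \<comment> \<open>If a component with an edge had a variable as head, it would stem from the
     second pass. But the neighbour of the head in it is a clause, and all clauses of U were placed
     in the first pass.\<close>
   have heads: "nv \<le> hd l" if m: "l \<in> set (ls @ ls')" "edgy (set l)" for l
   proof (rule ccontr)
    assume h: "\<not> nv \<le> hd l"
    then have l': "l \<in> set ls'" using m(1) l(4) by auto
    have cok: "comp_ok U (par_at N B) l" using K(17) m(1) by blast
    have "\<exists>x\<in>set l. x \<in> nb (hd l)"
     by (rule bfs_tree_root_nb[of _ _ "par_at N B", OF _ m(2)]) (use cok in \<open>simp add: comp_ok_def\<close>)
    then obtain x where x: "x \<in> set l" "x \<in> nb (hd l)" by blast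
    have "x \<in> U" using cok x by (auto simp: comp_ok_def closed_in_def)
    moreover have "nv \<le> x" using nb_type[OF x(2)] h by simp
    ultimately have "x \<in> set (concat ls)" using l(5) U by auto
    then show False using K(11) x(1) l' by auto
   qed
   have "frame_ok B (Suc ?u) U (ls @ ls') (mem N)"
   proof -
    have "(\<lambda>v. mem N (B + n + v)) = par_at N B" by (simp add: fun_eq_iff par_at_def)
    then show ?thesis
     unfolding frame_ok_def comps_def using K(11,13,16-18) all heads by auto
   qed
   then have "frame_ok B (Suc ?u) U (ls @ ls') (mem ?f)" by (simp add: set_reg_def)
   moreover have "stat ?f" by (rule stat_same[OF K(1) sf]) auto
   moreover have "fresh ?f" unfolding f using K(8) EN by (simp add: fresh_def set_reg_def)
   moreover have "regs ?f rVIS = Suc ?u" "regs ?f rUID = Suc ?u" "regs ?f rCNT = length (ls @ ls')"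
    "regs ?f rQT = B + n + n + length (concat (ls @ ls'))"
    unfolding f using K(7,14,19) by (simp_all add: set_reg_def)
   moreover have "same {B..<B + W} ({rVIS, rUID} \<union> scan_regs) Z ?f"
    by (rule same_trans[OF same_mono[OF s] same_trans[OF same_mono[OF l(3)]
      same_trans[OF same_mono[OF k(2)] same_mono[OF sf]]]]) auto
   moreover have "weight U \<le> wts xs"
    unfolding weight_set[OF dist, symmetric] weight_def by (rule sum_mono2) (use U in auto)
   then have "t + t' + 7 \<le> 110 * wts xs + 30"
    using l(6) k(4) length_le_wts[of xs] by simp
   ultimately show "\<exists>ls. frame_ok B (Suc ?u) U ls (mem ?f) \<and> stat ?f \<and> fresh ?f \<and> regs ?f rVIS = Suc ?u \<and>
     regs ?f rUID = Suc ?u \<and> regs ?f rCNT = length ls \<and> regs ?f rQT = B + n + n + length (concat ls) \<and>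
     same {B..<B + W} ({rVIS, rUID} \<union> scan_regs) Z ?f \<and> t + t' + 7 \<le> 110 * wts xs + 30" by blast
  qed
 qed
qed

section \<open>Choosing a variable\<close>

lemma same_empty: "same {} R Z Z' \<Longrightarrow> mem Z' = mem Z"
 by (auto simp: same_def)

lemma fresh_same:
 assumes "fresh Z" "same A R Z Z'" "regs Z rUID \<le> regs Z' rUID"
  "\<And>a. a \<in> A \<Longrightarrow> MK \<le> a \<Longrightarrow> a < EN \<Longrightarrow> mem Z' a \<le> regs Z' rUID"
 shows "fresh Z'"
 using assms unfolding fresh_def same_def by (metis order_trans)

abbreviation (input) walk_regs :: "reg set" where "walk_regs \<equiv> {rA, rU, rC}"

lemma wp_walk:
 assumes st: "stat Z" and fr: "fresh Z" and t: "bfs_tree nb K r par" and K: "K \<subseteq> {..<n}" and c: "c \<in> K"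
  and reg: "regs Z rU = c" "regs Z rC = d" "regs Z rF = f" and f: "FB \<le> f"
  and par: "\<And>v. v \<in> K \<Longrightarrow> mem Z (f + v) = par v"
  and new: "\<And>v. v < n \<Longrightarrow> mem Z (MK + v) \<noteq> regs Z rUID"
 shows "wp P (WhileNZ rC (block [Add rA rMK rU, Store rA rUID, Add rA rF rU, Load rU rA, Sub rC rC rONE]))
  (\<lambda>t Z'. stat Z' \<and> same {MK..<MK + n} walk_regs Z Z' \<and>
    (\<forall>v<n. mem Z' (MK + v) = regs Z rUID \<longleftrightarrow> v \<in> walk d par c) \<and>
    (\<forall>v<n. mem Z' (MK + v) = mem Z (MK + v) \<or> mem Z' (MK + v) = regs Z rUID) \<and> t \<le> 7 * d + 1) Z"
proof -
 let ?v = "\<lambda>i. (par ^^ i) c"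
 have vK: "?v i \<in> K" for i
 proof (induction i)
  case (Suc i)
  then show ?case using t unfolding bfs_tree_def by (cases "?v i = r") auto
 qed (simp add: c)
 have MF: "MK + n \<le> FB" by (simp add: FB)
 let ?I = "\<lambda>Y. \<exists>i\<le>d. same {MK..<MK + n} walk_regs Z Y \<and> regs Y rU = ?v i \<and> regs Y rC = d - i \<and>
  (\<forall>v<n. mem Y (MK + v) = (if v \<in> walk i par c then regs Z rUID else mem Z (MK + v)))"
 show ?thesis
 proof (rule wp_WhileNZ[where I = ?I and \<Phi> = "\<lambda>Y. 7 * regs Y rC"])
  show "?I Z" by (rule exI[of _ 0]) (simp add: same_refl reg walk_def)
 next
  fix Y assume "?I Y" and nz: "regs Y rC \<noteq> 0"
  then obtain i where I: "i \<le> d" "same {MK..<MK + n} walk_regs Z Y" "regs Y rU = ?v i" "regs Y rC = d - i"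
   "\<And>v. v < n \<Longrightarrow> mem Y (MK + v) = (if v \<in> walk i par c then regs Z rUID else mem Z (MK + v))" by blast
  have id: "i < d" using I nz by simp
  have sr: "regs Y rMK = MK" "regs Y rONE = 1" "regs Y rUID = regs Z rUID" "regs Y rF = f"
   using I(2) stat_regs[OF st] reg by (simp_all add: same_def)
  have vn: "?v i < n" using vK K by auto
  have fv: "mem Y (f + ?v i) = ?v (Suc i)"
   using same_mem[OF I(2), of "f + ?v i"] par[OF vK] f MF by simp
  have ws: "walk (Suc i) par c = insert (?v i) (walk i par c)" by (simp add: walk_def lessThan_Suc)
  let ?s = "Y\<lparr>mem := (mem Y)(MK + ?v i := regs Z rUID),
   regs := (regs Y)(rA := f + ?v i, rU := ?v (Suc i), rC := d - Suc i)\<rparr>"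
  have "same {MK..<MK + n} walk_regs Y ?s" using vn by (simp add: same_def)
  then have "same {MK..<MK + n} walk_regs Z ?s" by (rule same_trans[OF I(2)])
  moreover have "\<forall>v<n. mem ?s (MK + v) = (if v \<in> walk (Suc i) par c then regs Z rUID else mem Z (MK + v))"
   using I(5) by (simp add: ws)
  ultimately have "?I ?s" using id by (intro exI[of _ "Suc i"]) simp
  moreover have "wp P (block [Add rA rMK rU, Store rA rUID, Add rA rF rU, Load rU rA, Sub rC rC rONE]) Q Y \<longleftrightarrow>
    Q (Suc (Suc (Suc (Suc (Suc (Suc 0)))))) ?s" for Q
   using sr I(3,4) fv f MF vn by (simp add: wp_funs set_reg_def)
  ultimately show "wp P (block [Add rA rMK rU, Store rA rUID, Add rA rF rU, Load rU rA, Sub rC rC rONE])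
    (\<lambda>t Z'. ?I Z' \<and> t + 1 + 7 * regs Z' rC \<le> 7 * regs Y rC) Y"
   using I(4) id by simp
 next
  fix t' Y assume "?I Y" "regs Y rC = 0" and t: "t' + 7 * regs Y rC \<le> 7 * regs Z rC + 1"
  then have I: "same {MK..<MK + n} walk_regs Z Y"
   "\<And>v. v < n \<Longrightarrow> mem Y (MK + v) = (if v \<in> walk d par c then regs Z rUID else mem Z (MK + v))" by auto
  have "stat Y" by (rule stat_same[OF st I(1)]) (use FT_MK in auto)
  then show "stat Y \<and> same {MK..<MK + n} walk_regs Z Y \<and>
    (\<forall>v<n. mem Y (MK + v) = regs Z rUID \<longleftrightarrow> v \<in> walk d par c) \<and>
    (\<forall>v<n. mem Y (MK + v) = mem Z (MK + v) \<or> mem Y (MK + v) = regs Z rUID) \<and> t' \<le> 7 * d + 1"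
   using I t reg(2) new by auto
 qed
qed

abbreviation (input) look_regs :: "reg set" where
 "look_regs \<equiv> {rE, rA, rT, rG, rQ, rR, rX, rV, rI, rL, rXV, rFND}"

definition found :: "nat set \<Rightarrow> nat set \<Rightarrow> state \<Rightarrow> bool" where
 "found K M Z \<longleftrightarrow> (if regs Z rFND = 0 then \<forall>x\<in>K. \<not> hits x M else regs Z rXV \<in> K \<and> hits (regs Z rXV) M)"

lemma wp_look:
 assumes st: "stat Z" and seg: "regs Z rA0 = a" "regs Z rE0 = a + length seg" "list_at (mem Z) a seg" "set seg \<subseteq> {..<n}"
  and f0: "regs Z rFND = 0"
  and M: "\<And>v. v < n \<Longrightarrow> mem Z (MK + v) = regs Z rUID \<longleftrightarrow> v \<in> M"
 shows "wp P (for_seg (block [Sub rX rNV rV,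
    IfNZ rX (for_adj rV (block [Add rA rMK rT, Load rA rA, neq rA rUID,
     IfNZ rQ Skip (block [Add rXV rV rZ, Const rFND 1])])) Skip]))
  (\<lambda>t Z'. same {} look_regs Z Z' \<and> found (set seg) M Z' \<and> t \<le> 40 * wts seg + 10) Z"
proof -
 let ?b = "block [Add rA rMK rT, Load rA rA, neq rA rUID, IfNZ rQ Skip (block [Add rXV rV rZ, Const rFND 1])]"
 let ?I = "\<lambda>ys Y. same {} look_regs Z Y \<and> found (set ys) M Y"
 have stI: "stat Y" if "same {} look_regs Z Y" for Y by (rule stat_same[OF st that]) auto
 have MI: "mem Y (MK + v) = regs Y rUID \<longleftrightarrow> v \<in> M" if "same {} look_regs Z Y" "v < n" for Y v
  using M[OF that(2)] same_empty[OF that(1)] same_reg[OF that(1), of rUID] by simp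
 show ?thesis
 proof (rule wp_for_seg[where I = ?I and \<Phi> = "\<lambda>_. 0" and a = a and cost = "\<lambda>v. 30 * length (adj v) + 10"])
  show "regs Z rA0 = a" by (rule seg(1))
  show "?I [] Z" using f0 by (simp add: same_refl found_def)
  show "regs Y rZ = 0 \<and> regs Y rONE = 1 \<and> list_at (mem Y) a seg \<and> regs Y rE0 = a + length seg" if "?I ys Y" for ys Y
   using stat_regs[OF stI[OF conjunct1[OF that]]] same_empty[OF conjunct1[OF that]]
    same_reg[OF conjunct1[OF that], of rE0] seg by simp
  show "?I ys (set_reg r x Y) \<and> (0::nat) = 0" if "?I ys Y" "r \<in> {rI, rL, rV}" for ys Y r x
  proof (intro conjI)
   show "same {} look_regs Z (set_reg r x Y)"
    by (rule same_trans[OF conjunct1[OF that(1)] set_reg_same]) (use that(2) in auto)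
   show "found (set ys) M (set_reg r x Y)"
    using that by (auto simp: found_def set_reg_def)
  qed simp
 next
  fix ys v zs Y assume xs: "seg = ys @ v # zs" and I: "?I ys Y" and v: "regs Y rV = v"
  have vn: "v < n" using xs seg(4) by simp
  let ?s = "set_reg rX (nv - v) Y"
  let ?J = "\<lambda>ws N. same {} (look_regs - {rI, rL, rV}) Y N \<and>
   (if \<exists>w\<in>fst ` set ws. w \<in> M then regs N rFND = 1 \<and> regs N rXV = v
    else regs N rFND = regs Y rFND \<and> regs N rXV = regs Y rXV)"
  have sI: "same {} look_regs Z N" if "same {} (look_regs - {rI, rL, rV}) Y N" for N
   by (rule same_trans[OF conjunct1[OF I]], rule same_mono[OF that]) auto
  have loop: "wp P (for_adj rV ?b) (\<lambda>t N. ?J (adj v) N \<and> t \<le> (15 + 7) * length (adj v) + 4) ?s"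
  proof (rule wp_for_adj[OF vn, where I = ?J and cost = 15])
   show "regs ?s rV = v" using v by (simp add: set_reg_def)
   show "?J [] ?s" by (simp add: set_reg_same) (simp add: set_reg_def)
   show "stat N" if "?J ws N" for ws N by (rule stI[OF sI[OF conjunct1[OF that]]])
   show "?J ws (set_reg r x N)" if "?J ws N" "r \<in> {rE, rA, rT, rG}" for ws N r x
   proof (intro conjI)
    show "same {} (look_regs - {rI, rL, rV}) Y (set_reg r x N)"
     by (rule same_trans[OF conjunct1[OF that(1)] set_reg_same]) (use that(2) in auto)
    have "regs (set_reg r x N) rFND = regs N rFND" "regs (set_reg r x N) rXV = regs N rXV"
     using that(2) by (auto simp: set_reg_def)
    then show "if \<exists>w\<in>fst ` set ws. w \<in> M then regs (set_reg r x N) rFND = 1 \<and> regs (set_reg r x N) rXV = v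
      else regs (set_reg r x N) rFND = regs Y rFND \<and> regs (set_reg r x N) rXV = regs Y rXV"
     using that(1) by presburger
   qed
  next
   fix ws w s us N assume a: "adj v = ws @ (w, s) # us" and J: "?J ws N" and r: "regs N rT = w" "regs N rG = s"
   have "(w, s) \<in> set (adj v)" by (simp add: a)
   then have wn: "w < n" using adj_iff[OF vn] nb_less by blast
   have m: "mem N (MK + w) = regs N rUID \<longleftrightarrow> w \<in> M" by (rule MI[OF sI[OF conjunct1[OF J]] wn])
   have vr: "regs N rV = v" using same_reg[OF conjunct1[OF J], of rV] v by simp
   let ?m = "mem N (MK + w)"
   let ?q = "(regs N)(rA := ?m, rR := regs N rUID - ?m, rQ := ?m - regs N rUID + (regs N rUID - ?m))"
   let ?x = "N\<lparr>regs := ?q\<rparr>" and ?y = "N\<lparr>regs := ?q(rXV := v, rFND := 1)\<rparr>"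
   have run: "wp P ?b Q N \<longleftrightarrow> (if w \<in> M then Q (Suc (Suc (Suc (Suc (Suc (Suc (Suc (Suc (Suc (Suc (Suc 0))))))))))) ?y else Q (Suc (Suc (Suc (Suc (Suc (Suc (Suc (Suc (Suc 0))))))))) ?x)" for Q
    using m[symmetric] vr r stat_regs[OF stI[OF sI[OF conjunct1[OF J]]]]
    by (auto simp: wp_funs neq_def set_reg_def add_numeral_Suc)
   have "same {} (look_regs - {rI, rL, rV}) N ?x" "same {} (look_regs - {rI, rL, rV}) N ?y"
    by (auto simp: same_def)
   then have "same {} (look_regs - {rI, rL, rV}) Y ?x" "same {} (look_regs - {rI, rL, rV}) Y ?y"
    using same_trans[OF conjunct1[OF J]] by blast+
   then show "wp P ?b (\<lambda>t N'. ?J (ws @ [(w, s)]) N' \<and> regs N' rE = regs N rE \<and> t \<le> 15) N"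
    unfolding run using J by auto
  qed blast
  have hit: "hits v M \<longleftrightarrow> v < nv \<and> (\<exists>w\<in>fst ` set (adj v). w \<in> M)"
   using adj_iff[OF vn] by (force simp: hits_def)
  have s0: "same {} look_regs Z ?s"
   by (rule same_trans[OF conjunct1[OF I] set_reg_same]) simp
  have run: "wp P (block [Sub rX rNV rV, IfNZ rX (for_adj rV ?b) Skip]) Q Y \<longleftrightarrow>
   (if v < nv then wp P (for_adj rV ?b) (\<lambda>t. Q (t + 3)) ?s else Q (Suc (Suc (Suc (Suc 0)))) ?s)" for Q
   using v stat_regs[OF stI[OF conjunct1[OF I]]]
   by (simp add: wp_funs set_reg_def add_numeral_Suc)
  show "wp P (block [Sub rX rNV rV, IfNZ rX (for_adj rV ?b) Skip])
    (\<lambda>t Y'. ?I (ys @ [v]) Y' \<and> regs Y' rI = regs Y rI \<and> t + 0 \<le> 30 * length (adj v) + 10 + 0) Y"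
  proof (cases "v < nv")
   case False
   then have "found (set (ys @ [v])) M ?s" using I hit by (simp add: found_def set_reg_def)
   then show ?thesis unfolding run using False s0 by (simp add: set_reg_def)
  next
   case True
   have "wp P (for_adj rV ?b) (\<lambda>t Y'. ?I (ys @ [v]) Y' \<and> regs Y' rI = regs Y rI \<and> t + 3 + 0 \<le> 30 * length (adj v) + 10 + 0) ?s"
   proof (rule wp_mono[OF loop])
    fix t :: nat and N assume J: "?J (adj v) N \<and> t \<le> (15 + 7) * length (adj v) + 4"
    have "found (set (ys @ [v])) M N"
    proof (cases "\<exists>w\<in>fst ` set (adj v). w \<in> M")
     case yes: True
     then show ?thesis using J hit True by (auto simp: found_def)
    next
     case no: False
     then show ?thesis using J I hit by (auto simp: found_def)
    qed
    moreover have "regs N rI = regs Y rI" using same_reg[OF conjunct1[OF conjunct1[OF J]], of rI] by simp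
    ultimately show "?I (ys @ [v]) N \<and> regs N rI = regs Y rI \<and> t + 3 + 0 \<le> 30 * length (adj v) + 10 + 0"
     using J sI by simp
   qed
   then show ?thesis unfolding run using True by simp
  qed
 next
  fix t Y assume I: "?I seg Y" and t: "t + 0 \<le> (\<Sum>v\<leftarrow>seg. 30 * length (adj v) + 10) + 6 * length seg + 4 + 0"
  have "(\<Sum>v\<leftarrow>seg. 30 * length (adj v) + 10) + 6 * length seg \<le> 40 * wts seg"
   by (induction seg) (auto simp: wts_simps wt_def)
  then show "same {} look_regs Z Y \<and> found (set seg) M Y \<and> t \<le> 40 * wts seg + 10" using I t by simp
 qed
qed

text \<open>The frame addresses of the stages of the current branch are kept in the table at FT, from index 1 on.\<close>

definition stg_at :: "stage list \<Rightarrow> nat \<Rightarrow> state \<Rightarrow> bool" where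
 "stg_at stg bnd Z \<longleftrightarrow> regs Z rST = length stg \<and> (stg \<noteq> [] \<longrightarrow> regs Z rSH = fst (snd (last stg))) \<and>
   (\<forall>j<length stg. FB \<le> mem Z (FT + Suc j) \<and> mem Z (FT + Suc j) + W \<le> bnd \<and>
    (\<forall>v\<in>fst (stg ! j). mem Z (mem Z (FT + Suc j) + n + v) = snd (snd (stg ! j)) v))"

abbreviation (input) pick_regs :: "reg set" where
 "pick_regs \<equiv> {rUID, rF, rA, rU, rC, rA0, rE0, rE, rT, rG, rQ, rR, rX, rV, rI, rL, rXV, rFND}"

lemma hist_root_pre:
 assumes h: "hist D stg X U" and j: "j < length stg"
 shows "fst (snd (stg ! j)) \<in> fst (stg ! pre j)" "pre j < length stg" "fst (stg ! j) \<subseteq> {..<n}"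
proof -
 have ok: "stage_ok (stg ! j)" by (rule histD(5)[OF h j])
 then have r: "fst (snd (stg ! j)) \<in> fst (stg ! j)" by (simp add: stage_ok_def bfs_tree_def)
 show "fst (stg ! j) \<subseteq> {..<n}" using ok reduct_subset[of "fst (stg ! j)" "{..<n}"]
  by (simp add: stage_ok_def verts_dec)
 show "pre j < length stg" using j pre_less[of j] by (cases "j = 0") (auto simp: pre_0)
 show "fst (snd (stg ! j)) \<in> fst (stg ! pre j)"
 proof (cases "j = 0")
  case False
  then have "reduct G (dec ` fst (stg ! j)) (dec ` fst (stg ! pre j))"
   using pre_less[of j] by (intro histD(7)[OF h _ j]) simp
  then show ?thesis using r reduct_subset by blast
 qed (use r in \<open>simp add: pre_0\<close>)
qed

lemma wp_pick:
 assumes st: "stat Z" and fr: "fresh Z" and h: "hist D stg X U" and ne: "stg \<noteq> []" and len: "length stg \<le> D"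
  and sa: "stg_at stg bnd Z" and seg: "regs Z rSS = a" "regs Z rSD = a + length seg" "list_at (mem Z) a seg"
  "set seg \<subseteq> {..<n}" "FB \<le> a"
 shows "wp P pick (\<lambda>t Z'. stat Z' \<and> fresh Z' \<and> same {MK..<MK + n} pick_regs Z Z' \<and>
   regs Z rUID \<le> regs Z' rUID \<and>
   found (set seg) (marked D stg (length stg - 1)) Z' \<and> t \<le> 7 * D + 40 * wts seg + 40) Z"
proof -
 let ?j = "length stg - 1"
 let ?i = "pre ?j"
 let ?u = "Suc (regs Z rUID)"
 let ?f = "mem Z (FT + Suc ?i)"
 have j: "?j < length stg" using ne by (cases stg) auto
 note hr = hist_root_pre[OF h j]
 have ok: "stage_ok (stg ! ?i)" by (rule histD(5)[OF h hr(2)])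
 have sh: "regs Z rSH = fst (snd (stg ! ?j))" and rst: "regs Z rST = length stg"
  using sa ne by (simp_all add: stg_at_def last_conv_nth)
 have f: "FB \<le> ?f" "\<And>v. v \<in> fst (stg ! ?i) \<Longrightarrow> mem Z (?f + n + v) = snd (snd (stg ! ?i)) v"
  using sa hr(2) by (simp_all add: stg_at_def)
 \<comment> \<open>The last stage has number \<open>length stg - 1\<close>, and the table is
   addressed from 1 on.\<close>
 have "m0 (PR + length stg) = Suc (pre ?j)" by (rule pre_table) (use j len in simp_all)
 moreover have "PR + length stg < FT" using static(2) len by simp
 ultimately have PR: "mem Z (PR + length stg) = Suc ?i" using st by (simp add: stat_def)
 let ?s = "Z\<lparr>regs := (regs Z)(rUID := ?u, rA := FT + Suc ?i, rF := ?f + n, rU := fst (snd (stg ! ?j)), rC := D)\<rparr>"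
 have s: "same {} pick_regs Z ?s" by (simp add: same_def)
 have st_s: "stat ?s" by (rule stat_same[OF st s]) auto
 have fr_s: "fresh ?s" using fr by (auto simp: fresh_def intro: le_SucI)
 have new: "mem ?s (MK + v) \<noteq> regs ?s rUID" if "v < n" for v
 proof -
  have "mem Z (MK + v) \<le> regs Z rUID" using fr that FB FT_MK by (simp add: fresh_def)
  then show ?thesis by simp
 qed
 let ?M = "marked D stg ?j"
 have M: "?M = walk D (snd (snd (stg ! ?i))) (fst (snd (stg ! ?j)))" by (simp add: marked_def)
 have walk: "wp P (WhileNZ rC (block [Add rA rMK rU, Store rA rUID, Add rA rF rU, Load rU rA, Sub rC rC rONE]))
  (\<lambda>t Z'. stat Z' \<and> same {MK..<MK + n} walk_regs ?s Z' \<and>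
    (\<forall>v<n. mem Z' (MK + v) = regs ?s rUID \<longleftrightarrow> v \<in> ?M) \<and>
    (\<forall>v<n. mem Z' (MK + v) = mem ?s (MK + v) \<or> mem Z' (MK + v) = regs ?s rUID) \<and> t \<le> 7 * D + 1) ?s"
  unfolding M
 proof (rule wp_walk[OF st_s fr_s _ hist_root_pre(3)[OF h hr(2)] hr(1)])
  show "bfs_tree nb (fst (stg ! ?i)) (fst (snd (stg ! ?i))) (snd (snd (stg ! ?i)))"
   using ok by (simp add: stage_ok_def)
  show "FB \<le> ?f + n" using f(1) by simp
 qed (use f(2) new in simp_all)
 define loop where "loop = for_seg (block [Sub rX rNV rV,
    IfNZ rX (for_adj rV (block [Add rA rMK rT, Load rA rA, neq rA rUID,
     IfNZ rQ Skip (block [Add rXV rV rZ, Const rFND 1])])) Skip])"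
 have run: "wp P pick Q Z \<longleftrightarrow> wp P (WhileNZ rC (block [Add rA rMK rU, Store rA rUID, Add rA rF rU, Load rU rA, Sub rC rC rONE]))
   (\<lambda>t Y. wp P loop (\<lambda>t'. Q (t + t' + 12)) (Y\<lparr>regs := (regs Y)(rA0 := regs Y rSS + regs Y rZ,
    rE0 := regs Y rSD + regs Y rZ, rFND := 0)\<rparr>)) ?s" for Q
 proof -
  have eq: "Z\<lparr>regs := (regs Z)(13 := Suc (regs Z 13), 21 := FT + Suc ?i, 41 := ?f + n,
    35 := fst (snd (stg ! ?j)), 36 := D)\<rparr> = ?s" by simp
  show ?thesis
   unfolding pick_def loop_def[symmetric]
   using stat_regs[OF st] sh rst PR
   by (simp only: block.simps wp_funs) (simp add: set_reg_def add_numeral_Suc add.commute[of "regs Z 5"])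
 qed
 show ?thesis unfolding run
 proof (rule wp_mono[OF walk], elim conjE)
  fix t :: nat and Y assume w: "stat Y" "same {MK..<MK + n} walk_regs ?s Y"
   "\<forall>v<n. mem Y (MK + v) = regs ?s rUID \<longleftrightarrow> v \<in> ?M"
   "\<forall>v<n. mem Y (MK + v) = mem ?s (MK + v) \<or> mem Y (MK + v) = regs ?s rUID" "t \<le> 7 * D + 1"
  let ?t = "Y\<lparr>regs := (regs Y)(rA0 := regs Y rSS + regs Y rZ, rE0 := regs Y rSD + regs Y rZ, rFND := 0)\<rparr>"
  have s1: "same {MK..<MK + n} pick_regs Z Y"
   by (rule same_trans[OF same_mono[OF s] same_mono[OF w(2)]]) auto
  have s2: "same {} {rA0, rE0, rFND} Y ?t" by (simp add: same_def)
  have s3: "same {MK..<MK + n} pick_regs Z ?t"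
   by (rule same_trans[OF s1 same_mono[OF s2]]) auto
  have u: "regs Y rUID = ?u" using same_reg[OF w(2), of rUID] by simp
  have fr_t: "fresh Y"
  proof (rule fresh_same[OF fr_s w(2)])
   fix b assume "b \<in> {MK..<MK + n}"
   then obtain v where "b = MK + v" "v < n" by (metis atLeastLessThan_iff le_Suc_ex nat_add_left_cancel_less)
   then show "mem Y b \<le> regs Y rUID"
    using w(4) fr_s u FB FT_MK by (auto simp: fresh_def)
  qed (use u in simp)
  have look: "wp P loop (\<lambda>t' Z'. same {} look_regs ?t Z' \<and> found (set seg) ?M Z' \<and> t' \<le> 40 * wts seg + 10) ?t"
   unfolding loop_def
  proof (rule wp_look)
   show "stat ?t" by (rule stat_same[OF w(1) s2]) auto
   show "regs ?t rA0 = a" "regs ?t rE0 = a + length seg"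
    using seg(1,2) same_reg[OF s1, of rSS] same_reg[OF s1, of rSD] stat_regs[OF w(1)] by simp_all
   show "list_at (mem ?t) a seg"
    by (rule list_at_cong[OF seg(3)]) (use seg(5) FB same_mem[OF s3] in simp)
   show "mem ?t (MK + v) = regs ?t rUID \<longleftrightarrow> v \<in> ?M" if "v < n" for v using w(3) that u by simp
  qed (use seg(4) in simp_all)
  show "wp P loop (\<lambda>t' Z'. stat Z' \<and> fresh Z' \<and> same {MK..<MK + n} pick_regs Z Z' \<and>
   regs Z rUID \<le> regs Z' rUID \<and>
   found (set seg) ?M Z' \<and> t + t' + 12 \<le> 7 * D + 40 * wts seg + 40) ?t"
  proof (rule wp_mono[OF look], elim conjE)
   fix t' :: nat and N assume l: "same {} look_regs ?t N" "found (set seg) ?M N" "t' \<le> 40 * wts seg + 10"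
   have tr: "same {} (look_regs \<union> {rA0, rE0, rFND}) Y N"
    by (rule same_trans[OF same_mono[OF s2] same_mono[OF l(1)]]) auto
   have "stat N" by (rule stat_same[OF w(1) tr]) auto
   moreover have ur: "regs N rUID = ?u" using same_reg[OF tr, of rUID] u by simp
   moreover have "fresh N" by (rule fresh_same[OF fr_t tr]) (use ur u in simp_all)
   moreover have "same {MK..<MK + n} pick_regs Z N"
    by (rule same_trans[OF s1 same_mono[OF tr]]) auto
   ultimately show "stat N \<and> fresh N \<and> same {MK..<MK + n} pick_regs Z N \<and>
    regs Z rUID \<le> regs N rUID \<and>
    found (set seg) ?M N \<and> t + t' + 12 \<le> 7 * D + 40 * wts seg + 40" using l w(5) by simp
  qed
 qed
qed

abbreviation (input) choose_regs :: "reg set" where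
 "choose_regs \<equiv> {rST, rSH, rUID, rF, rA, rU, rC, rA0, rE0, rE, rT, rG, rQ, rR, rX, rV, rI, rL, rXV, rFND}"

lemma stg_at_same:
 assumes "stg_at stg bnd Z" "same A R Z Z'" "rST \<notin> R" "rSH \<notin> R" "bnd \<le> bnd'"
  and h: "hist D stg X U"
  and A: "\<And>a. a \<in> A \<Longrightarrow> FT + length stg < a \<and> (a < FB \<or> bnd \<le> a)"
 shows "stg_at stg bnd' Z'"
proof -
 have F: "mem Z' (FT + Suc j) = mem Z (FT + Suc j)" if "j < length stg" for j
  using A[of "FT + Suc j"] that by (intro same_mem[OF assms(2)]) auto
 have P: "mem Z' (mem Z (FT + Suc j) + n + v) = mem Z (mem Z (FT + Suc j) + n + v)"
  if j: "j < length stg" and v: "v \<in> fst (stg ! j)" for j v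
 proof -
  have "v < n" using hist_root_pre(3)[OF h j] v by auto
  moreover have "FB \<le> mem Z (FT + Suc j)" "mem Z (FT + Suc j) + W \<le> bnd"
   using assms(1) j by (simp_all add: stg_at_def)
  ultimately show ?thesis using A[of "mem Z (FT + Suc j) + n + v"] by (intro same_mem[OF assms(2)]) auto
 qed
 show ?thesis
  using assms(1,5) F P same_reg[OF assms(2,3)] same_reg[OF assms(2,4)] unfolding stg_at_def by auto
qed

text \<open>If no variable touches the path of the last stage, the component may open a new stage.
  Its own root clause is the first vertex of the new marked path and has a neighbour, so the search
  cannot fail a second time. At most one stage is added per assigned variable.\<close>

lemma wp_choose:
 assumes st: "stat Z" and fr: "fresh Z" and h: "hist D stg X (set seg)" and len: "length stg < D"
  and sa: "stg_at stg B Z" and B: "regs Z rB = B" "FB \<le> B" "B + W \<le> EN"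
  and seg: "regs Z rSS = a" "regs Z rSD = a + length seg" "list_at (mem Z) a seg" "set seg \<subseteq> {..<n}" "FB \<le> a"
  and comp: "edgy (set seg)" "nv \<le> hd seg" "bfs_tree nb (set seg) (hd seg) (\<lambda>v. mem Z (B + n + v))" "seg \<noteq> []"
 shows "wp P choose_var (\<lambda>t Z'. \<exists>stg'. stat Z' \<and> fresh Z' \<and>
   same ({MK..<MK + n} \<union> {FT + Suc (length stg)}) choose_regs Z Z' \<and> regs Z rUID \<le> regs Z' rUID \<and>
   hist D stg' X (set seg) \<and> stg_at stg' (B + W) Z' \<and> stg' \<noteq> [] \<and> length stg \<le> length stg' \<and> length stg' \<le> Suc (length stg) \<and>
   regs Z' rXV \<in> set seg \<and> hits (regs Z' rXV) (marked D stg' (length stg' - 1)) \<and>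
   t \<le> 14 * D + 80 * wts seg + 100) Z"
proof -
 let ?u0 = "regs Z rUID"
 let ?A = "{MK..<MK + n} \<union> {FT + Suc (length stg)}"
 let ?Q = "\<lambda>(t::nat) Z'. \<exists>stg'. stat Z' \<and> fresh Z' \<and> same ?A choose_regs Z Z' \<and> ?u0 \<le> regs Z' rUID \<and>
   hist D stg' X (set seg) \<and> stg_at stg' (B + W) Z' \<and> stg' \<noteq> [] \<and> length stg \<le> length stg' \<and> length stg' \<le> Suc (length stg) \<and>
   regs Z' rXV \<in> set seg \<and> hits (regs Z' rXV) (marked D stg' (length stg' - 1)) \<and>
   t \<le> 14 * D + 80 * wts seg + 100"
 have FT1: "FT + Suc (length stg) < MK" using len MK by simp
 have new: "wp P new_stage (\<lambda>t. ?Q (t + (7 * D + 40 * wts seg + 49))) Y"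
  if Y: "stat Y" "fresh Y" "same {MK..<MK + n} pick_regs Z Y" "?u0 \<le> regs Y rUID"
   and no: "stg \<noteq> [] \<Longrightarrow> \<forall>x\<in>set seg. \<not> hits x (marked D stg (length stg - 1))" for Y
 proof -
  let ?par = "\<lambda>v. mem Z (B + n + v)"
  let ?stg = "stg @ [(set seg, hd seg, ?par)]"
  let ?p = "FT + Suc (length stg)"
  have h': "hist D ?stg X (set seg)" by (rule hist_stage[OF h comp(2,1,3) no])
  have r: "regs Y rST = length stg" "regs Y rSS = a" "regs Y rB = B" "regs Y rSD = a + length seg"
   using sa seg(1,2) B(1) Y(3) by (simp_all add: stg_at_def same_def)
  have "mem Z a = hd seg" using seg(3) comp(4) by (cases seg) (simp_all add: list_at_Cons)
  then have ma: "mem Y a = hd seg" using same_mem[OF Y(3), of a] seg(5) FB by simp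
  let ?s = "Y\<lparr>mem := (mem Y)(?p := B), regs := (regs Y)(rST := Suc (length stg), rA := ?p, rSH := hd seg)\<rparr>"
  have run: "wp P new_stage Q Y \<longleftrightarrow> wp P pick (\<lambda>t. Q (t + 5)) ?s" for Q
   using r ma FT1 seg(5) FB stat_regs[OF Y(1)] unfolding new_stage_def
   by (simp only: block.simps wp_funs) (simp add: set_reg_def add_numeral_Suc)
  have s: "same {?p} {rST, rA, rSH} Y ?s" by (simp add: same_def)
  have s': "same ?A choose_regs Z ?s"
   by (rule same_trans[OF same_mono[OF Y(3)] same_mono[OF s]]) auto
  have st_s: "stat ?s" by (rule stat_same[OF Y(1) s]) auto
  have fr_s: "fresh ?s" by (rule fresh_same[OF Y(2) s]) (use FT1 in auto)
  have par: "mem ?s (B + n + v) = ?par v" if "v < n" for v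
   using same_mem[OF Y(3), of "B + n + v"] B(2) FB FT1 by simp
  have old: "mem ?s b = mem Z b" if "b \<notin> ?A" for b using same_mem[OF s' that] .
  have la: "list_at (mem ?s) a seg"
   by (rule list_at_cong[OF seg(3)], rule old) (use seg(5) FB FT1 in auto)
  have sa': "stg_at ?stg (B + W) ?s"
   unfolding stg_at_def
  proof (intro conjI allI impI ballI)
   fix j assume j: "j < length ?stg"
   have "FB \<le> mem ?s (FT + Suc j) \<and> mem ?s (FT + Suc j) + W \<le> B + W \<and>
    (\<forall>v\<in>fst (?stg ! j). mem ?s (mem ?s (FT + Suc j) + n + v) = snd (snd (?stg ! j)) v)"
   proof (cases "j = length stg")
    case True
    have "\<forall>v\<in>set seg. mem ?s (B + n + v) = ?par v" using par seg(4) by blast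
    then show ?thesis using True B(2) by simp
   next
    case False
    then have j': "j < length stg" using j by simp
    have F: "mem ?s (FT + Suc j) = mem Z (FT + Suc j)" by (rule old) (use j' FT1 in auto)
    have b: "FB \<le> mem Z (FT + Suc j)" "mem Z (FT + Suc j) + W \<le> B"
     "\<And>v. v \<in> fst (stg ! j) \<Longrightarrow> mem Z (mem Z (FT + Suc j) + n + v) = snd (snd (stg ! j)) v"
     using sa j' by (simp_all add: stg_at_def)
    have "mem ?s (mem Z (FT + Suc j) + n + v) = mem Z (mem Z (FT + Suc j) + n + v)" for v
     by (rule old) (use b(1) FB FT1 in auto)
    then show ?thesis using b j' unfolding F by (simp add: nth_append)
   qed
   then show "FB \<le> mem ?s (FT + Suc j)" "mem ?s (FT + Suc j) + W \<le> B + W"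
    "\<And>v. v \<in> fst (?stg ! j) \<Longrightarrow> mem ?s (mem ?s (FT + Suc j) + n + v) = snd (snd (?stg ! j)) v" by blast+
  qed simp_all
  show ?thesis unfolding run
  proof (rule wp_mono[OF wp_pick[where a = a and seg = seg, OF st_s fr_s h' _ _ sa']], goal_cases)
   case (8 t N)
   then have q: "stat N" "fresh N" "same {MK..<MK + n} pick_regs ?s N" "regs ?s rUID \<le> regs N rUID"
    "found (set seg) (marked D ?stg (length ?stg - 1)) N" "t \<le> 7 * D + 40 * wts seg + 40" by blast+
   obtain x where x: "x \<in> set seg" "x \<in> nb (hd seg)" using bfs_tree_root_nb[OF comp(3,1)] by blast
   have hit: "hits x (marked D ?stg (length ?stg - 1))"
    unfolding hits_def
   proof (intro conjI bexI)
    show "x < nv" using nb_type[OF x(2)] comp(2) by simp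
    show "hd seg \<in> nb x" using x(2) nb_sym by blast
    show "hd seg \<in> marked D ?stg (length ?stg - 1)"
     unfolding marked_def walk_def using len by (intro image_eqI[of _ _ 0]) auto
   qed
   then have "regs N rFND \<noteq> 0" using q(5) x(1) by (auto simp: found_def split: if_splits)
   then have xv: "regs N rXV \<in> set seg" "hits (regs N rXV) (marked D ?stg (length ?stg - 1))"
    using q(5) by (simp_all add: found_def)
   have "same ?A choose_regs Z N"
    by (rule same_trans[OF s' same_mono[OF q(3)]]) auto
   moreover have "stg_at ?stg (B + W) N"
    by (rule stg_at_same[OF sa' q(3) _ _ _ h']) (use FT1 FB in auto)
   moreover have "?u0 \<le> regs N rUID" using q(4) Y(4) by simp
   ultimately show ?case using q(1,2,6) h' xv by (intro exI[of _ ?stg]) simp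
  qed (use la r seg(4,5) len in simp_all)
 qed
 let ?s = "set_reg rFND 0 Z"
 have s: "same {} {rFND} Z ?s" by (rule set_reg_same) simp
 have st_s: "stat ?s" by (rule stat_same[OF st s]) auto
 have fr_s: "fresh ?s" by (rule fresh_same[OF fr s]) (simp_all add: set_reg_def)
 have run: "wp P choose_var Q Z \<longleftrightarrow> (if stg \<noteq> []
   then wp P pick (\<lambda>t Y. if regs Y rFND \<noteq> 0 then Q (t + 5) Y else wp P new_stage (\<lambda>t'. Q (t + t' + 4)) Y) ?s
   else wp P new_stage (\<lambda>t'. Q (t' + 5)) ?s)" for Q
  using sa unfolding choose_var_def stg_at_def
  by (simp only: block.simps wp_funs) (simp add: set_reg_def add_numeral_Suc)
 show ?thesis unfolding run
 proof (cases "stg = []")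
  case True
  have "wp P new_stage (\<lambda>t'. ?Q (t' + 5)) ?s"
   by (rule wp_mono[OF new[OF st_s fr_s]])
     (use s True in \<open>auto elim: same_mono simp: set_reg_def\<close>)
  then show "if stg \<noteq> [] then wp P pick (\<lambda>t Y. if regs Y rFND \<noteq> 0 then ?Q (t + 5) Y
    else wp P new_stage (\<lambda>t'. ?Q (t + t' + 4)) Y) ?s else wp P new_stage (\<lambda>t'. ?Q (t' + 5)) ?s"
   using True by simp
 next
  case False
  have sa_s: "stg_at stg B ?s" by (rule stg_at_same[OF sa s _ _ _ h]) auto
  have "wp P pick (\<lambda>t Y. if regs Y rFND \<noteq> 0 then ?Q (t + 5) Y else wp P new_stage (\<lambda>t'. ?Q (t + t' + 4)) Y) ?s"
  proof (rule wp_mono[OF wp_pick[where a = a and seg = seg, OF st_s fr_s h False _ sa_s]], goal_cases)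
   case (7 t Y)
   then have q: "stat Y" "fresh Y" "same {MK..<MK + n} pick_regs ?s Y" "regs ?s rUID \<le> regs Y rUID"
    "found (set seg) (marked D stg (length stg - 1)) Y" "t \<le> 7 * D + 40 * wts seg + 40" by blast+
   have sm: "same {MK..<MK + n} pick_regs Z Y"
    by (rule same_trans[OF same_mono[OF s] q(3)]) auto
   have u: "?u0 \<le> regs Y rUID" using q(4) by (simp add: set_reg_def)
   show ?case
   proof (cases "regs Y rFND = 0")
    case True
    have no: "\<forall>x\<in>set seg. \<not> hits x (marked D stg (length stg - 1))" using q(5) True by (simp add: found_def)
    have "wp P new_stage (\<lambda>t'. ?Q (t + t' + 4)) Y"
     by (rule wp_mono[OF new[OF q(1,2) sm u no]]) (use q(6) in auto)
    then show ?thesis using True by simp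
   next
    case found: False
    have "stg_at stg (B + W) Y"
     by (rule stg_at_same[OF sa sm _ _ _ h]) (use FT1 FB in auto)
    moreover have "same ?A choose_regs Z Y" by (rule same_mono[OF sm]) auto
    moreover have "regs Y rXV \<in> set seg" "hits (regs Y rXV) (marked D stg (length stg - 1))"
     using q(5) found by (simp_all add: found_def)
    ultimately have "?Q (t + 5) Y" using q(1,2,6) u h False by (intro exI[of _ stg]) simp
    then show ?thesis using found by simp
   qed
  qed (use seg len s in \<open>auto simp: set_reg_def\<close>)
  then show "if stg \<noteq> [] then wp P pick (\<lambda>t Y. if regs Y rFND \<noteq> 0 then ?Q (t + 5) Y
    else wp P new_stage (\<lambda>t'. ?Q (t + t' + 4)) Y) ?s else wp P new_stage (\<lambda>t'. ?Q (t' + 5)) ?s"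
   using False by simp
 qed
qed

end

section \<open>Backdoor trees and their codes\<close>

context numbered_formula
begin

lemma gr_inj: "U \<subseteq> {..<n} \<Longrightarrow> U' \<subseteq> {..<n} \<Longrightarrow> gr U = gr U' \<Longrightarrow> U = U'"
proof -
 assume U: "U \<subseteq> {..<n}" "U' \<subseteq> {..<n}" and "gr U = gr U'"
 then have "verts G \<inter> dec ` U = verts G \<inter> dec ` U'" by (metis gr_def verts_induced)
 moreover have "dec ` U \<subseteq> verts G" "dec ` U' \<subseteq> verts G" unfolding verts_dec using U by (auto intro: image_mono)
 ultimately have "dec ` U = dec ` U'" by blast
 then show ?thesis by (simp add: inj_image_eq_iff inj_def dec_inj)
qed

lemma linked_bfs_tree:
 assumes "bfs_tree nb K r par" shows "linked G (dec ` K)"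
proof -
 obtain lev where lev: "r \<in> K"
  "\<And>v. v \<in> K \<Longrightarrow> v \<noteq> r \<Longrightarrow> par v \<in> K \<and> v \<in> nb (par v) \<and> lev v = Suc (lev (par v))"
  using assms unfolding bfs_tree_def by blast
 let ?R = "adjacency G \<inter> dec ` K \<times> dec ` K"
 have "(dec r, dec v) \<in> ?R\<^sup>*" if "v \<in> K" for v
  using that
 proof (induction "lev v" arbitrary: v rule: less_induct)
  case less
  show ?case
  proof (cases "v = r")
   case False
   then have v: "par v \<in> K" "v \<in> nb (par v)" "lev (par v) < lev v" using lev(2)[OF less.prems] by auto
   have "(dec (par v), dec v) \<in> ?R" using v less.prems by (auto simp: nb_def)
   then show ?thesis using less.hyps[OF v(3,1)] by (rule rtrancl_into_rtrancl[rotated])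
  qed simp
 qed
 moreover have "sym (?R\<^sup>*)" by (rule sym_rtrancl) (use sym_adjacency in \<open>auto simp: sym_def\<close>)
 ultimately show ?thesis unfolding linked_def by (auto intro: rtrancl_trans dest: symD)
qed

text \<open>A search tree links the vertices of K, and closedness stops any walk from leaving
  it.\<close>

lemma comp_dec:
 assumes U: "U \<subseteq> {..<n}" and K: "closed_in K U" "bfs_tree nb K r par" "u \<in> K"
 shows "comp G (dec ` U) (dec u) = dec ` K"
proof
 have KU: "K \<subseteq> U" using K by (simp add: closed_in_def)
 show "dec ` K \<subseteq> comp G (dec ` U) (dec u)"
  by (rule linked_subset_comp[OF linked_bfs_tree[OF K(2)]]) (use KU K(3) in auto)
 show "comp G (dec ` U) (dec u) \<subseteq> dec ` K"
 proof
  fix w assume "w \<in> comp G (dec ` U) (dec u)"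
  then have "(dec u, w) \<in> (adjacency (induced G (dec ` U)))\<^sup>*" by (simp add: comp_def)
  then show "w \<in> dec ` K"
  proof induction
   case (step y z)
   then obtain a b where "a \<in> K" "y = dec a" "b \<in> U" "z = dec b" by (auto simp: adjacency_induced)
   then show ?case using step(2) K(1) by (auto simp: adjacency_induced closed_in_def nb_def)
  qed (use K(3) in simp)
 qed
qed

lemma verts_gr: "U \<subseteq> {..<n} \<Longrightarrow> verts G \<inter> dec ` U = dec ` U"
 by (auto simp: verts_dec)

lemma assign_gr: "x \<in> K \<Longrightarrow> x < nv \<Longrightarrow> assign (gr K) x s = gr (K - {x} - sat x s)"
 unfolding gr_def dec_setvar by (rule assign_induced) (simp add: Inl_dec)

lemma vars_gr: "x \<in> vars (gr K) \<longleftrightarrow> x < nv \<and> x \<in> K"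
 by (auto simp: gr_def induced_def nv Inl_dec)

lemma gr_class0: "gr K \<in> class0 \<longleftrightarrow> \<not> edgy K"
 by (simp add: gr_def class0_iff edgeless_dec)

lemma not_edgy_singleton: "\<not> edgy {v}"
 using nb_type by (auto simp: edgy_def)

end

context machine
begin

lemma comps_disjoint:
 assumes "comps U par ls" "l \<in> set ls" "l' \<in> set ls" "v \<in> set l" "v \<in> set l'" shows "l = l'"
proof -
 have "distinct (concat ls)" "[] \<notin> set ls" using assms(1) by (auto simp: comps_def comp_ok_def)
 then show ?thesis using assms(2-5) unfolding distinct_concat_iff by (metis disjoint_iff)
qed

lemma comps_distinct: "comps U par ls \<Longrightarrow> distinct ls"
proof -
 assume c: "comps U par ls"
 then have "distinct (concat ls)" "[] \<notin> set ls" by (auto simp: comps_def comp_ok_def)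
 then have "distinct (removeAll [] ls)" "removeAll [] ls = ls" by (simp_all add: distinct_concat_iff removeAll_id)
 then show ?thesis by simp
qed

text \<open>The empty list is included, since the empty graph counts as connected.\<close>

lemma comps_linked:
 assumes U: "U \<subseteq> {..<n}" and c: "comps U par ls"
 shows "connected_ig (gr U) \<longleftrightarrow> length ls \<le> 1"
proof -
 have ok: "comp_ok U par l" if "l \<in> set ls" for l using c that by (simp add: comps_def)
 have iff: "connected_ig (gr U) \<longleftrightarrow> linked G (dec ` U)"
  by (simp add: gr_def connected_induced_iff verts_gr[OF U])
 show ?thesis
 proof
  assume l1: "length ls \<le> 1"
  show "connected_ig (gr U)"
  proof (cases ls)
   case Nil
   then have "U = {}" using c by (simp add: comps_def)
   then show ?thesis unfolding iff by (simp add: linked_def)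
  next
   case (Cons l ls')
   then have "U = set l" using c l1 by (simp add: comps_def)
   then show ?thesis unfolding iff
    using ok[of l] Cons linked_bfs_tree[of "set l" "hd l" par] by (simp add: comp_ok_def)
  qed
 next
  assume con: "connected_ig (gr U)"
  show "length ls \<le> 1"
  proof (rule ccontr)
   assume "\<not> length ls \<le> 1"
   then obtain l l' ls' where ls: "ls = l # l' # ls'" by (cases ls rule: remdups_adj.cases) auto
   have "l \<noteq> l'" using comps_distinct[OF c] ls by simp
   have l: "comp_ok U par l" "comp_ok U par l'" using ok ls by auto
   then obtain u w where u: "u \<in> set l" "w \<in> set l'" by (metis comp_ok_def list.set_intros(1) neq_Nil_conv)
   have sub: "set l \<subseteq> U" "set l' \<subseteq> U" using l by (auto simp: comp_ok_def closed_in_def)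
   have "dec w \<in> comp G (dec ` U) (dec u)"
    using linked_subset_comp[of G "dec ` U" "dec ` U" "dec u"] con u sub by (auto simp: iff)
   also have "comp G (dec ` U) (dec u) = dec ` set l"
    using l(1) u(1) by (intro comp_dec[OF U]) (auto simp: comp_ok_def)
   finally have "w \<in> set l" by (simp add: dec_image_iff)
   then show False using comps_disjoint[OF c, of l l' w] ls u \<open>l \<noteq> l'\<close> by auto
  qed
 qed
qed

lemma components_gr:
 assumes U: "U \<subseteq> {..<n}" and c: "comps U par ls"
 shows "components (gr U) = (\<lambda>l. gr (set l)) ` set ls"
proof -
 have *: "induced G (comp G (dec ` U) (dec u)) = gr (set l)" if "l \<in> set ls" "u \<in> set l" for l u
  using c that comp_dec[OF U, of "set l" "hd l" par u] by (auto simp: comps_def comp_ok_def gr_def)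
 have "components (gr U) = (\<lambda>u. induced G (comp G (dec ` U) (dec u))) ` U"
  unfolding gr_def components_induced verts_gr[OF U] by (simp add: image_image)
 also have "\<dots> = (\<lambda>l. gr (set l)) ` set ls"
 proof (intro equalityI subsetI)
  fix H assume "H \<in> (\<lambda>u. induced G (comp G (dec ` U) (dec u))) ` U"
  then obtain u where u: "u \<in> U" "H = induced G (comp G (dec ` U) (dec u))" by blast
  then obtain l where "l \<in> set ls" "u \<in> set l" using c by (auto simp: comps_def)
  then show "H \<in> (\<lambda>l. gr (set l)) ` set ls" using * u by blast
 next
  fix H assume "H \<in> (\<lambda>l. gr (set l)) ` set ls"
  then obtain l where l: "l \<in> set ls" "H = gr (set l)" by blast
  then obtain u where "u \<in> set l" using c by (metis comps_def comp_ok_def list.set_intros(1) neq_Nil_conv)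
  moreover have "u \<in> U" using c l \<open>u \<in> set l\<close> by (auto simp: comps_def)
  ultimately show "H \<in> (\<lambda>u. induced G (comp G (dec ` U) (dec u))) ` U" using * l by force
 qed
 finally show ?thesis .
qed

definition edge_pairs :: "nat set \<Rightarrow> nat \<Rightarrow> nat \<Rightarrow> (nat \<times> nat) list" where
 "edge_pairs U s v = (if v < nv
   then concat (map (\<lambda>(w, s'). if s' = s \<and> w \<in> U then [(v, w - nv)] else []) (adj v)) else [])"

lemma lab_edges_pairs: "lab_edges U s v = concat (map (\<lambda>(x, c). [x, c]) (edge_pairs U s v))"
proof -
 have "concat (map (\<lambda>(w, s'). if s' = s \<and> w \<in> U then [v, w - nv] else []) ys) =
  concat (map (\<lambda>(x, c). [x, c]) (concat (map (\<lambda>(w, s'). if s' = s \<and> w \<in> U then [(v, w - nv)] else []) ys)))" for ys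
  by (induction ys) auto
 then show ?thesis by (simp add: lab_edges_def edge_pairs_def)
qed

lemma code_edges_lab:
 "code_edges (concat (map (edge_pairs U s) xs)) =
  length (concat (map (lab_edges U s) xs)) div 2 # concat (map (lab_edges U s) xs)"
proof -
 have "concat (map (lab_edges U s) xs) = concat (map (\<lambda>(x, c). [x, c]) (concat (map (edge_pairs U s) xs)))"
  by (induction xs) (simp_all add: lab_edges_pairs)
 moreover have "length (concat (map (\<lambda>(x, c). [x, c]) es)) = 2 * length es" for es :: "(nat \<times> nat) list"
  by (induction es) auto
 ultimately show ?thesis by (simp add: code_edges_def)
qed

lemma set_edge_pairs:
 assumes "v < n"
 shows "set (edge_pairs U s v) = {(x, c). x = v \<and> v < nv \<and> nv + c \<in> U \<and> (nv + c, s) \<in> set (adj v)}"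
proof -
 have "nv \<le> w" if "v < nv" "(w, s') \<in> set (adj v)" for w s'
  using that adj_iff[OF assms] nb_type[of w v] by auto
 then show ?thesis unfolding edge_pairs_def by (fastforce split: if_splits)
qed

lemma distinct_edge_pairs:
 assumes "v < n" shows "distinct (edge_pairs U s v)"
proof (cases "v < nv")
 case True
 have nvw: "nv \<le> w" if "(w, s') \<in> set (adj v)" for w s'
  using that adj_iff[OF assms] nb_type[of w v] True by auto
 have "distinct (concat (map (\<lambda>(w, s'). if s' = s \<and> w \<in> U then [(v, w - nv)] else []) ys))"
  if "distinct (map fst ys)" "\<forall>y\<in>set ys. nv \<le> fst y" for ys
  using that
 proof (induction ys)
  case (Cons y ys)
  have "\<forall>z\<in>set ys. fst z - nv \<noteq> fst y - nv"
  proof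
   fix z assume z: "z \<in> set ys"
   then have "fst z \<in> set (map fst ys)" by simp
   moreover have "fst y \<notin> set (map fst ys)" using Cons.prems(1) by simp
   ultimately have "fst z \<noteq> fst y" by metis
   then show "fst z - nv \<noteq> fst y - nv" using Cons.prems(2) z by (simp add: eq_diff_iff)
  qed
  then show ?case using Cons by (cases y) (fastforce split: if_splits)
 qed simp
 then show ?thesis using adj_distinct[OF assms] nvw True by (force simp: edge_pairs_def)
qed (simp add: edge_pairs_def)

lemma distinct_edges:
 assumes "distinct xs" "set xs \<subseteq> {..<n}" shows "distinct (concat (map (edge_pairs U s) xs))"
 using assms
proof (induction xs)
 case (Cons v xs)
 have "set (edge_pairs U s v) \<inter> set (concat (map (edge_pairs U s) xs)) = {}"
  using Cons.prems by (auto simp: set_edge_pairs subset_iff)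
 then show ?case using Cons distinct_edge_pairs by simp
qed simp

lemma codes_lab:
 assumes xs: "distinct xs" "set xs \<subseteq> {..<n}" and cl: "closed_in (set xs) U"
 shows "codes_label (Graph (gr (set xs))) (lab U xs)"
proof -
 let ?vs = "concat (map (\<lambda>v. if v < nv then [v] else []) xs)"
 let ?cs = "concat (map (\<lambda>v. if v < nv then [] else [v - nv]) xs)"
 let ?es = "\<lambda>s. concat (map (edge_pairs U s) xs)"
 have vs: "distinct ?vs \<and> set ?vs = vars (gr (set xs))"
 proof
  show "distinct ?vs" using xs(1) by (induction xs) auto
  show "set ?vs = vars (gr (set xs))" by (auto simp: vars_gr split: if_splits)
 qed
 have cs: "distinct ?cs \<and> set ?cs = clauses (gr (set xs))"
 proof
  have "distinct ys \<Longrightarrow> distinct (concat (map (\<lambda>v. if v < nv then [] else [v - nv]) ys))" for ys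
  proof (induction ys)
   case (Cons y ys)
   then show ?case by (auto split: if_splits simp: not_less eq_diff_iff)
  qed simp
  then show "distinct ?cs" using xs(1) .
  have "clauses (gr (set xs)) = {c. nv + c \<in> set xs}"
   using xs(2) by (auto simp: gr_def induced_def nc Inr_dec)
  then show "set ?cs = clauses (gr (set xs))"
   by (auto split: if_splits)
 qed
 have inU: "nv + c \<in> set xs" if "x \<in> set xs" "nv + c \<in> U" "nv + c \<in> nb x" for x c
  using cl that by (auto simp: closed_in_def)
 have sub: "set xs \<subseteq> U" using cl by (simp add: closed_in_def)
 have inc: "nv + c \<in> nb x \<longleftrightarrow> (x, c) \<in> pos_edges G \<union> neg_edges G" if "x < nv" for x c
  using nb_incident[OF that, of "nv + c"] by (simp add: incident_iff)
 have disj: "pos_edges G \<inter> neg_edges G = {}" using ig by (simp add: incidence_graph_def)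
 have adj: "(nv + c, s) \<in> set (adj x) \<longleftrightarrow> nv + c \<in> nb x \<and> s = (if (x, c) \<in> pos_edges G then 0 else 1)"
  if "x < nv" "x < n" for x c s
  using adj_iff[OF that(2), of "nv + c" s] that(1) by (simp add: min_def max_def)
 have es: "distinct (?es s) \<and> set (?es s) = {(x, c). x < nv \<and> x \<in> set xs \<and> nv + c \<in> U \<and> (nv + c, s) \<in> set (adj x)}" for s
  using distinct_edges[OF xs] xs(2) by (auto simp: set_edge_pairs subset_iff)
 have mem: "(x, c) \<in> set (?es s) \<longleftrightarrow> x < nv \<and> x \<in> set xs \<and> nv + c \<in> U \<and> (nv + c, s) \<in> set (adj x)" for x c s
  unfolding conjunct2[OF es] by simp
 have pe: "x < nv \<and> nv + c < n" if "(x, c) \<in> pos_edges G \<union> neg_edges G" for x c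
  using ig that by (auto simp: incidence_graph_def nv nc)
 have ps: "set (?es 0) = pos_edges (gr (set xs))"
 proof -
  have "(x, c) \<in> set (?es 0) \<longleftrightarrow> (x, c) \<in> pos_edges (gr (set xs))" for x c
  proof -
   have "(x, c) \<in> set (?es 0) \<longleftrightarrow> x < nv \<and> x \<in> set xs \<and> nv + c \<in> U \<and> (x, c) \<in> pos_edges G"
    unfolding mem using xs(2) adj[of x c 0] inc[of x c] by (auto simp: subset_iff split: if_splits)
   also have "\<dots> \<longleftrightarrow> (x, c) \<in> pos_edges (gr (set xs))"
    using inU[of x c] inc[of x c] sub pe by (auto simp: gr_def induced_def Inl_dec Inr_dec)
   finally show ?thesis .
  qed
  then show ?thesis by (intro set_eqI) (metis surj_pair)
 qed
 have ns: "set (?es 1) = neg_edges (gr (set xs))"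
 proof -
  have "(x, c) \<in> set (?es 1) \<longleftrightarrow> (x, c) \<in> neg_edges (gr (set xs))" for x c
  proof -
   have neg: "(x, c) \<in> neg_edges G \<longleftrightarrow> (x, c) \<in> pos_edges G \<union> neg_edges G \<and> (x, c) \<notin> pos_edges G"
    using disj by blast
   have "(x, c) \<in> set (?es 1) \<longleftrightarrow> x < nv \<and> x \<in> set xs \<and> nv + c \<in> U \<and> (x, c) \<in> neg_edges G"
   proof (cases "x < nv \<and> x \<in> set xs")
    case True
    then have "x < n" using xs(2) by auto
    then show ?thesis unfolding mem neg using True adj[of x c 1] inc[of x c] by simp
   qed (simp only: mem, blast)
   also have "\<dots> \<longleftrightarrow> (x, c) \<in> neg_edges (gr (set xs))"
    using inU[of x c] inc[of x c] sub pe by (auto simp: gr_def induced_def Inl_dec Inr_dec)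
   finally show ?thesis .
  qed
  then show ?thesis by (intro set_eqI) (metis surj_pair)
 qed
 have lab: "lab U xs = 0 # length ?vs # ?vs @ length ?cs # ?cs @ code_edges (?es 0) @ code_edges (?es 1)"
  by (simp add: lab_def code_edges_lab Let_def)
 have cg: "codes_graph (gr (set xs))
   (length ?vs # ?vs @ length ?cs # ?cs @ code_edges (?es 0) @ code_edges (?es 1))"
  unfolding codes_graph_def
  by (intro exI[of _ ?vs] exI[of _ ?cs] exI[of _ "?es 0"] exI[of _ "?es 1"] conjI
    conjunct1[OF vs] conjunct2[OF vs] conjunct1[OF cs] conjunct2[OF cs] conjunct1[OF es] ps ns refl)
 show ?thesis unfolding lab by (rule codes_label.intros(1)[OF cg])
qed

text \<open>An adjacency entry goes into at most one of the two edge lists and takes two words. The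
  constant 5 counts the tag and the four lengths.\<close>

lemma length_lab: "length (lab U xs) \<le> 2 * wts xs + 5"
proof -
 have e: "length (lab_edges U 0 v) + length (lab_edges U 1 v) \<le> 2 * length (adj v)" for v
 proof -
  have "length (concat (map (\<lambda>(w, s'). if s' = 0 \<and> w \<in> U then [v, w - nv] else []) ys)) +
    length (concat (map (\<lambda>(w, s'). if s' = 1 \<and> w \<in> U then [v, w - nv] else []) ys)) \<le> 2 * length ys" for ys :: "(nat \<times> nat) list"
   by (induction ys) auto
  then show ?thesis by (simp add: lab_edges_def)
 qed
 have es: "length (concat (map (lab_edges U 0) xs)) + length (concat (map (lab_edges U 1) xs)) + 2 * length xs \<le> 2 * wts xs"
 proof (induction xs)
  case (Cons v xs)
  then show ?case using e[of v] by (simp add: wts_simps wt_def)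
 qed (simp add: wts_simps)
 have vc: "length (concat (map (\<lambda>v. if v < nv then [v] else []) xs)) +
   length (concat (map (\<lambda>v. if v < nv then [] else [v - nv]) xs)) = length xs"
  by (induction xs) auto
 show ?thesis unfolding lab_def Let_def using es vc by simp
qed

end

section \<open>The recursion\<close>

context machine
begin

definition sign_of :: "nat \<Rightarrow> sign" where "sign_of s = (if s = 0 then Positive else Negative)"

lemma adj_sat:
 assumes x: "x < nv" and s: "s \<in> {0, 1}"
 shows "w \<in> sat x (sign_of s) \<longleftrightarrow> (w, s) \<in> set (adj x)"
proof -
 have xn: "x < n" using x nv_le by simp
 have disj: "pos_edges G \<inter> neg_edges G = {}" using ig by (simp add: incidence_graph_def)
 have adj: "(w, s) \<in> set (adj x) \<longleftrightarrow> w \<in> nb x \<and> s = (if (min x w, max x w - nv) \<in> pos_edges G then 0 else 1)"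
  by (rule adj_iff[OF xn])
 show ?thesis
 proof (cases "nv \<le> w")
  case True
  then have "w \<in> nb x \<longleftrightarrow> (x, w - nv) \<in> pos_edges G \<union> neg_edges G"
   using nb_incident[OF x, of w] by (simp add: incident_iff)
  moreover have "min x w = x" "max x w = w" using True x by auto
  ultimately show ?thesis using adj True s disj by (auto simp: sat_def sign_of_def)
 next
  case False
  then show ?thesis using adj nb_type[of w x] x by (auto simp: sat_def)
 qed
qed

abbreviation (input) child_regs :: "reg set" where
 "child_regs \<equiv> {rUID, rF, rA0, rE0, rA, rV, rI, rL, rE, rT, rG, rSB, rSE, rB}"

text \<open>The recursive call is left open: \<open>call\<close> describes the state in which it is
  made and takes over the rest of the execution, so that the specification of \<open>node\<close>
  can be supplied later by induction.\<close>

lemma wp_child: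
 assumes st: "stat Z" and fr: "fresh Z" and B: "regs Z rB = B" "FB \<le> B" "B + W + W \<le> EN"
  and seg: "regs Z rSS = a" "regs Z rSD = a + length seg" "list_at (mem Z) a seg" "set seg \<subseteq> {..<n}"
   "a + length seg \<le> B + W"
  and x: "regs Z rXV = x" "x \<in> set seg" "x < nv" and s: "s \<in> {0, 1}"
  and call: "\<And>Y t. stat Y \<Longrightarrow> fresh Y \<Longrightarrow> regs Y rB = B + W \<Longrightarrow> regs Y rSB = a \<Longrightarrow>
   regs Y rSE = a + length seg \<Longrightarrow> regs Z rUID \<le> regs Y rUID \<Longrightarrow>
   (\<And>v. v < n \<Longrightarrow> mem Y (B + W + v) = regs Y rUID \<longleftrightarrow> v \<in> set seg - {x} - sat x (sign_of s)) \<Longrightarrow>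
   same {B + W..<B + W + n} child_regs Z Y \<Longrightarrow> t \<le> 30 * wts seg + 30 \<Longrightarrow>
   wp P (Call 1) (\<lambda>t' Y'. Q (t + t') (set_reg rB (regs Y' rB - regs Y' rW) Y')) Y"
 shows "wp P (child s) Q Z"
proof -
 let ?u = "Suc (regs Z rUID)"
 let ?C = "B + W"
 let ?s = "Z\<lparr>regs := (regs Z)(rUID := ?u, rF := ?C, rA0 := a, rE0 := a + length seg)\<rparr>"
 have s0: "same {} child_regs Z ?s" by (simp add: same_def)
 have st_s: "stat ?s" by (rule stat_same[OF st s0]) auto
 have le: "mem Z (?C + v) \<noteq> ?u" if "v < n" for v
 proof -
  have "mem Z (?C + v) \<le> regs Z rUID" using fr that B FT_MK by (simp add: fresh_def)
  then show ?thesis by simp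
 qed
 have FC: "FT \<le> ?C" using B FT_MK by simp
 let ?R = "{rA, rV, rI, rL}"
 let ?I = "\<lambda>ys Y. same {?C..<?C + n} ?R ?s Y \<and>
  (\<forall>v<n. mem Y (?C + v) = (if v \<in> set ys then ?u else mem Z (?C + v)))"
 have mark: "wp P (for_seg (block [Add rA rF rV, Store rA rUID])) (\<lambda>t Y. ?I seg Y \<and> t \<le> 9 * length seg + 4) ?s"
 proof (rule wp_for_seg[where I = ?I and \<Phi> = "\<lambda>_. 0" and a = a and cost = "\<lambda>_. 3"])
  show "regs ?s rA0 = a" by simp
  show "?I [] ?s" by (simp add: same_refl)
  show "regs Y rZ = 0 \<and> regs Y rONE = 1 \<and> list_at (mem Y) a seg \<and> regs Y rE0 = a + length seg" if "?I ys Y" for ys Y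
  proof -
   have sm: "same {?C..<?C + n} ?R ?s Y" using that by blast
   have "stat Y" by (rule stat_same[OF st_s sm]) (use FC in auto)
   note stat_regs(1,10)[OF this]
   moreover have "list_at (mem Y) a seg"
    by (rule list_at_cong[OF seg(3)]) (use same_mem[OF sm] seg(5) in simp)
   moreover have "regs Y rE0 = a + length seg" using same_reg[OF sm, of rE0] by simp
   ultimately show ?thesis by simp
  qed
  show "?I ys (set_reg r y Y) \<and> (0::nat) = 0" if "?I ys Y" "r \<in> {rI, rL, rV}" for ys Y r y
   using same_trans[OF conjunct1[OF that(1)] set_reg_same[of r ?R "{?C..<?C + n}" Y y]] that
   by (auto simp: set_reg_def)
 next
  fix ys v zs Y assume xs: "seg = ys @ v # zs" and I: "?I ys Y" and v: "regs Y rV = v"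
  have vn: "v < n" using xs seg(4) by simp
  have r: "regs Y rF = ?C" "regs Y rUID = ?u" using I by (simp_all add: same_def)
  let ?t = "Y\<lparr>regs := (regs Y)(rA := ?C + v), mem := (mem Y)(?C + v := ?u)\<rparr>"
  have "same {?C..<?C + n} ?R Y ?t" using vn by (simp add: same_def)
  then have "same {?C..<?C + n} ?R ?s ?t" using I same_trans by blast
  then have "?I (ys @ [v]) ?t" using I by auto
  moreover have "wp P (block [Add rA rF rV, Store rA rUID]) Q' Y \<longleftrightarrow> Q' (Suc (Suc (Suc 0))) ?t" for Q'
   using r v by (simp add: wp_funs set_reg_def)
  ultimately show "wp P (block [Add rA rF rV, Store rA rUID])
    (\<lambda>t Y'. ?I (ys @ [v]) Y' \<and> regs Y' rI = regs Y rI \<and> t + 0 \<le> 3 + 0) Y" by simp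
 qed (simp add: sum_list_triv)
 let ?J = "\<lambda>ws Y. same {?C..<?C + n} {rA, rV, rI, rL, rE, rT, rG} ?s Y \<and>
  (\<forall>v<n. (mem Y (?C + v) = ?u \<longleftrightarrow> v \<in> set seg - {x} \<and> (v, s) \<notin> set ws) \<and> mem Y (?C + v) \<le> ?u)"
 have stJ: "stat Y" if "?J ws Y" for ws Y
  by (rule stat_same[OF st_s conjunct1[OF that]]) (use FC in auto)
 have xn: "x < n" using x seg(4) by auto
 have kill: "wp P (for_adj rXV (if_sign s (block [Add rA rF rT, Store rA rZ])))
  (\<lambda>t Y. ?J (adj x) Y \<and> t \<le> (6 + 7) * length (adj x) + 4) Y0" if J0: "?J [] Y0" for Y0
 proof (rule wp_for_adj[OF xn, where I = ?J and cost = 6])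
  show "regs Y0 rXV = x" using same_reg[OF conjunct1[OF J0], of rXV] x(1) by simp
  show "?J [] Y0" by (rule J0)
  show "stat Y" if "?J ws Y" for ws Y by (rule stJ[OF that])
  show "?J ws (set_reg r y Y)" if "?J ws Y" "r \<in> {rE, rA, rT, rG}" for ws Y r y
   using same_trans[OF conjunct1[OF that(1)] set_reg_same[of r "{rA, rV, rI, rL, rE, rT, rG}" "{?C..<?C + n}" Y y]] that
   by (auto simp: set_reg_def)
 next
  fix ws w s' us Y assume a: "adj x = ws @ (w, s') # us" and J: "?J ws Y" and r: "regs Y rT = w" "regs Y rG = s'"
  have "(w, s') \<in> set (adj x)" by (simp add: a)
  then have w: "w < n" "s' \<in> {0, 1}" using adj_iff[OF xn] nb_less by (auto split: if_splits)
  have sm: "same {?C..<?C + n} {rA, rV, rI, rL, rE, rT, rG} ?s Y" using J by blast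
  have rr: "regs Y rF = ?C" "regs Y rZ = 0" using same_reg[OF sm, of rF] stat_regs[OF stJ[OF J]] by simp_all
  let ?t = "Y\<lparr>regs := (regs Y)(rA := ?C + w), mem := (mem Y)(?C + w := 0)\<rparr>"
  have "same {?C..<?C + n} {rA, rV, rI, rL, rE, rT, rG} Y ?t" using w by (simp add: same_def)
  then have sm': "same {?C..<?C + n} {rA, rV, rI, rL, rE, rT, rG} ?s ?t" by (rule same_trans[OF sm])
  show "wp P (if_sign s (block [Add rA rF rT, Store rA rZ]))
    (\<lambda>t Y'. ?J (ws @ [(w, s')]) Y' \<and> regs Y' rE = regs Y rE \<and> t \<le> 6) Y"
  proof (cases "s' = s")
   case True
   have "?J (ws @ [(w, s')]) ?t" using sm' J True by auto
   moreover have "wp P (if_sign s (block [Add rA rF rT, Store rA rZ])) Q' Y \<longleftrightarrow> Q' (Suc (Suc (Suc (Suc 0)))) ?t" for Q'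
    using True s r rr by (auto simp: if_sign_def wp_funs set_reg_def)
   ultimately show ?thesis by simp
  next
   case False
   then have "?J (ws @ [(w, s')]) Y" using J by auto
   moreover have "wp P (if_sign s (block [Add rA rF rT, Store rA rZ])) Q' Y \<longleftrightarrow> Q' (Suc (Suc 0)) Y" for Q'
    using False s w(2) r by (auto simp: if_sign_def wp_funs)
   ultimately show ?thesis by simp
  qed
 qed blast
 have run: "wp P (child s) Q Z \<longleftrightarrow> wp P (for_seg (block [Add rA rF rV, Store rA rUID])) (\<lambda>t Y.
   wp P (for_adj rXV (if_sign s (block [Add rA rF rT, Store rA rZ]))) (\<lambda>t' Y'.
    wp P (Call 1) (\<lambda>t''. \<lambda>N. Q (t + (t' + t'') + 11) (set_reg rB (regs N rB - regs N rW) N))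
     (Y'\<lparr>regs := (regs Y')(rSB := regs Y' rSS + regs Y' rZ, rSE := regs Y' rSD + regs Y' rZ, rB := regs Y' rF + regs Y' rZ)\<rparr>))
    (Y\<lparr>regs := (regs Y)(rA := regs Y rF + regs Y rXV), mem := (mem Y)(regs Y rF + regs Y rXV := regs Y rZ)\<rparr>)) ?s" for Q
  unfolding child_def using seg(1,2) B(1) stat_regs[OF st]
  by (simp only: block.simps wp_funs) (simp add: set_reg_def add_numeral_Suc)
 show ?thesis unfolding run
 proof (rule wp_mono[OF mark])
  fix t :: nat and Y assume I: "?I seg Y \<and> t \<le> 9 * length seg + 4"
  have sm: "same {?C..<?C + n} ?R ?s Y" using I by blast
  have st_t: "stat Y" by (rule stat_same[OF st_s sm]) (use FC in auto)
  have rr: "regs Y rF = ?C" "regs Y rXV = x" "regs Y rZ = 0"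
   using same_reg[OF sm, of rF] same_reg[OF sm, of rXV] x(1) stat_regs[OF st_t] by simp_all
  let ?t = "Y\<lparr>regs := (regs Y)(rA := ?C + x), mem := (mem Y)(?C + x := 0)\<rparr>"
  have s1: "same {?C..<?C + n} {rA, rV, rI, rL, rE, rT, rG} Y ?t" using xn by (simp add: same_def)
  have "same {?C..<?C + n} {rA, rV, rI, rL, rE, rT, rG} ?s ?t"
   by (rule same_trans[OF same_mono[OF sm] s1]) auto
  moreover have "mem Z (?C + v) \<le> ?u" if "v < n" for v
   using that fr B FT_MK by (simp add: fresh_def le_SucI)
  ultimately have J0: "?J [] ?t" using I le by auto
  show "wp P (for_adj rXV (if_sign s (block [Add rA rF rT, Store rA rZ]))) (\<lambda>t' Y'.
    wp P (Call 1) (\<lambda>t''. \<lambda>N. Q (t + (t' + t'') + 11) (set_reg rB (regs N rB - regs N rW) N))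
     (Y'\<lparr>regs := (regs Y')(rSB := regs Y' rSS + regs Y' rZ, rSE := regs Y' rSD + regs Y' rZ, rB := regs Y' rF + regs Y' rZ)\<rparr>))
    (Y\<lparr>regs := (regs Y)(rA := regs Y rF + regs Y rXV), mem := (mem Y)(regs Y rF + regs Y rXV := regs Y rZ)\<rparr>)"
   unfolding rr
  proof (rule wp_mono[OF kill[OF J0]])
   fix t' :: nat and N assume J: "?J (adj x) N \<and> t' \<le> (6 + 7) * length (adj x) + 4"
   let ?f = "N\<lparr>regs := (regs N)(rSB := regs N rSS + regs N rZ, rSE := regs N rSD + regs N rZ, rB := regs N rF + regs N rZ)\<rparr>"
   have sJ: "same {?C..<?C + n} {rA, rV, rI, rL, rE, rT, rG} ?s N" using J by blast
   have st_r: "stat N" by (rule stJ[OF conjunct1[OF J]])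
   have sf: "same {} {rSB, rSE, rB} N ?f" by (simp add: same_def)
   have r: "regs N rSS = a" "regs N rSD = a + length seg" "regs N rF = ?C" "regs N rZ = 0" "regs N rUID = ?u"
    using seg(1,2) same_reg[OF sJ, of rSS] same_reg[OF sJ, of rSD] same_reg[OF sJ, of rF] same_reg[OF sJ, of rUID]
     stat_regs[OF st_r] by simp_all
   have all: "same {?C..<?C + n} child_regs Z ?f"
    by (rule same_trans[OF same_mono[OF s0] same_trans[OF same_mono[OF sJ] same_mono[OF sf]]]) auto
   have "1 \<le> length seg" using x(2) by (cases seg) auto
   have "wt x \<le> wts seg"
    using x(2) unfolding wts_def by (simp add: member_le_sum_list)
   then have time: "t + t' + 11 \<le> 30 * wts seg + 30"
    using I J length_le_wts[of seg] by (simp add: wt_def)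
   have "wp P (Call 1) (\<lambda>t'' N'. Q (t + t' + 11 + t'') (set_reg rB (regs N' rB - regs N' rW) N')) ?f"
   proof (rule call[OF _ _ _ _ _ _ _ all time])
    show "stat ?f" by (rule stat_same[OF st_r sf]) auto
    show "fresh ?f"
    proof (rule fresh_same[OF fr all])
     fix b assume "b \<in> {?C..<?C + n}"
     then obtain v where "b = ?C + v" "v < n" by (metis atLeastLessThan_iff le_Suc_ex nat_add_left_cancel_less)
     moreover have "mem N (?C + v) \<le> ?u" if "v < n" for v
      using J that by blast
     ultimately show "mem ?f b \<le> regs ?f rUID" using r by simp
    qed (use r in simp)
    show "mem ?f (?C + v) = regs ?f rUID \<longleftrightarrow> v \<in> set seg - {x} - sat x (sign_of s)" if "v < n" for v
     using J that r adj_sat[OF x(3) s] by simp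
   qed (use r in simp_all)
   then show "wp P (Call 1) (\<lambda>t''. \<lambda>N. Q (t + (t' + t'') + 11) (set_reg rB (regs N rB - regs N rW) N)) ?f"
    by (simp only: add.assoc add.commute add.left_commute)
  qed
 qed
qed

text \<open>What a call may overwrite: the marks, the stage table beyond its first l entries, memory
  from B up to the output, and the output buffer from its present end. The stages and frames of the
  callers are thus safe.\<close>

definition region :: "nat \<Rightarrow> nat \<Rightarrow> nat \<Rightarrow> nat set" where
 "region l B q = {MK..<MK + n} \<union> {FT + Suc l..<MK} \<union> {B..<EN} \<union> {q..}"

definition ran :: "reg set \<Rightarrow> nat \<Rightarrow> nat \<Rightarrow> nat list \<Rightarrow> state \<Rightarrow> state \<Rightarrow> bool" where
 "ran R l B us Z Z' \<longleftrightarrow> stat Z' \<and> fresh Z' \<and> regs Z rUID \<le> regs Z' rUID \<and> EN \<le> regs Z rOUT \<and>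
   same (region l B (regs Z rOUT)) R Z Z' \<and> wrote us Z Z'"

text \<open>Preserved are the constants, the frame pointer, the remaining budget and the start of
  the output. Frame pointer and budget do change on the way but are reset.\<close>

abbreviation (input) node_regs :: "reg set" where
 "node_regs \<equiv> - ({..10} \<union> {18, 19})"

lemma MK_n_EN: "MK + n \<le> EN"
 by (simp add: EN FB)

lemma ranD:
 assumes "ran R l B us Z Z'"
 shows "stat Z'" "fresh Z'" "regs Z rUID \<le> regs Z' rUID" "EN \<le> regs Z rOUT"
  "same (region l B (regs Z rOUT)) R Z Z'" "wrote us Z Z'" "EN \<le> regs Z' rOUT"
  "regs Z' rOUT = regs Z rOUT + length us"
 using assms by (auto simp: ran_def wrote_def)

lemma ran_trans:
 assumes "ran R l B us Z Z1" "ran R' l' B' vs Z1 Z2" "l \<le> l'" "B \<le> B'" "R' \<subseteq> R"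
 shows "ran R l B (us @ vs) Z Z2"
proof -
 note 1 = ranD[OF assms(1)] and 2 = ranD[OF assms(2)]
 have sub: "region l' B' (regs Z1 rOUT) \<subseteq> region l B (regs Z rOUT)"
  using 1(8) assms(3,4) by (auto simp: region_def)
 have "same (region l B (regs Z rOUT)) R Z Z2"
  by (rule same_trans[OF 1(5) same_mono[OF 2(5) sub assms(5)]])
 moreover have "wrote (us @ vs) Z Z2"
  by (rule wrote_trans[OF 1(6) 2(6) 2(5)])
   (use 1(4) FT_MK MK_n_EN in \<open>auto simp: region_def\<close>)
 ultimately show ?thesis using 1 2 by (simp add: ran_def)
qed

lemma ran_mono: "ran R l B us Z Z' \<Longrightarrow> l' \<le> l \<Longrightarrow> B' \<le> B \<Longrightarrow> R \<subseteq> R' \<Longrightarrow> ran R' l' B' us Z Z'"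
 unfolding ran_def by (auto intro!: same_mono[of _ R Z Z' _ R'] simp: region_def)

lemma ran_same:
 assumes "stat Z'" "fresh Z'" "regs Z rUID \<le> regs Z' rUID" "same A R Z Z'"
  "A \<subseteq> {MK..<MK + n} \<union> {FT + Suc l..<MK} \<union> {B..<EN}" "rOUT \<notin> R" "EN \<le> regs Z rOUT"
 shows "ran R l B [] Z Z'"
proof -
 have "same (region l B (regs Z rOUT)) R Z Z'"
  by (rule same_mono[OF assms(4)]) (use assms(5) in \<open>auto simp: region_def\<close>)
 moreover have "wrote [] Z Z'" using same_reg[OF assms(4,6)] by (simp add: wrote_Nil)
 ultimately show ?thesis using assms by (simp add: ran_def)
qed

lemma ran_regs:
 assumes "stat Z" "fresh Z" "EN \<le> regs Z rOUT" "same {} R Z Z'"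
  "R \<inter> {0, 1, 2, 3, 4, 5, 6, 7, 8, 18, rUID, rOUT} = {}"
 shows "ran R l B [] Z Z'"
proof -
 have u: "regs Z' rUID = regs Z rUID" by (rule same_reg[OF assms(4)]) (use assms(5) in auto)
 show ?thesis
 proof (rule ran_same[OF _ _ _ assms(4)])
  show "stat Z'" by (rule stat_same[OF assms(1,4)]) (use assms(5) in auto)
  show "fresh Z'" by (rule fresh_same[OF assms(2,4)]) (use u in auto)
 qed (use assms u in auto)
qed

lemma ran_emits:
 assumes "stat Z" "fresh Z" "EN \<le> regs Z rOUT" "emits R us Z Z'"
  "R \<inter> {0, 1, 2, 3, 4, 5, 6, 7, 8, 18, rUID} = {}"
 shows "ran R l B us Z Z'"
proof -
 have s: "same {regs Z rOUT..} R Z Z'" "wrote us Z Z'" using assms(4) by (simp_all add: emits_def)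
 have u: "regs Z' rUID = regs Z rUID" by (rule same_reg[OF s(1)]) (use assms(5) in auto)
 have "stat Z'" by (rule stat_same[OF assms(1) s(1)]) (use assms(3,5) FT_MK in auto)
 moreover have "fresh Z'" by (rule fresh_same[OF assms(2) s(1)]) (use u assms(3) in auto)
 moreover have "same (region l B (regs Z rOUT)) R Z Z'"
  by (rule same_mono[OF s(1)]) (auto simp: region_def)
 ultimately show ?thesis using s u assms(3) by (simp add: ran_def)
qed

lemma ran_reg: "ran R l B us Z Z' \<Longrightarrow> r \<notin> R \<Longrightarrow> regs Z' r = regs Z r"
 by (simp add: ran_def same_def)

lemma ran_mem:
 assumes "ran R l B us Z Z'" "MK + n \<le> b" "b < B" "B \<le> EN" shows "mem Z' b = mem Z b"
 by (rule same_mem[OF ranD(5)[OF assms(1)]]) (use assms ranD(4)[OF assms(1)] in \<open>auto simp: region_def\<close>)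

lemma ran_list_at:
 assumes "ran R l B us Z Z'" "list_at (mem Z) b xs" "MK + n \<le> b" "b + length xs \<le> B" "B \<le> EN"
 shows "list_at (mem Z') b xs"
 by (rule list_at_cong[OF assms(2)]) (rule ran_mem[OF assms(1)], use assms in auto)

lemma ran_stg_at:
 assumes "ran R l B us Z Z'" "stg_at stg bnd Z" "hist D stg X U" "length stg \<le> l" "length stg \<le> D" "bnd \<le> B" "B \<le> EN" "FB \<le> B"
  "regs Z' rST = regs Z rST" "regs Z' rSH = regs Z rSH"
 shows "stg_at stg bnd Z'"
proof -
 have s: "same (region l B (regs Z rOUT)) {} Z (Z'\<lparr>regs := regs Z\<rparr>)"
  using ranD(5)[OF assms(1)] by (simp add: same_def)
 have "FT + D < MK" "MK + n \<le> FB" by (simp_all add: MK FB)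
 then have "stg_at stg bnd (Z'\<lparr>regs := regs Z\<rparr>)"
  by (intro stg_at_same[OF assms(2) s _ _ _ assms(3)])
   (use assms(4-8) FT_MK ranD(4)[OF assms(1)] in \<open>auto simp: region_def\<close>)
 then show ?thesis using assms(9,10) by (simp add: stg_at_def)
qed

lemma wp_locals:
 assumes "stat Z" "regs Z rB = B"
 shows "wp P (locals j) Q Z \<longleftrightarrow> Q 7 (set_reg rP (B + 4 * n + j) Z)"
 using stat_regs[OF assms(1)] assms(2)
 by (simp add: locals_def wp_funs set_reg_def numeral_eq_Suc ac_simps)

lemma wp_save:
 assumes "regs Z rONE = 1" "regs Z rP = p" "rP \<notin> set rs"
  and "\<And>Z'. same {p..<p + length rs} {rP} Z Z' \<Longrightarrow> list_at (mem Z') p (map (regs Z) rs) \<Longrightarrow>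
   Q (3 * length rs + 1) Z'"
 shows "wp P (save rs) Q Z"
 using assms
proof (induction rs arbitrary: Z p Q)
 case Nil
 then show ?case by (simp add: wp_funs same_refl list_at_Nil)
next
 case (Cons r rs)
 let ?s = "Z\<lparr>mem := (mem Z)(p := regs Z r), regs := (regs Z)(rP := Suc p)\<rparr>"
 have "wp P (save rs) (\<lambda>t. Q (t + 3)) ?s"
 proof (rule Cons.IH[where p = "Suc p"])
  fix Z' assume s: "same {Suc p..<Suc p + length rs} {rP} ?s Z'" and l: "list_at (mem Z') (Suc p) (map (regs ?s) rs)"
  have "Q (3 * length (r # rs) + 1) Z'"
  proof (rule Cons.prems(4))
   show "same {p..<p + length (r # rs)} {rP} Z Z'" using s by (auto simp: same_def)
   have "map (regs ?s) rs = map (regs Z) rs" using Cons.prems(3) by auto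
   moreover have "mem Z' p = regs Z r" using s by (simp add: same_def)
   ultimately show "list_at (mem Z') p (map (regs Z) (r # rs))" using l by (simp only: list_at_Cons list.map)
  qed
  then show "Q (3 * length rs + 1 + 3) Z'" by (simp add: algebra_simps)
 qed (use Cons.prems in auto)
 then show ?case using Cons.prems(1,2)
  by (simp add: wp_funs set_reg_def add_numeral_Suc)
qed

lemma wp_restore:
 assumes "regs Z rONE = 1" "regs Z rP = p" "rP \<notin> set rs" "rONE \<notin> set rs" "distinct rs"
  "list_at (mem Z) p vs" "length vs = length rs"
  and "\<And>Z'. same {} (insert rP (set rs)) Z Z' \<Longrightarrow> map (regs Z') rs = vs \<Longrightarrow> Q (3 * length rs + 1) Z'"
 shows "wp P (restore rs) Q Z"
 using assms
proof (induction rs arbitrary: Z p vs Q)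
 case Nil
 then show ?case by (simp add: wp_funs same_refl)
next
 case (Cons r rs)
 then obtain v vs' where vs: "vs = v # vs'" by (cases vs) auto
 let ?s = "Z\<lparr>regs := (regs Z)(r := v, rP := Suc p)\<rparr>"
 have m: "mem Z p = v" "list_at (mem Z) (Suc p) vs'" using Cons.prems(6) vs by (simp_all add: list_at_Cons)
 have "wp P (restore rs) (\<lambda>t. Q (t + 3)) ?s"
 proof (rule Cons.IH[where p = "Suc p" and vs = vs'])
  fix Z' assume s: "same {} (insert rP (set rs)) ?s Z'" and l: "map (regs Z') rs = vs'"
  have "Q (3 * length (r # rs) + 1) Z'"
  proof (rule Cons.prems(8))
   show "same {} (insert rP (set (r # rs))) Z Z'" using s by (auto simp: same_def)
   have "regs Z' r = v" using same_reg[OF s, of r] Cons.prems(3,5) by simp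
   then show "map (regs Z') (r # rs) = vs" using l vs by simp
  qed
  then show "Q (3 * length rs + 1 + 3) Z'" by (simp add: algebra_simps)
 qed (use Cons.prems m vs in auto)
 moreover have "wp P (restore (r # rs)) Q Z \<longleftrightarrow> wp P (restore rs) (\<lambda>t. Q (t + 3)) ?s"
  using Cons.prems(1-5) m by (auto simp: wp_funs set_reg_def numeral_eq_Suc)
 ultimately show ?case by blast
qed

section \<open>Correctness of the recursion\<close>

text \<open>f and f' are the failure flag before and after. A clear flag at the end certifies all
  the output so far. A flag that was already set is passed on without a new claim, so the outcomes
  of consecutive parts can be chained.\<close>

definition outcome :: "bool \<Rightarrow> nat \<Rightarrow> nat \<Rightarrow> bool" where
 "outcome ok f f' \<longleftrightarrow> (if f' = 0 then f = 0 \<and> ok else f \<noteq> 0 \<or> enat k < srbd class0 G)"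

definition node_ok :: "nat set \<Rightarrow> nat \<Rightarrow> nat list \<Rightarrow> bool" where
 "node_ok U b us \<longleftrightarrow> (\<exists>T. label T = Graph (gr U) \<and> bd_subtree class0 T \<and> bd_depth T \<le> b \<and> codes_tree T us)"

text \<open>The code of a tree without the label of its root, which is written earlier. Vertices and
  edges may be listed in any order, so every code of the label has to be completed
  correctly.\<close>

definition tail_ok :: "nat set \<Rightarrow> nat \<Rightarrow> nat list \<Rightarrow> bool" where
 "tail_ok K b us \<longleftrightarrow> (\<forall>ws. codes_label (Graph (gr K)) ws \<longrightarrow> node_ok K b (ws @ us))"

lemma outcome_trans:
 "outcome ok f f1 \<Longrightarrow> outcome ok' f1 f2 \<Longrightarrow> (ok \<Longrightarrow> ok' \<Longrightarrow> ok'') \<Longrightarrow> outcome ok'' f f2"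
 by (auto simp: outcome_def split: if_splits)

lemma outcome_mono: "outcome ok f f' \<Longrightarrow> (ok \<Longrightarrow> ok') \<Longrightarrow> outcome ok' f f'"
 by (auto simp: outcome_def split: if_splits)

lemma tail_ok_leaf:
 assumes "\<not> edgy K" shows "tail_ok K b [0]"
 unfolding tail_ok_def node_ok_def
proof (intro allI impI)
 fix ws assume w: "codes_label (Graph (gr K)) ws"
 have "codes_tree (Node (Graph (gr K)) []) (ws @ length ([] :: (nat, nat) bd_tree list) # concat [])"
  by (rule codes_tree.intros[OF w]) simp
 moreover have "bd_subtree class0 (Node (Graph (gr K)) [])"
  by (rule bd_subtree.leaf) (simp add: gr_class0 assms)
 ultimately show "\<exists>T. label T = Graph (gr K) \<and> bd_subtree class0 T \<and> bd_depth T \<le> b \<and> codes_tree T (ws @ [0])"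
  by (intro exI[of _ "Node (Graph (gr K)) []"]) simp
qed

lemma tail_ok_branch:
 assumes c: "connected_ig (gr K)" and x: "x \<in> K" "x < nv"
  and 1: "node_ok (K - {x} - sat x Positive) b us1" and 2: "node_ok (K - {x} - sat x Negative) b us2"
 shows "tail_ok K (Suc b) ([1, 1, x, 2] @ us1 @ us2)"
 unfolding tail_ok_def
proof (intro allI impI)
 fix ws assume w: "codes_label (Graph (gr K)) ws"
 obtain T1 where T1: "label T1 = Graph (gr (K - {x} - sat x Positive))" "bd_subtree class0 T1" "bd_depth T1 \<le> b" "codes_tree T1 us1"
  using 1 unfolding node_ok_def by blast
 obtain T2 where T2: "label T2 = Graph (gr (K - {x} - sat x Negative))" "bd_subtree class0 T2" "bd_depth T2 \<le> b" "codes_tree T2 us2"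
  using 2 unfolding node_ok_def by blast
 let ?V = "Node (Var x) [T1, T2]" let ?T = "Node (Graph (gr K)) [?V]"
 have "codes_tree ?V ([1, x] @ length [T1, T2] # concat [us1, us2])"
  by (rule codes_tree.intros[OF codes_label.intros(2)]) (use T1 T2 in simp)
 then have "codes_tree ?T (ws @ length [?V] # concat [[1, x] @ length [T1, T2] # concat [us1, us2]])"
  by (intro codes_tree.intros[OF w]) simp
 moreover have "bd_subtree class0 ?T"
  by (rule bd_subtree.variable[OF c]) (use T1 T2 assign_gr[OF x] vars_gr x in simp_all)
 moreover have "bd_depth ?T \<le> Suc b" using T1 T2 by simp
 ultimately show "node_ok K (Suc b) (ws @ [1, 1, x, 2] @ us1 @ us2)"
  unfolding node_ok_def by (intro exI[of _ ?T]) (simp add: numeral_2_eq_2)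
qed

text \<open>An empty list of components belongs to the empty graph, which is a leaf because it
  counts as connected.\<close>

lemma node_ok_split:
 assumes U: "U \<subseteq> {..<n}" and c: "comps U par ls" and ls: "length ls \<noteq> 1"
  and w: "codes_label (Graph (gr U)) ws"
  and sub: "list_all2 (\<lambda>l us. node_ok (set l) b us) ls uss"
 shows "node_ok U b (ws @ length ls # concat uss)"
proof (cases "ls = []")
 case True
 then have "\<not> edgy U" using c by (simp add: comps_def edgy_def)
 then have "tail_ok U b [0]" by (rule tail_ok_leaf)
 then show ?thesis using w True sub by (simp add: tail_ok_def)
next
 case False
 have "\<exists>T. label T = Graph (gr (set (ls ! i))) \<and> bd_subtree class0 T \<and> bd_depth T \<le> b \<and> codes_tree T (uss ! i)"
  if "i < length ls" for i
  using list_all2_nthD[OF sub that] unfolding node_ok_def .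
 then obtain T where T: "\<And>i. i < length ls \<Longrightarrow> label (T i) = Graph (gr (set (ls ! i))) \<and> bd_subtree class0 (T i) \<and>
   bd_depth (T i) \<le> b \<and> codes_tree (T i) (uss ! i)" by metis
 let ?Ts = "map T [0..<length ls]"
 have len: "length uss = length ls" using list_all2_lengthD[OF sub] by simp
 have lab: "map label ?Ts = map (\<lambda>l. Graph (gr (set l))) ls"
  by (rule nth_equalityI) (use T in auto)
 \<comment> \<open>The split rule wants distinct labels. Different components induce different
   graphs, as they are nonempty and disjoint.\<close>
 have inj: "inj_on (\<lambda>l. Graph (gr (set l)) :: (nat, nat) bd_label) (set ls)"
 proof (rule inj_onI)
  fix l l' assume l: "l \<in> set ls" "l' \<in> set ls" and "(Graph (gr (set l)) :: (nat, nat) bd_label) = Graph (gr (set l'))"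
  then have "gr (set l) = gr (set l')" by simp
  moreover have "set l \<subseteq> {..<n}" "set l' \<subseteq> {..<n}" using l c U by (auto simp: comps_def)
  ultimately have "set l = set l'" using gr_inj by blast
  moreover have "l \<noteq> []" using c l(1) by (auto simp: comps_def comp_ok_def)
  ultimately show "l = l'" using comps_disjoint[OF c l, of "hd l"] hd_in_set[of l] by simp
 qed
 have "bd_subtree class0 (Node (Graph (gr U)) ?Ts)"
 proof (rule bd_subtree.split)
  show "\<not> connected_ig (gr U)" using comps_linked[OF U c] ls False by (cases ls; cases "tl ls") auto
  show "\<forall>T\<in>set ?Ts. bd_subtree class0 T" using T by simp
  show "distinct (map label ?Ts)" unfolding lab
   using inj comps_distinct[OF c] by (simp add: distinct_map)
  show "set (map label ?Ts) = Graph ` components (gr U)" unfolding lab components_gr[OF U c] by auto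
 qed
 moreover have "bd_depth (Node (Graph (gr U)) ?Ts) \<le> b" using T by simp
 moreover have "codes_tree (Node (Graph (gr U)) ?Ts) (ws @ length ?Ts # concat uss)"
  by (rule codes_tree.intros[OF w]) (use T len in \<open>simp add: list_all2_conv_all_nth\<close>)
 ultimately show ?thesis unfolding node_ok_def
  by (intro exI[of _ "Node (Graph (gr U)) ?Ts"]) simp
qed

text \<open>Assigning a variable makes two calls, each of cost \<open>cost b * (1 + w)\<close>,
  which is at most \<open>2 * cost b * w\<close> for a component of weight \<open>w \<ge> 1\<close>.
  These four shares and a fifth one for the linear work of the level give the base 5. The linear
  work contains a factor of D + 1, since a marked path is followed for D steps.\<close>

definition cost :: "nat \<Rightarrow> nat" where "cost b = 8000 * (D + 1) * 5 ^ b"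

text \<open>The list xs is the segment of the caller and may contain vertices that were deleted
  since; the stamps single out U. Each stage comes with an assigned variable, so
  \<open>length stg \<le> card X\<close> keeps the stage table within its D entries.\<close>

definition node_pre :: "nat \<Rightarrow> nat \<Rightarrow> nat set \<Rightarrow> nat list \<Rightarrow> nat \<Rightarrow> nat set \<Rightarrow> stage list \<Rightarrow> state \<Rightarrow> bool" where
 "node_pre b B U xs a X stg Z \<longleftrightarrow>
   stat Z \<and> fresh Z \<and> regs Z rB = B \<and> FB \<le> B \<and> B + W * Suc b \<le> EN \<and> regs Z rBUD = b \<and>
   regs Z rSB = a \<and> regs Z rSE = a + length xs \<and> list_at (mem Z) a xs \<and> a + length xs \<le> B \<and>
   set xs \<subseteq> {..<n} \<and> distinct xs \<and> U \<subseteq> set xs \<and>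
   (\<forall>v<n. mem Z (B + v) = regs Z rUID \<longleftrightarrow> v \<in> U) \<and> EN \<le> regs Z rOUT \<and>
   hist D stg X U \<and> card X + b = D \<and> stg_at stg B Z \<and> length stg \<le> card X \<and>
   (stg = [] \<longrightarrow> regs Z rSH = 0)"

text \<open>Each output word is charged ten extra units, which later pay for copying it to the
  tape.\<close>

definition node_post :: "nat \<Rightarrow> nat \<Rightarrow> nat set \<Rightarrow> nat list \<Rightarrow> stage list \<Rightarrow> state \<Rightarrow> nat \<Rightarrow> state \<Rightarrow> bool" where
 "node_post b B U xs stg Z t Z' \<longleftrightarrow> (\<exists>us. ran node_regs (length stg) B us Z Z' \<and>
   outcome (node_ok U b us) (regs Z rFAIL) (regs Z' rFAIL) \<and> t + 10 * length us \<le> cost b * (1 + wts xs))"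

definition spec :: "program \<Rightarrow> nat \<Rightarrow> bool" where
 "spec P b \<longleftrightarrow> (\<forall>B U xs a X stg Z. node_pre b B U xs a X stg Z \<longrightarrow> wp P (Call 1) (node_post b B U xs stg Z) Z)"

lemma ran_drop:
 assumes "ran (insert r R) l B us Z Z'" "regs Z' r = regs Z r"
 shows "ran R l B us Z Z'"
proof -
 have "same A R Z Z'" if "same A (insert r R) Z Z'" for A
  using that assms(2) by (auto simp: same_def)
 then show ?thesis using assms(1) by (simp add: ran_def)
qed

text \<open>A version of \<open>stg_at_same\<close> for saving registers: it permits writing into
  the topmost frame itself, as long as the stamps and parents in its first 2n words are
  spared.\<close>

lemma stg_at_frame:
 assumes sa: "stg_at stg bnd Z" and sm: "same A R Z Z'" and R: "rST \<notin> R" "rSH \<notin> R" and h: "hist D stg X U"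
  and A: "\<And>a. a \<in> A \<Longrightarrow> FT + length stg < a \<and> bnd + 2 * n \<le> a + W"
 shows "stg_at stg bnd Z'"
 unfolding stg_at_def
proof (intro conjI allI impI ballI)
 show "regs Z' rST = length stg" using sa same_reg[OF sm R(1)] by (simp add: stg_at_def)
 show "regs Z' rSH = fst (snd (last stg))" if "stg \<noteq> []"
  using sa that same_reg[OF sm R(2)] by (simp add: stg_at_def)
next
 fix j assume j: "j < length stg"
 have F: "mem Z' (FT + Suc j) = mem Z (FT + Suc j)"
  by (rule same_mem[OF sm]) (use A j in fastforce)
 have b: "FB \<le> mem Z (FT + Suc j)" "mem Z (FT + Suc j) + W \<le> bnd"
  "\<And>v. v \<in> fst (stg ! j) \<Longrightarrow> mem Z (mem Z (FT + Suc j) + n + v) = snd (snd (stg ! j)) v"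
  using sa j by (simp_all add: stg_at_def)
 show "FB \<le> mem Z' (FT + Suc j)" "mem Z' (FT + Suc j) + W \<le> bnd" using b F by simp_all
 fix v assume v: "v \<in> fst (stg ! j)"
 then have "v < n" using hist_root_pre(3)[OF h j] by blast
 then have "mem Z (FT + Suc j) + n + v \<notin> A" using A b(2) by fastforce
 then show "mem Z' (mem Z' (FT + Suc j) + n + v) = snd (snd (stg ! j)) v"
  using same_mem[OF sm] b(3)[OF v] F by simp
qed

lemma wp_child_node:
 assumes IH: "spec P b"
  and st: "stat Z" and fr: "fresh Z" and B: "regs Z rB = B" "FB \<le> B" "B + W * Suc (Suc b) \<le> EN"
  and bud: "regs Z rBUD = b"
  and seg: "regs Z rSS = a" "regs Z rSD = a + length seg" "list_at (mem Z) a seg" "set seg \<subseteq> {..<n}"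
   "distinct seg" "a + length seg \<le> B + W"
  and x: "regs Z rXV = x" "x \<in> set seg" "x < nv" and s: "s \<in> {0, 1}"
  and h: "hist D stg X (set seg - {x} - sat x (sign_of s))" "card X + b = D" "length stg \<le> card X" "stg \<noteq> []"
  and sa: "stg_at stg (B + W) Z" and out: "EN \<le> regs Z rOUT"
 shows "wp P (child s) (\<lambda>t Z'. \<exists>us. ran node_regs (length stg) (B + W) us Z Z' \<and>
  outcome (node_ok (set seg - {x} - sat x (sign_of s)) b us) (regs Z rFAIL) (regs Z' rFAIL) \<and>
  t + 10 * length us \<le> cost b * (1 + wts seg) + 30 * wts seg + 30) Z"
proof (rule wp_child[OF st fr B(1,2) _ seg(1-4,6) x s])
 show "B + W + W \<le> EN" using B(3) by simp
next
 let ?U = "set seg - {x} - sat x (sign_of s)"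
 fix Y :: state and t :: nat
 assume Y: "stat Y" "fresh Y" "regs Y rB = B + W" "regs Y rSB = a" "regs Y rSE = a + length seg"
   "regs Z rUID \<le> regs Y rUID"
   "\<And>v. v < n \<Longrightarrow> mem Y (B + W + v) = regs Y rUID \<longleftrightarrow> v \<in> ?U"
  and sm: "same {B + W..<B + W + n} child_regs Z Y" and t: "t \<le> 30 * wts seg + 30"
 have run1: "ran child_regs (length stg) (B + W) [] Z Y"
  by (rule ran_same[OF Y(1,2,6) sm _ _ out]) (use B in auto)
 have "B + W \<le> EN" using B(3) by simp
 have "node_pre b (B + W) ?U seg a X stg Y"
  unfolding node_pre_def
 proof (intro conjI allI impI)
  show "regs Y rBUD = b" using same_reg[OF sm, of rBUD] bud by simp
  show "list_at (mem Y) a seg"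
   by (rule list_at_cong[OF seg(3)]) (use same_mem[OF sm] seg(6) in simp)
  show "EN \<le> regs Y rOUT" by (rule ranD(7)[OF run1])
  show "stg_at stg (B + W) Y"
   by (rule stg_at_same[OF sa sm _ _ _ h(1)]) (use h(2,3) B MK FT_MK in auto)
 qed (use Y B seg h in auto)
 then have call: "wp P (Call 1) (node_post b (B + W) ?U seg stg Y) Y" using IH by (simp add: spec_def)
 show "wp P (Call 1) (\<lambda>t' Y'. \<exists>us. ran node_regs (length stg) (B + W) us Z (set_reg rB (regs Y' rB - regs Y' rW) Y') \<and>
  outcome (node_ok ?U b us) (regs Z rFAIL) (regs (set_reg rB (regs Y' rB - regs Y' rW) Y') rFAIL) \<and>
  t + t' + 10 * length us \<le> cost b * (1 + wts seg) + 30 * wts seg + 30) Y"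
 proof (rule wp_mono[OF call])
  fix t' :: nat and Y' assume "node_post b (B + W) ?U seg stg Y t' Y'"
  then obtain us where us: "ran node_regs (length stg) (B + W) us Y Y'"
   "outcome (node_ok ?U b us) (regs Y rFAIL) (regs Y' rFAIL)" "t' + 10 * length us \<le> cost b * (1 + wts seg)"
   unfolding node_post_def by blast
  let ?e = "set_reg rB (regs Y' rB - regs Y' rW) Y'"
  have e: "ran {rB} (length stg) (B + W) [] Y' ?e"
   by (rule ran_regs[OF ranD(1,2,7)[OF us(1)] set_reg_same]) auto
  have e': "ran (insert rB node_regs) (length stg) (B + W) (us @ []) Y ?e"
   by (rule ran_trans[OF ran_mono[OF us(1)] e]) auto
  have "ran (insert rB node_regs) (length stg) (B + W) ([] @ us @ []) Z ?e"
   by (rule ran_trans[OF ran_mono[OF run1] e']) auto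
  moreover have "regs ?e rB = regs Z rB"
   using ran_reg[OF us(1), of rB] Y(3) B(1) stat_regs(8)[OF ranD(1)[OF us(1)]] by (simp add: set_reg_def)
  ultimately have "ran node_regs (length stg) (B + W) us Z ?e"
   unfolding append_Nil append_Nil2 by (rule ran_drop)
  moreover have "regs Y rFAIL = regs Z rFAIL" "regs ?e rFAIL = regs Y' rFAIL"
   using same_reg[OF sm, of rFAIL] by (simp_all add: set_reg_def)
  ultimately show "\<exists>us. ran node_regs (length stg) (B + W) us Z ?e \<and>
   outcome (node_ok ?U b us) (regs Z rFAIL) (regs ?e rFAIL) \<and>
   t + t' + 10 * length us \<le> cost b * (1 + wts seg) + 30 * wts seg + 30"
   using us t by (intro exI[of _ us]) simp
 qed
qed

definition tail_pre :: "nat \<Rightarrow> nat \<Rightarrow> nat list \<Rightarrow> nat \<Rightarrow> nat set \<Rightarrow> stage list \<Rightarrow> state \<Rightarrow> bool" where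
 "tail_pre b B seg a X stg Z \<longleftrightarrow>
   stat Z \<and> fresh Z \<and> regs Z rB = B \<and> FB \<le> B \<and> B + W * Suc b \<le> EN \<and> regs Z rBUD = b \<and>
   regs Z rSS = a \<and> regs Z rSD = a + length seg \<and> list_at (mem Z) a seg \<and>
   B + n + n \<le> a \<and> a + length seg \<le> B + n + n + n \<and> set seg \<subseteq> {..<n} \<and> distinct seg \<and> seg \<noteq> [] \<and>
   EN \<le> regs Z rOUT \<and> hist D stg X (set seg) \<and> card X + b = D \<and> stg_at stg B Z \<and> length stg \<le> card X \<and>
   (edgy (set seg) \<longrightarrow> nv \<le> hd seg) \<and> bfs_tree nb (set seg) (hd seg) (\<lambda>v. mem Z (B + n + v))"

lemma tail_preD:
 assumes "tail_pre b B seg a X stg Z"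
 shows "stat Z" "fresh Z" "regs Z rB = B" "FB \<le> B" "B + W * Suc b \<le> EN" "regs Z rBUD = b"
   "regs Z rSS = a" "regs Z rSD = a + length seg" "list_at (mem Z) a seg"
   "B + n + n \<le> a" "a + length seg \<le> B + n + n + n" "set seg \<subseteq> {..<n}" "distinct seg" "seg \<noteq> []"
   "EN \<le> regs Z rOUT" "hist D stg X (set seg)" "card X + b = D" "stg_at stg B Z" "length stg \<le> card X"
   "edgy (set seg) \<Longrightarrow> nv \<le> hd seg" "bfs_tree nb (set seg) (hd seg) (\<lambda>v. mem Z (B + n + v))"
 using assms unfolding tail_pre_def by blast+

text \<open>The 6000 units per unit of weight and of D + 1 are left to the caller: 1000 for the loop
  over the components, including their labels, and 5000 for splitting the graph and writing its
  label.\<close>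

definition tail_post :: "nat \<Rightarrow> nat \<Rightarrow> nat list \<Rightarrow> stage list \<Rightarrow> state \<Rightarrow> nat \<Rightarrow> state \<Rightarrow> bool" where
 "tail_post b B seg stg Z t Z' \<longleftrightarrow> (\<exists>us. ran node_regs (length stg) (B + 4 * n + 8) us Z Z' \<and>
   outcome (tail_ok (set seg) b us) (regs Z rFAIL) (regs Z' rFAIL) \<and>
   t + 10 * length us + 6000 * (D + 1) * wts seg \<le> cost b * wts seg)"

text \<open>Choosing the variable may add a stage. Of the stage list only its length and last root
  need saving between the two children, since the first child does not touch the entries of the
  table that belong to it.\<close>

lemma wp_branch:
 assumes IH: "spec P b" and pre: "tail_pre (Suc b) B seg a X stg Z" and ed: "edgy (set seg)"
 shows "wp P branch (\<lambda>t Z'. \<exists>us. ran node_regs (length stg) (B + 4 * n + 8) us Z Z' \<and>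
   outcome (tail_ok (set seg) (Suc b) us) (regs Z rFAIL) (regs Z' rFAIL) \<and>
   t + 10 * length us \<le> 4 * cost b * wts seg + 500 * (D + 1) * wts seg) Z"
proof -
 note p = tail_preD[OF pre]
 let ?K = "set seg" and ?C = "B + 4 * n + 8"
 have BW: "B + W \<le> EN" "B + W * Suc (Suc b) \<le> EN" using p(5) by simp_all
 have w1: "1 \<le> wts seg" using p(14) length_le_wts[of seg] by (cases seg) auto
 have fin: "finite X" "X \<inter> ?K = {}" using histD(2,3)[OF p(16)] .
 have conn: "connected_ig (gr ?K)"
 proof -
  have "comps ?K (\<lambda>v. mem Z (B + n + v)) [seg]"
   using p(13,14,20,21) by (simp add: comps_def comp_ok_def closed_in_def)
  then show ?thesis using comps_linked[OF p(12)] by auto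
 qed
 let ?U = "\<lambda>x s. ?K - {x} - sat x (sign_of s)"
 let ?cost = "cost b * (1 + wts seg) + 30 * wts seg + 30"
 have main: "wp P (block [put rONE, put rONE, put rXV, Const rX 2, put rX, Sub rBUD rBUD rONE,
   locals 8, save tail_locals, child 0, locals 8, restore tail_locals, child 1, Add rBUD rBUD rONE])
  (\<lambda>t Z'. \<exists>us. ran (insert rBUD node_regs) (length stg') ?C us Y Z' \<and> regs Z' rBUD = Suc b \<and>
    outcome (tail_ok ?K (Suc b) us) (regs Y rFAIL) (regs Z' rFAIL) \<and>
    t + 10 * length us \<le> 2 * ?cost + 150) Y"
  if Y: "stat Y" "fresh Y" "regs Y rB = B" "regs Y rBUD = Suc b" "regs Y rSS = a" "regs Y rSD = a + length seg"
    "list_at (mem Y) a seg" "EN \<le> regs Y rOUT" "stg_at stg' (B + W) Y"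
   and h: "hist D stg' X ?K" "stg' \<noteq> []" "length stg' \<le> Suc (length stg)"
   and x: "regs Y rXV = x" "x \<in> ?K" "hits x (marked D stg' (length stg' - 1))" for Y stg' x
 proof -
  have xnv: "x < nv" using x(3) by (simp add: hits_def)
  have xX: "x \<notin> X" using fin x(2) by blast
  have hs: "hist D stg' (insert x X) (?U x s)" for s by (rule hist_assign[OF h(1) x(2,3) h(2)])
  have cX: "card (insert x X) + b = D" "length stg' \<le> card (insert x X)"
   using p(17,19) h(3) xX fin by simp_all
  have lD: "length stg' \<le> D" using cX by simp
  let ?vals = "[a, a + length seg, x, length stg', fst (snd (last stg'))]"
  have vals: "map (regs N) tail_locals = ?vals \<longleftrightarrow> regs N rSS = a \<and> regs N rSD = a + length seg \<and> regs N rXV = x \<and>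
    regs N rST = length stg' \<and> regs N rSH = fst (snd (last stg'))" for N
   by (simp add: tail_locals_def)
  let ?ready = "\<lambda>N. stat N \<and> fresh N \<and> regs N rB = B \<and> regs N rBUD = b \<and> list_at (mem N) a seg \<and>
   stg_at stg' (B + W) N \<and> EN \<le> regs N rOUT \<and> map (regs N) tail_locals = ?vals"
  have child: "wp P (child s) (\<lambda>t Z'. \<exists>us. ran node_regs (length stg') (B + W) us N Z' \<and>
   outcome (node_ok (?U x s) b us) (regs N rFAIL) (regs Z' rFAIL) \<and> t + 10 * length us \<le> ?cost) N"
   if r: "?ready N" and s: "s \<in> {0, 1}" for N s
  proof -
   have "regs N rSS = a" "regs N rSD = a + length seg" "regs N rXV = x" using r by (simp_all add: vals)
   then show ?thesis
    by (intro wp_child_node[OF IH _ _ _ p(4) BW(2) _ _ _ _ p(12,13) _ _ x(2) xnv s hs cX h(2)])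
     (use r p(11) in auto)
  qed
  have last: "wp P (block [child 1, Add rBUD rBUD rONE])
   (\<lambda>t Z'. \<exists>us. ran (insert rBUD node_regs) (length stg') ?C us N Z' \<and> regs Z' rBUD = Suc b \<and>
    outcome (node_ok (?U x 1) b us) (regs N rFAIL) (regs Z' rFAIL) \<and> t + 10 * length us \<le> ?cost + 2) N"
   if r: "?ready N" for N
  proof -
   have "wp P (child 1) (\<lambda>t Z'. \<exists>us. ran (insert rBUD node_regs) (length stg') ?C us N (set_reg rBUD (regs Z' rBUD + regs Z' rONE) Z') \<and>
     regs (set_reg rBUD (regs Z' rBUD + regs Z' rONE) Z') rBUD = Suc b \<and>
     outcome (node_ok (?U x 1) b us) (regs N rFAIL) (regs (set_reg rBUD (regs Z' rBUD + regs Z' rONE) Z') rFAIL) \<and>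
     Suc (Suc t) + 10 * length us \<le> ?cost + 2) N"
   proof (rule wp_mono[OF child[OF r, of 1]], simp, elim exE conjE)
    fix t us Z' assume us: "ran node_regs (length stg') (B + W) us N Z'"
     "outcome (node_ok (?U x 1) b us) (regs N rFAIL) (regs Z' rFAIL)" "t + 10 * length us \<le> ?cost"
    let ?e = "set_reg rBUD (regs Z' rBUD + regs Z' rONE) Z'"
    have e: "ran {rBUD} (length stg') (B + W) [] Z' ?e"
     by (rule ran_regs[OF ranD(1,2,7)[OF us(1)] set_reg_same]) auto
    have "ran (insert rBUD node_regs) (length stg') ?C (us @ []) N ?e"
     by (rule ran_trans[OF ran_mono[OF us(1)] e]) auto
    moreover have "regs ?e rBUD = Suc b" "regs ?e rFAIL = regs Z' rFAIL"
     using ran_reg[OF us(1), of rBUD] r stat_regs(1)[OF ranD(1)[OF us(1)]] by (simp_all add: set_reg_def)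
    ultimately show "\<exists>us. ran (insert rBUD node_regs) (length stg') ?C us N ?e \<and>
     regs ?e rBUD = Suc b \<and>
     outcome (node_ok (?U x 1) b us) (regs N rFAIL) (regs ?e rFAIL) \<and>
     Suc (Suc t) + 10 * length us \<le> ?cost + 2"
     using us(2,3) by (intro exI[of _ us]) simp
   qed
   then show ?thesis by (simp add: wp_funs)
  qed
  have mid: "wp P (block [child 0, locals 8, restore tail_locals, child 1, Add rBUD rBUD rONE])
   (\<lambda>t Z'. \<exists>us us'. ran (insert rBUD node_regs) (length stg') ?C (us @ us') N Z' \<and> regs Z' rBUD = Suc b \<and>
    outcome (node_ok (?U x 0) b us \<and> node_ok (?U x 1) b us') (regs N rFAIL) (regs Z' rFAIL) \<and>
    t + 10 * length (us @ us') \<le> 2 * ?cost + 30) N"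
   if r: "?ready N" and loc: "list_at (mem N) ?C ?vals" for N
  proof (rule wp_block_Cons, rule wp_mono[OF child[OF r, of 0]], simp, elim exE conjE, rule wp_block_Cons)
   fix t us Y' assume us: "ran node_regs (length stg') (B + W) us N Y'"
    "outcome (node_ok (?U x 0) b us) (regs N rFAIL) (regs Y' rFAIL)" "t + 10 * length us \<le> ?cost"
   note d = ranD[OF us(1)]
   let ?f = "set_reg rP ?C Y'"
   have B': "regs Y' rB = B" using ran_reg[OF us(1), of rB] r by simp
   have f: "ran {rP} (length stg') (B + W) [] Y' ?f"
    by (rule ran_regs[OF d(1,2,7) set_reg_same]) auto
   have loc': "list_at (mem ?f) ?C ?vals"
    using ran_list_at[OF us(1) loc] p(4) FB BW(1) by (simp add: set_reg_def)
   let ?Q = "\<lambda>t Z'. \<exists>us us'. ran (insert rBUD node_regs) (length stg') ?C (us @ us') N Z' \<and> regs Z' rBUD = Suc b \<and>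
    outcome (node_ok (?U x 0) b us \<and> node_ok (?U x 1) b us') (regs N rFAIL) (regs Z' rFAIL) \<and>
    t + 10 * length (us @ us') \<le> 2 * ?cost + 30"
   have "wp P (block [restore tail_locals, child 1, Add rBUD rBUD rONE]) (\<lambda>t'. ?Q (t + (7 + t'))) ?f"
   proof (rule wp_block_Cons, rule wp_restore[where p = ?C and vs = ?vals])
    fix N' assume s: "same {} (insert rP (set tail_locals)) ?f N'" and v: "map (regs N') tail_locals = ?vals"
    have "ran (insert rP (set tail_locals)) (length stg') (B + W) [] ?f N'"
     by (rule ran_regs[OF ranD(1,2,7)[OF f] s]) (simp add: tail_locals_def)
    then have g: "ran (insert rP (set tail_locals)) (length stg') (B + W) ([] @ []) Y' N'"
     by (intro ran_trans[OF ran_mono[OF f]]) auto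
    have a: "ran node_regs (length stg') (B + W) (us @ ([] @ [])) N N'"
     by (rule ran_trans[OF us(1) g]) (auto simp: tail_locals_def)
    have "regs N' rST = regs N rST" "regs N' rSH = regs N rSH" using v vals[of N] vals[of N'] r by simp_all
    then have sa': "stg_at stg' (B + W) N'"
     by (intro ran_stg_at[OF a _ h(1) _ lD]) (use r p(4) BW in auto)
    have "list_at (mem N') a seg"
     by (rule ran_list_at[OF a]) (use r p(4,10,11) FB BW(1) in auto)
    then have r': "?ready N'" using ranD(1,2,7)[OF a] ran_reg[OF a, of rB] ran_reg[OF a, of rBUD] r v sa' by simp
    have ff: "regs N' rFAIL = regs Y' rFAIL" using ran_reg[OF g, of rFAIL] by (simp add: tail_locals_def)
    show "wp P (block [child 1, Add rBUD rBUD rONE])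
     (\<lambda>t2. ?Q (t + (7 + (3 * length tail_locals + 1 + t2)))) N'"
    proof (rule wp_mono[OF last[OF r']], elim exE conjE)
     fix t2 us' Z' assume us': "ran (insert rBUD node_regs) (length stg') ?C us' N' Z'" "regs Z' rBUD = Suc b"
      "outcome (node_ok (?U x 1) b us') (regs N' rFAIL) (regs Z' rFAIL)" "t2 + 10 * length us' \<le> ?cost + 2"
     have "ran (insert rBUD node_regs) (length stg') ?C ((us @ ([] @ [])) @ us') N Z'"
      by (rule ran_trans[OF ran_mono[OF a] us'(1)]) auto
     then show "?Q (t + (7 + (3 * length tail_locals + 1 + t2))) Z'"
      using us'(2,4) us(3) outcome_trans[OF us(2) us'(3)[unfolded ff]]
      by (intro exI[of _ us] exI[of _ us']) (simp add: tail_locals_def)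
    qed
   qed (use stat_regs[OF ranD(1)[OF f]] loc' in \<open>simp_all add: tail_locals_def set_reg_def\<close>)
   then show "wp P (locals 8) (\<lambda>t'. wp P (block [restore tail_locals, child 1, Add rBUD rBUD rONE])
     (\<lambda>t2. ?Q (t + (t' + t2)))) Y'"
    unfolding wp_locals[OF d(1) B'] .
  qed
  let ?o = "regs Y rOUT"
  let ?e = "Y\<lparr>mem := (mem Y)(?o := 1, Suc ?o := 1, Suc (Suc ?o) := x, Suc (Suc (Suc ?o)) := 2),
    regs := (regs Y)(rOUT := Suc (Suc (Suc ?o)), rX := 2, rOUT := Suc (Suc (Suc (Suc ?o))), rBUD := b)\<rparr>"
  have run: "wp P (block [put rONE, put rONE, put rXV, Const rX 2, put rX, Sub rBUD rBUD rONE,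
   locals 8, save tail_locals, child 0, locals 8, restore tail_locals, child 1, Add rBUD rBUD rONE]) Q Y \<longleftrightarrow>
   wp P (block [locals 8, save tail_locals, child 0, locals 8, restore tail_locals, child 1, Add rBUD rBUD rONE])
    (\<lambda>t. Q (t + 14)) ?e" for Q
   using stat_regs[OF Y(1)] Y(4) x(1) unfolding put_def
   by (simp only: block.simps wp_funs) (simp add: set_reg_def add_numeral_Suc)
  have em: "emits {rOUT, rX, rBUD} [1, 1, x, 2] Y ?e"
   by (rule emits_intro) (auto simp: list_at_Cons list_at_Nil)
  have e: "ran {rOUT, rX, rBUD} (length stg') ?C [1, 1, x, 2] Y ?e"
   by (rule ran_emits[OF Y(1,2,8) em]) auto
  let ?f = "set_reg rP ?C ?e"
  have f: "ran {rP} (length stg') (B + W) [] ?e ?f"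
   by (rule ran_regs[OF ranD(1,2,7)[OF e] set_reg_same]) auto
  have "regs ?e rB = B" using Y(3) by simp
  note loc = wp_locals[OF ranD(1)[OF e] this]
  let ?Q = "\<lambda>t Z'. \<exists>us. ran (insert rBUD node_regs) (length stg') ?C us Y Z' \<and> regs Z' rBUD = Suc b \<and>
    outcome (tail_ok ?K (Suc b) us) (regs Y rFAIL) (regs Z' rFAIL) \<and>
    t + 10 * length us \<le> 2 * ?cost + 150"
  have "wp P (block [save tail_locals, child 0, locals 8, restore tail_locals, child 1, Add rBUD rBUD rONE])
    (\<lambda>t. ?Q (7 + t + 14)) ?f"
  proof (rule wp_block_Cons, rule wp_save[where p = ?C])
   fix N assume s: "same {?C..<?C + length tail_locals} {rP} ?f N" and l: "list_at (mem N) ?C (map (regs ?f) tail_locals)"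
   have st_r: "stat N" by (rule stat_same[OF ranD(1)[OF f] s]) (use p(4) FT_MK in auto)
   have ff: "EN \<le> regs ?f rUID" "regs ?f rUID = regs N rUID"
    using ranD(2)[OF f] same_reg[OF s, of rUID] by (simp_all add: fresh_def)
   have val: "map (regs ?f) tail_locals = ?vals"
    using Y(5,6,9) x(1) h(2) by (simp add: tail_locals_def set_reg_def stg_at_def)
   have val': "map (regs N) tail_locals = ?vals" unfolding val[symmetric]
    using same_reg[OF s] by (simp add: tail_locals_def)
   have root: "fst (snd (last stg')) < n"
   proof -
    have "length stg' - 1 < length stg'" using h(2) by simp
    from hist_root_pre[OF h(1) this] hist_root_pre(3)[OF h(1) hist_root_pre(2)[OF h(1) this]]
    show ?thesis using h(2) by (auto simp: last_conv_nth)
   qed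
   have "n \<le> EN" "D \<le> EN" using MK FB MK_n_EN by simp_all
   moreover have "x < n" using x(2) p(12) by blast
   \<comment> \<open>The saved values lie in the range watched by \<open>fresh\<close>, so they must
     not exceed the current stamp.\<close>
   ultimately have small: "v \<le> EN" if "v \<in> set ?vals" for v
    using that p(11) BW(1) lD root by auto
   have fr_r: "fresh N"
   proof (rule fresh_same[OF ranD(2)[OF f] s])
    fix y assume "y \<in> {?C..<?C + length tail_locals}"
    then obtain i where "y = ?C + i" "i < length tail_locals" by (metis atLeastLessThan_iff le_Suc_ex nat_add_left_cancel_less)
    then have "mem N y \<in> set ?vals" using l unfolding val list_at_def by (metis length_map nth_mem val)
    then show "mem N y \<le> regs N rUID" using small ff by (metis le_trans)
   qed (use ff in simp)
   have g: "ran {rP} (length stg') ?C [] ?f N"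
    by (rule ran_same[OF st_r fr_r _ s]) (use ff ranD(7)[OF f] BW in \<open>auto simp: tail_locals_def\<close>)
   have fg: "ran {rP} (length stg') ?C ([] @ []) ?e N"
    by (rule ran_trans[OF ran_mono[OF f] g]) auto
   have a: "ran (insert rBUD node_regs) (length stg') ?C ([1, 1, x, 2] @ []) Y N"
    by (rule ran_trans[OF ran_mono[OF e] fg[unfolded append_Nil]]) auto
   have "regs N rST = regs Y rST" "regs N rSH = regs Y rSH"
    using same_reg[OF s, of rST] same_reg[OF s, of rSH] by (simp_all add: set_reg_def)
   moreover have "same ({?C..<?C + length tail_locals} \<union> {?o..}) (insert rP {rOUT, rX, rBUD}) Y N"
    using s em by (auto simp: same_def emits_def set_reg_def)
   then have "stg_at stg' (B + W) N"
    by (rule stg_at_frame[OF Y(9) _ _ _ h(1)]) (use lD MK FT_MK p(4) Y(8) BW in auto)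
   moreover have "list_at (mem N) a seg"
    by (rule ran_list_at[OF a Y(7)]) (use p(4,10,11) FB BW(1) in auto)
   moreover have "regs N rB = B" "regs N rBUD = b" "regs N rFAIL = regs Y rFAIL"
    using same_reg[OF s, of rB] same_reg[OF s, of rBUD] same_reg[OF s, of rFAIL] Y(3) by (simp_all add: set_reg_def)
   ultimately have r: "?ready N" and fl: "regs N rFAIL = regs Y rFAIL"
    using st_r fr_r ranD(7)[OF a] val' by simp_all
   show "wp P (block [child 0, locals 8, restore tail_locals, child 1, Add rBUD rBUD rONE])
    (\<lambda>t2. ?Q (7 + (3 * length tail_locals + 1 + t2) + 14)) N"
   proof (rule wp_mono[OF mid[OF r l[unfolded val]]], elim exE conjE)
    fix t2 us us' Z' assume u: "ran (insert rBUD node_regs) (length stg') ?C (us @ us') N Z'" "regs Z' rBUD = Suc b"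
     "outcome (node_ok (?U x 0) b us \<and> node_ok (?U x 1) b us') (regs N rFAIL) (regs Z' rFAIL)"
     "t2 + 10 * length (us @ us') \<le> 2 * ?cost + 30"
    have "ran (insert rBUD node_regs) (length stg') ?C (([1, 1, x, 2] @ []) @ us @ us') Y Z'"
     by (rule ran_trans[OF a u(1)]) auto
    moreover have "outcome (tail_ok ?K (Suc b) ([1, 1, x, 2] @ us @ us')) (regs Y rFAIL) (regs Z' rFAIL)"
     using u(3) unfolding fl
     by (rule outcome_mono) (elim conjE, rule tail_ok_branch[OF conn x(2) xnv], simp_all add: sign_of_def)
    ultimately show "?Q (7 + (3 * length tail_locals + 1 + t2) + 14) Z'"
     using u(2,4) by (intro exI[of _ "[1, 1, x, 2] @ us @ us'"]) (simp add: tail_locals_def)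
   qed
  qed (use stat_regs[OF ranD(1)[OF f]] in \<open>simp_all add: tail_locals_def set_reg_def\<close>)
  then show ?thesis unfolding run by (intro wp_block_Cons) (simp only: loc)
 qed
 show ?thesis unfolding branch_def
 proof (rule wp_block_Cons, rule wp_mono[OF wp_choose[OF p(1,2,16) _ p(18,3,4) BW(1) p(7,8,9,12) _ ed p(20)[OF ed] p(21,14)]],
   goal_cases)
  case (3 t Y)
  then obtain stg' where c: "stat Y" "fresh Y" "same ({MK..<MK + n} \<union> {FT + Suc (length stg)}) choose_regs Z Y"
    "regs Z rUID \<le> regs Y rUID" "hist D stg' X ?K" "stg_at stg' (B + W) Y" "stg' \<noteq> []" "length stg \<le> length stg'"
    "length stg' \<le> Suc (length stg)" "regs Y rXV \<in> ?K" "hits (regs Y rXV) (marked D stg' (length stg' - 1))"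
    "t \<le> 14 * D + 80 * wts seg + 100" by blast
  have c0: "ran choose_regs (length stg) ?C [] Z Y"
   by (rule ran_same[OF c(1,2,4,3)]) (use p(15,17,19) MK in auto)
  have r: "regs Y r = regs Z r" if "r \<in> {rB, rBUD, rSS, rSD, rFAIL}" for r
   by (rule ran_reg[OF c0]) (use that in auto)
  have la: "list_at (mem Y) a seg"
   by (rule list_at_cong[OF p(9)]) (use same_mem[OF c(3)] p(4,10,17,19) FB MK in auto)
  show ?case
  proof (rule wp_mono[OF main[OF c(1,2) _ _ _ _ la ranD(7)[OF c0] c(6,5,7,9) refl c(10,11)]], goal_cases)
   case (5 t' Z')
   then obtain us where us: "ran (insert rBUD node_regs) (length stg') ?C us Y Z'" "regs Z' rBUD = Suc b"
    "outcome (tail_ok ?K (Suc b) us) (regs Y rFAIL) (regs Z' rFAIL)" "t' + 10 * length us \<le> 2 * ?cost + 150" by blast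
   have "ran (insert rBUD node_regs) (length stg) ?C ([] @ us) Z Z'"
    by (rule ran_trans[OF ran_mono[OF c0] us(1)]) (use c(8) in auto)
   then have "ran node_regs (length stg) ?C us Z Z'"
    unfolding append_Nil by (rule ran_drop) (use us(2) p(6) in simp)
   moreover have "t + t' + 10 * length us \<le> 4 * cost b * wts seg + 500 * (D + 1) * wts seg"
   proof -
    obtain w where w: "wts seg = Suc w" using w1 by (cases "wts seg") auto
    show ?thesis using us(4) c(12) unfolding w by (simp add: algebra_simps)
   qed
   ultimately show ?case using us(3) r[of rFAIL] by (intro exI[of _ us]) simp
  qed (use r p in simp_all)
 qed (use p FB in simp_all)
qed

lemma cost_ge: "8000 * (D + 1) \<le> cost b"
 by (simp add: cost_def)

lemma cost_Suc: "cost (Suc b) = 5 * cost b"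
 by (simp add: cost_def)

lemma tail_pre_rX:
 assumes p: "tail_pre b B seg a X stg Z"
 shows "tail_pre b B seg a X stg (set_reg rX y Z)"
proof -
 have s: "same {} {rX} Z (set_reg rX y Z)" by (rule set_reg_same) simp
 note q = tail_preD[OF p]
 have "stat (set_reg rX y Z)" by (rule stat_same[OF q(1) s]) auto
 moreover have "fresh (set_reg rX y Z)" by (rule fresh_same[OF q(2) s]) (simp_all add: set_reg_def)
 moreover have "stg_at stg B (set_reg rX y Z)" by (rule stg_at_same[OF q(18) s _ _ _ q(16)]) auto
 ultimately show ?thesis using p unfolding tail_pre_def by (simp add: set_reg_def)
qed

text \<open>A component with a second vertex has an edge, namely the one from that vertex to its
  parent. If the budget is used up at this point, \<open>hist\<close> itself is the evidence that
  the depth exceeds k.\<close>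

lemma wp_tail:
 assumes IH: "\<And>b'. b = Suc b' \<Longrightarrow> spec P b'" and pre: "tail_pre b B seg a X stg Z"
 shows "wp P tail (tail_post b B seg stg Z) Z"
proof -
 let ?s = "set_reg rX (length seg - 1) Z"
 have p0: "tail_pre b B seg a X stg ?s" by (rule tail_pre_rX[OF pre])
 note p = tail_preD[OF p0]
 have s0: "ran {rX} (length stg) (B + 4 * n + 8) [] Z ?s"
  by (rule ran_regs[OF tail_preD(1,2,15)[OF pre] set_reg_same]) auto
 have w1: "1 \<le> wts seg" using p(14) length_le_wts[of seg] by (cases seg) auto
 have f0: "regs ?s rFAIL = regs Z rFAIL" by (simp add: set_reg_def)
 have post: "tail_post b B seg stg Z t Y"
  if r: "ran node_regs (length stg) (B + 4 * n + 8) us ?s Y"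
   and o: "outcome (tail_ok (set seg) b us) (regs ?s rFAIL) (regs Y rFAIL)"
   and t: "t + 10 * length us + 6000 * (D + 1) * wts seg \<le> cost b * wts seg" for us Y t
 proof -
  have "ran node_regs (length stg) (B + 4 * n + 8) ([] @ us) Z Y"
   by (rule ran_trans[OF ran_mono[OF s0] r]) auto
  then show ?thesis using o t unfolding f0 tail_post_def by (intro exI[of _ us]) simp
 qed
 have small: "t + 10 * length us + 6000 * (D + 1) * wts seg \<le> cost b * wts seg" if "t + 10 * length us \<le> 100" for t and us :: "nat list"
 proof -
  have "8000 * (D + 1) * wts seg \<le> cost b * wts seg" by (rule mult_le_mono1[OF cost_ge])
  moreover have "100 \<le> 2000 * (D + 1) * wts seg" using w1 by (simp add: algebra_simps)
  ultimately show ?thesis using that by (simp add: algebra_simps)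
 qed
 have run: "wp P tail Q Z \<longleftrightarrow> (if length seg \<noteq> 1
   then (if b \<noteq> 0 then wp P branch (\<lambda>t. Q (t + 5)) ?s else Q 6 (set_reg rFAIL 1 ?s))
   else wp P (put rZ) (\<lambda>t. Q (t + 4)) ?s)" for Q
  using tail_preD[OF pre] stat_regs[OF tail_preD(1)[OF pre]] unfolding tail_def
  by (cases seg; cases "tl seg") (simp_all only: block.simps wp_funs, auto simp: set_reg_def add_numeral_Suc numeral_eq_Suc)
 show ?thesis unfolding run
 proof (cases "length seg = 1")
  case True
  then obtain v where "seg = [v]" by (cases seg) auto
  then have ne: "\<not> edgy (set seg)" using not_edgy_singleton by simp
  have "wp P (put rZ) (\<lambda>t. tail_post b B seg stg Z (t + 4)) ?s"
  proof (rule wp_put'[OF p(1) _ _ p(15)])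
   fix Y assume e: "emits {rOUT} [regs ?s rZ] ?s Y"
   have z: "regs ?s rZ = 0" using stat_regs[OF p(1)] by simp
   have "ran {rOUT} (length stg) (B + 4 * n + 8) [0] ?s Y"
    by (rule ran_emits[OF p(1,2,15) e[unfolded z]]) auto
   then have r: "ran node_regs (length stg) (B + 4 * n + 8) [0] ?s Y" by (rule ran_mono) auto
   have "outcome (tail_ok (set seg) b [0]) (regs ?s rFAIL) (regs Y rFAIL)"
    using emits_reg[OF e, of rFAIL] tail_ok_leaf[OF ne] by (simp add: outcome_def)
   then show "tail_post b B seg stg Z (Suc (Suc (Suc 0)) + 4) Y" by (rule post[OF r]) (rule small, simp)
  qed simp
  then show "if length seg \<noteq> 1
   then (if b \<noteq> 0 then wp P branch (\<lambda>t. tail_post b B seg stg Z (t + 5)) ?s else tail_post b B seg stg Z 6 (set_reg rFAIL 1 ?s))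
   else wp P (put rZ) (\<lambda>t. tail_post b B seg stg Z (t + 4)) ?s" using True by simp
 next
  case False
  then obtain u v ws where uv: "seg = u # v # ws" using p(14) by (cases seg; cases "tl seg") auto
  have ed: "edgy (set seg)"
  proof -
   have "v \<in> set seg - {hd seg}" using p(13) uv by auto
   then have "(\<lambda>v. mem ?s (B + n + v)) v \<in> set seg \<and> v \<in> nb (mem ?s (B + n + v))"
    using p(21) unfolding bfs_tree_def by blast
   then show ?thesis using uv unfolding edgy_def by auto
  qed
  have "if b \<noteq> 0 then wp P branch (\<lambda>t. tail_post b B seg stg Z (t + 5)) ?s else tail_post b B seg stg Z 6 (set_reg rFAIL 1 ?s)"
  proof (cases b)
   case 0
   let ?e = "set_reg rFAIL 1 ?s"
   have "ran {rFAIL} (length stg) (B + 4 * n + 8) [] ?s ?e"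
    by (rule ran_regs[OF p(1,2,15) set_reg_same]) auto
   then have r: "ran node_regs (length stg) (B + 4 * n + 8) [] ?s ?e" by (rule ran_mono) auto
   have "card X = 2 * k * 4 ^ k" using p(17) 0 D by simp
   then have "enat k < srbd class0 G" by (rule hist_exhausted[OF p(16)[unfolded D] _ ed])
   then have "outcome (tail_ok (set seg) b []) (regs ?s rFAIL) (regs ?e rFAIL)"
    by (simp add: outcome_def set_reg_def)
   then have "tail_post b B seg stg Z 6 ?e" by (rule post[OF r]) (rule small, simp)
   then show ?thesis using 0 by simp
  next
   case (Suc b')
   have "wp P branch (\<lambda>t. tail_post b B seg stg Z (t + 5)) ?s"
   proof (rule wp_mono[OF wp_branch[OF IH[OF Suc] p0[unfolded Suc] ed]], elim exE conjE)
    fix t us Y assume r: "ran node_regs (length stg) (B + 4 * n + 8) us ?s Y"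
     and o: "outcome (tail_ok (set seg) (Suc b') us) (regs ?s rFAIL) (regs Y rFAIL)"
     and t: "t + 10 * length us \<le> 4 * cost b' * wts seg + 500 * (D + 1) * wts seg"
    have "8000 * (D + 1) * wts seg \<le> cost b' * wts seg" by (rule mult_le_mono1[OF cost_ge])
    moreover have "100 \<le> 1000 * (D + 1) * wts seg" using w1 by (simp add: algebra_simps)
    ultimately have "t + 5 + 10 * length us + 6000 * (D + 1) * wts seg \<le> cost b * wts seg"
     using t unfolding Suc cost_Suc by (simp add: algebra_simps)
    then show "tail_post b B seg stg Z (t + 5) Y" by (rule post[OF r o[folded Suc]])
   qed
   then show ?thesis using Suc by simp
  qed
  then show "if length seg \<noteq> 1
   then (if b \<noteq> 0 then wp P branch (\<lambda>t. tail_post b B seg stg Z (t + 5)) ?s else tail_post b B seg stg Z 6 (set_reg rFAIL 1 ?s))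
   else wp P (put rZ) (\<lambda>t. tail_post b B seg stg Z (t + 4)) ?s" using False by simp
 qed
qed

lemma frame_ok_cong:
 assumes f: "frame_ok B u U ls m" and U: "U \<subseteq> {..<n}" and m: "\<And>b. B \<le> b \<Longrightarrow> b < B + 4 * n \<Longrightarrow> m' b = m b"
 shows "frame_ok B u U ls m'"
proof -
 have c: "comps U (\<lambda>v. m (B + n + v)) ls" using f by (simp add: frame_ok_def)
 then have ls: "distinct (concat ls)" "set (concat ls) = U" "[] \<notin> set ls" by (auto simp: comps_def comp_ok_def)
 have len: "length (concat ls) \<le> n"
  using card_mono[OF _ U] distinct_card[OF ls(1)] ls(2) by simp
 have "comp_ok U (\<lambda>v. m' (B + n + v)) l" if "l \<in> set ls" for l
 proof (rule comp_ok_cong)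
  show "comp_ok U (\<lambda>v. m (B + n + v)) l" using c that by (simp add: comps_def)
  fix v assume "v \<in> set l"
  then have "v < n" using that ls(2) U by auto
  then show "m' (B + n + v) = m (B + n + v)" by (intro m) auto
 qed
 then have "comps U (\<lambda>v. m' (B + n + v)) ls" using c by (simp add: comps_def)
 moreover have "list_at m' (B + n + n) (concat ls)"
  by (rule list_at_cong[of m]) (use f len in \<open>auto simp: frame_ok_def intro!: m\<close>)
 moreover have "segs_at m' n (B + n + n) ls"
  by (rule segs_at_cong[of m, OF _ ls(3)]) (use f len in \<open>auto simp: frame_ok_def intro!: m\<close>)
 moreover have "m' (B + v) = m (B + v)" if "v < n" for v by (rule m) (use that in auto)
 ultimately show ?thesis using f by (simp add: frame_ok_def)
qed

lemma numeral_add_Suc: "numeral w + (x :: nat) = Suc (pred_numeral w + x)"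
 by (simp add: numeral_eq_Suc)

text \<open>A single component continues the node of the whole graph, whose label has been written;
  several components become children with labels of their own.\<close>

definition part_ok :: "nat \<Rightarrow> nat list list \<Rightarrow> nat list \<Rightarrow> nat list \<Rightarrow> bool" where
 "part_ok b ls l us \<longleftrightarrow> (if length ls = 1 then tail_ok (set l) b us else node_ok (set l) b us)"

definition loop_state :: "nat \<Rightarrow> nat \<Rightarrow> nat \<Rightarrow> nat set \<Rightarrow> nat list list \<Rightarrow> stage list \<Rightarrow> state \<Rightarrow> bool" where
 "loop_state b B u U ls stg Z \<longleftrightarrow> stat Z \<and> fresh Z \<and> regs Z rB = B \<and> regs Z rBUD = b \<and> regs Z rVIS = u \<and>
   regs Z rQT = B + n + n + length (concat ls) \<and> regs Z rCNT = length ls \<and> regs Z rSH \<le> EN \<and>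
   stg_at stg B Z \<and> frame_ok B u U ls (mem Z) \<and> EN \<le> regs Z rOUT \<and> u \<le> regs Z rUID"

text \<open>The withheld part pays for splitting the graph and writing its label, which happens once
  for all components.\<close>

abbreviation (input) part_cost :: "nat \<Rightarrow> nat" where
 "part_cost b \<equiv> cost b - 5000 * (D + 1)"

abbreviation (input) end_body :: com where
 "end_body \<equiv> block [locals 0, restore node_locals, Add rSS rSD rZ, Sub rLL rQT rSS]"

lemma loop_stateD:
 assumes "loop_state b B u U ls stg Z"
 shows "stat Z" "fresh Z" "regs Z rB = B" "regs Z rBUD = b" "regs Z rVIS = u"
   "regs Z rQT = B + n + n + length (concat ls)" "regs Z rCNT = length ls" "regs Z rSH \<le> EN"
   "stg_at stg B Z" "frame_ok B u U ls (mem Z)" "EN \<le> regs Z rOUT" "u \<le> regs Z rUID"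
 using assms by (auto simp: loop_state_def)

lemma wp_node_body:
 assumes IH: "\<And>b'. b = Suc b' \<Longrightarrow> spec P b'"
  and B: "FB \<le> B" "B + W * Suc b \<le> EN" and U: "U \<subseteq> {..<n}"
  and h: "hist D stg X U" "card X + b = D" "length stg \<le> card X"
  and lp: "loop_state b B u U ls stg Z" and ls: "ls = ks @ l # rs" and ss: "regs Z rSS = B + n + n + length (concat ks)"
 shows "wp P (block [Add rA rSS rN, Load rSD rA, locals 0, save node_locals,
    neq rCNT rONE, IfNZ rQ (block [Add rA0 rSS rZ, Add rE0 rSD rZ, emit]) Skip,
    tail, locals 0, restore node_locals, Add rSS rSD rZ, Sub rLL rQT rSS])
  (\<lambda>t Z'. \<exists>us. ran node_regs (length stg) (B + 4 * n) us Z Z' \<and> loop_state b B u U ls stg Z' \<and>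
    regs Z' rSS = B + n + n + length (concat (ks @ [l])) \<and> regs Z' rLL = length (concat rs) \<and>
    outcome (part_ok b ls l us) (regs Z rFAIL) (regs Z' rFAIL) \<and>
    t + 1 + 10 * length us \<le> part_cost b * wts l) Z"
proof -
 note p = loop_stateD[OF lp]
 let ?a = "B + n + n + length (concat ks)" and ?C = "B + 4 * n" and ?q = "B + n + n + length (concat ls)"
 have BW: "B + W \<le> EN" using B(2) by simp
 have cs: "comps U (\<lambda>v. mem Z (B + n + v)) ls" and la: "list_at (mem Z) (B + n + n) (concat ls)"
  and sg: "segs_at (mem Z) n (B + n + n) ls" and stamps: "\<And>v. v < n \<Longrightarrow> mem Z (B + v) = u \<longleftrightarrow> v \<in> U"
  using p(10) by (simp_all add: frame_ok_def)
 have dist: "distinct (concat ls)" "set (concat ls) = U" using cs by (simp_all add: comps_def)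
 have len: "length (concat ls) \<le> n"
  using card_mono[OF _ U] distinct_card[OF dist(1)] dist(2) by simp
 have lsn: "length ls \<le> n"
 proof -
  have "[] \<notin> set ls" using cs by (auto simp: comps_def comp_ok_def)
  then have "length ls \<le> length (concat ls)"
  proof (induction ls)
   case (Cons l ls)
   then show ?case by (cases l) auto
  qed simp
  then show ?thesis using len by simp
 qed
 have l: "comp_ok U (\<lambda>v. mem Z (B + n + v)) l" "edgy (set l) \<Longrightarrow> nv \<le> hd l"
  using cs ls by (simp_all add: comps_def)
 then have l': "l \<noteq> []" "closed_in (set l) U" "bfs_tree nb (set l) (hd l) (\<lambda>v. mem Z (B + n + v))"
  by (simp_all add: comp_ok_def)
 have ln: "set l \<subseteq> {..<n}" "distinct l" "set l \<subseteq> U" using U dist ls by auto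
 have lal: "list_at (mem Z) ?a l" using la ls by (simp add: list_at_append)
 have ml: "mem Z (?a + n) = ?a + length l" using sg ls by (simp add: segs_at_append)
 have fitl: "?a + length l \<le> B + n + n + n" using len ls by simp
 have w1: "1 \<le> wts l" using l'(1) length_le_wts[of l] by (cases l) auto
 have hl: "hist D stg X (set l)" by (rule hist_reduct[OF h(1) closed_in_reduct[OF l'(2)]])
 have lD: "length stg \<le> D" using h(2,3) by simp
 let ?sd = "?a + length l"
 let ?vals = "[u, ?q, length ls, length stg, regs Z rSH, ?a, ?sd]"
 let ?Q = "\<lambda>t Z'. \<exists>us. ran node_regs (length stg) ?C us Z Z' \<and> loop_state b B u U ls stg Z' \<and>
    regs Z' rSS = B + n + n + length (concat (ks @ [l])) \<and> regs Z' rLL = length (concat rs) \<and>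
    outcome (part_ok b ls l us) (regs Z rFAIL) (regs Z' rFAIL) \<and>
    t + 1 + 10 * length us \<le> part_cost b * wts l"
 have fin: "wp P end_body (\<lambda>t'. ?Q (t + t')) N"
  if r: "ran node_regs (length stg) ?C us Z N" and loc: "list_at (mem N) ?C ?vals"
   and o: "outcome (part_ok b ls l us) (regs Z rFAIL) (regs N rFAIL)"
   and t: "t + 50 + 10 * length us \<le> part_cost b * wts l" for N us t
 proof (rule wp_block_Cons)
  note d = ranD[OF r]
  have B': "regs N rB = B" using ran_reg[OF r, of rB] p(3) by simp
  let ?f = "set_reg rP ?C N"
  have f: "ran {rP} (length stg) ?C [] N ?f" by (rule ran_regs[OF d(1,2,7) set_reg_same]) auto
  have "wp P (block [restore node_locals, Add rSS rSD rZ, Sub rLL rQT rSS]) (\<lambda>t'. ?Q (t + (7 + t'))) ?f"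
  proof (rule wp_block_Cons, rule wp_restore[where p = ?C and vs = ?vals])
   fix Y assume s: "same {} (insert rP (set node_locals)) ?f Y" and v: "map (regs Y) node_locals = ?vals"
   have v': "regs Y rVIS = u" "regs Y rQT = ?q" "regs Y rCNT = length ls" "regs Y rST = length stg"
     "regs Y rSH = regs Z rSH" "regs Y rSS = ?a" "regs Y rSD = ?sd"
    using v by (simp_all add: node_locals_def)
   have g: "ran (insert rP (set node_locals)) (length stg) ?C [] ?f Y"
    by (rule ran_regs[OF ranD(1,2,7)[OF f] s]) (simp add: node_locals_def)
   let ?e = "Y\<lparr>regs := (regs Y)(rSS := ?sd, rLL := length (concat rs))\<rparr>"
   have "same {} {rSS, rLL} Y ?e" by (simp add: same_def)
   then have e: "ran {rSS, rLL} (length stg) ?C [] Y ?e"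
    by (rule ran_regs[OF ranD(1,2,7)[OF g]]) auto
   have a1: "ran node_regs (length stg) ?C (us @ []) Z ?f" by (rule ran_trans[OF r f]) auto
   have a2: "ran node_regs (length stg) ?C ((us @ []) @ []) Z Y"
    by (rule ran_trans[OF a1 g]) (auto simp: node_locals_def)
   have a3: "ran node_regs (length stg) ?C (((us @ []) @ []) @ []) Z ?e"
    by (rule ran_trans[OF a2 e]) auto
   note dd = ranD[OF a3]
   have st_e: "regs ?e rST = regs Z rST" using v' p(9) by (simp add: stg_at_def)
   have sa: "stg_at stg B ?e"
    by (rule ran_stg_at[OF a3 p(9) h(1) _ lD]) (use v' st_e B BW in auto)
   have fo: "frame_ok B u U ls (mem ?e)"
    by (rule frame_ok_cong[OF p(10) U], rule ran_mem[OF a3]) (use B BW FB in auto)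
   have "loop_state b B u U ls stg ?e"
    unfolding loop_state_def using dd sa fo v' p(8,12) ran_reg[OF a3, of rB] ran_reg[OF a3, of rBUD] p(3,4) by simp
   moreover have "regs ?e rFAIL = regs N rFAIL"
    using same_reg[OF s, of rFAIL] by (simp add: node_locals_def set_reg_def)
   ultimately have "?Q (t + 7 + 22 + 3) ?e"
    using a3 o t ls by (intro exI[of _ us]) simp
   moreover have "wp P (block [Add rSS rSD rZ, Sub rLL rQT rSS]) Q' Y \<longleftrightarrow> Q' (Suc (Suc (Suc 0))) ?e" for Q'
    using v' stat_regs[OF ranD(1)[OF g]] ls by (simp add: wp_funs set_reg_def)
   ultimately show "wp P (block [Add rSS rSD rZ, Sub rLL rQT rSS])
     (\<lambda>t2. ?Q (t + (7 + (3 * length node_locals + 1 + t2)))) Y"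
    by (simp add: node_locals_def)
  qed (use stat_regs[OF ranD(1)[OF f]] loc in \<open>simp_all add: node_locals_def set_reg_def\<close>)
  then show "wp P (locals 0) (\<lambda>t1. wp P (block [restore node_locals, Add rSS rSD rZ, Sub rLL rQT rSS])
    (\<lambda>t2. ?Q (t + (t1 + t2)))) N"
   by (simp only: wp_locals[OF d(1) B'] add_0_right)
 qed
 \<comment> \<open>The common end of the two cases below; us is what was written for the component
   before \<open>tail\<close> runs, either nothing or its label.\<close>
 have tl: "wp P (block [tail, locals 0, restore node_locals, Add rSS rSD rZ, Sub rLL rQT rSS]) (\<lambda>t'. ?Q (t + t')) N"
  if r: "ran node_regs (length stg) ?C us Z N" and loc: "list_at (mem N) ?C ?vals"
   and reg: "regs N rSS = ?a" "regs N rSD = ?sd" "regs N rST = length stg" "regs N rSH = regs Z rSH" "regs N rFAIL = regs Z rFAIL"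
   and ok: "\<And>vs. tail_ok (set l) b vs \<Longrightarrow> part_ok b ls l (us @ vs)"
   and t: "t + 10 * length us \<le> 500 * wts l" for N us t
 proof (rule wp_block_Cons)
  note d = ranD[OF r]
  have par: "mem N (B + n + v) = mem Z (B + n + v)" if "v < n" for v
   by (rule ran_mem[OF r]) (use that B BW FB in auto)
  have "tail_pre b B l ?a X stg N"
   unfolding tail_pre_def
  proof (intro conjI impI)
   show "regs N rB = B" "regs N rBUD = b" using ran_reg[OF r, of rB] ran_reg[OF r, of rBUD] p(3,4) by simp_all
   show "list_at (mem N) ?a l" by (rule ran_list_at[OF r lal]) (use B BW FB fitl in auto)
   show "stg_at stg B N"
    by (rule ran_stg_at[OF r p(9) h(1) _ lD]) (use reg p(9) B BW in \<open>auto simp: stg_at_def\<close>)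
   show "bfs_tree nb (set l) (hd l) (\<lambda>v. mem N (B + n + v))"
    by (rule bfs_tree_cong[OF l'(3)]) (use par ln(1) in auto)
  qed (use d reg B fitl ln l' h hl l(2) in simp_all)
  then have T: "wp P tail (tail_post b B l stg N) N" using IH by (rule wp_tail[rotated])
  show "wp P tail (\<lambda>t1. wp P end_body (\<lambda>t2. ?Q (t + (t1 + t2)))) N"
  proof (rule wp_mono[OF T])
   fix t1 Y assume "tail_post b B l stg N t1 Y"
   then obtain vs where vs: "ran node_regs (length stg) (?C + 8) vs N Y"
    "outcome (tail_ok (set l) b vs) (regs N rFAIL) (regs Y rFAIL)"
    "t1 + 10 * length vs + 6000 * (D + 1) * wts l \<le> cost b * wts l"
    unfolding tail_post_def by auto
   have a: "ran node_regs (length stg) ?C (us @ vs) Z Y" by (rule ran_trans[OF r vs(1)]) auto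
   have loc': "list_at (mem Y) ?C ?vals" by (rule ran_list_at[OF vs(1) loc]) (use B BW FB in auto)
   have o: "outcome (part_ok b ls l (us @ vs)) (regs Z rFAIL) (regs Y rFAIL)"
    using outcome_mono[OF vs(2) ok] reg(5) by simp
   have "t + t1 + 50 + 10 * length (us @ vs) \<le> part_cost b * wts l"
   proof -
    have "5000 * (D + 1) \<le> cost b" using cost_ge[of b] by simp
    then have "part_cost b * wts l + 5000 * (D + 1) * wts l = cost b * wts l"
     by (metis add_mult_distrib le_add_diff_inverse2)
    moreover have "550 * wts l \<le> 1000 * (D + 1) * wts l" by (rule mult_le_mono1) simp
    ultimately show ?thesis using t vs(3) w1 by (simp add: algebra_simps)
   qed
   from fin[OF a loc' o this] show "wp P end_body (\<lambda>t2. ?Q (t + (t1 + t2))) Y"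
    by (simp only: add.assoc)
  qed
 qed
 let ?s = "Z\<lparr>regs := (regs Z)(rA := ?a + n, rSD := ?sd, rP := ?C)\<rparr>"
 have run: "wp P (block [Add rA rSS rN, Load rSD rA, locals 0, save node_locals,
    neq rCNT rONE, IfNZ rQ (block [Add rA0 rSS rZ, Add rE0 rSD rZ, emit]) Skip,
    tail, locals 0, restore node_locals, Add rSS rSD rZ, Sub rLL rQT rSS]) Q Z \<longleftrightarrow>
   wp P (block [save node_locals, neq rCNT rONE, IfNZ rQ (block [Add rA0 rSS rZ, Add rE0 rSD rZ, emit]) Skip,
    tail, locals 0, restore node_locals, Add rSS rSD rZ, Sub rLL rQT rSS]) (\<lambda>t. Q (9 + t)) ?s" for Q
 proof -
  let ?r = "Z\<lparr>regs := (regs Z)(rA := ?a + n, rSD := ?sd)\<rparr>"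
  have sr: "same {} {rA, rSD} Z ?r" by (simp add: same_def)
  have "stat ?r" by (rule stat_same[OF p(1) sr]) auto
  moreover have "regs ?r rB = B" using p(3) by simp
  ultimately have "wp P (locals 0) Q' ?r \<longleftrightarrow> Q' 7 (set_reg rP (?C + 0) ?r)" for Q' by (rule wp_locals)
  moreover have "wp P (block (Add rA rSS rN # Load rSD rA # cs)) Q' Z \<longleftrightarrow> wp P (block cs) (\<lambda>t. Q' (Suc (Suc t))) ?r" for cs Q'
   using ss ml stat_regs[OF p(1)] by (simp add: wp_funs set_reg_def)
  ultimately show ?thesis
   by (simp only:) (simp add: wp_Seq_eq set_reg_def numeral_add_Suc)
 qed
 have s0: "same {} {rA, rSD, rP} Z ?s" by (simp add: same_def)
 have s: "ran {rA, rSD, rP} (length stg) ?C [] Z ?s" by (rule ran_regs[OF p(1,2,11) s0]) auto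
 note d = ranD[OF s]
 have len7: "length node_locals = 7" by (simp add: node_locals_def)
 show ?thesis unfolding run
 proof (rule wp_block_Cons, rule wp_save[where p = ?C])
  fix N assume sv: "same {?C..<?C + length node_locals} {rP} ?s N" and loc0: "list_at (mem N) ?C (map (regs ?s) node_locals)"
  have val: "map (regs ?s) node_locals = ?vals"
   using p(5-7,9) ss by (simp add: node_locals_def stg_at_def)
  note loc = loc0[unfolded val]
  have st_r: "stat N" by (rule stat_same[OF d(1) sv]) (use B FT_MK in auto)
  have uid: "regs N rUID = regs Z rUID" "EN \<le> regs Z rUID"
   using same_reg[OF sv, of rUID] p(2) by (simp_all add: fresh_def)
  have "n \<le> EN" "D \<le> EN" using MK FB MK_n_EN by simp_all
  then have small: "v \<le> regs Z rUID" if "v \<in> set ?vals" for v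
   using that p(8,12) uid(2) lD lsn len fitl BW by auto
  have fr_r: "fresh N"
  proof (rule fresh_same[OF d(2) sv])
   fix y assume "y \<in> {?C..<?C + length node_locals}"
   then obtain i where i: "y = ?C + i" "i < length node_locals" by (metis atLeastLessThan_iff le_Suc_ex nat_add_left_cancel_less)
   have i': "i < length ?vals" using i(2) by (simp add: node_locals_def)
   have "mem N y = ?vals ! i" using loc i' unfolding list_at_def i(1) by blast
   moreover have "?vals ! i \<in> set ?vals" by (rule nth_mem[OF i'])
   ultimately show "mem N y \<le> regs N rUID" using small uid(1) by metis
  qed (use uid in simp)
  have sr: "ran {rP} (length stg) ?C [] ?s N"
   by (rule ran_same[OF st_r fr_r _ sv]) (use uid p(11) BW in \<open>auto simp: node_locals_def\<close>)
  have r: "ran {rA, rSD, rP} (length stg) ?C ([] @ []) Z N" by (rule ran_trans[OF s sr]) auto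
  have reg: "regs N rSS = ?a" "regs N rSD = ?sd" "regs N rST = length stg" "regs N rSH = regs Z rSH" "regs N rFAIL = regs Z rFAIL"
    "regs N rCNT = length ls" "regs N rB = B" "regs N rVIS = u"
   using same_reg[OF sv] ss p(3,5,7,9) by (simp_all add: stg_at_def)
  let ?t = "N\<lparr>regs := (regs N)(rR := 1 - length ls, rQ := (length ls - 1) + (1 - length ls))\<rparr>"
  have st0: "same {} {rQ, rR} N ?t" by (simp add: same_def)
  have tr: "ran {rQ, rR} (length stg) ?C [] N ?t"
   by (rule ran_regs[OF ranD(1,2,7)[OF r] st0]) auto
  have rt: "ran node_regs (length stg) ?C (([] @ []) @ []) Z ?t"
   by (rule ran_trans[OF ran_mono[OF r] tr]) auto
  have loct: "list_at (mem ?t) ?C ?vals" using loc by simp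
  have runn: "wp P (block (neq rCNT rONE # cs)) Q N \<longleftrightarrow> wp P (block cs) (\<lambda>t. Q (4 + t)) ?t" for Q cs
   using reg(6) stat_regs[OF ranD(1)[OF r]] unfolding neq_def
   by (simp add: wp_funs set_reg_def fun_upd_twist numeral_add_Suc)
  show "wp P (block [neq rCNT rONE, IfNZ rQ (block [Add rA0 rSS rZ, Add rE0 rSD rZ, emit]) Skip,
    tail, locals 0, restore node_locals, Add rSS rSD rZ, Sub rLL rQT rSS]) (\<lambda>t2. ?Q (9 + (3 * length node_locals + 1 + t2))) N"
   unfolding runn
  proof (cases "length ls = 1")
   case True
   have T: "wp P (block [tail, locals 0, restore node_locals, Add rSS rSD rZ, Sub rLL rQT rSS]) (\<lambda>t'. ?Q (37 + t')) ?t"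
    by (rule tl[OF rt loct]) (use reg True w1 in \<open>simp_all add: part_ok_def\<close>)
   have run1: "wp P (block (IfNZ rQ c Skip # cs)) Q ?t \<longleftrightarrow> wp P (block cs) (\<lambda>t. Q (2 + t)) ?t" for c cs Q
    using True by (simp add: wp_funs numeral_add_Suc)
   show "wp P (block [IfNZ rQ (block [Add rA0 rSS rZ, Add rE0 rSD rZ, emit]) Skip,
     tail, locals 0, restore node_locals, Add rSS rSD rZ, Sub rLL rQT rSS])
     (\<lambda>t. ?Q (9 + (3 * length node_locals + 1 + (4 + t)))) ?t"
    unfolding run1 by (rule wp_mono[OF T]) (simp add: len7)
  next
   case False
   then have q: "Suc 0 < length ls" using ls by (cases "length ls") auto
   let ?v = "?t\<lparr>regs := (regs ?t)(rA0 := ?a, rE0 := ?sd)\<rparr>"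
   have vs: "same {} {rA0, rE0} ?t ?v" by (simp add: same_def)
   have v: "ran {rA0, rE0} (length stg) ?C [] ?t ?v" by (rule ran_regs[OF ranD(1,2,7)[OF rt] vs]) auto
   have rv: "ran node_regs (length stg) ?C ((([] @ []) @ []) @ []) Z ?v" by (rule ran_trans[OF rt v]) auto
   have stm: "mem ?v (B + c) = u \<longleftrightarrow> c \<in> U" if "c < n" for c
    using ran_mem[OF rv, of "B + c"] stamps[OF that] that B BW FB by simp
   have ok: "emit_ok U l ?a ?v"
    unfolding emit_ok_def
   proof (intro conjI)
    show "list_at (mem ?v) ?a l" by (rule ran_list_at[OF rv lal]) (use B BW FB fitl in auto)
   qed (use ranD[OF rv] reg fitl BW ln stm in auto)
   have T: "wp P emit (\<lambda>t1. wp P (block [tail, locals 0, restore node_locals, Add rSS rSD rZ, Sub rLL rQT rSS])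
     (\<lambda>t2. ?Q (9 + (3 * length node_locals + 1 + (4 + (4 + t1 + t2)))))) ?v"
   proof (rule wp_emit[OF ok])
    fix t1 Y assume em: "emits emit_regs (lab U l) ?v Y" and t1: "t1 \<le> 120 * wts l + 50"
    have e: "ran emit_regs (length stg) ?C (lab U l) ?v Y"
     by (rule ran_emits[OF ranD(1,2,7)[OF rv] em]) auto
    have re: "ran node_regs (length stg) ?C (((([] @ []) @ []) @ []) @ lab U l) Z Y"
     by (rule ran_trans[OF rv e]) auto
    have cl: "codes_label (Graph (gr (set l))) (lab U l)" by (rule codes_lab[OF ln(2,1) l'(2)])
    \<comment> \<open>Writing a label changes nothing below EN. The weaker bound of \<open>e\<close>
      would not exclude that the saved registers are overwritten.\<close>
    have e2: "ran emit_regs (length stg) EN (lab U l) ?v Y"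
     by (rule ran_emits[OF ranD(1,2,7)[OF rv] em]) auto
    have "list_at (mem Y) ?C ?vals"
     by (rule ran_list_at[OF e2]) (use loct B BW FB in simp_all)
    then have T': "wp P (block [tail, locals 0, restore node_locals, Add rSS rSD rZ, Sub rLL rQT rSS])
      (\<lambda>t'. ?Q ((t1 + 39) + t')) Y"
     by (rule tl[OF re]) (use reg emits_reg[OF em] t1 w1 False cl length_lab[of U l] in \<open>simp_all add: part_ok_def tail_ok_def\<close>)
    show "wp P (block [tail, locals 0, restore node_locals, Add rSS rSD rZ, Sub rLL rQT rSS])
     (\<lambda>t2. ?Q (9 + (3 * length node_locals + 1 + (4 + (4 + t1 + t2))))) Y"
     by (rule wp_mono[OF T']) (simp add: len7)
   qed
   have run2: "wp P (block (IfNZ rQ (block [Add rA0 rSS rZ, Add rE0 rSD rZ, emit]) Skip # cs)) Q ?t \<longleftrightarrow>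
     wp P emit (\<lambda>t1. wp P (block cs) (\<lambda>t2. Q (4 + t1 + t2))) ?v" for cs Q
    using q reg stat_regs[OF ranD(1)[OF rt]] by (simp add: wp_funs set_reg_def numeral_add_Suc)
   show "wp P (block [IfNZ rQ (block [Add rA0 rSS rZ, Add rE0 rSD rZ, emit]) Skip,
     tail, locals 0, restore node_locals, Add rSS rSD rZ, Sub rLL rQT rSS])
     (\<lambda>t. ?Q (9 + (3 * length node_locals + 1 + (4 + t)))) ?t"
    unfolding run2 by (rule T)
  qed
 qed (use stat_regs[OF p(1)] in \<open>simp_all add: node_locals_def\<close>)
qed

lemma ran_refl: "stat Z \<Longrightarrow> fresh Z \<Longrightarrow> EN \<le> regs Z rOUT \<Longrightarrow> ran R l B [] Z Z"
 by (rule ran_mono[OF ran_regs[where R = "{}"]]) (auto simp: same_refl)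

text \<open>The words written so far are part of the potential. So the final bound covers their
  surcharge as well.\<close>

lemma wp_node_loop:
 assumes IH: "\<And>b'. b = Suc b' \<Longrightarrow> spec P b'"
  and B: "FB \<le> B" "B + W * Suc b \<le> EN" and U: "U \<subseteq> {..<n}"
  and h: "hist D stg X U" "card X + b = D" "length stg \<le> card X"
  and lp: "loop_state b B u U ls stg Z" and ss: "regs Z rSS = B + n + n" "regs Z rLL = length (concat ls)"
 shows "wp P (WhileNZ rLL (block [Add rA rSS rN, Load rSD rA, locals 0, save node_locals,
    neq rCNT rONE, IfNZ rQ (block [Add rA0 rSS rZ, Add rE0 rSD rZ, emit]) Skip,
    tail, locals 0, restore node_locals, Add rSS rSD rZ, Sub rLL rQT rSS]))
  (\<lambda>t Z'. \<exists>uss. ran node_regs (length stg) (B + 4 * n) (concat uss) Z Z' \<and>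
    outcome (list_all2 (part_ok b ls) ls uss) (regs Z rFAIL) (regs Z' rFAIL) \<and>
    t + 10 * length (concat uss) \<le> part_cost b * wts (concat ls) + 1) Z"
proof -
 let ?I = "\<lambda>p Y. \<exists>ks rs uss. ls = ks @ rs \<and> ran node_regs (length stg) (B + 4 * n) (concat uss) Z Y \<and>
  loop_state b B u U ls stg Y \<and> regs Y rSS = B + n + n + length (concat ks) \<and> regs Y rLL = length (concat rs) \<and>
  outcome (list_all2 (part_ok b ls) ks uss) (regs Z rFAIL) (regs Y rFAIL) \<and>
  p = 10 * length (concat uss) + part_cost b * wts (concat rs)"
 have ne: "[] \<notin> set ls" using loop_stateD(10)[OF lp] by (auto simp: frame_ok_def comps_def comp_ok_def)
 show ?thesis
 proof (rule wp_WhileNZ'[where I = ?I and p = "part_cost b * wts (concat ls)"])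
  have "ran node_regs (length stg) (B + 4 * n) [] Z Z"
   by (rule ran_refl[OF loop_stateD(1,2,11)[OF lp]])
  moreover have "outcome True (regs Z rFAIL) (regs Z rFAIL)" by (simp add: outcome_def)
  ultimately show "?I (part_cost b * wts (concat ls)) Z"
   using lp ss by (intro exI[of _ "[]"] exI[of _ ls]) simp
 next
  fix p Y assume I: "?I p Y" and nz: "regs Y rLL \<noteq> 0"
  then obtain ks rs uss where i: "ls = ks @ rs" "ran node_regs (length stg) (B + 4 * n) (concat uss) Z Y"
   "loop_state b B u U ls stg Y" "regs Y rSS = B + n + n + length (concat ks)" "regs Y rLL = length (concat rs)"
   "outcome (list_all2 (part_ok b ls) ks uss) (regs Z rFAIL) (regs Y rFAIL)"
   "p = 10 * length (concat uss) + part_cost b * wts (concat rs)" by blast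
  have "rs \<noteq> []" using i(5) nz by auto
  then obtain l rs' where rs: "rs = l # rs'" by (cases rs) auto
  show "wp P (block [Add rA rSS rN, Load rSD rA, locals 0, save node_locals,
    neq rCNT rONE, IfNZ rQ (block [Add rA0 rSS rZ, Add rE0 rSD rZ, emit]) Skip,
    tail, locals 0, restore node_locals, Add rSS rSD rZ, Sub rLL rQT rSS])
    (\<lambda>t Z'. \<exists>p'. ?I p' Z' \<and> t + 1 + p' \<le> p) Y"
  proof (rule wp_mono[OF wp_node_body[OF IH B U h i(3) i(1)[unfolded rs] i(4)]], assumption, elim exE conjE)
   fix t us N assume r: "ran node_regs (length stg) (B + 4 * n) us Y N" "loop_state b B u U ls stg N"
    "regs N rSS = B + n + n + length (concat (ks @ [l]))" "regs N rLL = length (concat rs')"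
    "outcome (part_ok b ls l us) (regs Y rFAIL) (regs N rFAIL)"
    "t + 1 + 10 * length us \<le> part_cost b * wts l"
   have "ran node_regs (length stg) (B + 4 * n) (concat uss @ us) Z N" by (rule ran_trans[OF i(2) r(1)]) auto
   moreover have "outcome (list_all2 (part_ok b ls) (ks @ [l]) (uss @ [us])) (regs Z rFAIL) (regs N rFAIL)"
    by (rule outcome_trans[OF i(6) r(5)]) (simp add: list_all2_appendI)
   ultimately have "?I (10 * length (concat (uss @ [us])) + part_cost b * wts (concat rs')) N"
    using i(1) rs r(2-4) by (intro exI[of _ "ks @ [l]"] exI[of _ rs'] exI[of _ "uss @ [us]"]) simp
   moreover have "t + 1 + (10 * length (concat (uss @ [us])) + part_cost b * wts (concat rs')) \<le> p"
    using r(6) unfolding i(7) rs by (simp add: wts_simps add_mult_distrib2)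
   ultimately show "\<exists>p'. ?I p' N \<and> t + 1 + p' \<le> p" by blast
  qed
 next
  fix p' t Y assume I: "?I p' Y" and z: "regs Y rLL = 0" and t: "t + p' \<le> part_cost b * wts (concat ls) + 1"
  then obtain ks rs uss where i: "ls = ks @ rs" "ran node_regs (length stg) (B + 4 * n) (concat uss) Z Y"
   "regs Y rLL = length (concat rs)"
   "outcome (list_all2 (part_ok b ls) ks uss) (regs Z rFAIL) (regs Y rFAIL)"
   "p' = 10 * length (concat uss) + part_cost b * wts (concat rs)" by blast
  have "rs = []" using i(1,3) z ne by (cases rs; cases "hd rs") auto
  then show "\<exists>uss. ran node_regs (length stg) (B + 4 * n) (concat uss) Z Y \<and>
    outcome (list_all2 (part_ok b ls) ls uss) (regs Z rFAIL) (regs Y rFAIL) \<and>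
    t + 10 * length (concat uss) \<le> part_cost b * wts (concat ls) + 1"
   using i t by (intro exI[of _ uss]) simp
 qed
qed

lemma wts_subset:
 assumes "distinct xs" "distinct ys" "set ys \<subseteq> set xs" shows "wts ys \<le> wts xs"
 using weight_Diff[of "set xs" "set ys"] assms by (simp add: weight_set)

lemma wp_node:
 assumes IH: "\<And>b'. b = Suc b' \<Longrightarrow> spec P b'" and pre: "node_pre b B U xs a X stg Z"
 shows "wp P node (\<lambda>t. node_post b B U xs stg Z (Suc t)) Z"
proof -
 have p: "stat Z" "fresh Z" "regs Z rB = B" "FB \<le> B" "B + W * Suc b \<le> EN" "regs Z rBUD = b"
   "regs Z rSB = a" "regs Z rSE = a + length xs" "list_at (mem Z) a xs" "a + length xs \<le> B"
   "set xs \<subseteq> {..<n}" "distinct xs" "U \<subseteq> set xs"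
   "\<And>v. v < n \<Longrightarrow> mem Z (B + v) = regs Z rUID \<longleftrightarrow> v \<in> U" "EN \<le> regs Z rOUT"
   "hist D stg X U" "card X + b = D" "stg_at stg B Z" "length stg \<le> card X" "stg = [] \<Longrightarrow> regs Z rSH = 0"
  using pre unfolding node_pre_def by blast+
 have U: "U \<subseteq> {..<n}" using p(11,13) by blast
 have BW: "B + W \<le> EN" using p(5) by simp
 have lD: "length stg \<le> D" using p(17,19) by simp
 let ?u = "Suc (regs Z rUID)" and ?q = "B + n + n"
 let ?loop = "WhileNZ rLL (block [Add rA rSS rN, Load rSD rA, locals 0, save node_locals,
    neq rCNT rONE, IfNZ rQ (block [Add rA0 rSS rZ, Add rE0 rSD rZ, emit]) Skip,
    tail, locals 0, restore node_locals, Add rSS rSD rZ, Sub rLL rQT rSS])"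
 let ?rest = "block [neq rCNT rONE, IfNZ rQ (put rCNT) Skip, Add rSS rB rN, Add rSS rSS rN, Sub rLL rQT rSS, ?loop]"
 have sh: "regs Z rSH \<le> EN"
 proof (cases "stg = []")
  case False
  then have l: "length stg - 1 < length stg" by simp
  from hist_root_pre[OF p(16) l] hist_root_pre(3)[OF p(16) hist_root_pre(2)[OF p(16) l]]
  have "fst (snd (last stg)) < n" using False by (auto simp: last_conv_nth)
  then show ?thesis using p(18) False BW by (simp add: stg_at_def)
 qed (use p(20) in simp)
 have run: "wp P node Q Z \<longleftrightarrow> wp P split_comps (\<lambda>t Y.
   wp P emit (\<lambda>t'. wp P ?rest (\<lambda>t''. Q (t + (t' + t'') + 3)))
    (Y\<lparr>regs := (regs Y)(rA0 := regs Y rB + regs Y rN, rA0 := regs Y rB + regs Y rN + regs Y rN, rE0 := regs Y rQT + regs Y rZ)\<rparr>)) Z" for Q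
  unfolding node_def
  by (simp add: wp_funs(3,8) set_reg_def add_numeral_Suc)
 show ?thesis unfolding run
 proof (rule wp_mono[OF wp_split_comps[OF p(1-4) BW p(13,7-12,14)]], assumption, elim exE conjE)
  fix t ls Y assume Y: "frame_ok B ?u U ls (mem Y)" "stat Y" "fresh Y" "regs Y rVIS = ?u" "regs Y rUID = ?u"
   "regs Y rCNT = length ls" "regs Y rQT = ?q + length (concat ls)"
   and sm: "same {B..<B + W} ({rVIS, rUID} \<union> scan_regs) Z Y" and t: "t \<le> 110 * wts xs + 30"
  have cs: "comps U (\<lambda>v. mem Y (B + n + v)) ls" and la: "list_at (mem Y) ?q (concat ls)"
   and stamps: "\<And>v. v < n \<Longrightarrow> mem Y (B + v) = ?u \<longleftrightarrow> v \<in> U"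
   using Y(1) by (simp_all add: frame_ok_def)
  have dist: "distinct (concat ls)" "set (concat ls) = U" using cs by (simp_all add: comps_def)
  have len: "length (concat ls) \<le> n"
   using card_mono[OF _ U] distinct_card[OF dist(1)] dist(2) by simp
  have wls: "wts (concat ls) \<le> wts xs" by (rule wts_subset[OF p(12) dist(1)]) (use dist(2) p(13) in simp)
  have r1: "ran ({rVIS, rUID} \<union> scan_regs) (length stg) B [] Z Y"
   by (rule ran_same[OF Y(2,3) _ sm _ _ p(15)]) (use Y(5) BW in auto)
  have sa: "stg_at stg B Y" by (rule stg_at_same[OF p(18) sm _ _ _ p(16)]) (use lD MK FT_MK p(4) in auto)
  have reg: "regs Y rB = B" "regs Y rBUD = b" "regs Y rSH = regs Z rSH" "regs Y rFAIL = regs Z rFAIL"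
   using same_reg[OF sm, of rB] same_reg[OF sm, of rBUD] same_reg[OF sm, of rSH] same_reg[OF sm, of rFAIL] p(3,6) by simp_all
  note sr = stat_regs[OF Y(2)]
  let ?v = "Y\<lparr>regs := (regs Y)(rA0 := regs Y rB + regs Y rN, rA0 := regs Y rB + regs Y rN + regs Y rN, rE0 := regs Y rQT + regs Y rZ)\<rparr>"
  have vs: "same {} {rA0, rE0} Y ?v" by (simp add: same_def)
  have v: "ran {rA0, rE0} (length stg) B [] Y ?v" by (rule ran_regs[OF ranD(1,2,7)[OF r1] vs]) auto
  have r2: "ran node_regs (length stg) B ([] @ []) Z ?v" by (rule ran_trans[OF ran_mono[OF r1] v]) auto
  have ok: "emit_ok U (concat ls) ?q ?v"
   unfolding emit_ok_def using ranD[OF r2] sr reg la len BW U dist(2) stamps Y(4,7) by simp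
  show "wp P emit (\<lambda>t'. wp P ?rest (\<lambda>t''. node_post b B U xs stg Z (Suc (t + (t' + t'') + 3)))) ?v"
  proof (rule wp_emit[OF ok])
   fix t' N assume em: "emits emit_regs (lab U (concat ls)) ?v N" and t': "t' \<le> 120 * wts (concat ls) + 50"
   have e: "ran emit_regs (length stg) EN (lab U (concat ls)) ?v N"
    by (rule ran_emits[OF ranD(1,2,7)[OF r2] em]) auto
   have cl: "codes_label (Graph (gr U)) (lab U (concat ls))"
   proof -
    have "closed_in U U" by (simp add: closed_in_def)
    then show ?thesis by (rule codes_lab[OF dist(1), of U, unfolded dist(2), OF U])
   qed
   have re: "regs N rB = B" "regs N rQT = ?q + length (concat ls)" "regs N rCNT = length ls"
    using emits_reg[OF em, of rB] emits_reg[OF em, of rQT] emits_reg[OF em, of rCNT] reg Y(6,7) by simp_all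
   note de = ranD[OF e] and se = stat_regs[OF ranD(1)[OF e]]
   \<comment> \<open>Both cases, with and without a written number of children, are brought to one
     form so that the loop is treated only once.\<close>
   have "\<exists>\<phi> vs s. ran node_regs (length stg) EN vs N \<phi> \<and> regs \<phi> rSS = ?q \<and>
     regs \<phi> rLL = length (concat ls) \<and> vs = (if length ls = 1 then [] else [length ls]) \<and> s \<le> 15 \<and>
     (\<forall>r\<in>{rVIS, rQT, rCNT, rSH, rST, rFAIL}. regs \<phi> r = regs N r) \<and>
     (\<forall>Q. wp P ?rest Q N \<longleftrightarrow> wp P ?loop (\<lambda>t. Q (s + t)) \<phi>)"
   proof (cases "length ls = 1")
    case True
    let ?f = "N\<lparr>regs := (regs N)(rR := 0, rQ := 0, rSS := B + n, rSS := B + n + n, rLL := length (concat ls))\<rparr>"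
    have "same {} {rR, rQ, rSS, rLL} N ?f" by (simp add: same_def)
    then have "ran {rR, rQ, rSS, rLL} (length stg) EN [] N ?f" by (rule ran_regs[OF de(1,2,7)]) auto
    then have rf: "ran node_regs (length stg) EN [] N ?f" by (rule ran_mono) auto
    have wf: "wp P (block [neq rCNT rONE, IfNZ rQ (put rCNT) Skip, Add rSS rB rN, Add rSS rSS rN, Sub rLL rQT rSS, c]) Q N \<longleftrightarrow>
      wp P c (\<lambda>t. Q (10 + t)) ?f" for Q c
    proof -
     have neq: "wp P (block (neq rCNT rONE # cs)) Q' N \<longleftrightarrow> wp P (block cs) (\<lambda>t. Q' (4 + t))
      (N\<lparr>regs := (regs N)(rR := 0, rQ := 0)\<rparr>)" for cs Q'
      using re se True unfolding neq_def by (simp add: wp_funs set_reg_def fun_upd_twist numeral_add_Suc)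
     show ?thesis unfolding neq
      by (simp only: block.simps wp_funs put_def) (use re se in \<open>simp add: set_reg_def numeral_add_Suc\<close>)
    qed
    show ?thesis
    proof (rule exI[of _ ?f], rule exI[of _ "[]"], rule exI[of _ 10], intro conjI allI)
     show "ran node_regs (length stg) EN [] N ?f" by (rule rf)
     show "wp P ?rest Q N \<longleftrightarrow> wp P ?loop (\<lambda>t. Q (10 + t)) ?f" for Q by (rule wf)
    qed (use True in simp_all)
   next
    case False
    let ?f = "N\<lparr>mem := (mem N)(regs N rOUT := length ls), regs := (regs N)(rR := 1 - length ls,
     rQ := (length ls - 1) + (1 - length ls), rOUT := Suc (regs N rOUT), rSS := B + n, rSS := B + n + n, rLL := length (concat ls))\<rparr>"
    have "emits {rR, rQ, rOUT, rSS, rLL} [length ls] N ?f"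
     by (rule emits_intro) (auto simp: list_at_Cons list_at_Nil)
    then have "ran {rR, rQ, rOUT, rSS, rLL} (length stg) EN [length ls] N ?f" by (rule ran_emits[OF de(1,2,7)]) auto
    then have rf: "ran node_regs (length stg) EN [length ls] N ?f" by (rule ran_mono) auto
    have wf: "wp P (block [neq rCNT rONE, IfNZ rQ (put rCNT) Skip, Add rSS rB rN, Add rSS rSS rN, Sub rLL rQT rSS, c]) Q N \<longleftrightarrow>
      wp P c (\<lambda>t. Q (12 + t)) ?f" for Q c
    proof -
     have q: "(length ls - 1) + (1 - length ls) \<noteq> 0" using False by arith
     have neq: "wp P (block (neq rCNT rONE # cs)) Q' N \<longleftrightarrow> wp P (block cs) (\<lambda>t. Q' (4 + t))
      (N\<lparr>regs := (regs N)(rR := 1 - length ls, rQ := (length ls - 1) + (1 - length ls))\<rparr>)" for cs Q'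
      using re se unfolding neq_def by (simp add: wp_funs set_reg_def fun_upd_twist numeral_add_Suc)
     have iff: "wp P (block (IfNZ rQ c Skip # cs)) Q' \<psi> \<longleftrightarrow> wp P c (\<lambda>t. wp P (block cs) (\<lambda>t'. Q' (1 + t + t'))) \<psi>"
      if "regs \<psi> rQ \<noteq> 0" for c cs Q' \<psi>
      using that by (simp add: wp_funs)
     show ?thesis unfolding neq
      by (subst iff) (use q in simp, simp only: block.simps wp_funs put_def, use re se in \<open>simp add: set_reg_def numeral_add_Suc\<close>)
    qed
    show ?thesis
    proof (rule exI[of _ ?f], rule exI[of _ "[length ls]"], rule exI[of _ 12], intro conjI allI)
     show "ran node_regs (length stg) EN [length ls] N ?f" by (rule rf)
     show "wp P ?rest Q N \<longleftrightarrow> wp P ?loop (\<lambda>t. Q (12 + t)) ?f" for Q by (rule wf)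
    qed (use False in simp_all)
   qed
   then show "wp P ?rest (\<lambda>t''. node_post b B U xs stg Z (Suc (t + (t' + t'') + 3))) N"
   proof (elim exE conjE)
   fix \<phi> vs s assume f: "ran node_regs (length stg) EN vs N \<phi>" "regs \<phi> rSS = ?q"
     "regs \<phi> rLL = length (concat ls)" "vs = (if length ls = 1 then [] else [length ls])" "s \<le> 15"
     "\<forall>r\<in>{rVIS, rQT, rCNT, rSH, rST, rFAIL}. regs \<phi> r = regs N r"
     "\<forall>Q. wp P ?rest Q N \<longleftrightarrow> wp P ?loop (\<lambda>t. Q (s + t)) \<phi>"
   have ef: "ran node_regs (length stg) EN (lab U (concat ls) @ vs) ?v \<phi>"
    by (rule ran_trans[OF ran_mono[OF e] f(1)]) auto
   have tf: "ran node_regs (length stg) EN ([] @ (lab U (concat ls) @ vs)) Y \<phi>"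
   proof (rule ran_trans[OF _ ef])
    show "ran node_regs (length stg) EN [] Y ?v"
     by (rule ran_mono[OF ran_regs[OF ranD(1,2,7)[OF r1] vs, of _ EN]]) auto
   qed auto
   have r3: "ran node_regs (length stg) B (([] @ []) @ (lab U (concat ls) @ vs)) Z \<phi>"
    by (rule ran_trans[OF r2 ef]) (use BW in auto)
   have rr: "regs \<phi> r = regs Y r" if "r \<in> {rVIS, rQT, rCNT, rSH, rST, rFAIL}" for r
    using bspec[OF f(6) that] emits_reg[OF em, of r] that by auto
   have lp: "loop_state b B ?u U ls stg \<phi>"
    unfolding loop_state_def
   proof (intro conjI)
    show "stat \<phi>" "fresh \<phi>" "EN \<le> regs \<phi> rOUT" using ranD[OF tf] by simp_all
    show "regs \<phi> rB = B" "regs \<phi> rBUD = b" using ran_reg[OF tf, of rB] ran_reg[OF tf, of rBUD] reg by simp_all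
    show "regs \<phi> rVIS = ?u" "regs \<phi> rQT = ?q + length (concat ls)" "regs \<phi> rCNT = length ls" "regs \<phi> rSH \<le> EN"
     using rr Y(4,6,7) reg(3) sh by simp_all
    show "stg_at stg B \<phi>"
     by (rule ran_stg_at[OF tf sa p(16) _ lD]) (use rr p(4) BW in auto)
    show "frame_ok B ?u U ls (mem \<phi>)"
     by (rule frame_ok_cong[OF Y(1) U], rule ran_mem[OF tf]) (use p(4) FB BW in auto)
    show "?u \<le> regs \<phi> rUID" using ranD(3)[OF tf] Y(5) by simp
   qed
   show "wp P ?rest (\<lambda>t''. node_post b B U xs stg Z (Suc (t + (t' + t'') + 3))) N"
    unfolding f(7)[rule_format]
   proof (rule wp_mono[OF wp_node_loop[OF IH p(4,5) U p(16,17,19) lp f(2,3)]], assumption, elim exE conjE)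
    fix t2 uss \<omega> assume w: "ran node_regs (length stg) (B + 4 * n) (concat uss) \<phi> \<omega>"
     "outcome (list_all2 (part_ok b ls) ls uss) (regs \<phi> rFAIL) (regs \<omega> rFAIL)"
     "t2 + 10 * length (concat uss) \<le> part_cost b * wts (concat ls) + 1"
    let ?us = "(([] @ []) @ (lab U (concat ls) @ vs)) @ concat uss"
    have r4: "ran node_regs (length stg) B ?us Z \<omega>" by (rule ran_trans[OF r3 w(1)]) auto
    have good: "node_ok U b ?us" if l2: "list_all2 (part_ok b ls) ls uss"
    proof (cases "length ls = 1")
     case True
     then obtain l where l: "ls = [l]" by (cases ls) auto
     then obtain us where us: "uss = [us]" "part_ok b ls l us" using l2 by (cases uss) auto
     have "tail_ok U b us" using us(2) l dist(2) by (simp add: part_ok_def)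
     then show ?thesis using cl f(4) l us(1) by (simp add: tail_ok_def)
    next
     case False
     have "list_all2 (\<lambda>l us. node_ok (set l) b us) ls uss"
      by (rule list_all2_mono[OF l2]) (use False in \<open>simp add: part_ok_def\<close>)
     from node_ok_split[OF U cs False cl this] show ?thesis using False f(4) by simp
    qed
    have o: "outcome (node_ok U b ?us) (regs Z rFAIL) (regs \<omega> rFAIL)"
     using outcome_mono[OF w(2) good] rr[of rFAIL] reg(4) by simp
    have "Suc (t + (t' + (s + t2)) + 3) + 10 * length ?us \<le> cost b * (1 + wts xs)"
    proof -
     define pc where "pc = part_cost b"
     have c: "8000 * (D + 1) \<le> cost b" by (rule cost_ge)
     then have "5000 * (D + 1) \<le> cost b" by simp
     then have 1: "pc * wts xs + 5000 * (D + 1) * wts xs = cost b * wts xs"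
      unfolding pc_def by (metis add_mult_distrib le_add_diff_inverse2)
     have 2: "pc * wts (concat ls) \<le> pc * wts xs" by (rule mult_le_mono2[OF wls])
     have 3: "300 * wts xs \<le> 5000 * (D + 1) * wts xs" by (rule mult_le_mono1) simp
     have 4: "length vs \<le> 1" using f(4) by simp
     have 5: "length ?us = length (lab U (concat ls)) + length vs + length (concat uss)" by simp
     have 6: "cost b * (1 + wts xs) = cost b + cost b * wts xs" by simp
     have 7: "8000 \<le> cost b" using c by simp
     have 8: "t2 + 10 * length (concat uss) \<le> pc * wts (concat ls) + 1" using w(3) unfolding pc_def .
     \<comment> \<open>The products are replaced by variables to make the inequality linear.\<close>
     have "Suc (t + (t' + (s + t2)) + 3) + 10 * (m + v + z) \<le> c + c1"
      if "p1 + q = c1" "p2 \<le> p1" "300 * wts xs \<le> q" "v \<le> 1" "8000 \<le> c" "t2 + 10 * z \<le> p2 + 1"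
       "m \<le> 2 * wts (concat ls) + 5" for p1 q c1 p2 v c z m :: nat
     proof -
      have "t + t' + 10 * m \<le> 250 * wts xs + 130" using t t' wls that(7) by linarith
      moreover have "250 * wts xs \<le> q" using that(3) by linarith
      moreover have "s + t2 + 10 * z + 10 * v \<le> p1 + 26" using f(5) that(2,4,6) by linarith
      ultimately show ?thesis using that(1,5) by simp
     qed
     from this[OF 1 2 3 4 7 8 length_lab] show ?thesis unfolding 5 6 .
    qed
    then show "node_post b B U xs stg Z (Suc (t + (t' + (s + t2)) + 3)) \<omega>"
     using r4 o unfolding node_post_def by blast
   qed
   qed
  qed
 qed
qed

text \<open>Induction on the remaining budget, which drops by one between a call and the calls that
  it makes.\<close>

lemma node_correct: "spec backdoor_program b"
proof (induction b)
 case 0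
 show ?case unfolding spec_def
 proof (intro allI impI)
  fix B U xs a X stg Z assume "node_pre 0 B U xs a X stg Z"
  then have "wp backdoor_program node (\<lambda>t. node_post 0 B U xs stg Z (Suc t)) Z" by (rule wp_node[rotated]) simp
  then show "wp backdoor_program (Call 1) (node_post 0 B U xs stg Z) Z"
   by (intro wp_Call) (simp_all add: backdoor_program_def)
 qed
next
 case (Suc b)
 show ?case unfolding spec_def
 proof (intro allI impI)
  fix B U xs a X stg Z assume "node_pre (Suc b) B U xs a X stg Z"
  then have "wp backdoor_program node (\<lambda>t. node_post (Suc b) B U xs stg Z (Suc t)) Z"
   by (rule wp_node[rotated]) (use Suc in simp)
  then show "wp backdoor_program (Call 1) (node_post (Suc b) B U xs stg Z) Z"
   by (intro wp_Call) (simp_all add: backdoor_program_def)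
 qed
qed

end

section \<open>The complete run\<close>

context machine
begin

lemma gr_all: "gr {..<n} = G"
 using ig unfolding gr_def verts_dec[symmetric]
 by (cases G) (auto simp: induced_def verts_def incidence_graph_def)

lemma wp_report:
 assumes st: "regs Z rZ = 0" "regs Z rONE = 1" "out_tape Z = []"
  and ob: "regs Z rOB = a" "regs Z rOUT = a + length us" "list_at (mem Z) a us"
  and Q: "\<And>t (Z' :: state). out_tape Z' = (if regs Z rFAIL = 0 then 1 # us else [0]) \<Longrightarrow> t \<le> 6 * length us + 10 \<Longrightarrow> Q t Z'"
 shows "wp P report Q Z"
proof (cases "regs Z rFAIL = 0")
 case False
 then show ?thesis using st unfolding report_def by (auto simp: wp_funs intro!: Q)
next
 case True
 let ?b = "block [Load rX rOB, Write rX, Add rOB rOB rONE, Sub rL rOUT rOB]"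
 let ?s = "Z\<lparr>out_tape := [1], regs := (regs Z)(rL := length us)\<rparr>"
 let ?I = "\<lambda>q Y. \<exists>vs ws. us = vs @ ws \<and> regs Y rOB = a + length vs \<and> regs Y rL = length ws \<and> regs Y rONE = 1 \<and>
  regs Y rOUT = a + length us \<and> mem Y = mem Z \<and> out_tape Y = 1 # vs \<and> q = 6 * length ws"
 have loop: "wp P (WhileNZ rL ?b) (\<lambda>t. Q (t + 4)) ?s"
 proof (rule wp_WhileNZ'[where I = ?I and p = "6 * length us"])
  show "?I (6 * length us) ?s" using st ob by (intro exI[of _ "[]"] exI[of _ us]) simp
 next
  fix q :: nat and Y :: state assume I: "?I q Y" and nz: "regs Y rL \<noteq> 0"
  then obtain vs ws where i: "us = vs @ ws" "regs Y rOB = a + length vs" "regs Y rL = length ws" "regs Y rONE = 1"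
   "regs Y rOUT = a + length us" "mem Y = mem Z" "out_tape Y = 1 # vs" "q = 6 * length ws" by blast
  then obtain w ws' where w: "ws = w # ws'" using nz by (cases ws) auto
  have "mem Z (a + length vs) = w" using ob(3) i(1) w by (simp add: list_at_append list_at_Cons)
  let ?e = "Y\<lparr>out_tape := 1 # vs @ [w], regs := (regs Y)(rX := w, rOB := a + length (vs @ [w]), rL := length ws')\<rparr>"
  have run: "wp P ?b Q' Y \<longleftrightarrow> Q' (Suc (Suc (Suc (Suc (Suc 0))))) ?e" for Q'
   using i w \<open>mem Z (a + length vs) = w\<close> by (simp add: wp_funs set_reg_def)
  have "?I (6 * length ws') ?e" using i w by (intro exI[of _ "vs @ [w]"] exI[of _ ws']) simp
  then show "wp P ?b (\<lambda>t Z'. \<exists>p'. ?I p' Z' \<and> t + 1 + p' \<le> q) Y"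
   unfolding run by (intro exI[of _ "6 * length ws'"]) (use i w in simp)
 next
  fix p' t :: nat and Y :: state assume "?I p' Y" "regs Y rL = 0" "t + p' \<le> 6 * length us + 1"
  then show "Q (t + 4) Y" using True by (intro Q) auto
 qed
 have "wp P report Q Z \<longleftrightarrow> wp P (WhileNZ rL ?b) (\<lambda>t. Q (t + 4)) ?s"
  using True st ob unfolding report_def
  by (simp only: wp_funs block.simps) (simp add: set_reg_def add_numeral_Suc)
 then show ?thesis using loop by simp
qed

lemma wp_layout:
 assumes reg: "regs Z rONE = 1" "regs Z rNV = nv" "regs Z rN = n" "regs Z rHD = HD" "regs Z rDD = D" "regs Z rPR = PR"
   "regs Z rZ = 0" "regs Z rST = 0" "regs Z rSH = 0" "regs Z rFAIL = 0" "out_tape Z = []"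
  and m: "\<And>a. a < FT \<Longrightarrow> mem Z a = m0 a" "\<And>a. MK \<le> a \<Longrightarrow> mem Z a = 0" and FT: "FT = PR + D + D + 1"
  and Q: "\<And>t Y. node_pre D FB {..<n} [0..<n] (MK + n) {} [] Y \<Longrightarrow> regs Y rFAIL = 0 \<Longrightarrow> regs Y rOB = EN \<Longrightarrow>
   regs Y rOUT = EN \<Longrightarrow> out_tape Y = [] \<Longrightarrow> t \<le> 4 * D + 8 * n + 60 \<Longrightarrow> Q t Y"
 shows "wp P layout Q Z"
proof -
 let ?b1 = "block [Add rOUT rOUT rW, Sub rC rC rONE]"
 let ?b2 = "block [Add rA rSB rI, Store rA rI, Add rA rB rI, Store rA rUID, Add rI rI rONE, Sub rL rN rI]"
 let ?s1 = "Z\<lparr>regs := (regs Z)(rFT := FT, rMK := MK, rSB := MK + n, rSE := MK + n + n, rB := FB, rW := W,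
   rOUT := FB, rC := Suc (Suc D))\<rparr>"
 let ?rest = "block [Add rOB rOUT rZ, Add rUID rOUT rONE, Add rBUD rDD rZ, Const rI 0, Sub rL rN rI, WhileNZ rL ?b2]"
 have run1: "wp P layout Q Z \<longleftrightarrow> wp P (WhileNZ rC ?b1) (\<lambda>t. wp P ?rest (\<lambda>t'. Q (t + t' + 17))) ?s1" for Q
 proof -
  have e: "Suc (PR + D + D) = FT" "Suc (Suc (FT + D)) = MK" "MK + n + n = FB" "16 + n + n + n + n = W"
   using FT MK FB by simp_all
  have e17: "x + 17 = Suc (Suc (Suc (Suc (Suc (Suc (Suc (Suc (Suc (Suc (Suc (Suc (Suc (Suc (Suc (Suc (Suc x))))))))))))))))" for x :: nat
   by simp
  show ?thesis
   unfolding layout_def using reg(1,3,5,6,7)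
   by (simp add: wp_simps set_reg_def e e17)
 qed
 let ?I = "\<lambda>q Y. \<exists>j. regs Y rC = j \<and> regs Y rOUT + j * W = EN \<and> same {} {rOUT, rC} ?s1 Y \<and> q = 4 * j"
 show ?thesis unfolding run1
 proof (rule wp_WhileNZ'[where I = ?I and p = "4 * (D + 2)"])
  show "?I (4 * (D + 2)) ?s1" by (simp add: same_def EN)
 next
  fix q :: nat and Y :: state assume I: "?I q Y" and nz: "regs Y rC \<noteq> 0"
  obtain j where "regs Y rC = Suc j" using nz by (cases "regs Y rC") auto
  then have j: "regs Y rC = Suc j" "regs Y rOUT + Suc j * W = EN" "same {} {rOUT, rC} ?s1 Y" "q = 4 * Suc j"
   using I by (auto simp del: mult_Suc)
  let ?e = "Y\<lparr>regs := (regs Y)(rOUT := regs Y rOUT + W, rC := j)\<rparr>"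
  have "regs Y rW = W" "regs Y rONE = 1"
   using same_reg[OF j(3), of rW] same_reg[OF j(3), of rONE] reg(1) by simp_all
  then have run: "wp P ?b1 Q' Y \<longleftrightarrow> Q' 3 ?e" for Q'
   using j(1) by (simp add: wp_funs set_reg_def numeral_3_eq_3)
  have "?I (4 * j) ?e" using j by (simp add: same_def)
  then show "wp P ?b1 (\<lambda>t Z'. \<exists>p'. ?I p' Z' \<and> t + 1 + p' \<le> q) Y"
   unfolding run by (intro exI[of _ "4 * j"]) (use j(4) in simp)
 next
  fix p' t :: nat and Y :: state assume "?I p' Y" "regs Y rC = 0" and t: "t + p' \<le> 4 * (D + 2) + 1"
  then have Y: "regs Y rOUT = EN" "same {} {rOUT, rC} ?s1 Y" by auto
  have r: "regs Y r = regs ?s1 r" if "r \<notin> {rOUT, rC}" for r using same_reg[OF Y(2) that] .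
  have mt: "mem Y = mem Z" "out_tape Y = []" using Y(2) reg(11) by (auto simp: same_def)
  let ?s2 = "Y\<lparr>regs := (regs Y)(rOB := EN, rUID := Suc EN, rBUD := D, rI := 0, rL := n)\<rparr>"
  have run2: "wp P ?rest Q' Y \<longleftrightarrow> wp P (WhileNZ rL ?b2) (\<lambda>t. Q' (t + 6)) ?s2" for Q'
   using Y(1) r[of rZ] r[of rONE] r[of rDD] r[of rN] reg
   by (simp only: wp_funs block.simps) (simp add: set_reg_def add_numeral_Suc)
  let ?J = "\<lambda>q N. \<exists>i j. i + j = n \<and> regs N rI = i \<and> regs N rL = j \<and> same {MK + n..<FB + n} {rA, rI, rL} ?s2 N \<and>
   (\<forall>v<i. mem N (MK + n + v) = v \<and> mem N (FB + v) = Suc EN) \<and>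
   (\<forall>a. MK \<le> a \<longrightarrow> mem N a \<le> Suc EN) \<and> q = 8 * j"
  have nEN: "FB + n \<le> EN" "n \<le> EN" by (simp_all add: EN)
  show "wp P ?rest (\<lambda>t'. Q (t + t' + 17)) Y" unfolding run2
  proof (rule wp_WhileNZ'[where I = ?J and p = "8 * n"])
   show "?J (8 * n) ?s2" using m(2) mt by (simp add: same_refl)
  next
   fix q :: nat and N :: state assume J: "?J q N" and nz: "regs N rL \<noteq> 0"
   then obtain i j where ij: "i + Suc j = n" "regs N rI = i" "regs N rL = Suc j" and sm: "same {MK + n..<FB + n} {rA, rI, rL} ?s2 N"
    and mm: "\<forall>v<i. mem N (MK + n + v) = v \<and> mem N (FB + v) = Suc EN" "\<forall>a. MK \<le> a \<longrightarrow> mem N a \<le> Suc EN" and q: "q = 8 * Suc j"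
   proof (elim exE conjE)
    fix i j assume h: "\<And>i j. i + Suc j = n \<Longrightarrow> regs N rI = i \<Longrightarrow> regs N rL = Suc j \<Longrightarrow> same {MK + n..<FB + n} {rA, rI, rL} ?s2 N \<Longrightarrow>
     \<forall>v<i. mem N (MK + n + v) = v \<and> mem N (FB + v) = Suc EN \<Longrightarrow> \<forall>a\<ge>MK. mem N a \<le> Suc EN \<Longrightarrow> q = 8 * Suc j \<Longrightarrow> thesis"
     and i: "i + j = n" "regs N rI = i" "regs N rL = j" "same {MK + n..<FB + n} {rA, rI, rL} ?s2 N"
     "\<forall>v<i. mem N (MK + n + v) = v \<and> mem N (FB + v) = Suc EN" "\<forall>a\<ge>MK. mem N a \<le> Suc EN" "q = 8 * j"
    obtain j' where j': "j = Suc j'" using nz i(3) by (cases j) auto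
    show thesis by (rule h[OF _ i(2) _ i(4-6), of j']) (use i j' in simp_all)
   qed
   let ?e = "N\<lparr>mem := (mem N)(MK + n + i := i, FB + i := Suc EN), regs := (regs N)(rA := FB + i, rI := Suc i, rL := j)\<rparr>"
   have "regs N rSB = MK + n" "regs N rB = FB" "regs N rUID = Suc EN" "regs N rONE = 1" "regs N rN = n"
    using same_reg[OF sm, of rSB] same_reg[OF sm, of rB] same_reg[OF sm, of rUID] same_reg[OF sm, of rONE] same_reg[OF sm, of rN]
     r[of rSB] r[of rB] r[of rONE] r[of rN] reg by simp_all
   moreover have "n - Suc i = j" using ij(1) by simp
   ultimately have run: "wp P ?b2 Q' N \<longleftrightarrow> Q' 7 ?e" for Q'
    using ij by (simp add: wp_funs set_reg_def eval_nat_numeral)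
   have s': "same {MK + n..<FB + n} {rA, rI, rL} ?s2 ?e"
    using sm ij(1) FB by (simp add: same_def)
   have m1: "mem ?e (MK + n + v) = v \<and> mem ?e (FB + v) = Suc EN" if "v < Suc i" for v
    using mm(1) that ij(1) FB by (cases "v = i") auto
   have m2: "mem ?e b \<le> Suc EN" if "MK \<le> b" for b using mm(2) that ij(1) nEN by auto
   have "?J (8 * j) ?e"
   proof (rule exI[of _ "Suc i"], rule exI[of _ j], intro conjI allI impI)
    show "same {MK + n..<FB + n} {rA, rI, rL} ?s2 ?e" by (rule s')
   qed (use ij m1 m2 in simp_all)
   then show "wp P ?b2 (\<lambda>t Z'. \<exists>p'. ?J p' Z' \<and> t + 1 + p' \<le> q) N"
    unfolding run by (intro exI[of _ "8 * j"]) (use q in simp)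
  next
   fix p' t' :: nat and N :: state assume J: "?J p' N" and z: "regs N rL = 0" and t': "t' + p' \<le> 8 * n + 1"
   then have sm: "same {MK + n..<FB + n} {rA, rI, rL} ?s2 N"
    and mm: "\<forall>v<n. mem N (MK + n + v) = v \<and> mem N (FB + v) = Suc EN" "\<forall>a. MK \<le> a \<longrightarrow> mem N a \<le> Suc EN"
    by auto
   have rr: "regs N x = regs ?s2 x" if "x \<notin> {rA, rI, rL}" for x using same_reg[OF sm that] .
   have low: "mem N a = m0 a" if "a < FT" for a
    using same_mem[OF sm, of a] that FT_MK m(1)[OF that] mt by simp
   have st: "stat N" unfolding stat_def const_regs_def using low rr r reg by simp
   have pre: "node_pre D FB {..<n} [0..<n] (MK + n) {} [] N"
    unfolding node_pre_def
   proof (intro conjI allI impI)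
    show "stat N" by (rule st)
    show "fresh N" using mm(2) rr by (simp add: fresh_def)
    show "list_at (mem N) (MK + n) [0..<n]" using mm(1) by (simp add: list_at_def)
    show "FB + W * Suc D \<le> EN" by (simp add: EN algebra_simps)
    show "hist D [] {} {..<n}" by (rule hist_Nil)
    show "stg_at [] FB N" using rr r reg by (simp add: stg_at_def)
    show "mem N (FB + v) = regs N rUID \<longleftrightarrow> v \<in> {..<n}" if "v < n" for v
     using mm(1) that rr by simp
   qed (use rr r reg Y(1) FB in auto)
   show "Q (t + (t' + 6) + 17) N"
    by (rule Q[OF pre]) (use rr r reg Y(1) sm mt t t' in \<open>simp_all add: same_def\<close>)
  qed
 qed
qed

lemma wp_main:
 assumes reg: "regs Z rONE = 1" "regs Z rNV = nv" "regs Z rN = n" "regs Z rHD = HD" "regs Z rDD = D" "regs Z rPR = PR"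
   "regs Z rZ = 0" "regs Z rST = 0" "regs Z rSH = 0" "regs Z rFAIL = 0" "out_tape Z = []"
  and m: "\<And>a. a < FT \<Longrightarrow> mem Z a = m0 a" "\<And>a. MK \<le> a \<Longrightarrow> mem Z a = 0" and FT: "FT = PR + D + D + 1"
 shows "wp backdoor_program (block [layout, Call 1, report]) (\<lambda>t Z'. t \<le> 3 * cost D * (1 + wts [0..<n]) \<and>
  ((\<exists>T us. out_tape Z' = 1 # us \<and> codes_tree T us \<and> strong_recursive_backdoor class0 G T \<and> bd_depth T \<le> D) \<or>
   (out_tape Z' = [0] \<and> enat k < srbd class0 G))) Z"
 (is "wp _ _ ?Q _")
proof (rule wp_block_Cons, rule wp_layout[OF reg m FT], assumption, assumption)
 let ?c = "cost D * (1 + wts [0..<n])"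
 fix t Y assume pre: "node_pre D FB {..<n} [0..<n] (MK + n) {} [] Y" and Y: "regs Y rFAIL = 0" "regs Y rOB = EN"
   "regs Y rOUT = EN" "out_tape Y = []" and t: "t \<le> 4 * D + 8 * n + 60"
 have call: "wp backdoor_program (Call 1) (node_post D FB {..<n} [0..<n] [] Y) Y"
  using node_correct[of D] pre unfolding spec_def by blast
 show "wp backdoor_program (block [Call 1, report]) (\<lambda>t'. ?Q (t + t')) Y"
 proof (rule wp_block_Cons, rule wp_mono[OF call])
  fix t' N assume "node_post D FB {..<n} [0..<n] [] Y t' N"
  then obtain us where us: "ran node_regs 0 FB us Y N" "outcome (node_ok {..<n} D us) (regs Y rFAIL) (regs N rFAIL)"
   "t' + 10 * length us \<le> ?c" unfolding node_post_def by auto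
  note d = ranD[OF us(1)]
  have o: "out_tape N = []" using d(5) Y(4) by (simp add: same_def)
  have la: "list_at (mem N) EN us" using d(6) Y(3) by (simp add: wrote_list_at)
  have ob: "regs N rOB = EN" using ran_reg[OF us(1), of rOB] Y(2) by simp
  have ou: "regs N rOUT = EN + length us" using d(8) Y(3) by simp
  have "wp backdoor_program report (\<lambda>t2. ?Q (t + (t' + (t2 + 1)))) N"
  proof (rule wp_report[OF stat_regs(10,1)[OF d(1)] o ob ou la])
   fix t2 :: nat and \<omega> :: state assume w: "out_tape \<omega> = (if regs N rFAIL = 0 then 1 # us else [0])" "t2 \<le> 6 * length us + 10"
   have time: "t + (t' + (t2 + 1)) \<le> 3 * cost D * (1 + wts [0..<n])"
   proof -
    have "n \<le> wts [0..<n]" using length_le_wts[of "[0..<n]"] by simp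
    moreover have "8000 * (D + 1) * (1 + wts [0..<n]) \<le> ?c" by (rule mult_le_mono1[OF cost_ge])
    moreover have "8000 * (D + 1) * (1 + wts [0..<n]) = 8000 + 8000 * D + 8000 * wts [0..<n] + 8000 * (D * wts [0..<n])"
     by (simp add: algebra_simps)
    moreover have "3 * cost D * (1 + wts [0..<n]) = ?c + ?c + ?c" by simp
    ultimately show ?thesis using t us(3) w(2) by linarith
   qed
   show "?Q (t + (t' + (t2 + 1))) \<omega>"
   proof (cases "regs N rFAIL = 0")
    case True
    then have "node_ok {..<n} D us" using us(2) by (simp add: outcome_def)
    then show ?thesis using True w(1) time
     unfolding node_ok_def gr_all strong_recursive_backdoor_def by auto
   next
    case False
    then have "enat k < srbd class0 G" using us(2) Y(1) by (simp add: outcome_def)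
    then show ?thesis using False w(1) time by simp
   qed
  qed
  then show "wp backdoor_program (block [report]) (\<lambda>t2. ?Q (t + (t' + t2))) N"
   by (simp add: wp_funs)
 qed
qed

end

section \<open>Reading the input\<close>

text \<open>A list under construction. Unlike in \<open>cells\<close>, all of it lies at or above
  \<open>lo\<close>, so updates of the array of list heads below that address cannot damage
  it.\<close>

fun chain :: "(nat \<Rightarrow> nat) \<Rightarrow> nat \<Rightarrow> nat \<Rightarrow> nat \<Rightarrow> (nat \<times> nat) list \<Rightarrow> bool" where
 "chain m lo b p [] \<longleftrightarrow> p = 0"
| "chain m lo b p (x # xs) \<longleftrightarrow> lo \<le> p \<and> p + 2 < b \<and> m (p + 1) = fst x \<and> m (p + 2) = snd x \<and> chain m lo b (m p) xs"

lemma chain_cong: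
 assumes "chain m lo b p xs" "\<And>a. lo \<le> a \<Longrightarrow> a < b \<Longrightarrow> m' a = m a" "b \<le> b'"
 shows "chain m' lo b' p xs"
 using assms(1)
proof (induction xs arbitrary: p)
 case (Cons x xs)
 then show ?case using assms(2)[of p] assms(2)[of "p + 1"] assms(2)[of "p + 2"] assms(3) by auto
qed simp

lemma chain_cells: "chain m lo b p xs \<Longrightarrow> 0 < lo \<Longrightarrow> cells m b p xs"
 by (induction xs arbitrary: p) auto

definition heads :: "(nat \<Rightarrow> nat) \<Rightarrow> nat \<Rightarrow> nat \<Rightarrow> nat \<Rightarrow> (nat \<Rightarrow> (nat \<times> nat) list) \<Rightarrow> bool" where
 "heads m hp n p A \<longleftrightarrow> (\<forall>u<n. chain m (hp + n) p (m (hp + u)) (A u))"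

lemma heads_add:
 assumes h: "heads m hp n p A" and x: "x < n" and p: "hp + n \<le> p"
  and m': "m' = m(hp + x := p, p := m (hp + x), Suc p := w, Suc (Suc p) := s)"
 shows "heads m' hp n (Suc (Suc (Suc p))) (A(x := (w, s) # A x))"
 unfolding heads_def
proof (intro allI impI)
 fix u assume u: "u < n"
 have old: "m' a = m a" if "hp + n \<le> a" "a < p" for a using m' that x by simp
 have c: "chain m' (hp + n) (Suc (Suc (Suc p))) (m (hp + v)) (A v)" if "v < n" for v
  by (rule chain_cong[of m _ p]) (use h that old in \<open>auto simp: heads_def\<close>)
 show "chain m' (hp + n) (Suc (Suc (Suc p))) (m' (hp + u)) ((A(x := (w, s) # A x)) u)"
 proof (cases "u = x")
  case True
  then show ?thesis using c[OF x] p m' x by simp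
 next
  case False
  then show ?thesis using c[OF u] p m' u by simp
 qed
qed

text \<open>Cells are pushed to the front of a list, which reverses the order of the input.\<close>

definition adjs :: "nat \<Rightarrow> (nat \<times> nat \<times> nat) list \<Rightarrow> nat \<Rightarrow> (nat \<times> nat) list" where
 "adjs nv L u = rev (concat (map (\<lambda>(x, c, s). if u = x then [(nv + c, s)] else if u = nv + c then [(x, s)] else []) L))"

lemma adjs_snoc:
 "x < nv \<Longrightarrow> adjs nv (L @ [(x, c, s)]) = (adjs nv L)(x := (nv + c, s) # adjs nv L x, nv + c := (x, s) # adjs nv L (nv + c))"
 by (auto simp: adjs_def fun_eq_iff)

lemma wp_add_cell:
 assumes "regs Z rONE = 1" "regs Z rHD = hp" "regs Z rP = p" "u \<notin> {rA, rX, rP}" "w \<notin> {rA, rX, rP}"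
  and Q: "\<And>Z' :: state. mem Z' = (mem Z)(hp + regs Z u := p, p := mem Z (hp + regs Z u), Suc p := regs Z w, Suc (Suc p) := s) \<Longrightarrow>
   (\<And>r. r \<notin> {rA, rX, rP} \<Longrightarrow> regs Z' r = regs Z r) \<Longrightarrow> regs Z' rP = Suc (Suc (Suc p)) \<Longrightarrow> out_tape Z' = out_tape Z \<Longrightarrow>
   Q (Suc (Suc (Suc (Suc (Suc (Suc (Suc (Suc (Suc (Suc (Suc 0))))))))))) Z'"
 shows "wp P (add_cell u w s) Q Z"
proof -
 let ?e = "Z\<lparr>mem := (mem Z)(hp + regs Z u := p, p := mem Z (hp + regs Z u), Suc p := regs Z w, Suc (Suc p) := s),
  regs := (regs Z)(rA := hp + regs Z u, rX := mem Z (hp + regs Z u), rP := Suc (Suc p), rX := s, rP := Suc (Suc (Suc p)))\<rparr>"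
 have "wp P (add_cell u w s) Q Z \<longleftrightarrow> Q (Suc (Suc (Suc (Suc (Suc (Suc (Suc (Suc (Suc (Suc (Suc 0))))))))))) ?e"
  using assms(1-5) by (simp add: add_cell_def wp_simps set_reg_def)
 then show ?thesis using Q[of ?e] by simp
qed

lemma length_pairs: "length (concat (map (\<lambda>(x, c). [x, c]) es)) = 2 * length es"
 by (induction es) auto

abbreviation (input) read_regs :: "reg set" where
 "read_regs \<equiv> {rL, rU, rI, rV, rA, rX, rP}"

lemma wp_read_edges:
 assumes reg: "regs Z rI = a" "regs Z rE0 = a + 2 * length es" "regs Z rONE = 1" "regs Z rNV = nv" "regs Z rHD = hp" "regs Z rP = p"
  and la: "list_at (mem Z) a (concat (map (\<lambda>(x, c). [x, c]) es))" and fit: "a + 2 * length es \<le> hp" "hp + n \<le> p"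
  and h: "heads (mem Z) hp n p (adjs nv L)" and es: "\<And>x c. (x, c) \<in> set es \<Longrightarrow> x < nv \<and> nv + c < n"
  and Q: "\<And>t (Y :: state). regs Y rP = p + 6 * length es \<Longrightarrow>
   heads (mem Y) hp n (p + 6 * length es) (adjs nv (L @ map (\<lambda>(x, c). (x, c, s)) es)) \<Longrightarrow>
   (\<And>b. b < hp \<or> p + 6 * length es \<le> b \<Longrightarrow> mem Y b = mem Z b) \<Longrightarrow>
   (\<And>r. r \<notin> read_regs \<Longrightarrow> regs Y r = regs Z r) \<Longrightarrow> out_tape Y = out_tape Z \<Longrightarrow> t \<le> 35 * length es + 3 \<Longrightarrow> Q t Y"
 shows "wp P (read_edges s) Q Z"
proof -
 let ?b = "block [Load rU rI, Add rI rI rONE, Load rV rI, Add rI rI rONE, Add rV rV rNV,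
    add_cell rU rV s, add_cell rV rU s, Sub rL rE0 rI]"
 let ?L = "\<lambda>es. L @ map (\<lambda>(x, c). (x, c, s)) es"
 let ?J = "\<lambda>es1 es2 Y. es = es1 @ es2 \<and> regs Y rI = a + 2 * length es1 \<and> regs Y rL = 2 * length es2 \<and>
  regs Y rP = p + 6 * length es1 \<and> heads (mem Y) hp n (p + 6 * length es1) (adjs nv (?L es1)) \<and>
  (\<forall>b. b < hp \<or> p + 6 * length es1 \<le> b \<longrightarrow> mem Y b = mem Z b) \<and>
  (\<forall>r. r \<notin> read_regs \<longrightarrow> regs Y r = regs Z r) \<and> out_tape Y = out_tape Z"
 let ?I = "\<lambda>q Y. \<exists>es1 es2. ?J es1 es2 Y \<and> q = 35 * length es2"
 let ?s = "set_reg rL (2 * length es) Z"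
 have run: "wp P (read_edges s) Q Z \<longleftrightarrow> wp P (WhileNZ rL ?b) (\<lambda>t. Q (Suc (Suc t))) ?s"
  using reg unfolding read_edges_def by (simp add: wp_simps wp_funs(1))
 show ?thesis unfolding run
 proof (rule wp_WhileNZ'[where I = ?I and p = "35 * length es"])
  have "?J [] es ?s" using reg h by (simp add: set_reg_def)
  then show "?I (35 * length es) ?s" by (intro exI[of _ "[]"] exI[of _ es] conjI) simp_all
 next
  fix q :: nat and Y :: state assume I: "?I q Y" and nz: "regs Y rL \<noteq> 0"
  show "wp P ?b (\<lambda>t Z'. \<exists>p'. ?I p' Z' \<and> t + 1 + p' \<le> q) Y"
   using I
  proof (elim exE conjE)
   fix es1 es2 assume e: "es = es1 @ es2" "regs Y rI = a + 2 * length es1" "regs Y rL = 2 * length es2"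
    "regs Y rP = p + 6 * length es1" "heads (mem Y) hp n (p + 6 * length es1) (adjs nv (?L es1))"
    "\<forall>b. b < hp \<or> p + 6 * length es1 \<le> b \<longrightarrow> mem Y b = mem Z b"
    "\<forall>r. r \<notin> read_regs \<longrightarrow> regs Y r = regs Z r" "out_tape Y = out_tape Z" "q = 35 * length es2"
   obtain x c es3 where e2: "es2 = (x, c) # es3" using e(3) nz by (cases es2) auto
   have xc: "x < nv" "nv + c < n" "x < n" using es[of x c] e(1) e2 by auto
   let ?i = "a + 2 * length es1" let ?p = "p + 6 * length es1"
   have il: "Suc ?i < hp" using fit(1) e(1) e2 by simp
   have "list_at (mem Z) ?i ([x, c] @ concat (map (\<lambda>(x, c). [x, c]) es3))"
    using la e(1) e2 by (simp add: list_at_append length_pairs)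
   then have mx: "mem Y ?i = x" "mem Y (Suc ?i) = c" using e(6) il by (simp_all add: list_at_Cons)
   have r: "regs Y rONE = 1" "regs Y rNV = nv" "regs Y rHD = hp" "regs Y rE0 = a + 2 * length es"
    using e(7) reg by simp_all
   let ?t = "Y\<lparr>regs := (regs Y)(rU := x, rI := Suc ?i, rV := c, rI := Suc (Suc ?i), rV := c + nv)\<rparr>"
   have run1: "wp P ?b Q' Y \<longleftrightarrow> wp P (block [add_cell rU rV s, add_cell rV rU s, Sub rL rE0 rI])
     (\<lambda>t. Q' (Suc (Suc (Suc (Suc (Suc t)))))) ?t" for Q'
    using r e(2) mx by (simp add: wp_simps set_reg_def)
   show "wp P ?b (\<lambda>t Z'. \<exists>p'. ?I p' Z' \<and> t + 1 + p' \<le> q) Y"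
    unfolding run1
   proof (rule wp_block_Cons, rule wp_add_cell[where hp = hp and p = ?p], goal_cases)
    case (6 N)
    have m1: "mem N = (mem Y)(hp + x := ?p, ?p := mem Y (hp + x), Suc ?p := nv + c, Suc (Suc ?p) := s)"
     using 6(1) by (simp add: add.commute)
    have h1: "heads (mem N) hp n (Suc (Suc (Suc ?p))) ((adjs nv (?L es1))(x := (nv + c, s) # adjs nv (?L es1) x))"
     by (rule heads_add[OF e(5) xc(3) _ m1]) (use fit(2) in simp)
    have o1: "out_tape N = out_tape ?t" by (rule 6(4))
    have r1: "regs N r = regs ?t r" if "r \<notin> {rA, rX, rP}" for r using 6(2) that by blast
    show ?case
    proof (rule wp_block_Cons, rule wp_add_cell[where hp = hp and p = "Suc (Suc (Suc ?p))"], goal_cases)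
     case (6 \<phi>)
     have m2: "mem \<phi> = (mem N)(hp + (nv + c) := Suc (Suc (Suc ?p)), Suc (Suc (Suc ?p)) := mem N (hp + (nv + c)),
       Suc (Suc (Suc (Suc ?p))) := x, Suc (Suc (Suc (Suc (Suc ?p)))) := s)"
      using 6(1) r1[of rV] r1[of rU] by (simp add: add.commute)
     have "heads (mem \<phi>) hp n (Suc (Suc (Suc (Suc (Suc (Suc ?p))))))
       (((adjs nv (?L es1))(x := (nv + c, s) # adjs nv (?L es1) x))(nv + c := (x, s) # ((adjs nv (?L es1))(x := (nv + c, s) # adjs nv (?L es1) x)) (nv + c)))"
      by (rule heads_add[OF h1 xc(2) _ m2]) (use fit(2) in simp)
     moreover have "((adjs nv (?L es1))(x := (nv + c, s) # adjs nv (?L es1) x))(nv + c := (x, s) # ((adjs nv (?L es1))(x := (nv + c, s) # adjs nv (?L es1) x)) (nv + c))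
       = adjs nv (?L (es1 @ [(x, c)]))"
      using adjs_snoc[OF xc(1), of "?L es1" c s] xc(1) by simp
     moreover have "Suc (Suc (Suc (Suc (Suc (Suc ?p))))) = p + 6 * length (es1 @ [(x, c)])" by simp
     ultimately have h2: "heads (mem \<phi>) hp n (p + 6 * length (es1 @ [(x, c)])) (adjs nv (?L (es1 @ [(x, c)])))"
      by (simp only:)
     have r2: "regs \<phi> r = regs ?t r" if "r \<notin> {rA, rX, rP}" for r using 6(2) r1 that by simp
     have mm: "mem \<phi> b = mem Z b" if "b < hp \<or> p + 6 * length (es1 @ [(x, c)]) \<le> b" for b
      using that m1 m2 e(6) fit(2) xc by auto
     let ?e = "set_reg rL (2 * length es3) \<phi>"
     have J: "?J (es1 @ [(x, c)]) es3 ?e"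
     proof (intro conjI allI impI)
      show "regs ?e r' = regs Z r'" if "r' \<notin> read_regs" for r'
       using r2[of r'] e(7) that by (auto simp: set_reg_def)
      show "out_tape ?e = out_tape Z" using 6(4) o1 e(8) by (simp add: set_reg_def)
     qed (use e(1) e2 r2[of rI] 6(3) h2 mm in \<open>auto simp: set_reg_def\<close>)
     have run3: "wp P (block [Sub rL rE0 rI]) Q' \<phi> \<longleftrightarrow> Q' (Suc (Suc 0)) ?e" for Q'
      using r2[of rE0] r2[of rI] r(4) e(1) e2 by (simp add: wp_simps set_reg_def)
     show ?case unfolding run3
      by (rule exI[of _ "35 * length es3"], rule conjI, rule exI[of _ "es1 @ [(x, c)]"], rule exI[of _ es3], rule conjI, rule J)
       (use e(9) e2 in simp_all)
    qed (use r r1 6(3) in simp_all)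
   qed (use r e(4) in simp_all)
  qed
 next
  fix p' t :: nat and Y :: state assume I: "?I p' Y" and z: "regs Y rL = 0" and t: "t + p' \<le> 35 * length es + 1"
  show "Q (Suc (Suc t)) Y" using I
  proof (elim exE conjE)
   fix es1 es2 assume e: "es = es1 @ es2" "regs Y rI = a + 2 * length es1" "regs Y rL = 2 * length es2"
    "regs Y rP = p + 6 * length es1" "heads (mem Y) hp n (p + 6 * length es1) (adjs nv (?L es1))"
    "\<forall>b. b < hp \<or> p + 6 * length es1 \<le> b \<longrightarrow> mem Y b = mem Z b"
    "\<forall>r. r \<notin> read_regs \<longrightarrow> regs Y r = regs Z r" "out_tape Y = out_tape Z" "p' = 35 * length es2"
   have "es1 = es" using e(1,3) z by simp
   then show ?thesis using e(4-8) t by (intro Q) auto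
  qed
 qed
qed

lemma wp_fill_pre:
 assumes reg: "regs Z rONE = 1" "regs Z rPR = PR" "regs Z rDD = d" "regs Z rZ = 0"
  and Q: "\<And>t (Y :: state). (\<And>i. i < 2 * d \<Longrightarrow> mem Y (Suc (PR + i)) = Suc (pre i)) \<Longrightarrow>
   (\<And>b. b \<le> PR \<or> PR + 2 * d + 2 \<le> b \<Longrightarrow> mem Y b = mem Z b) \<Longrightarrow>
   (\<And>r. r \<notin> {rI, rF, rU, rC, rX} \<Longrightarrow> regs Y r = regs Z r) \<Longrightarrow> out_tape Y = out_tape Z \<Longrightarrow> t \<le> 13 * d + 7 \<Longrightarrow> Q t Y"
 shows "wp P fill_pre Q Z"
proof -
 let ?b = "block [Load rX rI, Add rX rX rX, Sub rX rX rONE, Store rF rX, Add rF rF rONE,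
    Store rF rU, Add rF rF rONE, Add rU rU rONE, Add rU rU rONE, Add rI rI rONE, Sub rC rC rONE]"
 let ?s = "Z\<lparr>mem := (mem Z)(Suc PR := 1), regs := (regs Z)(rI := Suc PR, rF := Suc PR, rU := 1, rC := d)\<rparr>"
 have run: "wp P fill_pre Q Z \<longleftrightarrow> wp P (WhileNZ rC ?b) (\<lambda>t. Q (Suc (Suc (Suc (Suc (Suc (Suc t))))))) ?s"
  using reg unfolding fill_pre_def by (simp add: wp_simps wp_funs(1) set_reg_def)
 \<comment> \<open>The first entry is listed separately: in the first round it is read although no
   entry has been computed yet.\<close>
 let ?J = "\<lambda>i j Y. i + j = d \<and> regs Y rI = Suc (PR + i) \<and> regs Y rF = Suc (PR + 2 * i) \<and> regs Y rU = Suc (2 * i) \<and>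
  regs Y rC = j \<and> (\<forall>v<2 * i. mem Y (Suc (PR + v)) = Suc (pre v)) \<and> mem Y (Suc PR) = 1 \<and>
  (\<forall>b. b \<le> PR \<or> PR + 2 * i + 2 \<le> b \<longrightarrow> mem Y b = mem Z b) \<and>
  (\<forall>r. r \<notin> {rI, rF, rU, rC, rX} \<longrightarrow> regs Y r = regs Z r) \<and> out_tape Y = out_tape Z"
 let ?I = "\<lambda>q Y. \<exists>i j. ?J i j Y \<and> q = 13 * j"
 show ?thesis unfolding run
 proof (rule wp_WhileNZ'[where I = ?I and p = "13 * d"])
  have "?J 0 d ?s" by simp
  then show "?I (13 * d) ?s" by (intro exI[of _ 0] exI[of _ d] conjI) simp_all
 next
  fix q :: nat and Y :: state assume I: "?I q Y" and nz: "regs Y rC \<noteq> 0"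
  show "wp P ?b (\<lambda>t Z'. \<exists>p'. ?I p' Z' \<and> t + 1 + p' \<le> q) Y"
   using I
  proof (elim exE conjE)
   fix i j assume e: "i + j = d" "regs Y rI = Suc (PR + i)" "regs Y rF = Suc (PR + 2 * i)" "regs Y rU = Suc (2 * i)"
    "regs Y rC = j" "\<forall>v<2 * i. mem Y (Suc (PR + v)) = Suc (pre v)" "mem Y (Suc PR) = 1"
    "\<forall>b. b \<le> PR \<or> PR + 2 * i + 2 \<le> b \<longrightarrow> mem Y b = mem Z b"
    "\<forall>r. r \<notin> {rI, rF, rU, rC, rX} \<longrightarrow> regs Y r = regs Z r" "out_tape Y = out_tape Z" "q = 13 * j"
   obtain j' where j: "j = Suc j'" using nz e(5) by (cases j) auto
   have x: "mem Y (Suc (PR + i)) = Suc (pre i)"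
   proof (cases "i = 0")
    case True
    then show ?thesis using e(7) by (simp add: pre_0)
   qed (use e(6) in simp)
   let ?f = "Suc (PR + 2 * i)"
   let ?e = "Y\<lparr>mem := (mem Y)(?f := Suc (pre i + pre i), Suc ?f := Suc (2 * i)),
    regs := (regs Y)(rX := Suc (pre i + pre i), rF := Suc (Suc ?f), rU := Suc (Suc (Suc (2 * i))), rI := Suc (Suc (PR + i)), rC := j')\<rparr>"
   have r: "regs Y rONE = 1" using e(9) reg(1) by simp
   have run1: "wp P ?b Q' Y \<longleftrightarrow> Q' (Suc (Suc (Suc (Suc (Suc (Suc (Suc (Suc (Suc (Suc (Suc (Suc 0)))))))))))) ?e" for Q'
    using r e(2-5) x j by (simp add: wp_simps set_reg_def)
   have tab: "mem ?e (Suc (PR + v)) = Suc (pre v)" if "v < 2 * Suc i" for v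
   proof -
    have "v < 2 * i \<or> v = 2 * i \<or> v = Suc (2 * i)" using that by auto
    then consider "v < 2 * i" | "v = 2 * i" | "v = Suc (2 * i)" by blast
    then show ?thesis
    proof cases
     case 2
     then show ?thesis by (simp add: pre_even)
    next
     case 3
     then show ?thesis by (simp add: pre_odd)
    qed (use e(6) in simp)
   qed
   have J: "?J (Suc i) j' ?e"
   proof (intro conjI allI impI)
    show "mem ?e (Suc (PR + v)) = Suc (pre v)" if "v < 2 * Suc i" for v by (rule tab[OF that])
    show "mem ?e (Suc PR) = 1" using tab[of 0] by (simp add: pre_0)
    show "mem ?e b' = mem Z b'" if "b' \<le> PR \<or> PR + 2 * Suc i + 2 \<le> b'" for b' using e(8) that by auto
   qed (use e j in auto)
   show "wp P ?b (\<lambda>t Z'. \<exists>p'. ?I p' Z' \<and> t + 1 + p' \<le> q) Y"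
    unfolding run1
    by (rule exI[of _ "13 * j'"], rule conjI, rule exI[of _ "Suc i"], rule exI[of _ j'], rule conjI, rule J) (use e(11) j in simp_all)
  qed
 next
  fix p' t :: nat and Y :: state assume I: "?I p' Y" and z: "regs Y rC = 0" and t: "t + p' \<le> 13 * d + 1"
  show "Q (Suc (Suc (Suc (Suc (Suc (Suc t)))))) Y" using I
  proof (elim exE conjE)
   fix i j assume e: "i + j = d" "regs Y rI = Suc (PR + i)" "regs Y rF = Suc (PR + 2 * i)" "regs Y rU = Suc (2 * i)"
    "regs Y rC = j" "\<forall>v<2 * i. mem Y (Suc (PR + v)) = Suc (pre v)" "mem Y (Suc PR) = 1"
    "\<forall>b. b \<le> PR \<or> PR + 2 * i + 2 \<le> b \<longrightarrow> mem Y b = mem Z b"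
    "\<forall>r. r \<notin> {rI, rF, rU, rC, rX} \<longrightarrow> regs Y r = regs Z r" "out_tape Y = out_tape Z" "p' = 13 * j"
   have "i = d" using e(1,5) z by simp
   then show ?thesis using e(6,8-10) t by (intro Q) auto
  qed
 qed
qed

lemma wp_parse:
 fixes vs cs :: "nat list" and ps ns :: "(nat \<times> nat) list"
 defines "nv \<equiv> length vs" and "n \<equiv> length vs + length cs" and "E \<equiv> length ps + length ns"
 defines "L \<equiv> map (\<lambda>(x, c). (x, c, 0)) ps @ map (\<lambda>(x, c). (x, c, 1)) ns"
 assumes es: "\<And>x c. (x, c) \<in> set ps \<union> set ns \<Longrightarrow> x < nv \<and> nv + c < n"
  and Q: "\<And>t (Y :: state). regs Y rONE = 1 \<Longrightarrow> regs Y rNV = nv \<Longrightarrow> regs Y rN = n \<Longrightarrow> regs Y rHD = n + 2 * E + 5 \<Longrightarrow>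
   regs Y rDD = 2 * k * 4 ^ k \<Longrightarrow> regs Y rPR = 2 * n + 8 * E + 5 \<Longrightarrow>
   regs Y rZ = 0 \<Longrightarrow> regs Y rST = 0 \<Longrightarrow> regs Y rSH = 0 \<Longrightarrow> regs Y rFAIL = 0 \<Longrightarrow> out_tape Y = [] \<Longrightarrow>
   heads (mem Y) (n + 2 * E + 5) n (2 * n + 8 * E + 5) (adjs nv L) \<Longrightarrow>
   (\<And>b. 2 * n + 8 * E + 5 \<le> b \<Longrightarrow> mem Y b = 0) \<Longrightarrow> t \<le> 5 * k + 35 * E + 50 \<Longrightarrow> Q t Y"
 shows "wp P parse Q (initial_state (k # length vs # vs @ length cs # cs @ code_edges ps @ code_edges ns))"
  (is "wp P parse Q (initial_state ?in)")
proof -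
 let ?Z = "initial_state ?in"
 let ?hp = "n + 2 * E + 5"
 \<comment> \<open>The number k, four lengths, n vertices and two words per edge.\<close>
 have len: "length ?in = ?hp" by (simp add: code_edges_def length_pairs n_def E_def)
 have zero: "mem ?Z b = 0" if "?hp \<le> b" for b
 proof -
  have "\<not> b < length ?in" unfolding len using that by simp
  then show ?thesis by (simp only: initial_state_def state.simps if_False)
 qed
 have r0: "regs ?Z r = 0" "out_tape ?Z = []" for r by (simp_all add: initial_state_def)
 have "list_at (mem ?Z) 0 ?in"
  unfolding list_at_def by (simp only: initial_state_def state.simps add_0 if_True) simp
 then have in0: "mem ?Z 0 = k" "mem ?Z 1 = nv" "mem ?Z (nv + 2) = length cs" "mem ?Z (n + 3) = length ps"
  "list_at (mem ?Z) (n + 4) (concat (map (\<lambda>(x, c). [x, c]) ps))" "mem ?Z (n + 4 + 2 * length ps) = length ns"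
  "list_at (mem ?Z) (n + 5 + 2 * length ps) (concat (map (\<lambda>(x, c). [x, c]) ns))"
  by (simp_all add: list_at_Cons list_at_append code_edges_def length_pairs n_def nv_def eval_nat_numeral ac_simps)
 let ?b = "block [Add rDD rDD rDD, Add rDD rDD rDD, Sub rC rC rONE]"
 let ?s = "?Z\<lparr>regs := (regs ?Z)(rONE := 1, rK := k, rDD := k + k, rC := k)\<rparr>"
 let ?r2 = "block [read_edges 0, Add rI rF rZ, Add rE0 rHD rZ, read_edges 1, Add rPR rP rZ]"
 let ?rest = "block [Load rNV rONE, Add rA rNV rONE, Add rA rA rONE, Load rN rA, Add rA rA rONE, Add rA rA rN,
   Add rN rN rNV, Load rX rA, Add rI rA rONE, Add rE0 rX rX, Add rE0 rE0 rI,
   Load rX rE0, Add rF rE0 rONE, Add rHD rX rX, Add rHD rHD rF, Add rP rHD rN,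
   read_edges 0, Add rI rF rZ, Add rE0 rHD rZ, read_edges 1, Add rPR rP rZ]"
 have run1: "wp P parse Q ?Z \<longleftrightarrow> wp P (WhileNZ rC ?b) (\<lambda>t. wp P ?rest (\<lambda>t'. Q (Suc (Suc (Suc (Suc (t + t'))))))) ?s" for Q
  using in0(1) r0 unfolding parse_def by (simp add: wp_simps set_reg_def)
 let ?I = "\<lambda>q Y. \<exists>i. regs Y rDD = 2 * k * 4 ^ i \<and> regs Y rC + i = k \<and> same {} {rDD, rC} ?s Y \<and> q = 5 * regs Y rC"
 show ?thesis unfolding run1
 proof (rule wp_WhileNZ'[where I = ?I and p = "5 * k"])
  show "?I (5 * k) ?s" by (simp add: same_refl)
 next
  fix q :: nat and Y :: state assume I: "?I q Y" and nz: "regs Y rC \<noteq> 0"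
  from I show "wp P ?b (\<lambda>t Z'. \<exists>p'. ?I p' Z' \<and> t + 1 + p' \<le> q) Y"
  proof (elim exE conjE)
   fix i assume e: "regs Y rDD = 2 * k * 4 ^ i" "regs Y rC + i = k" "same {} {rDD, rC} ?s Y" "q = 5 * regs Y rC"
   let ?e = "Y\<lparr>regs := (regs Y)(rDD := (2 * k * 4 ^ i + 2 * k * 4 ^ i) + (2 * k * 4 ^ i + 2 * k * 4 ^ i), rC := regs Y rC - 1)\<rparr>"
   have r: "regs Y rONE = 1" using same_reg[OF e(3), of rONE] by simp
   have run: "wp P ?b Q' Y \<longleftrightarrow> Q' (Suc (Suc (Suc (Suc 0)))) ?e" for Q'
    using r e(1) by (simp add: wp_simps set_reg_def)
   have "same {} {rDD, rC} ?s ?e" using e(3) by (simp add: same_def)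
   then have J: "?I (5 * regs ?e rC) ?e" using e(2) nz by (intro exI[of _ "Suc i"]) simp
   show ?thesis unfolding run
    by (rule exI[of _ "5 * regs ?e rC"], rule conjI, rule J) (use e(4) nz in simp)
  qed
 next
  fix p' t :: nat and Y :: state assume I: "?I p' Y" and z: "regs Y rC = 0" and t: "t + p' \<le> 5 * k + 1"
  from I obtain i where i: "regs Y rDD = 2 * k * 4 ^ i" "regs Y rC + i = k" "same {} {rDD, rC} ?s Y" by (elim exE conjE)
  have DD: "regs Y rDD = 2 * k * 4 ^ k" using i(1,2) z by simp
  have mt: "mem Y b = mem ?Z b" for b using same_mem[OF i(3), of b] by simp
  have rt: "regs Y r = regs ?s r" if "r \<notin> {rDD, rC}" for r using same_reg[OF i(3) that] .
  have ot: "out_tape Y = []" using i(3) r0(2) by (simp add: same_def)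
  have c: "length cs + nv = n" "nv + length cs = n" by (simp_all add: n_def nv_def)
  let ?p = "length ps" and ?q = "length ns"
  have m4: "mem Y (Suc 0) = nv" "mem Y (Suc (Suc nv)) = length cs" "mem Y (Suc (Suc (Suc n))) = ?p"
   "mem Y (Suc (Suc (Suc (Suc (?p + ?p + n))))) = ?q"
   using in0(2-4,6) by (simp_all add: mt eval_nat_numeral ac_simps)
  let ?t = "Y\<lparr>regs := (regs Y)(rNV := nv, rA := Suc (Suc nv), rN := length cs, rA := Suc (Suc (Suc n)), rN := n, rX := ?p,
   rI := Suc (Suc (Suc (Suc n))), rE0 := Suc (Suc (Suc (Suc (?p + ?p + n)))), rX := ?q,
   rF := Suc (Suc (Suc (Suc (Suc (?p + ?p + n))))), rHD := Suc (Suc (Suc (Suc (Suc (?q + ?q + (?p + ?p + n)))))),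
   rP := Suc (Suc (Suc (Suc (Suc (?q + ?q + (?p + ?p + n) + n))))))\<rparr>"
  have run2: "wp P ?rest Q' Y \<longleftrightarrow> wp P ?r2 (\<lambda>t. Q' (Suc (Suc (Suc (Suc (Suc (Suc (Suc (Suc (Suc (Suc (Suc (Suc (Suc (Suc (Suc (Suc t))))))))))))))))) ?t" for Q'
   using rt[of rONE] m4 by (simp add: wp_simps set_reg_def c)
  have hp: "regs ?t rHD = ?hp" "regs ?t rP = ?hp + n" "regs ?t rE0 = n + 4 + 2 * ?p" "regs ?t rI = n + 4" "regs ?t rF = n + 5 + 2 * ?p"
   by (simp_all add: E_def)
  have h0: "heads (mem ?t) ?hp n (?hp + n) (adjs nv [])"
   unfolding heads_def by (simp add: mt zero adjs_def)
  have ES: "?p + ?q = E" by (simp add: E_def)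
  show "wp P ?rest (\<lambda>t'. Q (Suc (Suc (Suc (Suc (t + t')))))) Y" unfolding run2
  proof (rule wp_block_Cons, rule wp_read_edges[OF hp(4,3) _ _ hp(1,2) _ _ _ h0], goal_cases)
   case (7 t1 N)
   have r2: "regs N r = regs ?t r" if "r \<notin> read_regs" for r by (rule 7(4)[OF that])
   have rr: "regs N rF = n + 5 + 2 * ?p" "regs N rZ = 0" "regs N rHD = ?hp" "regs N rONE = 1" "regs N rNV = nv"
    using r2[of rF] r2[of rZ] r2[of rHD] r2[of rONE] r2[of rNV] hp rt[of rZ] rt[of rONE] r0 by simp_all
   let ?v = "N\<lparr>regs := (regs N)(rI := n + 5 + 2 * ?p, rE0 := ?hp)\<rparr>"
   have run3: "wp P (block [Add rI rF rZ, Add rE0 rHD rZ, read_edges 1, Add rPR rP rZ]) Q' N \<longleftrightarrow>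
     wp P (block [read_edges 1, Add rPR rP rZ]) (\<lambda>t. Q' (Suc (Suc t))) ?v" for Q'
    using rr by (simp add: wp_simps set_reg_def)
   show ?case unfolding run3
   proof (rule wp_block_Cons, rule wp_read_edges[where a = "n + 5 + 2 * ?p" and es = ns and hp = ?hp and p = "?hp + n + 6 * ?p" and nv = nv and n = n
      and L = "[] @ map (\<lambda>(x, c). (x, c, 0)) ps"], goal_cases)
    case (12 t2 \<phi>)
    have r3: "regs \<phi> r = regs ?v r" if "r \<notin> read_regs" for r by (rule 12(4)[OF that])
    let ?e = "set_reg rPR (regs \<phi> rP + 0) \<phi>"
    \<comment> \<open>After the input there are n list heads and, for each edge, two cells of three
      words.\<close>
    have PR: "?hp + n + 6 * ?p + 6 * ?q = 2 * n + 8 * E + 5" by (simp add: E_def)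
    have run4: "wp P (block [Add rPR rP rZ]) Q' \<phi> \<longleftrightarrow> Q' (Suc (Suc 0)) ?e" for Q'
     using r3[of rZ] rr by (simp add: wp_simps set_reg_def)
    have k1: "regs \<phi> r = regs Y r" if "r \<in> {rONE, rDD, rZ, rST, rSH, rFAIL}" for r
    proof -
     have "r \<notin> read_regs" "r \<notin> {rI, rE0}" using that by auto
     then have "regs \<phi> r = regs N r" using r3[of r] by simp
     also have "\<dots> = regs ?t r" by (rule r2) fact
     also have "\<dots> = regs Y r" using that by auto
     finally show ?thesis .
    qed
    have k2: "regs Y rONE = 1" "regs Y rZ = 0" "regs Y rST = 0" "regs Y rSH = 0" "regs Y rFAIL = 0"
     using rt[of rONE] rt[of rZ] rt[of rST] rt[of rSH] rt[of rFAIL] by (simp_all add: r0)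
    have k3: "regs \<phi> rNV = nv" "regs \<phi> rN = n" "regs \<phi> rHD = ?hp"
     using r3[of rNV] r3[of rN] r3[of rHD] r2[of rN] rr by simp_all
    have k4: "regs \<phi> rONE = 1" "regs \<phi> rDD = 2 * k * 4 ^ k" "regs \<phi> rZ = 0" "regs \<phi> rST = 0" "regs \<phi> rSH = 0" "regs \<phi> rFAIL = 0"
     using k1 k2 DD by simp_all
    show ?case unfolding run4
    proof (rule Q)
     show "heads (mem ?e) (n + 2 * E + 5) n (2 * n + 8 * E + 5) (adjs nv L)"
      using 12(2) unfolding PR by (simp add: set_reg_def L_def)
     show "mem ?e b = 0" if b: "2 * n + 8 * E + 5 \<le> b" for b
     proof -
      have "mem ?e b = mem N b" using 12(3)[of b] b PR by (simp add: set_reg_def)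
      also have "\<dots> = mem Y b" using 7(3)[of b] b PR by simp
      finally show ?thesis using zero[of b] b by (simp add: mt)
     qed
     show "regs ?e rPR = 2 * n + 8 * E + 5" using 12(1) PR by (simp add: set_reg_def)
     show "out_tape ?e = []" using 12(5) 7(5) ot by (simp add: set_reg_def)
    qed (use k3 k4 t 7(6) 12(6) ES in \<open>simp_all add: set_reg_def\<close>)
   next
    case (11 x c)
    then show ?case using es by blast
   next
    case 10
    then show ?case using 7(2) by simp
   next
    case 7
    show ?case
     by (rule list_at_cong[OF in0(7)]) (use \<open>\<And>b. b < ?hp \<or> ?hp + n + 6 * ?p \<le> b \<Longrightarrow> mem N b = mem ?t b\<close> in \<open>simp add: mt length_pairs E_def\<close>)
   qed (use rr 7(1) in \<open>simp_all add: E_def\<close>)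
  next
   case 3
   show ?case by (rule list_at_cong[OF in0(5)]) (simp add: mt)
  next
   case (6 x c)
   then show ?case using es by blast
  qed (use rt[of rONE] in \<open>simp_all add: E_def\<close>)
 qed
qed

section \<open>The adjacency lists and the graph\<close>

lemma set_adjs:
 "(w, s) \<in> set (adjs nv L u) \<longleftrightarrow> (\<exists>x c. (x, c, s) \<in> set L \<and> (if u = x then w = nv + c else u = nv + c \<and> w = x))"
 unfolding adjs_def by (force split: if_splits)

lemma adjs_distinct:
 assumes "distinct (map (\<lambda>(x, c, s). (x, c)) L)" "\<And>x c s. (x, c, s) \<in> set L \<Longrightarrow> x < nv"
 shows "distinct (map fst (adjs nv L u))"
 using assms
proof (induction L rule: rev_induct)
 case (snoc e L)
 obtain x c s where e: "e = (x, c, s)" by (cases e)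
 have IH: "distinct (map fst (adjs nv L u))" using snoc by auto
 have new: "(x, c, s') \<notin> set L" for s' using snoc.prems(1) e by force
 have lt: "x' < nv" if "(x', c', s') \<in> set (L @ [e])" for x' c' s' using snoc.prems(2) that by blast
 have 1: "nv + c \<notin> fst ` set (adjs nv L x)"
 proof
  assume "nv + c \<in> fst ` set (adjs nv L x)"
  then obtain s' where "(nv + c, s') \<in> set (adjs nv L x)" by auto
  then obtain x' c' where "(x', c', s') \<in> set L" "if x = x' then nv + c = nv + c' else x = nv + c' \<and> nv + c = x'"
   unfolding set_adjs by blast
  then show False using new lt[of x' c' s'] by (auto split: if_splits)
 qed
 have 2: "x \<notin> fst ` set (adjs nv L (nv + c))"
 proof
  assume "x \<in> fst ` set (adjs nv L (nv + c))"
  then obtain s' where "(x, s') \<in> set (adjs nv L (nv + c))" by auto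
  then obtain x' c' where "(x', c', s') \<in> set L" "if nv + c = x' then x = nv + c' else nv + c = nv + c' \<and> x = x'"
   unfolding set_adjs by blast
  then show False using new lt[of x' c' s'] by (auto split: if_splits)
 qed
 have "adjs nv (L @ [e]) u = (if u = x then [(nv + c, s)] else if u = nv + c then [(x, s)] else []) @ adjs nv L u"
  by (simp add: adjs_def e)
 then show ?case using IH 1 2 by auto
qed (simp add: adjs_def)

lemma sum_adjs:
 assumes "\<And>x c s. (x, c, s) \<in> set L \<Longrightarrow> x < nv \<and> nv + c < n"
 shows "(\<Sum>u<n. length (adjs nv L u)) = 2 * length L"
 using assms
proof (induction L rule: rev_induct)
 case (snoc e L)
 obtain x c s where e: "e = (x, c, s)" by (cases e)
 have xc: "x < nv" "nv + c < n" "x < n" using snoc.prems[of x c s] e by auto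
 have "length (adjs nv (L @ [e]) u) = (if u = x then 1 else 0) + (if u = nv + c then 1 else 0) + length (adjs nv L u)" for u
  using xc by (simp add: adjs_def e)
 then have "(\<Sum>u<n. length (adjs nv (L @ [e]) u)) = 2 + (\<Sum>u<n. length (adjs nv L u))"
  using xc by (simp add: sum.distrib)
 moreover have "x < nv \<and> nv + c < n" if "(x, c, s) \<in> set L" for x c s
  by (rule snoc.prems[of x c s]) (use that in simp)
 then have "(\<Sum>u<n. length (adjs nv L u)) = 2 * length L" by (rule snoc.IH)
 ultimately show ?case by simp
qed (simp add: adjs_def)

context numbered_formula
begin

lemma adjs_iff:
 assumes ps: "set ps = pos_edges G" and ns: "set ns = neg_edges G" and u: "u < n"
 shows "(w, s) \<in> set (adjs nv (map (\<lambda>(x, c). (x, c, 0)) ps @ map (\<lambda>(x, c). (x, c, 1)) ns) u) \<longleftrightarrow>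
  w \<in> nb u \<and> s = (if (min u w, max u w - nv) \<in> pos_edges G then 0 else 1)"
proof -
 let ?L = "map (\<lambda>(x, c). (x, c, 0 :: nat)) ps @ map (\<lambda>(x, c). (x, c, 1)) ns"
 have mem: "(x, c, s) \<in> set ?L \<longleftrightarrow> (x, c) \<in> pos_edges G \<and> s = 0 \<or> (x, c) \<in> neg_edges G \<and> s = 1" for x c s
  using ps ns by auto
 have disj: "pos_edges G \<inter> neg_edges G = {}" and lt: "\<And>x c. (x, c) \<in> pos_edges G \<union> neg_edges G \<Longrightarrow> x < nv"
  using ig nv by (auto simp: incidence_graph_def)
 show ?thesis
 proof (cases "u < nv")
  case True
  have "(w, s) \<in> set (adjs nv ?L u) \<longleftrightarrow> (\<exists>c. w = nv + c \<and> (u, c, s) \<in> set ?L)"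
   unfolding set_adjs using True by auto
  also have "\<dots> \<longleftrightarrow> nv \<le> w \<and> ((u, w - nv) \<in> pos_edges G \<and> s = 0 \<or> (u, w - nv) \<in> neg_edges G \<and> s = 1)"
   unfolding mem by (auto simp: le_iff_add)
  also have "\<dots> \<longleftrightarrow> w \<in> nb u \<and> s = (if (min u w, max u w - nv) \<in> pos_edges G then 0 else 1)"
  proof (cases "nv \<le> w")
   case wv: True
   have "min u w = u" "max u w = w" using True wv by auto
   moreover have "w \<in> nb u \<longleftrightarrow> (u, w - nv) \<in> pos_edges G \<union> neg_edges G"
    using nb_incident[OF True, of w] wv by (simp add: incident_iff)
   ultimately show ?thesis using wv disj by auto
  next
   case False
   then show ?thesis using nb_type[of w u] True by auto
  qed
  finally show ?thesis .
 next
  case False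
  have "(w, s) \<in> set (adjs nv ?L u) \<longleftrightarrow> (w, u - nv, s) \<in> set ?L"
  proof -
   have "x \<noteq> u" if "(x, c, s) \<in> set ?L" for x c using lt[of x c] that False unfolding mem by auto
   moreover have "u = nv + c \<longleftrightarrow> c = u - nv" for c using False by auto
   ultimately show ?thesis unfolding set_adjs by metis
  qed
  also have "\<dots> \<longleftrightarrow> (w, u - nv) \<in> pos_edges G \<and> s = 0 \<or> (w, u - nv) \<in> neg_edges G \<and> s = 1" by (rule mem)
  also have "\<dots> \<longleftrightarrow> w \<in> nb u \<and> s = (if (min u w, max u w - nv) \<in> pos_edges G then 0 else 1)"
  proof (cases "w < nv")
   case wv: True
   have "min u w = w" "max u w = u" using False wv by auto
   moreover have "w \<in> nb u \<longleftrightarrow> (w, u - nv) \<in> pos_edges G \<union> neg_edges G"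
    using nb_incident[OF wv, of u] nb_sym[of w u] False by (simp add: incident_iff)
   ultimately show ?thesis using disj by auto
  next
   case wv: False
   then show ?thesis using nb_type[of w u] False lt[of w "u - nv"] by auto
  qed
  finally show ?thesis .
 qed
qed

end

text \<open>The right-hand side equals \<open>4 * k\<^sup>2 * 6 ^ k\<close>, so the budget stays
  well below the required depth.\<close>

lemma budget_le: "2 * k * 4 ^ k \<le> 3 ^ k * lambda_param k * k\<^sup>2"
proof (cases "k = 0")
 case False
 have "2 * k * 4 ^ k \<le> 2 * k * (6 :: nat) ^ k" by (intro mult_le_mono2 power_mono) simp_all
 also have "\<dots> \<le> (4 * k * k) * 6 ^ k" using False by (intro mult_le_mono1) simp
 also have "\<dots> = 3 ^ k * lambda_param k * k\<^sup>2"
  by (simp add: lambda_param_def power2_eq_square flip: power_mult_distrib)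
 finally show ?thesis .
qed simp

text \<open>With \<open>d \<le> 2 ^ (3 * k + 1)\<close>, the three factors are at most
  \<open>2 ^ 17\<close>, \<open>2 ^ d\<close> and \<open>8 ^ d\<close>, together
  \<open>2 ^ (17 + 4 * d)\<close>. For \<open>z = 2 ^ (3 * k)\<close> the exponent is at most 17 +
  8z, which is below 32z, the value of \<open>2 ^ (3 * k + 5)\<close>.\<close>

lemma time_bound:
 fixes k M t :: nat
 defines "d \<equiv> 2 * k * 4 ^ k"
 assumes "t \<le> 80000 * (d + 1) * 5 ^ d * M"
 shows "real t \<le> 2 powr (2 powr (3 * real k + 5)) * real M"
proof -
 have "k \<le> 2 ^ k" using less_exp[of k] by simp
 then have "d \<le> 2 * 2 ^ k * 4 ^ k" by (simp add: d_def)
 also have "\<dots> = 2 ^ (3 * k + 1)"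
  by (simp add: power_add power_mult flip: power_mult_distrib)
 finally have d: "d \<le> 2 ^ (3 * k + 1)" .
 have "80000 \<le> (2 :: nat) ^ 17" by simp
 moreover have "d + 1 \<le> 2 ^ d" by (metis Suc_eq_plus1 Suc_leI less_exp)
 moreover have "(5 :: nat) ^ d \<le> 8 ^ d" by (rule power_mono) simp_all
 ultimately have "80000 * (d + 1) * 5 ^ d \<le> 2 ^ 17 * 2 ^ d * (8 :: nat) ^ d" by (intro mult_le_mono)
 also have "\<dots> = 2 ^ (17 + 4 * d)"
  by (simp add: power_add power_mult flip: power_mult_distrib)
 also have "\<dots> \<le> 2 ^ (2 ^ (3 * k + 5))"
 proof (rule power_increasing)
  define z :: nat where "z = 2 ^ (3 * k)"
  have "1 \<le> z" "d \<le> 2 * z" "2 ^ (3 * k + 5) = 32 * z" using d by (simp_all add: z_def power_add)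
  then show "17 + 4 * d \<le> 2 ^ (3 * k + 5)" by linarith
 qed simp
 finally have "80000 * (d + 1) * 5 ^ d * M \<le> 2 ^ (2 ^ (3 * k + 5)) * M" by (rule mult_le_mono1)
 then have "real t \<le> real (2 ^ (2 ^ (3 * k + 5)) * M)" using assms(2) by (meson le_trans of_nat_le_iff)
 also have "\<dots> = 2 ^ (2 ^ (3 * k + 5)) * real M" by simp
 also have "(2 :: real) ^ (2 ^ (3 * k + 5)) = 2 powr (2 powr (3 * real k + 5))"
 proof -
  have "(2 :: real) powr (3 * real k + 5) = 2 powr real (3 * k + 5)" by simp
  also have "\<dots> = 2 ^ (3 * k + 5)" by (rule powr_realpow) simp
  also have "\<dots> = real (2 ^ (3 * k + 5))" by simp
  finally show ?thesis using powr_realpow[of "2 :: real" "2 ^ (3 * k + 5)"] by simp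
 qed
 finally show ?thesis .
qed

lemma backdoor_program_run:
 assumes G: "incidence_graph G" "numbered G" "codes_graph G ws"
 shows "\<exists>t ys. computes backdoor_program (k # ws) t ys \<and>
  t \<le> 80000 * (2 * k * 4 ^ k + 1) * 5 ^ (2 * k * 4 ^ k) * max 1 (igraph_size G) \<and>
  ((\<exists>T us. ys = 1 # us \<and> codes_tree T us \<and> strong_recursive_backdoor class0 G T \<and> bd_depth T \<le> 2 * k * 4 ^ k) \<or>
   (ys = [0] \<and> enat k < srbd class0 G))"
proof -
 obtain vs cs ps ns where w: "distinct vs" "set vs = vars G" "distinct cs" "set cs = clauses G"
   "distinct ps" "set ps = pos_edges G" "distinct ns" "set ns = neg_edges G"
  and ws: "ws = length vs # vs @ length cs # cs @ code_edges ps @ code_edges ns"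
  using G(3) unfolding codes_graph_def by blast
 define nv where "nv = length vs"
 define n where "n = nv + length cs"
 define E where "E = length ps + length ns"
 define d where "d = 2 * k * 4 ^ k"
 define L where "L = map (\<lambda>(x, c). (x, c, 0 :: nat)) ps @ map (\<lambda>(x, c). (x, c, 1)) ns"
 have cv: "card (vars G) = nv" "card (clauses G) = length cs" using distinct_card w nv_def by metis+
 have G': "vars G = {..<nv}" "clauses G = {..<n - nv}" using G(2) cv by (simp_all add: numbered_def n_def)
 have size: "igraph_size G = n + E"
  using distinct_card[OF w(5)] distinct_card[OF w(7)] w(6,8) cv by (simp add: igraph_size_def n_def E_def)
 interpret NF: numbered_formula G nv n
  by unfold_locales (use G(1) G' in \<open>simp_all add: n_def\<close>)
 have sub: "pos_edges G \<union> neg_edges G \<subseteq> vars G \<times> clauses G" "pos_edges G \<inter> neg_edges G = {}"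
  using G(1) by (auto simp: incidence_graph_def)
 have es: "x < nv \<and> nv + c < n" if "(x, c) \<in> set ps \<union> set ns" for x c
  using that sub(1) G' unfolding w by (auto simp: less_diff_conv)
 have esL: "x < nv \<and> nv + c < n" if "(x, c, s) \<in> set L" for x c s
  by (rule es) (use that in \<open>auto simp: L_def\<close>)
 have dist: "distinct (map (\<lambda>(x, c, s). (x, c)) L)"
 proof -
  have "map (\<lambda>(x, c, s). (x, c)) L = ps @ ns" by (auto simp: L_def intro!: map_idI)
  then show ?thesis using w(5-8) sub(2) by simp
 qed
 let ?hp = "n + 2 * E + 5" let ?PR = "2 * n + 8 * E + 5" let ?FT = "2 * n + 8 * E + 5 + d + d + 1"
 let ?MK = "?FT + d + 2" let ?FB = "?MK + n + n" let ?EN = "?FB + (d + 2) * (4 * n + 16)"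
 \<comment> \<open>One more than the total weight of the vertices, the quantity to which the running
   time of the recursion is proportional.\<close>
 define w where "w = 1 + n + 2 * E"
 let ?Q = "\<lambda>t (Z :: state). t \<le> 24000 * (d + 1) * 5 ^ d * w + 60 + 5 * k + 35 * E + 13 * d \<and>
  ((\<exists>T us. out_tape Z = 1 # us \<and> codes_tree T us \<and> strong_recursive_backdoor class0 G T \<and> bd_depth T \<le> d) \<or>
   (out_tape Z = [0] \<and> enat k < srbd class0 G))"
 have "wp backdoor_program (block [parse, fill_pre, layout, Call 1, report]) ?Q (initial_state (k # ws))"
  unfolding ws
 proof (rule wp_block_Cons, rule wp_parse, goal_cases)
  case (1 x c)
  then show ?case using es unfolding nv_def n_def by blast
 next
  case (2 t1 Y)
  have Y: "regs Y rONE = 1" "regs Y rNV = nv" "regs Y rN = n" "regs Y rHD = ?hp" "regs Y rDD = d" "regs Y rPR = ?PR"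
   "regs Y rZ = 0" "regs Y rST = 0" "regs Y rSH = 0" "regs Y rFAIL = 0" "out_tape Y = []"
   "heads (mem Y) ?hp n ?PR (adjs nv L)" "\<And>b. ?PR \<le> b \<Longrightarrow> mem Y b = 0" "t1 \<le> 5 * k + 35 * E + 50"
   using 2 unfolding nv_def[symmetric] n_def[symmetric] E_def[symmetric] L_def[symmetric] d_def[symmetric] by simp_all
  show ?case
  proof (rule wp_block_Cons, rule wp_fill_pre[OF Y(1,6,5,7)], goal_cases)
   case (1 t2 Z)
   have r: "regs Z r = regs Y r" if "r \<notin> {rI, rF, rU, rC, rX}" for r by (rule 1(3)[OF that])
   have m: "mem Z b = mem Y b" if "b \<le> ?PR \<or> ?PR + 2 * d + 2 \<le> b" for b by (rule 1(2)[OF that])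
   \<comment> \<open>The locale is about a fixed static memory, so it can be entered only now: its
     \<open>m0\<close> is the memory after the adjacency lists and the table of \<open>pre\<close>
     have been built.\<close>
   interpret M: machine G nv n k d ?hp ?PR ?FT ?MK ?FB ?EN "mem Z" "adjs nv L"
   proof unfold_locales
    show "d = 2 * k * 4 ^ k" by (rule d_def)
    show "cells (mem Z) ?FT (mem Z (?hp + u)) (adjs nv L u)" if u: "u < n" for u
    proof (rule chain_cells)
     have "chain (mem Y) (?hp + n) ?PR (mem Y (?hp + u)) (adjs nv L u)"
      using Y(12) u unfolding heads_def by blast
     then have "chain (mem Z) (?hp + n) ?FT (mem Y (?hp + u)) (adjs nv L u)"
      by (rule chain_cong) (use m in auto)
     then show "chain (mem Z) (?hp + n) ?FT (mem Z (?hp + u)) (adjs nv L u)"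
      using m[of "?hp + u"] u by simp
    qed simp
    show "(v, s) \<in> set (adjs nv L u) \<longleftrightarrow> v \<in> NF.nb u \<and> s = (if (min u v, max u v - nv) \<in> pos_edges G then 0 else 1)"
     if "u < n" for u v s
     unfolding L_def by (rule NF.adjs_iff[OF \<open>set ps = pos_edges G\<close> \<open>set ns = neg_edges G\<close> that])
    show "distinct (map fst (adjs nv L u))" if "u < n" for u
     by (rule adjs_distinct[OF dist]) (use esL in blast)
    show "mem Z (?PR + t) = Suc (pre (t - 1))" if "1 \<le> t" "t \<le> 2 * d" for t
    proof -
     have e: "Suc (?PR + (t - 1)) = ?PR + t" using that by simp
     show ?thesis by (rule 1(1)[of "t - 1", unfolded e]) (use that in simp)
    qed
   qed simp_all
   have wts: "1 + M.wts [0..<n] = w"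
   proof -
    have "M.wts [0..<n] = (\<Sum>u<n. 1 + length (adjs nv L u))"
     by (simp add: M.wts_def M.wt_def interv_sum_list_conv_sum_set_nat atLeast0LessThan)
    also have "\<dots> = (\<Sum>u<n. 1) + (\<Sum>u<n. length (adjs nv L u))" by (rule sum.distrib)
    also have "\<dots> = n + 2 * length L" using sum_adjs[OF esL] by simp
    finally show ?thesis by (simp add: w_def L_def E_def)
   qed
   show ?case
   proof (rule wp_mono[OF M.wp_main], goal_cases)
    case (15 t3 N)
    have c: "3 * M.cost d * w = 24000 * (d + 1) * 5 ^ d * w" by (simp add: M.cost_def)
    have t3: "t3 \<le> 24000 * (d + 1) * 5 ^ d * w" using conjunct1[OF 15] unfolding wts c .
    have "t1 + (t2 + t3) \<le> 24000 * (d + 1) * 5 ^ d * w + 60 + 5 * k + 35 * E + 13 * d"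
     using add_mono[OF Y(14) add_mono[OF 1(5) t3]] by simp
    then show ?case using conjunct2[OF 15] by (rule conjI)
   qed (use r Y 1(4) m in simp_all)
  qed
 qed
 then obtain t Z where ex: "exec backdoor_program (block [parse, fill_pre, layout, Call 1, report]) (initial_state (k # ws)) t Z"
  and Q: "?Q t Z" unfolding wp_def by blast
 have "exec backdoor_program (Call 0) (initial_state (k # ws)) (1 + t) Z"
  by (rule exec.Call) (use ex in \<open>simp_all add: backdoor_program_def\<close>)
 then have "computes backdoor_program (k # ws) (1 + t) (out_tape Z)" unfolding computes_def by blast
 moreover have "1 + t \<le> 80000 * (d + 1) * 5 ^ d * max 1 (igraph_size G)"
 proof -
  let ?M = "max 1 (igraph_size G)"
  define X where "X = (d + 1) * 5 ^ d"
  have "n + E \<le> ?M" "1 \<le> ?M" unfolding size by simp_all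
  then have M: "w \<le> 3 * ?M" "E \<le> ?M" "1 \<le> ?M" unfolding w_def by linarith+
  have "k \<le> d" by (simp add: d_def)
  moreover have "(d + 1) * 1 \<le> (d + 1) * 5 ^ d" by (rule mult_le_mono2) simp
  then have "d + 1 \<le> X" unfolding X_def mult_1_right .
  ultimately have X: "k \<le> X" "d \<le> X" "1 \<le> X" by simp_all
  have z: "24000 * X * w \<le> 72000 * (X * ?M)"
   using mult_le_mono2[OF M(1), of "24000 * X"] by (simp add: mult.assoc mult.left_commute)
  have y: "E \<le> X * ?M" "k \<le> X * ?M" "d \<le> X * ?M" "1 \<le> X * ?M"
   using mult_le_mono[OF X(3) M(2)] mult_le_mono[OF X(1) M(3)] mult_le_mono[OF X(2) M(3)] mult_le_mono[OF X(3) M(3)]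
   by (simp_all only: mult_1 mult_1_right)
  have t: "t \<le> 24000 * X * w + 60 + 5 * k + 35 * E + 13 * d"
   using conjunct1[OF Q] by (simp only: X_def mult.assoc)
  \<comment> \<open>The constant 80000 consists of 72000 for the recursion, which is 24000 times the
    factor 3 in \<open>w \<le> 3 * ?M\<close>, and room for the preprocessing.\<close>
  have gen: "1 + t \<le> 80000 * v" if "t \<le> z + 60 + 5 * k + 35 * E + 13 * d" "z \<le> 72000 * v" "E \<le> v" "k \<le> v" "d \<le> v" "1 \<le> v"
   for v z :: nat using that by linarith
  have "1 + t \<le> 80000 * (X * ?M)" by (rule gen[OF t z y])
  then show ?thesis by (simp only: X_def mult.assoc)
 qed
 ultimately show ?thesis using conjunct2[OF Q] unfolding d_def by (intro exI conjI)
qed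

theorem theorem5p10:
 "\<exists>(P :: program) (g :: nat \<Rightarrow> real).
   g \<in> O(\<lambda>k. real k) \<and>
   (\<forall>(k :: nat) (G :: (nat, nat) igraph) (ws :: nat list).
    incidence_graph G \<longrightarrow> numbered G \<longrightarrow> codes_graph G ws \<longrightarrow>
    (\<exists>t ys.
      computes P (k # ws) t ys \<and>
      real t \<le> 2 powr (2 powr g k) * real (max 1 (igraph_size G)) \<and>
      ((\<exists>T us. ys = 1 # us \<and> codes_tree T us \<and>
        strong_recursive_backdoor class0 G T \<and>
        bd_depth T \<le> 3 ^ k * lambda_param k * k\<^sup>2) \<or>
      (ys = [0] \<and> srbd class0 G > enat k))))"
proof (intro exI[of _ backdoor_program] exI[of _ "\<lambda>k. 3 * real k + 5"] conjI allI impI)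
 show "(\<lambda>k. 3 * real k + 5) \<in> O(\<lambda>k. real k)"
 proof (rule bigoI[of _ 8])
  show "\<forall>\<^sub>F k in sequentially. norm (3 * real k + 5) \<le> 8 * norm (real k)"
   using eventually_ge_at_top[of 1] by eventually_elim simp
 qed
next
 fix k :: nat and G :: "(nat, nat) igraph" and ws
 assume G: "incidence_graph G" "numbered G" "codes_graph G ws"
 obtain t ys where run: "computes backdoor_program (k # ws) t ys"
  and t: "t \<le> 80000 * (2 * k * 4 ^ k + 1) * 5 ^ (2 * k * 4 ^ k) * max 1 (igraph_size G)"
  and ys: "(\<exists>T us. ys = 1 # us \<and> codes_tree T us \<and> strong_recursive_backdoor class0 G T \<and> bd_depth T \<le> 2 * k * 4 ^ k) \<or>
   (ys = [0] \<and> enat k < srbd class0 G)"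
  using backdoor_program_run[OF G, of k] by (elim exE conjE) (rule that)
 show "\<exists>t ys. computes backdoor_program (k # ws) t ys \<and>
   real t \<le> 2 powr (2 powr (3 * real k + 5)) * real (max 1 (igraph_size G)) \<and>
   ((\<exists>T us. ys = 1 # us \<and> codes_tree T us \<and> strong_recursive_backdoor class0 G T \<and>
     bd_depth T \<le> 3 ^ k * lambda_param k * k\<^sup>2) \<or> (ys = [0] \<and> srbd class0 G > enat k))"
 proof (intro exI conjI)
  show "computes backdoor_program (k # ws) t ys" by (rule run)
  show "real t \<le> 2 powr (2 powr (3 * real k + 5)) * real (max 1 (igraph_size G))" by (rule time_bound[OF t])
  show "(\<exists>T us. ys = 1 # us \<and> codes_tree T us \<and> strong_recursive_backdoor class0 G T \<and>
     bd_depth T \<le> 3 ^ k * lambda_param k * k\<^sup>2) \<or> (ys = [0] \<and> srbd class0 G > enat k)"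
   using ys
  proof (elim disjE exE conjE)
   fix T us assume T: "ys = 1 # us" "codes_tree T us" "strong_recursive_backdoor class0 G T" "bd_depth T \<le> 2 * k * 4 ^ k"
   show ?thesis by (intro disjI1 exI[of _ T] exI[of _ us] conjI T(1-3) le_trans[OF T(4) budget_le])
  next
   assume "ys = [0]" "enat k < srbd class0 G"
   then show ?thesis by (intro disjI2 conjI)
  qed
 qed
qed

end
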